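(* For every smooth homogeneous $f\in\mathbb{Z}[x_1,\ldots,x_n]$ of degree $d$ with $n>2^d(d-1)$ and for every box $\mathcal{B}\subset[-1,1]^n$ (as in the context) we have $$\lim_{P\to\infty}\frac{1}{P^n\log P}\sum_{\substack{\mathbf{x}\in\mathbb{Z}^n\cap P\mathcal{B}\\ f(\mathbf{x})\neq 0}}\tau(|f(\mathbf{x})|)=d\,\mathrm{vol}(\mathcal{B})\prod_p\left(1-\frac1p\right)\lim_{m\to\infty}\frac{1}{p^{nm}}\sum_{\mathbf{t}\in(\mathbb{Z}/p^m\mathbb{Z})^n}\tau_{p^m}(f(\mathbf{t})),$$ where the product is over all primes $p$.
   Context: $\tau$ is the divisor function (number of positive divisors). For a prime $p$ and a positive integer $m$, $\tau_{p^m}(\ell):=1+\min\{v_p(\ell),m\}$, where $v_p$ is the $p$-adic valuation; this depends only on $\ell$ modulo $p^m$ (with value $1+m$ on the zero class), so it is defined on $\mathbb{Z}/p^m\mathbb{Z}$. A form $f\in\mathbb{Z}[x_1,\ldots,x_n]$ of degree $d$ is smooth if the projective hypersurface $f=0$ is smooth, i.e. the partial derivatives of $f$ have no common zero in $\mathbb{C}^n\setminus\{0\}$. A box is a set $\mathcal{B}\subset[-1,1]^n$ of the form $\mathcal{B}=\prod_{j=1}^n[a_j,a'_j]$ with real $a_j,a_j'$ satisfying $\max_j|a'_j-a_j|\leq 1$; $P\mathcal{B}=\{P\mathbf{t}:\mathbf{t}\in\mathcal{B}\}$. *)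

theory Defs
  imports
    "HOL-Analysis.Analysis"
    "HOL-Computational_Algebra.Computational_Algebra"
    "HOL-Number_Theory.Cong"
    "HOL-Library.Poly_Mapping"
begin

text \<open>
  Integer polynomials in variables indexed by a finite type \<open>'n\<close>: finitely supported maps from
  exponent vectors to coefficients, with the ring structure of \<open>poly_mapping\<close>.
\<close>
type_synonym 'n int_mpoly = "('n \<Rightarrow>\<^sub>0 nat) \<Rightarrow>\<^sub>0 int"

definition mpoly_eval :: "('n::finite) int_mpoly \<Rightarrow> 'a::comm_ring_1 ^ 'n \<Rightarrow> 'a" where
  "mpoly_eval f x =
     (\<Sum>e\<in>Poly_Mapping.keys f. of_int (Poly_Mapping.lookup f e) * (\<Prod>i\<in>UNIV. (x $ i) ^ Poly_Mapping.lookup e i))"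

definition mpoly_pderiv :: "'n::finite \<Rightarrow> 'n int_mpoly \<Rightarrow> 'n int_mpoly" where
  "mpoly_pderiv i f =
     (\<Sum>e\<in>Poly_Mapping.keys f.
        Poly_Mapping.single (e - Poly_Mapping.single i 1)
          (int (Poly_Mapping.lookup e i) * Poly_Mapping.lookup f e))"

definition homogeneous_of_degree :: "nat \<Rightarrow> ('n::finite) int_mpoly \<Rightarrow> bool" where
  "homogeneous_of_degree d f \<longleftrightarrow>
     f \<noteq> 0 \<and> (\<forall>e\<in>Poly_Mapping.keys f. (\<Sum>i\<in>UNIV. Poly_Mapping.lookup e i) = d)"

definition smooth_form :: "('n::finite) int_mpoly \<Rightarrow> bool" where
  "smooth_form f \<longleftrightarrow>
     \<not> (\<exists>z :: complex ^ 'n. z \<noteq> 0 \<and> (\<forall>i. mpoly_eval (mpoly_pderiv i f) z = 0))"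

definition is_box :: "(real ^ 'n) set \<Rightarrow> bool" where
  "is_box B \<longleftrightarrow>
     B \<subseteq> {t. \<forall>j. -1 \<le> t $ j \<and> t $ j \<le> 1} \<and>
     (\<exists>a a'. B = cbox a a' \<and> (\<forall>j. \<bar>a' $ j - a $ j\<bar> \<le> 1))"

text \<open>Only meaningful for \<open>n > 0\<close>: every number divides \<open>0\<close>, and \<open>card\<close> of an infinite set is \<open>0\<close>.\<close>
definition divisor_tau :: "nat \<Rightarrow> nat" where
  "divisor_tau n = card {k. k dvd n}"

text \<open>
  The case \<open>l = 0\<close> stands for \<open>v\<^sub>p(0) = \<infinity>\<close>; the library sets \<open>multiplicity p 0 = 0\<close>.
\<close>
definition tau_prime_power :: "nat \<Rightarrow> nat \<Rightarrow> int \<Rightarrow> nat" where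
  "tau_prime_power p m l =
     1 + (if l = 0 then m else min (multiplicity (int p) l) m)"

text \<open>
  \<open>(\<int>/p\<^sup>m\<int>)\<^sup>n\<close> is represented by the vectors with entries in \<open>{0..<p\<^sup>m}\<close>;
  the two congruence lemmas below show that the summand depends on the classes only.
\<close>
definition local_average :: "('n::finite) int_mpoly \<Rightarrow> nat \<Rightarrow> nat \<Rightarrow> real" where
  "local_average f p m =
     1 / real p ^ (CARD('n) * m) *
     (\<Sum>t | t \<in> {t :: int ^ 'n. \<forall>i. t $ i \<in> {0..<int p ^ m}}.
        real (tau_prime_power p m (mpoly_eval f t)))"

definition lattice_points :: "(real ^ 'n) set \<Rightarrow> real \<Rightarrow> (int ^ 'n) set" where
  "lattice_points B P = {x. (\<chi> i. real_of_int (x $ i)) \<in> (\<lambda>t. P *\<^sub>R t) ` B}"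

definition divisor_sum :: "('n::finite) int_mpoly \<Rightarrow> (real ^ 'n) set \<Rightarrow> real \<Rightarrow> real" where
  "divisor_sum f B P =
     (\<Sum>x | x \<in> lattice_points B P \<and> mpoly_eval f x \<noteq> 0.
        real (divisor_tau (nat \<bar>mpoly_eval f x\<bar>)))"

lemma tau_prime_power_altdef:
  assumes "prime p"
  shows "tau_prime_power p m l = 1 + card {k\<in>{1..m}. int p ^ k dvd l}"
proof (cases "l = 0")
  case True
  then have "{k\<in>{1..m}. int p ^ k dvd l} = {1..m}" by auto
  then show ?thesis using True by (simp add: tau_prime_power_def)
next
  case False
  have "\<not> is_unit (int p)"
    using assms by (metis not_prime_unit prime_int_nat_transfer nat_int of_nat_0_le_iff)
  then have "{k\<in>{1..m}. int p ^ k dvd l} = {1..min (multiplicity (int p) l) m}"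
    using False by (auto simp: power_dvd_iff_le_multiplicity)
  then show ?thesis using False by (simp add: tau_prime_power_def)
qed

lemma tau_prime_power_cong:
  assumes "prime p" "[l = l'] (mod (int p ^ m))"
  shows "tau_prime_power p m l = tau_prime_power p m l'"
proof -
  have "int p ^ k dvd l \<longleftrightarrow> int p ^ k dvd l'" if "k \<in> {1..m}" for k
    using that assms(2) by (intro cong_dvd_iff) (auto intro: cong_dvd_modulus le_imp_power_dvd)
  then show ?thesis
    unfolding tau_prime_power_altdef[OF assms(1)] by (metis (no_types, lifting) Collect_cong)
qed

lemma mpoly_eval_cong:
  fixes s t :: "int ^ 'n::finite"
  assumes "\<And>i. [s $ i = t $ i] (mod q)"
  shows "[mpoly_eval f s = mpoly_eval f t] (mod q)"
  unfolding mpoly_eval_def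
  by (intro cong_sum cong_mult cong_prod cong_pow cong_refl assms)

text \<open>The sum in \<open>divisor_sum\<close> is finite, so it does not take its junk value.\<close>
lemma finite_lattice_points:
  assumes "is_box B"
  shows "finite (lattice_points B P)"
proof -
  define M where "M = \<lceil>\<bar>P\<bar>\<rceil>"
  have "lattice_points B P \<subseteq> vec_lambda ` (PiE UNIV (\<lambda>_. {-M..M}))"
  proof
    fix x assume "x \<in> lattice_points B P"
    then obtain t where t: "t \<in> B" "(\<chi> i. real_of_int (x $ i)) = P *\<^sub>R t"
      by (auto simp: lattice_points_def)
    have "x $ i \<in> {-M..M}" for i
    proof -
      have "real_of_int (x $ i) = P * t $ i"
        using arg_cong[OF t(2), of "\<lambda>v. v $ i"] by simp
      moreover have "\<bar>t $ i\<bar> \<le> 1"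
        using assms t(1) unfolding is_box_def abs_le_iff by (smt (verit) mem_Collect_eq subsetD)
      ultimately have "real_of_int \<bar>x $ i\<bar> \<le> \<bar>P\<bar>"
        by (simp add: abs_mult mult_left_le)
      then have "\<bar>x $ i\<bar> \<le> M" unfolding M_def by linarith
      then show ?thesis by auto
    qed
    then have "vec_nth x \<in> PiE UNIV (\<lambda>_. {-M..M})" by auto
    then show "x \<in> vec_lambda ` (PiE UNIV (\<lambda>_. {-M..M}))"
      by (metis image_eqI vec_nth_inverse)
  qed
  then show ?thesis
    by (rule finite_subset) (intro finite_imageI finite_PiE; simp)
qed

end

theory Submission
  imports
    Defs
    "HOL-Number_Theory.Totient"
    "HOL-Real_Asymp.Real_Asymp"
begin

text \<open>
  By the hyperbola method \<open>\<tau>(\<bar>f(x)\<bar>)\<close> is essentially twice the number of divisors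
  \<open>q \<le> Q\<close> of \<open>f(x)\<close> with \<open>Q\<close> of size \<open>P powr (d / 2)\<close>. Detecting \<open>q dvd f(x)\<close> by Ramanujan sums
  turns \<open>\<Sum>\<^sub>x #{q \<le> Q. q dvd f(x)}\<close> into \<open>\<Sum>\<^sub>q C\<^sub>q(P) / q\<close> times a harmonic number of length
  \<open>Q div q\<close>, where \<open>C\<^sub>q(P) = \<Sum>\<^sub>x c\<^sub>q(f(x))\<close>. Let \<open>A(q)\<close> be the mean
  of \<open>c\<^sub>q \<circ> f\<close> over the residues modulo \<open>q\<close>. Counting residues gives
  \<open>C\<^sub>q(P) = vol(B) P\<^sup>n A(q) + O(P powr (n - 1) q\<^sup>2)\<close>, while Weyl's inequality in Birch's form bounds
  the error by \<open>O(P powr (n + \<epsilon>) q powr (\<epsilon> - 1))\<close> for \<open>q \<le> Q\<close> and \<open>d \<ge> 2\<close>; a geometric mean of the two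
  bounds is summable with a power saving. The main term is \<open>vol(B) P\<^sup>n (ln Q) \<Sum>\<^sub>q A(q) / q\<close>, and
  \<open>A\<close> is multiplicative, so that the singular series is the Euler product.

  For a smooth form the count of integer zeros of the differenced system that Birch's argument needs
  is obtained without dimension theory. By the Nullstellensatz powers of the coordinates lie in the
  ideal of the partial derivatives, so boundedly many solutions have prescribed differences of
  the variables.

  For the lower bound the cutoff is \<open>P powr (d / 2 - \<epsilon>)\<close>; the points with
  \<open>\<bar>f(x)\<bar> \<le> P powr (d - 2 * \<epsilon>)\<close> are few by slicing along a line and contribute little by the divisor
  bound, and the zeros of \<open>f\<close> are already bounded by the main sum, as every \<open>q\<close> divides \<open>0\<close>.
\<close>

text \<open>Divisibility is detected by exact fractions a / q, so there is no integral over the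
  circle and there are no minor arcs: only exponential sums at rational points with q up to about P
  powr (d / 2) occur. This is the range in which the Weyl step works. Shrinking all d - 1 difference
  vectors to a size R with R^(d-1) about q pushes the fractional parts below 1 / q as soon as q^2 is
  at most a constant times P^d, and then the polar form must vanish exactly. The saving R^(-n) in
  the 2^(d-1)-th power of the sum is q powr (- n / (d - 1)); the condition n > 2^d (d - 1) turns it
  into q powr (-2) for the sum itself. The sum over a costs one factor q, so after division by q the
  errors are summable over q, but with P powr (n + \<epsilon>) in front. This loss of P powr
  \<epsilon> against the main term is the obstacle that forces the interpolation with the residue
  count.\<close>

no_notation fps_nth (infixl "$" 75)

section \<open>Iterated differences and the polar form\<close>

definition fdiff :: "'v::ab_group_add \<Rightarrow> ('v \<Rightarrow> int) \<Rightarrow> 'v \<Rightarrow> int" where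
  "fdiff h u = (\<lambda>x. u (x + h) - u x)"

primrec fdiffs :: "'v::ab_group_add list \<Rightarrow> ('v \<Rightarrow> int) \<Rightarrow> 'v \<Rightarrow> int" where
  "fdiffs [] u = u"
| "fdiffs (h # hs) u = fdiffs hs (fdiff h u)"

lemma fdiff_commute: "fdiff h (fdiff k u) = fdiff k (fdiff h u)"
  by (auto simp: fdiff_def algebra_simps)

lemma fdiffs_fdiff: "fdiffs hs (fdiff h u) = fdiff h (fdiffs hs u)"
proof (induction hs arbitrary: u)
  case (Cons k hs)
  then show ?case by (simp add: fdiff_commute[of k h])
qed simp

lemma fdiffs_Cons_eq: "fdiffs (h # hs) u x = fdiffs hs u (x + h) - fdiffs hs u x"
  by (simp add: fdiffs_fdiff) (simp add: fdiff_def)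

lemma fdiffs_mset:
  assumes "mset xs = mset ys"
  shows "fdiffs xs u = fdiffs ys u"
proof -
  have *: "fdiffs zs u = fold fdiff zs u" for zs :: "'a list" and u
    by (induction zs arbitrary: u) auto
  have "fold fdiff xs = fold fdiff ys"
    by (rule fold_permuted_eq[where P = "\<lambda>_. True", THEN ext])
       (use assms in \<open>auto simp: fdiff_commute\<close>)
  then show ?thesis by (simp add: *)
qed

lemma fdiffs_cmult: "fdiffs hs (\<lambda>x. c * u x) = (\<lambda>x. c * fdiffs hs u x)"
proof (induction hs arbitrary: u)
  case (Cons h hs)
  have "fdiff h (\<lambda>x. c * u x) = (\<lambda>x. c * fdiff h u x)"
    by (simp add: fdiff_def algebra_simps)
  then show ?case using Cons by simp
qed auto

lemma fdiffs_add: "fdiffs hs (\<lambda>x. u x + v x) = (\<lambda>x. fdiffs hs u x + fdiffs hs v x)"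
proof (induction hs arbitrary: u v)
  case (Cons h hs)
  have "fdiff h (\<lambda>x. u x + v x) = (\<lambda>x. fdiff h u x + fdiff h v x)"
    by (simp add: fdiff_def algebra_simps)
  then show ?case using Cons by simp
qed auto

lemma fdiffs_zero: "fdiffs hs (\<lambda>x. 0) = (\<lambda>x. 0)"
  using fdiffs_cmult[of hs 0 "\<lambda>x. 0"] by simp

lemma fdiffs_sum: "fdiffs hs (\<lambda>x. \<Sum>a\<in>A. c a * u a x) = (\<lambda>x. \<Sum>a\<in>A. c a * fdiffs hs (u a) x)"
  by (induction A rule: infinite_finite_induct)
     (auto simp: fdiffs_zero fdiffs_add fdiffs_cmult)

lemma fdiffs_shift: "fdiffs hs (\<lambda>x. u (x + h)) = (\<lambda>x. fdiffs hs u (x + h))"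
proof (induction hs arbitrary: u)
  case (Cons k hs)
  have "fdiff k (\<lambda>x. u (x + h)) = (\<lambda>x. fdiff k u (x + h))"
    by (simp add: fdiff_def algebra_simps)
  then show ?case using Cons by simp
qed auto

text \<open>Leibniz rule with a coordinate as one factor: a second difference of a coordinate is
  zero, so at most one difference falls on it. That one contributes the constant
  \<open>hs ! j $ i\<close>, at the price of a shift in the other factor.\<close>

lemma fdiffs_coord_mult:
  fixes u :: "int ^ 'n::finite \<Rightarrow> int"
  shows "fdiffs hs (\<lambda>x. x $ i * u x) x =
    x $ i * fdiffs hs u x +
    (\<Sum>j<length hs. hs ! j $ i * fdiffs (take j hs @ drop (Suc j) hs) u (x + hs ! j))"
proof (induction hs arbitrary: u x)
  case (Cons h hs)
  have "fdiff h (\<lambda>x. x $ i * u x) = (\<lambda>x. h $ i * u (x + h) + x $ i * fdiff h u x)"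
    by (simp add: fdiff_def algebra_simps)
  then have "fdiffs (h # hs) (\<lambda>x. x $ i * u x) x =
      h $ i * fdiffs hs u (x + h) + fdiffs hs (\<lambda>x. x $ i * fdiff h u x) x"
    by (simp add: fdiffs_add fdiffs_cmult fdiffs_shift)
  also have "\<dots> = x $ i * fdiffs hs (fdiff h u) x + (h $ i * fdiffs hs u (x + h) +
      (\<Sum>j<length hs. hs ! j $ i * fdiffs (take j hs @ drop (Suc j) hs) (fdiff h u) (x + hs ! j)))"
    unfolding Cons.IH by simp
  also have "(h $ i * fdiffs hs u (x + h) +
      (\<Sum>j<length hs. hs ! j $ i * fdiffs (take j hs @ drop (Suc j) hs) (fdiff h u) (x + hs ! j))) =
      (\<Sum>j<length (h # hs). (h # hs) ! j $ i *
         fdiffs (take j (h # hs) @ drop (Suc j) (h # hs)) u (x + (h # hs) ! j))"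
    unfolding length_Cons sum.lessThan_Suc_shift by simp
  finally show ?case by simp
qed simp

definition int_monomial :: "('n::finite \<Rightarrow>\<^sub>0 nat) \<Rightarrow> int ^ 'n \<Rightarrow> int" where
  "int_monomial e x = (\<Prod>i\<in>UNIV. (x $ i) ^ Poly_Mapping.lookup e i)"

definition exp_degree :: "('n::finite \<Rightarrow>\<^sub>0 nat) \<Rightarrow> nat" where
  "exp_degree e = (\<Sum>i\<in>UNIV. Poly_Mapping.lookup e i)"

text \<open>Splitting off one variable is the induction step for the statements on differences of
  monomials below.\<close>

lemma exp_degree_Suc_obtain:
  assumes "exp_degree e = Suc k"
  obtains i e' where "e = Poly_Mapping.single i 1 + e'" "exp_degree e' = k"
    "int_monomial e = (\<lambda>x. x $ i * int_monomial e' x)"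
proof -
  obtain i where i: "Poly_Mapping.lookup e i > 0"
    using assms unfolding exp_degree_def by (metis gr0I sum.neutral nat.distinct(1))
  define e' where "e' = e - Poly_Mapping.single i 1"
  have e: "e = Poly_Mapping.single i 1 + e'"
    unfolding e'_def using i
    by (intro poly_mapping_eqI) (auto simp: lookup_add lookup_minus lookup_single when_def)
  have l: "Poly_Mapping.lookup e j = (if j = i then 1 else 0) + Poly_Mapping.lookup e' j" for j
    by (subst e) (auto simp: lookup_add lookup_single when_def)
  have "exp_degree e = 1 + exp_degree e'"
    unfolding exp_degree_def l by (simp add: sum.distrib)
  moreover have "int_monomial e = (\<lambda>x. x $ i * int_monomial e' x)"
    unfolding int_monomial_def l
    by (auto simp: power_add prod.distrib if_distrib[of "\<lambda>k. _ ^ k"] cong: if_cong)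
  ultimately show ?thesis using that e assms by auto
qed

lemma fdiffs_monomial_eq_0:
  fixes e :: "'n::finite \<Rightarrow>\<^sub>0 nat"
  assumes "exp_degree e < length hs"
  shows "fdiffs hs (int_monomial e) = (\<lambda>x. 0)"
  using assms
proof (induction "exp_degree e" arbitrary: e hs)
  case 0
  then have "int_monomial e = (\<lambda>x. 1)"
    unfolding exp_degree_def int_monomial_def by auto
  then show ?case using 0 by (cases hs) (auto simp: fdiff_def fdiffs_zero)
next
  case (Suc k)
  obtain i e' where e': "exp_degree e' = k" "int_monomial e = (\<lambda>x. x $ i * int_monomial e' x)"
    using exp_degree_Suc_obtain[OF Suc(2)[symmetric]] by metis
  have *: "fdiffs gs (int_monomial e') = (\<lambda>x. 0)" if "k < length gs" for gs
    using Suc(1)[of e' gs] e' that by auto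
  have **: "fdiffs (take j hs @ drop (Suc j) hs) (int_monomial e') = (\<lambda>x. 0)" if "j < length hs" for j
    using that Suc(2,3) by (intro *) auto
  show ?case
    unfolding e'(2) using ** *[of hs] Suc(2,3) by (auto simp: fdiffs_coord_mult)
qed

text \<open>The two diagonal values of the polar form identify it with \<open>k! e\<close> and with the gradient of \<open>e\<close>.\<close>
lemma fdiffs_monomial_diagonal:
  fixes e :: "'n::finite \<Rightarrow>\<^sub>0 nat"
  assumes "exp_degree e = k"
  shows "fdiffs (replicate k x) (int_monomial e) z = fact k * int_monomial e x"
  using assms
proof (induction k arbitrary: e z)
  case 0
  then show ?case by (auto simp: int_monomial_def exp_degree_def)
next
  case (Suc k)
  obtain i e' where e': "exp_degree e' = k" "int_monomial e = (\<lambda>x. x $ i * int_monomial e' x)"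
    using exp_degree_Suc_obtain[OF Suc(2)] by metis
  have "fdiffs (replicate (Suc k) x) (int_monomial e') = (\<lambda>x. 0)"
    by (intro fdiffs_monomial_eq_0) (use e' in auto)
  moreover have "fdiffs (take j (replicate (Suc k) x) @ drop (Suc j) (replicate (Suc k) x))
      (int_monomial e') w = fact k * int_monomial e' x" if "j < Suc k" for j w
  proof -
    have "take j (replicate (Suc k) x) @ drop (Suc j) (replicate (Suc k) x) = replicate k x"
      using that by (simp add: min_def replicate_add[symmetric] del: replicate_Suc)
    then show ?thesis using Suc.IH e' by auto
  qed
  ultimately show ?case
    unfolding e'(2) fdiffs_coord_mult by (simp del: replicate_Suc)
qed

lemma fdiffs_monomial_gradient:
  fixes e :: "'n::finite \<Rightarrow>\<^sub>0 nat"
  assumes "exp_degree e = Suc k"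
  shows "fdiffs (replicate k x @ [axis l 1]) (int_monomial e) z =
    fact k * (int (Poly_Mapping.lookup e l) * int_monomial (e - Poly_Mapping.single l 1) x)"
  using assms
proof (induction k arbitrary: e z)
  case 0
  obtain i e' where e': "e = Poly_Mapping.single i 1 + e'" "exp_degree e' = 0"
      "int_monomial e = (\<lambda>x. x $ i * int_monomial e' x)"
    using exp_degree_Suc_obtain[OF 0] by metis
  have e0: "e' = 0" using e'(2) by (intro poly_mapping_eqI) (auto simp: exp_degree_def)
  have m: "int_monomial e' = (\<lambda>x. 1)" using e'(2) by (auto simp: int_monomial_def exp_degree_def)
  show ?case
    unfolding e'(3) m using e0 e'(1)
    by (cases "i = l") (auto simp: fdiff_def axis_def lookup_single int_monomial_def lookup_minus)
next
  case (Suc k)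
  obtain i e' where e': "e = Poly_Mapping.single i 1 + e'" "exp_degree e' = Suc k"
      "int_monomial e = (\<lambda>x. x $ i * int_monomial e' x)"
    using exp_degree_Suc_obtain[OF Suc(2)] by metis
  let ?hs = "replicate (Suc k) x @ [axis l 1]"
  have "fdiffs ?hs (int_monomial e') = (\<lambda>x. 0)"
    by (intro fdiffs_monomial_eq_0) (use e' in auto)
  moreover have "fdiffs (take j ?hs @ drop (Suc j) ?hs) (int_monomial e') w =
      fact k * (int (Poly_Mapping.lookup e' l) * int_monomial (e' - Poly_Mapping.single l 1) x)"
    if "j < Suc k" for j w
  proof -
    have "take j ?hs @ drop (Suc j) ?hs = replicate k x @ [axis l 1]"
      using replicate_add[of j "k - j" x] that by (simp add: min_def del: replicate_Suc)
    then show ?thesis using Suc.IH[of e'] e'(2) by auto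
  qed
  \<comment> \<open>Omitting the last vector \<open>axis l 1\<close> leaves the diagonal. This is
    the term in which the derivative falls on the factor \<open>x $ i\<close> that was split
    off.\<close>
  moreover have "fdiffs (take (Suc k) ?hs @ drop (Suc (Suc k)) ?hs) (int_monomial e') w =
      fact (Suc k) * int_monomial e' x" for w
    using fdiffs_monomial_diagonal[OF e'(2)] by (simp del: replicate_Suc fact_Suc)
  ultimately have eq: "fdiffs ?hs (int_monomial e) z =
      int (Suc k) * (x $ i * (fact k * (int (Poly_Mapping.lookup e' l) *
        int_monomial (e' - Poly_Mapping.single l 1) x))) +
      (axis l 1 :: int ^ 'n) $ i * (fact (Suc k) * int_monomial e' x)"
    unfolding e'(3) fdiffs_coord_mult
    by (simp add: nth_append del: replicate_Suc fact_Suc)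
  \<comment> \<open>Subtraction of exponents truncates at 0. Where it truncates in
    \<open>e'\<close>, the factor \<open>lookup e' l\<close> is zero, so only a positive exponent
    needs an argument.\<close>
  have 1: "int (Poly_Mapping.lookup e' l) * (x $ i * int_monomial (e' - Poly_Mapping.single l 1) x) =
      int (Poly_Mapping.lookup e' l) * int_monomial (e - Poly_Mapping.single l 1) x"
  proof (cases "Poly_Mapping.lookup e' l = 0")
    case False
    then have "e - Poly_Mapping.single l 1 = Poly_Mapping.single i 1 + (e' - Poly_Mapping.single l 1)"
      unfolding e'(1)
      by (intro poly_mapping_eqI) (auto simp: lookup_add lookup_minus lookup_single when_def)
    then have "Poly_Mapping.lookup (e - Poly_Mapping.single l 1) j =
        (if j = i then 1 else 0) + Poly_Mapping.lookup (e' - Poly_Mapping.single l 1) j" for j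
      by (auto simp: lookup_add lookup_single when_def)
    then have "int_monomial (e - Poly_Mapping.single l 1) x =
        x $ i * int_monomial (e' - Poly_Mapping.single l 1) x"
      unfolding int_monomial_def
      by (simp add: power_add prod.distrib if_distrib[of "\<lambda>k. _ ^ k"] cong: if_cong)
    then show ?thesis by simp
  qed auto
  have 2: "(axis l 1 :: int ^ 'n) $ i * int_monomial e' x =
      (if i = l then 1 else 0) * int_monomial (e - Poly_Mapping.single l 1) x"
    unfolding e'(1) by (auto simp: axis_def)
  have 3: "int (Poly_Mapping.lookup e l) = int (Poly_Mapping.lookup e' l) + (if i = l then 1 else 0)"
    unfolding e'(1) by (auto simp: lookup_add lookup_single when_def)
  have "fdiffs ?hs (int_monomial e) z =
      int (Suc k) * (fact k * (int (Poly_Mapping.lookup e' l) *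
        (x $ i * int_monomial (e' - Poly_Mapping.single l 1) x))) +
      fact (Suc k) * ((axis l 1 :: int ^ 'n) $ i * int_monomial e' x)"
    unfolding eq by (simp only: ac_simps)
  also have "\<dots> = fact (Suc k) * (int (Poly_Mapping.lookup e l) * int_monomial (e - Poly_Mapping.single l 1) x)"
    unfolding 1 2 3 by (simp add: algebra_simps)
  finally show ?case .
qed

section \<open>Evaluation of polynomials and the polar form\<close>

lemma mpoly_eval_superset:
  assumes "finite S" "Poly_Mapping.keys f \<subseteq> S"
  shows "mpoly_eval f x =
    (\<Sum>e\<in>S. of_int (Poly_Mapping.lookup f e) * (\<Prod>i\<in>UNIV. (x $ i) ^ Poly_Mapping.lookup e i))"
  unfolding mpoly_eval_def
  by (rule sum.mono_neutral_left) (use assms in \<open>auto simp: in_keys_iff\<close>)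

lemma mpoly_eval_add: "mpoly_eval (f + g) x = mpoly_eval f x + mpoly_eval g x"
proof -
  let ?S = "Poly_Mapping.keys f \<union> Poly_Mapping.keys g"
  show ?thesis
    using Poly_Mapping.keys_add[of f g]
    by (simp add: mpoly_eval_superset[of ?S] lookup_add algebra_simps sum.distrib)
qed

lemma mpoly_eval_sum: "mpoly_eval (\<Sum>a\<in>A. F a) x = (\<Sum>a\<in>A. mpoly_eval (F a) x)"
proof (induction A rule: infinite_finite_induct)
  case (insert a A)
  then show ?case by (simp add: mpoly_eval_add)
qed (simp_all add: mpoly_eval_def)

lemma mpoly_eval_single:
  "mpoly_eval (Poly_Mapping.single e c) x = of_int c * (\<Prod>i\<in>UNIV. (x $ i) ^ Poly_Mapping.lookup e i)"
  by (subst mpoly_eval_superset[of "{e}"]) auto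

lemma mpoly_eval_pderiv:
  "mpoly_eval (mpoly_pderiv l f) x = (\<Sum>e\<in>Poly_Mapping.keys f.
     of_int (int (Poly_Mapping.lookup e l) * Poly_Mapping.lookup f e) *
     (\<Prod>i\<in>UNIV. (x $ i) ^ Poly_Mapping.lookup (e - Poly_Mapping.single l 1) i))"
  unfolding mpoly_pderiv_def by (simp only: mpoly_eval_sum mpoly_eval_single)

lemma mpoly_eval_of_int:
  "mpoly_eval f (\<chi> i. of_int (x $ i)) = of_int (mpoly_eval f x)"
  by (simp add: mpoly_eval_def)

lemma mpoly_eval_int:
  fixes x :: "int ^ 'n::finite"
  shows "mpoly_eval f x = (\<Sum>e\<in>Poly_Mapping.keys f. Poly_Mapping.lookup f e * int_monomial e x)"
  by (simp add: mpoly_eval_def int_monomial_def)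

text \<open>For a form of degree \<open>d\<close> and \<open>d\<close> vectors this is
  \<open>d!\<close> times its symmetric multilinear form, with integer values. The base point 0 is
  immaterial, as one further difference vanishes.\<close>

definition polar :: "('n::finite) int_mpoly \<Rightarrow> (int ^ 'n) list \<Rightarrow> int" where
  "polar f hs = fdiffs hs (mpoly_eval f) 0"

lemma fdiffs_mpoly:
  "fdiffs hs (mpoly_eval f) x =
    (\<Sum>e\<in>Poly_Mapping.keys f. Poly_Mapping.lookup f e * fdiffs hs (int_monomial e) x)"
proof -
  have "mpoly_eval f = (\<lambda>x. \<Sum>e\<in>Poly_Mapping.keys f. Poly_Mapping.lookup f e * int_monomial e x)"
    using mpoly_eval_int by blast
  then show ?thesis by (simp add: fdiffs_sum)
qed

lemma homogeneous_exp_degree: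
  assumes "homogeneous_of_degree d f" "e \<in> Poly_Mapping.keys f"
  shows "exp_degree e = d"
  using assms by (auto simp: homogeneous_of_degree_def exp_degree_def)

lemma fdiffs_homogeneous_eq_0:
  assumes "homogeneous_of_degree d f" "d < length hs"
  shows "fdiffs hs (mpoly_eval f) x = 0"
  unfolding fdiffs_mpoly
  by (intro sum.neutral) (use assms homogeneous_exp_degree fdiffs_monomial_eq_0 in fastforce)

text \<open>Weyl differencing stops here: after \<open>d - 1\<close> differences the variable enters
  only through \<open>polar f (x # hs)\<close>, which is linear in \<open>x\<close>, so the
  exponential sum factors into geometric sums.\<close>

lemma fdiffs_homogeneous_affine:
  assumes "homogeneous_of_degree d f" "d = Suc (length hs)"
  shows "fdiffs hs (mpoly_eval f) x = fdiffs hs (mpoly_eval f) 0 + polar f (x # hs)"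
  by (simp add: polar_def fdiffs_Cons_eq del: fdiffs.simps)

text \<open>Smoothness speaks about the gradient, differencing produces the polar form. They meet on
  the diagonal, up to \<open>fact k\<close>.\<close>

lemma polar_gradient:
  assumes "homogeneous_of_degree d f" "d = Suc k"
  shows "polar f (replicate k x @ [axis l 1]) = fact k * mpoly_eval (mpoly_pderiv l f) x"
proof -
  have "fdiffs (replicate k x @ [axis l 1]) (int_monomial e) 0 =
      fact k * (int (Poly_Mapping.lookup e l) * int_monomial (e - Poly_Mapping.single l 1) x)"
    if "e \<in> Poly_Mapping.keys f" for e
    using fdiffs_monomial_gradient homogeneous_exp_degree[OF assms(1) that] assms(2) by metis
  then show ?thesis
    unfolding polar_def fdiffs_mpoly mpoly_eval_pderiv sum_distrib_left
    by (intro sum.cong) (auto simp: int_monomial_def)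
qed

text \<open>Symmetry as dependence on the multiset of arguments lets additivity in the first slot
  serve for every slot; homogeneity over the integers follows from additivity.\<close>

locale sym_multilinear =
  fixes d :: nat and M :: "(int ^ 'n::finite) list \<Rightarrow> int"
  assumes M_mset: "mset xs = mset ys \<Longrightarrow> M xs = M ys"
    and M_add: "Suc (length hs) = d \<Longrightarrow> M ((a + b) # hs) = M (a # hs) + M (b # hs)"
begin

lemma M_zero: "Suc (length hs) = d \<Longrightarrow> M (0 # hs) = 0"
  using M_add[of hs 0 0] by simp

lemma M_diff: "Suc (length hs) = d \<Longrightarrow> M ((a - b) # hs) = M (a # hs) - M (b # hs)"
  using M_add[of hs "a - b" b] by simp

lemma M_scale:
  assumes "Suc (length hs) = d"
  shows "M ((k *s a) # hs) = k * M (a # hs)"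
proof (induction k rule: int_induct[of _ 0])
  case base
  then show ?case using M_zero[OF assms] by simp
next
  case (step1 i)
  have "(i + 1) *s a = i *s a + a" by (simp add: vec_eq_iff algebra_simps)
  then show ?case using step1 M_add[OF assms, of "i *s a" a] by (simp add: algebra_simps)
next
  case (step2 i)
  have "(i - 1) *s a = i *s a - a" by (simp add: vec_eq_iff algebra_simps)
  then show ?case using step2 M_diff[OF assms, of "i *s a" a] by (simp add: algebra_simps)
qed

lemma M_sum:
  assumes "Suc (length hs) = d"
  shows "M ((\<Sum>i\<in>A. v i) # hs) = (\<Sum>i\<in>A. M (v i # hs))"
  by (induction A rule: infinite_finite_induct) (auto simp: M_zero M_add assms)

lemma M_expand:
  assumes "Suc (length hs) = d"
  shows "M (h # hs) = (\<Sum>i\<in>UNIV. h $ i * M (axis i 1 # hs))"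
proof -
  have "h = (\<Sum>i\<in>UNIV. h $ i *s axis i 1)"
    by (simp add: vec_eq_iff axis_def if_distrib[of "\<lambda>k. _ * k"] cong: if_cong)
  then have "M (h # hs) = M ((\<Sum>i\<in>UNIV. h $ i *s axis i 1) # hs)" by simp
  then show ?thesis by (simp add: M_sum M_scale assms)
qed

lemma M_swap: "M (xs @ y # ys) = M (y # xs @ ys)"
  by (rule M_mset) simp

end

text \<open>The failure of additivity in the first slot is a difference with \<open>d + 1\<close>
  vectors in all, which is zero on a form of degree \<open>d\<close>.\<close>

lemma polar_sym_multilinear:
  fixes f :: "('n::finite) int_mpoly"
  assumes "homogeneous_of_degree d f"
  shows "sym_multilinear d (polar f)"
proof
  show "polar f xs = polar f ys" if "mset xs = mset ys" for xs ys
    using fdiffs_mset[OF that] by (simp add: polar_def)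
next
  fix hs :: "(int ^ 'n) list" and a b
  assume hs: "Suc (length hs) = d"
  have "fdiffs (b # a # hs) (mpoly_eval f) 0 = 0"
    by (rule fdiffs_homogeneous_eq_0[OF assms]) (use hs in auto)
  then have "fdiffs (a # hs) (mpoly_eval f) b = fdiffs (a # hs) (mpoly_eval f) 0"
    by (simp add: fdiffs_Cons_eq[of b] del: fdiffs.simps)
  then show "polar f ((a + b) # hs) = polar f (a # hs) + polar f (b # hs)"
    by (simp add: polar_def fdiffs_Cons_eq algebra_simps del: fdiffs.simps)
qed

section \<open>Nullstellensatz for polynomial functions\<close>

definition cmono :: "('n::finite \<Rightarrow> nat) \<Rightarrow> complex ^ 'n \<Rightarrow> complex" where
  "cmono e z = (\<Prod>i\<in>UNIV. (z $ i) ^ e i)"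

definition expset :: "nat \<Rightarrow> ('n::finite \<Rightarrow> nat) set" where
  "expset k = {e. sum e UNIV < k}"

text \<open>The degree bound is strict: \<open>polyfun 0\<close> contains only the zero function,
  and "of lower order than degree \<open>r\<close>" is \<open>polyfun r\<close>, also for
  \<open>r = 0\<close>.\<close>

definition polyfun :: "nat \<Rightarrow> (complex ^ 'n::finite \<Rightarrow> complex) set" where
  "polyfun k = {F. \<exists>c. F = (\<lambda>z. \<Sum>e\<in>expset k. c e * cmono e z)}"

lemma finite_expset [simp]: "finite (expset k :: ('n::finite \<Rightarrow> nat) set)"
proof (rule finite_subset)
  show "(expset k :: ('n \<Rightarrow> nat) set) \<subseteq> PiE UNIV (\<lambda>_. {..<k})"
  proof
    fix e :: "'n \<Rightarrow> nat" assume "e \<in> expset k"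
    then have "e i < k" for i
      using member_le_sum[of i UNIV e] by (auto simp: expset_def)
    then show "e \<in> PiE UNIV (\<lambda>_. {..<k})" by auto
  qed
qed (intro finite_PiE; simp)

lemma polyfun_mono:
  assumes "k \<le> l" "F \<in> polyfun k"
  shows "F \<in> polyfun l"
proof -
  obtain c where c: "F = (\<lambda>z. \<Sum>e\<in>expset k. c e * cmono e z)"
    using assms by (auto simp: polyfun_def)
  have "(expset k :: ('a \<Rightarrow> nat) set) \<subseteq> expset l" using assms by (auto simp: expset_def)
  then have "F = (\<lambda>z. \<Sum>e\<in>expset l. (if e \<in> expset k then c e else 0) * cmono e z)"
    unfolding c by (intro ext sum.mono_neutral_cong_left) auto
  then show ?thesis unfolding polyfun_def by (intro CollectI exI)
qed

lemma polyfun_zero: "(\<lambda>z. 0) \<in> polyfun k"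
  unfolding polyfun_def by (auto intro: exI[of _ "\<lambda>_. 0"])

lemma polyfun_add:
  assumes "F \<in> polyfun k" "G \<in> polyfun k"
  shows "(\<lambda>z. F z + G z) \<in> polyfun k"
proof -
  obtain c c' where c: "F = (\<lambda>z. \<Sum>e\<in>expset k. c e * cmono e z)" "G = (\<lambda>z. \<Sum>e\<in>expset k. c' e * cmono e z)"
    using assms by (auto simp: polyfun_def)
  then show ?thesis
    by (auto simp: polyfun_def sum.distrib ring_distribs intro!: exI[of _ "\<lambda>e. c e + c' e"])
qed

lemma polyfun_cmult:
  assumes "F \<in> polyfun k"
  shows "(\<lambda>z. a * F z) \<in> polyfun k"
proof -
  obtain c where c: "F = (\<lambda>z. \<Sum>e\<in>expset k. c e * cmono e z)"
    using assms by (auto simp: polyfun_def)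
  then show ?thesis
    by (auto simp: polyfun_def sum_distrib_left mult.assoc intro!: exI[of _ "\<lambda>e. a * c e"])
qed

lemma polyfun_sum:
  assumes "\<And>a. a \<in> A \<Longrightarrow> F a \<in> polyfun k"
  shows "(\<lambda>z. \<Sum>a\<in>A. F a z) \<in> polyfun k"
  using assms by (induction A rule: infinite_finite_induct) (auto simp: polyfun_zero polyfun_add)

lemma polyfun_cmono:
  assumes "sum e UNIV < k"
  shows "cmono e \<in> polyfun k"
proof -
  have "cmono e = (\<lambda>z. \<Sum>e'\<in>expset k. (if e' = e then 1 else 0) * cmono e' z)"
    using assms by (auto simp: expset_def if_distrib[of "\<lambda>x. x * _"] sum.delta[OF finite_expset[unfolded expset_def]] cong: if_cong)
  then show ?thesis unfolding polyfun_def by (intro CollectI exI)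
qed

lemma cmono_mult: "cmono e z * cmono e' z = cmono (\<lambda>i. e i + e' i) z"
  by (simp add: cmono_def power_add prod.distrib)

lemma polyfun_mult:
  assumes "F \<in> polyfun (Suc a)" "G \<in> polyfun b"
  shows "(\<lambda>z. F z * G z) \<in> polyfun (a + b)"
proof -
  obtain c c' where c: "F = (\<lambda>z. \<Sum>e\<in>expset (Suc a). c e * cmono e z)" "G = (\<lambda>z. \<Sum>e\<in>expset b. c' e * cmono e z)"
    using assms by (auto simp: polyfun_def)
  have "(\<lambda>z. F z * G z) = (\<lambda>z. \<Sum>e\<in>expset (Suc a). \<Sum>e'\<in>expset b. (c e * c' e') * cmono (\<lambda>i. e i + e' i) z)"
    unfolding c sum_product cmono_mult[symmetric] by (simp add: mult_ac)
  also have "\<dots> \<in> polyfun (a + b)"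
    by (intro polyfun_sum polyfun_cmult polyfun_cmono) (auto simp: expset_def sum.distrib)
  finally show ?thesis .
qed

lemma polyfun_const: "(\<lambda>z. c) \<in> polyfun (Suc 0)"
proof -
  have "(\<lambda>z. c * cmono (\<lambda>_. 0) z) \<in> polyfun (Suc 0)"
    by (intro polyfun_cmult polyfun_cmono) simp
  then show ?thesis by (simp add: cmono_def)
qed

lemma cmono_single: "cmono (\<lambda>j. if j = i then m else 0) z = z $ i ^ m"
  by (simp add: cmono_def if_distrib[of "\<lambda>k. _ ^ k"] cong: if_cong)

lemma polyfun_power_coord: "(\<lambda>z. z $ i ^ m) \<in> polyfun (Suc m)"
  unfolding cmono_single[symmetric] by (intro polyfun_cmono) simp

lemma polyfun_coord: "(\<lambda>z. z $ i) \<in> polyfun (Suc (Suc 0))"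
  using polyfun_power_coord[of i 1] by simp

section \<open>Polynomial functions of arbitrary degree\<close>

definition polyfuns :: "(complex ^ 'n::finite \<Rightarrow> complex) set" where
  "polyfuns = (\<Union>k. polyfun k)"

lemma polyfunsI: "F \<in> polyfun k \<Longrightarrow> F \<in> polyfuns"
  by (auto simp: polyfuns_def)

lemma polyfuns_add:
  assumes "F \<in> polyfuns" "G \<in> polyfuns"
  shows "(\<lambda>z. F z + G z) \<in> polyfuns"
proof -
  obtain k l where "F \<in> polyfun k" "G \<in> polyfun l" using assms by (auto simp: polyfuns_def)
  then show ?thesis
    using polyfun_mono[of k "max k l" F] polyfun_mono[of l "max k l" G]
    by (intro polyfunsI[of _ "max k l"] polyfun_add) auto
qed

lemma polyfuns_mult:
  assumes "F \<in> polyfuns" "G \<in> polyfuns"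
  shows "(\<lambda>z. F z * G z) \<in> polyfuns"
proof -
  obtain k l where "F \<in> polyfun k" "G \<in> polyfun l" using assms by (auto simp: polyfuns_def)
  then show ?thesis
    using polyfun_mono[of k "Suc k" F] by (intro polyfunsI[of _ "k + l"] polyfun_mult) auto
qed

lemma polyfuns_const: "(\<lambda>z. c) \<in> polyfuns"
  by (rule polyfunsI[OF polyfun_const])

lemma polyfuns_coord: "(\<lambda>z. z $ i) \<in> polyfuns"
  by (rule polyfunsI[OF polyfun_coord])

lemma polyfuns_power_coord: "(\<lambda>z. z $ i ^ m) \<in> polyfuns"
  by (rule polyfunsI[OF polyfun_power_coord])

lemma polyfuns_cmult: "F \<in> polyfuns \<Longrightarrow> (\<lambda>z. c * F z) \<in> polyfuns"
  by (rule polyfuns_mult[OF polyfuns_const])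

lemma polyfuns_diff: "F \<in> polyfuns \<Longrightarrow> G \<in> polyfuns \<Longrightarrow> (\<lambda>z. F z - G z) \<in> polyfuns"
  using polyfuns_add[OF _ polyfuns_cmult[of G "-1"], of F] by simp

lemma polyfuns_sum: "(\<And>a. a \<in> A \<Longrightarrow> F a \<in> polyfuns) \<Longrightarrow> (\<lambda>z. \<Sum>a\<in>A. F a z) \<in> polyfuns"
  by (induction A rule: infinite_finite_induct) (auto simp: polyfuns_const polyfuns_add)

lemma polyfuns_prod: "(\<And>a. a \<in> A \<Longrightarrow> F a \<in> polyfuns) \<Longrightarrow> (\<lambda>z. \<Prod>a\<in>A. F a z) \<in> polyfuns"
  by (induction A rule: infinite_finite_induct) (auto simp: polyfuns_const polyfuns_mult)

text \<open>Gaussian elimination: an equation with a nonzero pivot \<open>c j0 e\<close> eliminates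
  the unknown \<open>j0\<close>, which leaves one equation and one unknown fewer.\<close>

lemma underdetermined_system:
  fixes c :: "'j \<Rightarrow> 'e \<Rightarrow> 'a::field"
  assumes "finite E" "finite J" "card E < card J"
  shows "\<exists>l. (\<exists>j\<in>J. l j \<noteq> 0) \<and> (\<forall>e\<in>E. (\<Sum>j\<in>J. l j * c j e) = 0)"
  using assms
proof (induction E arbitrary: J c rule: finite_induct)
  case empty
  then have "J \<noteq> {}" by auto
  then show ?case by (auto intro!: exI[of _ "\<lambda>_. 1"])
next
  case (insert e E)
  show ?case
  proof (cases "\<forall>j\<in>J. c j e = 0")
    case True
    have "card E < card J" using insert by simp
    from insert.IH[OF \<open>finite J\<close> this, of c] True show ?thesis by auto
  next
    case False
    then obtain j0 where j0: "j0 \<in> J" "c j0 e \<noteq> 0" by auto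
    let ?J = "J - {j0}"
    have "card E < card ?J" using insert j0 by simp
    from insert.IH[OF _ this, of "\<lambda>j e'. c j e' - c j e / c j0 e * c j0 e'"] insert.prems
    obtain l where l: "\<exists>j\<in>?J. l j \<noteq> 0"
      "\<And>e'. e' \<in> E \<Longrightarrow> (\<Sum>j\<in>?J. l j * (c j e' - c j e / c j0 e * c j0 e')) = 0"
      by auto
    define l' where "l' = (\<lambda>j. if j = j0 then - (\<Sum>j\<in>?J. l j * c j e) / c j0 e else l j)"
    have s: "(\<Sum>j\<in>J. l' j * c j e') = l' j0 * c j0 e' + (\<Sum>j\<in>?J. l j * c j e')" for e'
      using j0 insert.prems by (subst sum.remove[of J j0]) (auto simp: l'_def)
    have "(\<Sum>j\<in>J. l' j * c j e) = 0"
      unfolding s by (simp add: l'_def j0)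
    moreover have "(\<Sum>j\<in>J. l' j * c j e') = 0" if "e' \<in> E" for e'
    proof -
      have "l' j0 * c j0 e' = - (\<Sum>j\<in>?J. l j * (c j e / c j0 e * c j0 e'))"
        by (simp add: l'_def sum_distrib_right sum_divide_distrib mult.assoc)
      then show ?thesis
        unfolding s using l(2)[OF that] by (simp add: right_diff_distrib sum_subtractf)
    qed
    moreover have "\<exists>j\<in>J. l' j \<noteq> 0" using l(1) by (auto simp: l'_def)
    ultimately show ?thesis by auto
  qed
qed

text \<open>Functions of degree below \<open>k\<close> are given by \<open>card (expset k)\<close>
  coefficients, so more functions than that are dependent.\<close>

lemma polyfun_dependent:
  fixes F :: "'j \<Rightarrow> complex ^ 'n::finite \<Rightarrow> complex"
  assumes "finite J" "card (expset k :: ('n \<Rightarrow> nat) set) < card J" "\<And>j. j \<in> J \<Longrightarrow> F j \<in> polyfun k"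
  shows "\<exists>l. (\<exists>j\<in>J. l j \<noteq> 0) \<and> (\<forall>z. (\<Sum>j\<in>J. l j * F j z) = 0)"
proof -
  have "\<forall>j\<in>J. \<exists>c. F j = (\<lambda>z. \<Sum>e\<in>expset k. c e * cmono e z)"
    using assms(3) by (auto simp: polyfun_def)
  then obtain c where c: "\<And>j. j \<in> J \<Longrightarrow> F j = (\<lambda>z. \<Sum>e\<in>expset k. c j e * cmono e z)"
    by metis
  obtain l where l: "\<exists>j\<in>J. l j \<noteq> 0" "\<forall>e\<in>expset k. (\<Sum>j\<in>J. l j * c j e) = 0"
    using underdetermined_system[OF _ assms(1,2), of c] by auto
  have "(\<Sum>j\<in>J. l j * F j z) = 0" for z
  proof -
    have "(\<Sum>j\<in>J. l j * F j z) = (\<Sum>j\<in>J. \<Sum>e\<in>expset k. l j * c j e * cmono e z)"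
      by (intro sum.cong) (auto simp: c sum_distrib_left mult.assoc)
    also have "\<dots> = (\<Sum>e\<in>expset k. (\<Sum>j\<in>J. l j * c j e) * cmono e z)"
      by (subst sum.swap) (simp add: sum_distrib_right)
    also have "\<dots> = 0" using l(2) by simp
    finally show ?thesis .
  qed
  then show ?thesis using l(1) by blast
qed

section \<open>Ideals of polynomial functions\<close>

definition polyfun_ideal :: "(complex ^ 'n::finite \<Rightarrow> complex) set \<Rightarrow> bool" where
  "polyfun_ideal J \<longleftrightarrow> J \<subseteq> polyfuns \<and> (\<lambda>z. 0) \<in> J \<and>
     (\<forall>F\<in>J. \<forall>G\<in>J. (\<lambda>z. F z + G z) \<in> J) \<and> (\<forall>F\<in>polyfuns. \<forall>G\<in>J. (\<lambda>z. F z * G z) \<in> J)"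

lemma polyfun_ideal_sum:
  assumes "polyfun_ideal J" "\<And>a. a \<in> A \<Longrightarrow> F a \<in> J"
  shows "(\<lambda>z. \<Sum>a\<in>A. F a z) \<in> J"
  using assms(2) by (induction A rule: infinite_finite_induct) (use assms(1) in \<open>auto simp: polyfun_ideal_def\<close>)

text \<open>Maximality is taken among the ideals that avoid all powers of one coordinate, not among
  proper ideals. This amounts to a maximal ideal after inverting the coordinate, and so yields the
  statement on powers without Rabinowitsch's additional variable.\<close>

context
  fixes J :: "(complex ^ 'n::finite \<Rightarrow> complex) set" and j :: 'n
  assumes ideal: "polyfun_ideal J"
    and avoid: "\<And>m. (\<lambda>z. z $ j ^ m) \<notin> J"
    and maximal: "\<And>K. polyfun_ideal K \<Longrightarrow> J \<subseteq> K \<Longrightarrow> (\<And>m. (\<lambda>z. z $ j ^ m) \<notin> K) \<Longrightarrow> K = J"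
begin

lemma max_ideal_add: "F \<in> J \<Longrightarrow> G \<in> J \<Longrightarrow> (\<lambda>z. F z + G z) \<in> J"
  using ideal by (auto simp: polyfun_ideal_def)

lemma max_ideal_mult: "F \<in> polyfuns \<Longrightarrow> G \<in> J \<Longrightarrow> (\<lambda>z. F z * G z) \<in> J"
  using ideal by (auto simp: polyfun_ideal_def)

lemma max_ideal_diff:
  assumes "F \<in> J" "G \<in> J"
  shows "(\<lambda>z. F z - G z) \<in> J"
  using max_ideal_add[OF assms(1) max_ideal_mult[OF polyfuns_const assms(2)], of "-1"] by simp

text \<open>Modulo \<open>J\<close> the function \<open>F\<close> is invertible up to a power of the
  coordinate: the ideal generated by \<open>J\<close> and \<open>F\<close> is strictly larger, so by
  maximality it contains such a power.\<close>

lemma max_ideal_power: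
  assumes F: "F \<in> polyfuns" and "F \<notin> J"
  shows "\<exists>m u. u \<in> polyfuns \<and> (\<lambda>z. z $ j ^ m - u z * F z) \<in> J"
proof (rule ccontr)
  assume no: "\<not> ?thesis"
  define K where "K = {H. \<exists>a\<in>J. \<exists>u\<in>polyfuns. H = (\<lambda>z. a z + u z * F z)}"
  have KI: "(\<lambda>z. a z + u z * F z) \<in> K" if "a \<in> J" "u \<in> polyfuns" for a u
    using that by (auto simp: K_def)
  have J: "J \<subseteq> polyfuns" "(\<lambda>z. 0) \<in> J" using ideal by (auto simp: polyfun_ideal_def)
  have "polyfun_ideal K"
    unfolding polyfun_ideal_def
  proof (intro conjI ballI)
    show "K \<subseteq> polyfuns" using J F by (auto simp: K_def intro!: polyfuns_add polyfuns_mult)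
    show "(\<lambda>z. 0) \<in> K" using KI[OF J(2) polyfuns_const[of 0]] by simp
  next
    fix H H' assume "H \<in> K" "H' \<in> K"
    then obtain a u a' u' where *: "a \<in> J" "u \<in> polyfuns" "H = (\<lambda>z. a z + u z * F z)"
      "a' \<in> J" "u' \<in> polyfuns" "H' = (\<lambda>z. a' z + u' z * F z)" by (auto simp: K_def)
    show "(\<lambda>z. H z + H' z) \<in> K"
      using KI[OF max_ideal_add[OF *(1,4)] polyfuns_add[OF *(2,5)]] by (simp add: * algebra_simps)
  next
    fix H H' :: "complex ^ 'n \<Rightarrow> complex" assume "H \<in> polyfuns" "H' \<in> K"
    then obtain a' u' where *: "a' \<in> J" "u' \<in> polyfuns" "H' = (\<lambda>z. a' z + u' z * F z)"
      by (auto simp: K_def)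
    show "(\<lambda>z. H z * H' z) \<in> K"
      using KI[OF max_ideal_mult[OF \<open>H \<in> polyfuns\<close> *(1)] polyfuns_mult[OF \<open>H \<in> polyfuns\<close> *(2)]]
      by (simp add: * algebra_simps)
  qed
  moreover have "J \<subseteq> K"
    using KI[OF _ polyfuns_const[of 0]] by auto
  moreover have "(\<lambda>z. z $ j ^ m) \<notin> K" for m
  proof
    assume "(\<lambda>z. z $ j ^ m) \<in> K"
    then obtain a u where *: "a \<in> J" "u \<in> polyfuns" "(\<lambda>z. z $ j ^ m) = (\<lambda>z. a z + u z * F z)"
      by (auto simp: K_def)
    have "(\<lambda>z. z $ j ^ m - u z * F z) = a"
    proof
      fix z
      show "z $ j ^ m - u z * F z = a z" using fun_cong[OF *(3), of z] by simp
    qed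
    then have "(\<lambda>z. z $ j ^ m - u z * F z) \<in> J" using *(1) by simp
    with no *(2) show False by blast
  qed
  ultimately have "K = J" by (rule maximal)
  moreover have "F \<in> K" using KI[OF J(2) polyfuns_const[of 1]] by simp
  ultimately show False using assms by simp
qed

lemma max_ideal_prime:
  assumes "F \<in> polyfuns" "G \<in> polyfuns" "(\<lambda>z. F z * G z) \<in> J"
  shows "F \<in> J \<or> G \<in> J"
proof (rule ccontr)
  assume "\<not> ?thesis"
  then obtain m u m' u' where *: "u \<in> polyfuns" "(\<lambda>z. z $ j ^ m - u z * F z) \<in> J"
     "u' \<in> polyfuns" "(\<lambda>z. z $ j ^ m' - u' z * G z) \<in> J"
    using max_ideal_power[OF assms(1)] max_ideal_power[OF assms(2)] by blast
  \<comment> \<open>Three members of \<open>J\<close>, weighted so that everything cancels except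
    \<open>z $ j ^ (m + m')\<close>.\<close>
  have "(\<lambda>z. (z $ j ^ m' * (z $ j ^ m - u z * F z) + (u z * F z) * (z $ j ^ m' - u' z * G z)) +
      (u z * u' z) * (F z * G z)) \<in> J"
    by (rule max_ideal_add[OF max_ideal_add[OF
          max_ideal_mult[OF polyfuns_power_coord *(2)]
          max_ideal_mult[OF polyfuns_mult[OF *(1) assms(1)] *(4)]]
          max_ideal_mult[OF polyfuns_mult[OF *(1,3)] assms(3)]])
  also have "(\<lambda>z. (z $ j ^ m' * (z $ j ^ m - u z * F z) + (u z * F z) * (z $ j ^ m' - u' z * G z)) +
      (u z * u' z) * (F z * G z)) = (\<lambda>z. z $ j ^ (m + m'))"
    by (auto simp: algebra_simps power_add)
  finally show False using avoid[of "m + m'"] by simp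
qed

lemma max_ideal_const:
  assumes "(\<lambda>z. c) \<in> J"
  shows "c = 0"
proof (rule ccontr)
  assume "c \<noteq> 0"
  then have "(\<lambda>z. z $ j ^ 0) \<in> J"
    using max_ideal_mult[OF polyfuns_const[of "1/c"] assms] by simp
  then show False using avoid by blast
qed

lemma max_ideal_prod_mset:
  assumes "(\<lambda>z. \<Prod>r\<in>#A. z $ i - r) \<in> J"
  shows "\<exists>r. (\<lambda>z. z $ i - r) \<in> J"
  using assms
proof (induction A)
  case empty
  then show ?case using avoid[of 0] by simp
next
  case (add r A)
  have "(\<lambda>z. \<Prod>r\<in>#A. z $ i - r) \<in> polyfuns"
    by (induction A) (auto intro!: polyfuns_const polyfuns_mult polyfuns_diff polyfuns_coord)
  moreover have "(\<lambda>z. z $ i - r) \<in> polyfuns"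
    by (intro polyfuns_diff polyfuns_coord polyfuns_const)
  ultimately show ?case using max_ideal_prime[of "\<lambda>z. z $ i - r"] add by auto
qed

text \<open>Uncountability of the complex numbers replaces Zariski's lemma: the
  inverses of \<open>z\<^sub>i - c\<close> modulo \<open>J\<close> would be linearly dependent.\<close>
lemma max_ideal_coord: "\<exists>c. (\<lambda>z. z $ i - c) \<in> J"
proof (rule ccontr)
  assume no: "\<not> ?thesis"
  have "\<exists>m u k. u \<in> polyfun k \<and> (\<lambda>z. z $ j ^ m - u z * (z $ i - c)) \<in> J" for c
  proof -
    have "(\<lambda>z. z $ i - c) \<in> polyfuns" by (intro polyfuns_diff polyfuns_coord polyfuns_const)
    from max_ideal_power[OF this] no show ?thesis by (auto simp: polyfuns_def)
  qed
  moreover define P where "P c m u k \<longleftrightarrow> u \<in> polyfun k \<and> (\<lambda>z. z $ j ^ m - u z * (z $ i - c)) \<in> J" for c m u k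
  ultimately have "\<forall>c. \<exists>m u k. P c m u k" by simp
  then obtain m u k where "\<And>c. P c (m c) (u c) (k c)" by metis
  then have muk: "\<And>c. u c \<in> polyfun (k c)"
    "\<And>c. (\<lambda>z. z $ j ^ m c - u c z * (z $ i - c)) \<in> J" unfolding P_def by simp_all
  \<comment> \<open>Uncountably many \<open>c\<close> share countably many pairs of exponent and
    degree bound, so infinitely many of them agree in both.\<close>
  have "\<exists>m0 k0. infinite {c. m c = m0 \<and> k c = k0}"
  proof (rule ccontr)
    assume "\<not> ?thesis"
    then have "countable (\<Union>(m0, k0)\<in>(UNIV :: (nat \<times> nat) set). {c. m c = m0 \<and> k c = k0})"
      by (intro countable_UN) (auto intro: countable_finite)
    moreover have "(\<Union>(m0, k0)\<in>(UNIV :: (nat \<times> nat) set). {c. m c = m0 \<and> k c = k0}) = UNIV" by auto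
    ultimately show False using uncountable_UNIV_complex by simp
  qed
  then obtain m0 k0 where inf: "infinite {c. m c = m0 \<and> k c = k0}" by blast
  obtain J0 where J0: "finite J0" "card J0 = Suc (card (expset k0 :: ('n \<Rightarrow> nat) set))"
    "J0 \<subseteq> {c. m c = m0 \<and> k c = k0}"
    using infinite_arbitrarily_large[OF inf] by blast
  obtain l where l: "\<exists>c\<in>J0. l c \<noteq> 0" "\<And>z. (\<Sum>c\<in>J0. l c * u c z) = 0"
  proof -
    have "card (expset k0 :: ('n \<Rightarrow> nat) set) < card J0" using J0 by simp
    from polyfun_dependent[OF J0(1) this, of u] show ?thesis using that muk(1) J0(3) by blast
  qed
  \<comment> \<open>The numerator of the sum of \<open>l c / (w - c)\<close> over \<open>J0\<close>.
    At a node with \<open>l c \<noteq> 0\<close> every other summand vanishes, which makes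
    \<open>q\<close> nonzero.\<close>
  define q where "q = (\<Sum>c\<in>J0. smult (l c) (\<Prod>b\<in>J0 - {c}. [:-b, 1:]))"
  have q_eval: "poly q w = (\<Sum>c\<in>J0. l c * (\<Prod>b\<in>J0 - {c}. w - b))" for w
    by (simp add: q_def poly_sum poly_prod)
  have "q \<noteq> 0"
  proof -
    obtain c where c: "c \<in> J0" "l c \<noteq> 0" using l by blast
    have "poly q c = l c * (\<Prod>b\<in>J0 - {c}. c - b)"
      unfolding q_eval using c J0(1)
      by (subst sum.remove[of J0 c]) (auto intro!: sum.neutral prod_zero)
    also have "\<dots> \<noteq> 0" using c J0(1) by auto
    finally show ?thesis by auto
  qed
  \<comment> \<open>Each relation modulo \<open>J\<close> is multiplied by \<open>l c\<close> and by
    the linear factors of the other nodes. The parts with \<open>u c\<close> then carry the common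
    product over \<open>J0\<close> and cancel, because the combination of the \<open>u c\<close> is
    zero.\<close>
  have "(\<lambda>z. \<Sum>c\<in>J0. (l c * (\<Prod>b\<in>J0 - {c}. z $ i - b)) * (z $ j ^ m c - u c z * (z $ i - c))) \<in> J"
    by (intro polyfun_ideal_sum ideal max_ideal_mult polyfuns_cmult polyfuns_prod polyfuns_diff
        polyfuns_coord polyfuns_const muk)
  also have "(\<lambda>z. \<Sum>c\<in>J0. (l c * (\<Prod>b\<in>J0 - {c}. z $ i - b)) * (z $ j ^ m c - u c z * (z $ i - c))) =
      (\<lambda>z. z $ j ^ m0 * poly q (z $ i))"
  proof
    fix z :: "complex ^ 'n"
    have "(\<Sum>c\<in>J0. (l c * (\<Prod>b\<in>J0 - {c}. z $ i - b)) * (z $ j ^ m c - u c z * (z $ i - c))) =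
      (\<Sum>c\<in>J0. z $ j ^ m0 * (l c * (\<Prod>b\<in>J0 - {c}. z $ i - b)) -
         (\<Prod>b\<in>J0. z $ i - b) * (l c * u c z))"
    proof (intro sum.cong refl)
      fix c assume c: "c \<in> J0"
      have mc: "m c = m0" using c J0(3) by auto
      have P0: "(\<Prod>b\<in>J0. z $ i - b) = (z $ i - c) * (\<Prod>b\<in>J0 - {c}. z $ i - b)"
        using J0(1) c by (rule prod.remove)
      show "(l c * (\<Prod>b\<in>J0 - {c}. z $ i - b)) * (z $ j ^ m c - u c z * (z $ i - c)) =
          z $ j ^ m0 * (l c * (\<Prod>b\<in>J0 - {c}. z $ i - b)) - (\<Prod>b\<in>J0. z $ i - b) * (l c * u c z)"
        unfolding mc P0 by (simp add: algebra_simps)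
    qed
    also have "\<dots> = z $ j ^ m0 * poly q (z $ i) - (\<Prod>b\<in>J0. z $ i - b) * (\<Sum>c\<in>J0. l c * u c z)"
      by (simp add: sum_subtractf sum_distrib_left q_eval)
    finally show "(\<Sum>c\<in>J0. (l c * (\<Prod>b\<in>J0 - {c}. z $ i - b)) * (z $ j ^ m c - u c z * (z $ i - c))) =
      z $ j ^ m0 * poly q (z $ i)" using l(2) by simp
  qed
  finally have "(\<lambda>z. z $ j ^ m0 * poly q (z $ i)) \<in> J" .
  moreover have "(\<lambda>z. poly q (z $ i)) \<in> polyfuns"
    unfolding q_eval by (intro polyfuns_sum polyfuns_cmult polyfuns_prod polyfuns_diff polyfuns_coord polyfuns_const)
  ultimately have qJ: "(\<lambda>z. poly q (z $ i)) \<in> J"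
    using max_ideal_prime[OF polyfuns_power_coord] avoid by blast
  \<comment> \<open>Over the complex numbers \<open>q\<close> splits into linear factors, and
    primality of \<open>J\<close> puts one of them into \<open>J\<close>.\<close>
  obtain A where A: "q = smult (lead_coeff q) (\<Prod>x\<in>#A. [:-x, 1:])"
    using alg_closed_imp_factorization[OF \<open>q \<noteq> 0\<close>] by blast
  have "poly q w = lead_coeff q * (\<Prod>r\<in>#A. w - r)" for w
    by (subst A) (simp add: poly_prod_mset)
  then have "(\<lambda>z. 1 / lead_coeff q * poly q (z $ i)) = (\<lambda>z. \<Prod>r\<in>#A. z $ i - r)"
    using \<open>q \<noteq> 0\<close> by (intro ext) simp
  moreover have "(\<lambda>z. 1 / lead_coeff q * poly q (z $ i)) \<in> J"
    by (rule max_ideal_mult[OF polyfuns_const qJ])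
  ultimately have "(\<lambda>z. \<Prod>r\<in>#A. z $ i - r) \<in> J" by simp
  then show False using max_ideal_prod_mset no by blast
qed

text \<open>Reduction modulo \<open>J\<close> is evaluation at a point: the functions
  \<open>F\<close> congruent to \<open>F z0\<close> are closed under sums and products and contain
  the constants and the coordinates.\<close>

lemma max_ideal_point: "\<exists>z0. \<forall>F\<in>polyfuns. (\<lambda>z. F z - F z0) \<in> J"
proof -
  have "\<forall>i. \<exists>c. (\<lambda>z. z $ i - c) \<in> J" using max_ideal_coord by blast
  from choice[OF this] obtain c where c: "\<And>i. (\<lambda>z. z $ i - c i) \<in> J" by blast
  define z0 where "z0 = (\<chi> i. c i)"
  define Q where "Q F \<longleftrightarrow> F \<in> polyfuns \<and> (\<lambda>z. F z - F z0) \<in> J" for F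
  have Q_mult: "Q (\<lambda>z. F z * G z)" if "Q F" "Q G" for F G
  proof -
    have "(\<lambda>z. G z * (F z - F z0) + F z0 * (G z - G z0)) \<in> J"
      using that by (intro max_ideal_add max_ideal_mult polyfuns_const) (auto simp: Q_def)
    moreover have "(\<lambda>z. G z * (F z - F z0) + F z0 * (G z - G z0)) = (\<lambda>z. F z * G z - F z0 * G z0)"
      by (auto simp: algebra_simps)
    ultimately show ?thesis using that by (auto simp: Q_def polyfuns_mult)
  qed
  have Q_const: "Q (\<lambda>z. a)" for a
    using ideal by (auto simp: Q_def polyfuns_const polyfun_ideal_def)
  have Q_add: "Q (\<lambda>z. F z + G z)" if "Q F" "Q G" for F G
  proof -
    have "(\<lambda>z. (F z - F z0) + (G z - G z0)) \<in> J"
      using that by (intro max_ideal_add) (auto simp: Q_def)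
    then show ?thesis using that by (auto simp: Q_def polyfuns_add algebra_simps)
  qed
  have Q_sum: "Q (\<lambda>z. \<Sum>a\<in>A. F a z)" if "\<And>a. a \<in> A \<Longrightarrow> Q (F a)" for A :: "('n \<Rightarrow> nat) set" and F
    using that by (induction A rule: infinite_finite_induct) (auto simp: Q_const Q_add)
  have Q_coord: "Q (\<lambda>z. z $ i)" for i
    using c by (auto simp: Q_def polyfuns_coord z0_def)
  have Q_pow: "Q (\<lambda>z. z $ i ^ m)" for i m
    by (induction m) (auto simp: Q_const intro!: Q_mult Q_coord)
  have Q_cmono: "Q (cmono e)" for e
  proof -
    have "Q (\<lambda>z. \<Prod>i\<in>A. z $ i ^ e i)" for A
      by (induction A rule: infinite_finite_induct) (auto simp: Q_const Q_mult Q_pow)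
    then show ?thesis by (simp add: cmono_def[abs_def])
  qed
  have "Q F" if F: "F \<in> polyfuns" for F
  proof -
    obtain k a where "F = (\<lambda>z. \<Sum>e\<in>expset k. a e * cmono e z)" using F by (auto simp: polyfuns_def polyfun_def)
    then show ?thesis by (auto intro!: Q_sum Q_mult Q_const Q_cmono)
  qed
  then show ?thesis unfolding Q_def by blast
qed

end

lemma polyfun_idealD:
  assumes "polyfun_ideal J"
  shows "J \<subseteq> polyfuns" "(\<lambda>z. 0) \<in> J"
    "F \<in> J \<Longrightarrow> G \<in> J \<Longrightarrow> (\<lambda>z. F z + G z) \<in> J"
    "F \<in> polyfuns \<Longrightarrow> G \<in> J \<Longrightarrow> (\<lambda>z. F z * G z) \<in> J"
  using assms by (simp_all add: polyfun_ideal_def)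

text \<open>Zorn's lemma gives an ideal \<open>J\<close> above the one generated by the
  \<open>G i\<close>, maximal among those without a power of the coordinate. Its point
  \<open>z0\<close> is a common zero of the \<open>G i\<close>, so \<open>z0 $ j = 0\<close> and the
  coordinate itself lies in \<open>J\<close>, a contradiction.\<close>

lemma nullstellensatz_coord:
  fixes G :: "'n::finite \<Rightarrow> complex ^ 'n \<Rightarrow> complex"
  assumes G: "\<And>i. G i \<in> polyfuns" and zero: "\<And>z. (\<forall>i. G i z = 0) \<Longrightarrow> z $ j = 0"
  shows "\<exists>m g. (\<forall>i. g i \<in> polyfuns) \<and> (\<forall>z. z $ j ^ m = (\<Sum>i\<in>UNIV. g i z * G i z))"
proof (rule ccontr)
  assume no: "\<not> ?thesis"
  define I where "I = {H. \<exists>g. (\<forall>i. g i \<in> polyfuns) \<and> H = (\<lambda>z. \<Sum>i\<in>UNIV. g i z * G i z)}"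
  have "polyfun_ideal I"
    unfolding polyfun_ideal_def
  proof (intro conjI ballI)
    show "I \<subseteq> polyfuns" using G by (auto simp: I_def intro!: polyfuns_sum polyfuns_mult)
    show "(\<lambda>z. 0) \<in> I" by (auto simp: I_def polyfuns_const intro!: exI[of _ "\<lambda>_ _. 0"])
  next
    fix F F' assume "F \<in> I" "F' \<in> I"
    then obtain g g' where "\<forall>i. g i \<in> polyfuns" "F = (\<lambda>z. \<Sum>i\<in>UNIV. g i z * G i z)"
      "\<forall>i. g' i \<in> polyfuns" "F' = (\<lambda>z. \<Sum>i\<in>UNIV. g' i z * G i z)" by (auto simp: I_def)
    then show "(\<lambda>z. F z + F' z) \<in> I"
      by (auto simp: I_def sum.distrib ring_distribs intro!: polyfuns_add exI[of _ "\<lambda>i z. g i z + g' i z"])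
  next
    fix F F' :: "complex ^ 'n \<Rightarrow> complex" assume F: "F \<in> polyfuns" "F' \<in> I"
    then obtain g' where "\<forall>i. g' i \<in> polyfuns" "F' = (\<lambda>z. \<Sum>i\<in>UNIV. g' i z * G i z)" by (auto simp: I_def)
    then show "(\<lambda>z. F z * F' z) \<in> I"
      using F(1) by (auto simp: I_def sum_distrib_left mult.assoc intro!: polyfuns_mult exI[of _ "\<lambda>i z. F z * g' i z"])
  qed
  moreover have "(\<lambda>z. z $ j ^ m) \<notin> I" for m
  proof
    assume "(\<lambda>z. z $ j ^ m) \<in> I"
    then obtain g where "\<forall>i. g i \<in> polyfuns" "(\<lambda>z. z $ j ^ m) = (\<lambda>z. \<Sum>i\<in>UNIV. g i z * G i z)"
      by (auto simp: I_def)
    with no show False by (metis (no_types))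
  qed
  moreover define S where "S = {K. polyfun_ideal K \<and> I \<subseteq> K \<and> (\<forall>m. (\<lambda>z. z $ j ^ m) \<notin> K)}"
  ultimately have "I \<in> S" by simp
  then have "S \<noteq> {}" by auto
  then have "\<exists>J\<in>S. \<forall>X\<in>S. J \<subseteq> X \<longrightarrow> X = J"
  proof (rule subset_Zorn_nonempty)
    fix C assume C: "C \<noteq> {}" "subset.chain S C"
    then have CS: "\<And>K. K \<in> C \<Longrightarrow> K \<in> S" by (auto simp: subset_chain_def)
    have idl: "polyfun_ideal K" if "K \<in> C" for K using CS[OF that] by (auto simp: S_def)
    have "polyfun_ideal (\<Union>C)"
      unfolding polyfun_ideal_def
    proof (intro conjI ballI)
      show "\<Union>C \<subseteq> polyfuns" using polyfun_idealD(1)[OF idl] by (rule Union_least)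
      obtain K where "K \<in> C" using C(1) by blast
      then show "(\<lambda>z. 0) \<in> \<Union>C" by (rule UnionI) (rule polyfun_idealD(2)[OF idl], fact)
    next
      fix F F' assume "F \<in> \<Union>C" "F' \<in> \<Union>C"
      then obtain K1 K2 where "K1 \<in> C" "F \<in> K1" "K2 \<in> C" "F' \<in> K2" by (elim UnionE)
      moreover from this have "K1 \<subseteq> K2 \<or> K2 \<subseteq> K1" using C(2) unfolding subset_chain_def by blast
      ultimately obtain K where K: "K \<in> C" "F \<in> K" "F' \<in> K" by blast
      from K(1) show "(\<lambda>z. F z + F' z) \<in> \<Union>C"
        by (rule UnionI) (rule polyfun_idealD(3)[OF idl[OF K(1)] K(2,3)])
    next
      fix F F' :: "complex ^ 'n \<Rightarrow> complex" assume F: "F \<in> polyfuns" "F' \<in> \<Union>C"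
      then obtain K where K: "K \<in> C" "F' \<in> K" by (elim UnionE)
      from K(1) show "(\<lambda>z. F z * F' z) \<in> \<Union>C"
        by (rule UnionI) (rule polyfun_idealD(4)[OF idl[OF K(1)] F(1) K(2)])
    qed
    then show "\<Union>C \<in> S" using C(1) CS unfolding S_def by blast
  qed
  then obtain J where J: "J \<in> S" "\<And>K. K \<in> S \<Longrightarrow> J \<subseteq> K \<Longrightarrow> K = J" by blast
  have Ji: "polyfun_ideal J" "\<And>m. (\<lambda>z. z $ j ^ m) \<notin> J" "I \<subseteq> J" using J by (auto simp: S_def)
  have Jmax: "K = J" if "polyfun_ideal K" "J \<subseteq> K" "\<And>m. (\<lambda>z. z $ j ^ m) \<notin> K" for K
    using that Ji J by (intro J(2)) (auto simp: S_def)
  obtain z0 where z0: "\<And>F. F \<in> polyfuns \<Longrightarrow> (\<lambda>z. F z - F z0) \<in> J"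
    using max_ideal_point[OF Ji(1,2) Jmax] by metis
  have "G i z0 = 0" for i
  proof -
    have "G i \<in> I"
      unfolding I_def
      by (intro CollectI exI[of _ "\<lambda>i' z. if i' = i then 1 else 0"])
         (auto simp: polyfuns_const if_distrib[of "\<lambda>x. x * _"] cong: if_cong)
    then have a: "G i \<in> J" using Ji(3) by blast
    have b: "(\<lambda>z. G i z - G i z0) \<in> J" by (rule z0[OF G])
    have "(\<lambda>z. G i z - (G i z - G i z0)) \<in> J"
      by (rule max_ideal_diff[OF Ji(1,2) Jmax a b])
    then have c: "(\<lambda>z. G i z0) \<in> J" by simp
    show ?thesis by (rule max_ideal_const[OF Ji(1,2) Jmax c])
  qed
  then have "z0 $ j = 0" by (intro zero allI)
  then have "(\<lambda>z. z $ j ^ 1) \<in> J" using z0[OF polyfuns_coord[of j]] by simp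
  then show False by (rule notE[OF Ji(2)])
qed

section \<open>From the Nullstellensatz to uniformly finite solution sets\<close>

lemma polyfuns_common_degree:
  fixes g :: "'n::finite \<Rightarrow> complex ^ 'n \<Rightarrow> complex"
  assumes "\<And>i. g i \<in> polyfuns"
  obtains k where "\<And>i. g i \<in> polyfun k"
proof -
  have "\<forall>i. \<exists>k. g i \<in> polyfun k" using assms by (auto simp: polyfuns_def)
  then obtain k where k: "\<And>i. g i \<in> polyfun (k i)" by metis
  have "g i \<in> polyfun (Max (range k))" for i
    by (rule polyfun_mono[OF _ k]) simp
  then show ?thesis by (rule that)
qed

lemma cmono_scale: "cmono e (t *s z) = t ^ (sum e UNIV) * cmono e z"
  by (simp add: cmono_def power_mult_distrib prod.distrib power_sum)

text \<open>For homogeneous \<open>G\<close> only the component of the right degree of the cofactors matters; it is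
  isolated by comparing coefficients in the scaling parameter.\<close>
lemma nullstellensatz_homogeneous:
  fixes G :: "'n::finite \<Rightarrow> complex ^ 'n \<Rightarrow> complex"
  assumes G: "\<And>i. G i \<in> polyfuns" and zero: "\<And>z. (\<forall>i. G i z = 0) \<Longrightarrow> z = 0"
    and hom: "\<And>i t z. G i (t *s z) = t ^ r * G i z"
  shows "\<exists>s g. (\<forall>i. g i \<in> polyfun (Suc s)) \<and> (\<forall>z. z $ j ^ (s + r) = (\<Sum>i\<in>UNIV. g i z * G i z))"
proof -
  have "z $ j = 0" if "\<forall>i. G i z = 0" for z
    using zero[OF that] by simp
  then obtain s g0 where g0: "\<And>i. g0 i \<in> polyfuns" "\<And>z. z $ j ^ s = (\<Sum>i\<in>UNIV. g0 i z * G i z)"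
    using nullstellensatz_coord[where G = G and j = j, OF G] by metis
  obtain k0 where k0: "\<And>i. g0 i \<in> polyfun k0" using polyfuns_common_degree[where g = g0, OF g0(1)] by metis
  \<comment> \<open>The factor \<open>z $ j ^ r\<close> lifts the exponent to \<open>s + r\<close>.
    The component of the cofactors that pairs with \<open>G\<close> of degree \<open>r\<close> then
    has degree \<open>s\<close>, which is never negative.\<close>
  define k where "k = k0 + r"
  have "(\<lambda>z. z $ j ^ r * g0 i z) \<in> polyfun k" for i
    unfolding k_def add.commute[of k0 r] by (rule polyfun_mult[OF polyfun_power_coord k0])
  then have "\<forall>i. \<exists>c. (\<lambda>z. z $ j ^ r * g0 i z) = (\<lambda>z. \<Sum>e\<in>expset k. c e * cmono e z)"
    by (auto simp: polyfun_def)
  then obtain c where "\<And>i. (\<lambda>z. z $ j ^ r * g0 i z) = (\<lambda>z. \<Sum>e\<in>expset k. c i e * cmono e z)" by metis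
  then have c: "z $ j ^ r * g0 i z = (\<Sum>e\<in>expset k. c i e * cmono e z)" for i z by meson
  have eq: "z $ j ^ (s + r) = (\<Sum>i\<in>UNIV. \<Sum>e\<in>expset k. c i e * cmono e z * G i z)" for z
    unfolding sum_distrib_right[symmetric] c[symmetric]
    by (simp add: power_add g0(2) sum_distrib_left sum_distrib_right mult_ac)
  define g where "g i z = (\<Sum>e\<in>{e\<in>expset k. sum e UNIV = s}. c i e * cmono e z)" for i z
  have "g i \<in> polyfun (Suc s)" for i
    unfolding g_def[abs_def] by (intro polyfun_sum polyfun_cmult polyfun_cmono) auto
  moreover have "z $ j ^ (s + r) = (\<Sum>i\<in>UNIV. g i z * G i z)" for z
  proof -
    define p where "p = (\<Sum>i\<in>UNIV. \<Sum>e\<in>expset k. monom (c i e * cmono e z * G i z) (sum e UNIV + r))"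
    have "poly (monom (z $ j ^ (s + r)) (s + r)) t = poly p t" for t
      using eq[of "t *s z"]
      by (simp add: poly_monom p_def poly_sum cmono_scale hom power_mult_distrib power_add mult_ac)
    then have "monom (z $ j ^ (s + r)) (s + r) = p"
      by (intro poly_eq_poly_eq_iff[THEN iffD1] ext)
    then have "coeff (monom (z $ j ^ (s + r)) (s + r)) (s + r) = coeff p (s + r)" by simp
    also have "coeff p (s + r) = (\<Sum>i\<in>UNIV. \<Sum>e\<in>expset k. if sum e UNIV = s then c i e * cmono e z * G i z else 0)"
      by (simp add: p_def coeff_sum)
    also have "\<dots> = (\<Sum>i\<in>UNIV. g i z * G i z)"
      unfolding g_def sum_distrib_right by (rule sum.cong[OF refl], rule sum.mono_neutral_cong_right) auto
    finally show ?thesis by simp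
  qed
  ultimately show ?thesis by blast
qed

text \<open>Lagrange interpolation: each other point is killed by a coordinate in which it differs
  from \<open>x0\<close>.\<close>

lemma polyfun_separation:
  fixes X :: "(complex ^ 'n::finite) set"
  assumes "finite X" "x0 \<in> X"
  shows "\<exists>F\<in>polyfuns. F x0 \<noteq> 0 \<and> (\<forall>x\<in>X - {x0}. F x = 0)"
proof -
  have "\<exists>i. x $ i \<noteq> x0 $ i" if "x \<in> X - {x0}" for x
    using that by (auto simp: vec_eq_iff)
  then obtain i where i: "\<And>x. x \<in> X - {x0} \<Longrightarrow> x $ i x \<noteq> x0 $ i x" by metis
  define F where "F z = (\<Prod>y\<in>X - {x0}. z $ i y - y $ i y)" for z :: "complex ^ 'n"
  have "F \<in> polyfuns"
    unfolding F_def[abs_def] by (intro polyfuns_prod polyfuns_diff polyfuns_coord polyfuns_const)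
  moreover have "F x0 \<noteq> 0" using assms i by (force simp: F_def)
  moreover have "F x = 0" if "x \<in> X - {x0}" for x
    unfolding F_def using that assms by (intro prod_zero) auto
  ultimately show ?thesis by blast
qed

text \<open>Modulo the equations every monomial of large degree drops in degree, so the functions on the
  solution set are spanned by finitely many monomials, independently of the lower order terms.\<close>
lemma perturbed_system_finite:
  fixes G :: "'n::finite \<Rightarrow> complex ^ 'n \<Rightarrow> complex"
  assumes G: "\<And>i. G i \<in> polyfuns" and zero: "\<And>z. (\<forall>i. G i z = 0) \<Longrightarrow> z = 0"
    and hom: "\<And>i t z. G i (t *s z) = t ^ r * G i z"
  shows "\<exists>D. \<forall>R X. (\<forall>i. R i \<in> polyfun r) \<longrightarrow> (\<forall>x\<in>X. \<forall>i. G i x = R i x) \<longrightarrow> finite X \<and> card X \<le> D"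
proof -
  define Q where "Q j s g \<longleftrightarrow> (\<forall>i. g i \<in> polyfun (Suc s)) \<and>
      (\<forall>z. z $ j ^ (s + r) = (\<Sum>i\<in>UNIV. g i z * G i z))" for j s g
  have "\<exists>s g. Q j s g" for j
    unfolding Q_def by (rule nullstellensatz_homogeneous[where G = G, OF G zero hom])
  then obtain s0 g0 where "\<And>j. Q j (s0 j) (g0 j)" by metis
  then have g0: "\<And>j i. g0 j i \<in> polyfun (Suc (s0 j))"
     "\<And>j z. z $ j ^ (s0 j + r) = (\<Sum>i\<in>UNIV. g0 j i z * G i z)" unfolding Q_def by blast+
  \<comment> \<open>One exponent for all coordinates: the relation for \<open>j\<close> is
    multiplied by the missing power of the coordinate.\<close>
  define s where "s = Max (range s0)"
  have s: "s0 j \<le> s" for j by (simp add: s_def)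
  define g where "g j i z = z $ j ^ (s - s0 j) * g0 j i z" for j i z
  have gP: "g j i \<in> polyfun (Suc s)" for j i
    using polyfun_mult[OF polyfun_power_coord g0(1), of j "s - s0 j" j i] s[of j] by (simp add: g_def[abs_def])
  have gG: "z $ j ^ (s + r) = (\<Sum>i\<in>UNIV. g j i z * G i z)" for j z
  proof -
    have "s + r = (s - s0 j) + (s0 j + r)" using s[of j] by simp
    then have "z $ j ^ (s + r) = z $ j ^ (s - s0 j) * z $ j ^ (s0 j + r)"
      by (metis power_add)
    then show ?thesis unfolding g0(2) g_def by (simp only: sum_distrib_left mult.assoc)
  qed
  \<comment> \<open>A monomial of degree at least \<open>K\<close> has an exponent of at least
    \<open>s + r\<close>, so it is divisible by the left side of one of the relations.\<close>
  define K where "K = CARD('n) * (s + r) + 1"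
  define D where "D = card (expset K :: ('n \<Rightarrow> nat) set)"
  have main: "finite X \<and> card X \<le> D"
    if R: "\<And>i. R i \<in> polyfun r" and X: "\<And>x i. x \<in> X \<Longrightarrow> G i x = R i x" for R X
  proof -
    have red: "\<exists>F\<in>polyfun K. \<forall>x\<in>X. cmono e x = F x" for e
    proof (induction "sum e UNIV" arbitrary: e rule: less_induct)
      case less
      show ?case
      proof (cases "sum e UNIV < K")
        case True
        then show ?thesis using polyfun_cmono by blast
      next
        case False
        obtain j where j: "e j \<ge> s + r"
        proof (rule ccontr)
          assume "\<not> thesis"
          then have "\<And>j. e j \<le> s + r" using that by (metis nat_le_linear)
          then have "sum e UNIV \<le> CARD('n) * (s + r)"
            using sum_bounded_above[of UNIV e "s + r"] by simp
          then show False using False by (simp add: K_def)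
        qed
        define e' where "e' = (\<lambda>i. if i = j then e i - (s + r) else e i)"
        have e: "e = (\<lambda>i. (if i = j then s + r else 0) + e' i)" using j by (auto simp: e'_def)
        have se: "sum e UNIV = (s + r) + sum e' UNIV"
          by (subst e) (simp add: sum.distrib)
        \<comment> \<open>On \<open>X\<close> the \<open>G i\<close> may be replaced by the
          \<open>R i\<close>, whose degree is below \<open>r\<close>. This is the drop in degree
          that drives the induction.\<close>
        define H where "H z = cmono e' z * (\<Sum>i\<in>UNIV. g j i z * R i z)" for z
        have "H \<in> polyfun (sum e' UNIV + (s + r))"
          unfolding H_def[abs_def]
          by (intro polyfun_mult polyfun_sum polyfun_cmono gP R) simp
        then obtain c where c: "H = (\<lambda>z. \<Sum>e\<in>expset (sum e UNIV). c e * cmono e z)"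
          unfolding se by (auto simp: polyfun_def add.commute)
        have "\<forall>e1\<in>expset (sum e UNIV). \<exists>F\<in>polyfun K. \<forall>x\<in>X. cmono e1 x = F x"
          using less by (auto simp: expset_def)
        then obtain F where F: "\<And>e1. e1 \<in> expset (sum e UNIV) \<Longrightarrow> F e1 \<in> polyfun K"
          "\<And>e1 x. e1 \<in> expset (sum e UNIV) \<Longrightarrow> x \<in> X \<Longrightarrow> cmono e1 x = F e1 x"
          using bchoice[of "expset (sum e UNIV)" "\<lambda>e1 F. F \<in> polyfun K \<and> (\<forall>x\<in>X. cmono e1 x = F x)"] by blast
        have "(\<lambda>z. \<Sum>e1\<in>expset (sum e UNIV). c e1 * F e1 z) \<in> polyfun K"
          by (intro polyfun_sum polyfun_cmult F)
        moreover have "cmono e x = (\<Sum>e1\<in>expset (sum e UNIV). c e1 * F e1 x)" if x: "x \<in> X" for x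
        proof -
          have "cmono e x = x $ j ^ (s + r) * cmono e' x"
            by (subst e) (simp add: cmono_mult[symmetric] cmono_single)
          also have "\<dots> = H x" unfolding gG H_def using X[OF x] by (simp add: mult.commute)
          also have "\<dots> = (\<Sum>e1\<in>expset (sum e UNIV). c e1 * F e1 x)"
            unfolding c using F(2)[OF _ x] by simp
          finally show ?thesis .
        qed
        ultimately show ?thesis by (intro bexI[of _ "\<lambda>z. \<Sum>e1\<in>expset (sum e UNIV). c e1 * F e1 z"]) auto
      qed
    qed
    \<comment> \<open>More than \<open>D\<close> points would have linearly dependent evaluations on
      \<open>polyfun K\<close>, hence by the reduction on all polynomial functions, but these
      separate points.\<close>
    have bound: "card Y \<le> D" if Y: "finite Y" "Y \<subseteq> X" for Y
    proof (rule ccontr)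
      assume "\<not> card Y \<le> D"
      then have "card (expset K :: ('n \<Rightarrow> nat) set) < card Y" by (simp add: D_def)
      from underdetermined_system[OF finite_expset Y(1) this, of "\<lambda>x e. cmono e x"]
      obtain l where l: "\<exists>x\<in>Y. l x \<noteq> 0" "\<And>e. e \<in> expset K \<Longrightarrow> (\<Sum>x\<in>Y. l x * cmono e x) = 0" by auto
      have 1: "(\<Sum>x\<in>Y. l x * F x) = 0" if F: "F \<in> polyfun K" for F :: "complex ^ 'n \<Rightarrow> complex"
      proof -
        obtain c where c: "F = (\<lambda>z. \<Sum>e\<in>expset K. c e * cmono e z)" using F by (auto simp: polyfun_def)
        have "(\<Sum>x\<in>Y. l x * F x) = (\<Sum>e\<in>expset K. c e * (\<Sum>x\<in>Y. l x * cmono e x))"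
          unfolding c sum_distrib_left by (subst sum.swap) (simp add: mult_ac)
        then show ?thesis using l(2) by simp
      qed
      have 2: "(\<Sum>x\<in>Y. l x * F x) = 0" if F: "F \<in> polyfuns" for F :: "complex ^ 'n \<Rightarrow> complex"
      proof -
        obtain k c where c: "F = (\<lambda>z. \<Sum>e\<in>expset k. c e * cmono e z)" using F by (auto simp: polyfuns_def polyfun_def)
        obtain H where H: "\<And>e. H e \<in> polyfun K" "\<And>e x. x \<in> X \<Longrightarrow> cmono e x = H e x"
          using choice[of "\<lambda>e F. F \<in> polyfun K \<and> (\<forall>x\<in>X. cmono e x = F x)"] red by blast
        have "(\<Sum>x\<in>Y. l x * F x) = (\<Sum>e\<in>expset k. c e * (\<Sum>x\<in>Y. l x * cmono e x))"
          unfolding c sum_distrib_left by (subst sum.swap) (simp add: mult_ac)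
        also have "\<dots> = (\<Sum>e\<in>expset k. c e * (\<Sum>x\<in>Y. l x * H e x))"
        proof -
          have "(\<Sum>x\<in>Y. l x * cmono e x) = (\<Sum>x\<in>Y. l x * H e x)" for e
            using H(2) Y(2) by (intro sum.cong) auto
          then show ?thesis by simp
        qed
        also have "\<dots> = 0" using 1[OF H(1)] by simp
        finally show ?thesis .
      qed
      obtain x0 where x0: "x0 \<in> Y" "l x0 \<noteq> 0" using l(1) by blast
      obtain F where F: "F \<in> polyfuns" "F x0 \<noteq> 0" "\<And>x. x \<in> Y - {x0} \<Longrightarrow> F x = 0"
        using polyfun_separation[OF Y(1) x0(1)] by blast
      have "(\<Sum>x\<in>Y. l x * F x) = l x0 * F x0"
        using x0 F(3) Y(1) by (subst sum.remove[of Y x0]) auto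
      then show False using 2[OF F(1)] x0 F by simp
    qed
    have "finite X"
    proof (rule ccontr)
      assume "infinite X"
      then obtain Y where "finite Y" "card Y = Suc D" "Y \<subseteq> X"
        using infinite_arbitrarily_large by blast
      then show False using bound[of Y] by simp
    qed
    then show ?thesis using bound[of X] by simp
  qed
  show ?thesis by (intro exI[of _ D] allI impI main) auto
qed

section \<open>Integer zeros of the polar system\<close>

definition int_box :: "nat \<Rightarrow> (int ^ 'n::finite) set" where
  "int_box R = {x. \<forall>i. \<bar>x $ i\<bar> \<le> int R}"

definition vec_lists :: "nat \<Rightarrow> nat \<Rightarrow> (int ^ 'n::finite) list set" where
  "vec_lists k R = {hs. set hs \<subseteq> int_box R \<and> length hs = k}"

lemma card_vec_box:
  fixes A :: "'n::finite \<Rightarrow> 'a set"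
  assumes "\<And>i. finite (A i)"
  shows "finite {x :: 'a ^ 'n. \<forall>i. x $ i \<in> A i} \<and>
         card {x :: 'a ^ 'n. \<forall>i. x $ i \<in> A i} = (\<Prod>i\<in>UNIV. card (A i))"
proof -
  have bij: "bij_betw vec_lambda (PiE UNIV A) {x :: 'a ^ 'n. \<forall>i. x $ i \<in> A i}"
    by (rule bij_betwI[where g = vec_nth]) (auto simp: vec_lambda_beta vec_nth_inverse PiE_UNIV_domain)
  have fin: "finite (PiE UNIV A)" by (intro finite_PiE assms) auto
  show ?thesis
    using bij_betw_finite[OF bij] fin bij_betw_same_card[OF bij] by (simp add: card_PiE)
qed

lemma int_box_eq: "int_box R = {x :: int ^ 'n::finite. \<forall>i. x $ i \<in> {- int R..int R}}"
  by (auto simp: int_box_def abs_le_iff) (metis minus_le_iff)+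

lemma finite_int_box [simp]: "finite (int_box R :: (int ^ 'n::finite) set)"
  unfolding int_box_eq using card_vec_box[of "\<lambda>_. {- int R..int R}"] by blast

lemma card_int_box: "card (int_box R :: (int ^ 'n::finite) set) = (2 * R + 1) ^ CARD('n)"
proof -
  have "nat (int R - - int R + 1) = 2 * R + 1" by simp
  then show ?thesis
    unfolding int_box_eq using card_vec_box[of "\<lambda>_::'n. {- int R..int R}"] by simp
qed

lemma finite_vec_lists [simp]: "finite (vec_lists k R :: (int ^ 'n::finite) list set)"
  unfolding vec_lists_def by (rule finite_lists_length_eq) simp

lemma card_vec_lists: "card (vec_lists k R :: (int ^ 'n::finite) list set) = (2 * R + 1) ^ (CARD('n) * k)"
  unfolding vec_lists_def by (simp add: card_lists_length_eq card_int_box power_mult)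

definition cvec :: "int ^ 'n::finite \<Rightarrow> complex ^ 'n" where
  "cvec x = (\<chi> i. of_int (x $ i))"

lemma cvec_nth [simp]: "cvec x $ i = of_int (x $ i)"
  by (simp add: cvec_def)

lemma inj_cvec: "inj cvec"
  by (rule injI) (simp add: vec_eq_iff)

section \<open>Zeros of the polar system along translates\<close>

context sym_multilinear
begin

lemma M_replicate_polyfun:
  assumes "k + length rest = d"
  shows "\<exists>F\<in>polyfun (Suc k). \<forall>x. of_int (M (replicate k x @ rest)) = F (cvec x)"
  using assms
proof (induction k arbitrary: rest)
  case 0
  show ?case using polyfun_const[of "of_int (M rest)"] by auto
next
  case (Suc k)
  have "\<forall>i. \<exists>F\<in>polyfun (Suc k). \<forall>x. of_int (M (replicate k x @ axis i 1 # rest)) = F (cvec x)"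
    using Suc by simp
  then obtain F where F: "\<And>i. F i \<in> polyfun (Suc k)"
    "\<And>i x. of_int (M (replicate k x @ axis i 1 # rest)) = F i (cvec x)" by metis
  have "(\<lambda>z. \<Sum>i\<in>UNIV. z $ i * F i z) \<in> polyfun (Suc 0 + Suc k)"
    by (intro polyfun_sum polyfun_mult polyfun_coord F)
  moreover have "of_int (M (replicate (Suc k) x @ rest)) = (\<Sum>i\<in>UNIV. cvec x $ i * F i (cvec x))" for x
    using Suc.prems by (simp add: M_expand[of "replicate k x @ rest" x] F(2)[symmetric] M_swap)
  ultimately show ?case by (intro bexI[of _ "\<lambda>z. \<Sum>i\<in>UNIV. z $ i * F i z"]) auto
qed

text \<open>In the multilinear expansion of the arguments \<open>y + x\<close> only the term without
  any \<open>y\<close> has full degree in \<open>x\<close>; the others have degree below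
  \<open>length ys\<close>.\<close>

lemma M_shift_polyfun:
  assumes "length ys + length rest = d"
  shows "\<exists>F\<in>polyfun (length ys). \<forall>x. of_int (M (map (\<lambda>y. y + x) ys @ rest)) =
           of_int (M (replicate (length ys) x @ rest)) + F (cvec x)"
  using assms
proof (induction ys arbitrary: rest)
  case Nil
  show ?case using polyfun_zero[of 0] by auto
next
  case (Cons y ys)
  let ?k = "length ys"
  obtain F0 where F0: "F0 \<in> polyfun ?k" "\<And>x. of_int (M (map (\<lambda>y. y + x) ys @ y # rest)) =
      of_int (M (replicate ?k x @ y # rest)) + F0 (cvec x)"
    using Cons.IH[of "y # rest"] Cons.prems by auto
  obtain F1 where F1: "F1 \<in> polyfun (Suc ?k)" "\<And>x. of_int (M (replicate ?k x @ y # rest)) = F1 (cvec x)"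
    using M_replicate_polyfun[of ?k "y # rest"] Cons.prems by auto
  have "\<forall>i. \<exists>F\<in>polyfun ?k. \<forall>x. of_int (M (map (\<lambda>y. y + x) ys @ axis i 1 # rest)) =
      of_int (M (replicate ?k x @ axis i 1 # rest)) + F (cvec x)"
    using Cons.IH Cons.prems by simp
  then obtain F where F: "\<And>i. F i \<in> polyfun ?k"
    "\<And>i x. of_int (M (map (\<lambda>y. y + x) ys @ axis i 1 # rest)) =
      of_int (M (replicate ?k x @ axis i 1 # rest)) + F i (cvec x)" by metis
  define H where "H z = F1 z + F0 z + (\<Sum>i\<in>UNIV. z $ i * F i z)" for z
  have "(\<lambda>z. \<Sum>i\<in>UNIV. z $ i * F i z) \<in> polyfun (Suc 0 + ?k)"
    by (intro polyfun_sum polyfun_mult polyfun_coord F)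
  then have "H \<in> polyfun (Suc ?k)"
    unfolding H_def[abs_def]
    using polyfun_mono[OF _ F0(1), of "Suc ?k"] F1(1) by (intro polyfun_add) auto
  moreover have "of_int (M (map (\<lambda>y. y + x) (y # ys) @ rest)) =
      of_int (M (replicate (length (y # ys)) x @ rest)) + H (cvec x)" for x
  proof -
    have "M (map (\<lambda>y. y + x) (y # ys) @ rest) =
        M (map (\<lambda>y. y + x) ys @ y # rest) + M (x # map (\<lambda>y. y + x) ys @ rest)"
      using Cons.prems by (simp add: M_add M_swap)
    moreover have "M (x # map (\<lambda>y. y + x) ys @ rest) =
        (\<Sum>i\<in>UNIV. x $ i * M (map (\<lambda>y. y + x) ys @ axis i 1 # rest))"
      using Cons.prems by (simp add: M_expand[of _ x] M_swap)
    moreover have "M (x # replicate ?k x @ rest) =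
        (\<Sum>i\<in>UNIV. x $ i * M (replicate ?k x @ axis i 1 # rest))"
      using Cons.prems by (simp add: M_expand[of _ x] M_swap)
    ultimately show ?thesis
      by (simp add: F0 F1 F H_def algebra_simps sum.distrib)
  qed
  ultimately show ?case by (intro bexI[of _ H]) auto
qed

end

text \<open>For fixed \<open>ys\<close> the equations in \<open>x\<close> are, up to the constant
  \<open>fact r\<close>, the gradient of \<open>f\<close> plus terms of degree below
  \<open>r\<close>. By smoothness the gradient vanishes only at 0, and the bound for perturbations
  of such a system does not depend on the perturbation, hence not on \<open>ys\<close>.\<close>

lemma polar_zeros_fibre:
  fixes f :: "('n::finite) int_mpoly"
  assumes hom: "homogeneous_of_degree d f" and smooth: "smooth_form f" and d: "d = Suc r"
  shows "\<exists>D. \<forall>ys. length ys = r \<longrightarrow>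
    finite {x. \<forall>i. polar f (map (\<lambda>y. y + x) ys @ [axis i 1]) = 0} \<and>
    card {x. \<forall>i. polar f (map (\<lambda>y. y + x) ys @ [axis i 1]) = 0} \<le> D"
proof -
  interpret sym_multilinear d "polar f" by (rule polar_sym_multilinear[OF hom])
  define G where "G i z = of_int (fact r) * mpoly_eval (mpoly_pderiv i f) z" for i and z :: "complex ^ 'n"
  have mono: "(\<Prod>j\<in>UNIV. (z $ j) ^ Poly_Mapping.lookup e j) = cmono (Poly_Mapping.lookup e) z" for e and z :: "complex ^ 'n"
    by (simp add: cmono_def)
  have deg: "sum (Poly_Mapping.lookup (e - Poly_Mapping.single i 1)) UNIV = r"
    if "e \<in> Poly_Mapping.keys f" "Poly_Mapping.lookup e i \<noteq> 0" for e i
  proof -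
    have "Poly_Mapping.lookup (e - Poly_Mapping.single i 1) j + (if j = i then 1 else 0) = Poly_Mapping.lookup e j" for j
      using that(2) by (auto simp: lookup_minus lookup_single when_def)
    then have "exp_degree e =
        (\<Sum>j\<in>UNIV. Poly_Mapping.lookup (e - Poly_Mapping.single i 1) j + (if j = i then 1 else 0))"
      unfolding exp_degree_def by simp
    then have "exp_degree e = sum (Poly_Mapping.lookup (e - Poly_Mapping.single i 1)) UNIV + 1"
      by (simp add: sum.distrib)
    then show ?thesis using homogeneous_exp_degree[OF hom that(1)] d by simp
  qed
  have GP: "G i \<in> polyfuns" for i
    unfolding G_def[abs_def] mpoly_eval_pderiv mono
    by (intro polyfuns_cmult polyfuns_sum polyfunsI[OF polyfun_cmono[OF lessI]])
  have hG: "G i (t *s z) = t ^ r * G i z" for i t z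
  proof -
    have "of_int (int (Poly_Mapping.lookup e i) * Poly_Mapping.lookup f e) *
         cmono (Poly_Mapping.lookup (e - Poly_Mapping.single i 1)) (t *s z) =
        t ^ r * (of_int (int (Poly_Mapping.lookup e i) * Poly_Mapping.lookup f e) *
         cmono (Poly_Mapping.lookup (e - Poly_Mapping.single i 1)) z)"
      if "e \<in> Poly_Mapping.keys f" for e
      using deg[OF that, of i] by (cases "Poly_Mapping.lookup e i = 0") (auto simp: cmono_scale)
    then have "(\<Sum>e\<in>Poly_Mapping.keys f. of_int (int (Poly_Mapping.lookup e i) * Poly_Mapping.lookup f e) *
         cmono (Poly_Mapping.lookup (e - Poly_Mapping.single i 1)) (t *s z)) =
        (\<Sum>e\<in>Poly_Mapping.keys f. t ^ r * (of_int (int (Poly_Mapping.lookup e i) * Poly_Mapping.lookup f e) *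
         cmono (Poly_Mapping.lookup (e - Poly_Mapping.single i 1)) z))"
      by (intro sum.cong refl)
    then show ?thesis
      unfolding G_def mpoly_eval_pderiv mono by (simp only: sum_distrib_left[symmetric] mult.left_commute)
  qed
  have zG: "z = 0" if "\<forall>i. G i z = 0" for z
    using smooth that unfolding smooth_form_def G_def by auto
  obtain D where D: "\<And>R X. (\<And>i. R i \<in> polyfun r) \<Longrightarrow> (\<And>x i. x \<in> X \<Longrightarrow> G i x = R i x) \<Longrightarrow> finite X \<and> card X \<le> D"
    using perturbed_system_finite[where G = G, OF GP zG hG] by blast
  show ?thesis
  proof (intro exI[of _ D] allI impI)
    fix ys :: "(int ^ 'n) list" assume len: "length ys = r"
    define Z where "Z = {x. \<forall>i. polar f (map (\<lambda>y. y + x) ys @ [axis i 1]) = 0}"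
    have "\<forall>i. \<exists>F\<in>polyfun r. \<forall>x. of_int (polar f (map (\<lambda>y. y + x) ys @ [axis i 1])) =
        of_int (polar f (replicate r x @ [axis i 1])) + F (cvec x)"
      using M_shift_polyfun[of ys] len d by auto
    then obtain F where F: "\<And>i. F i \<in> polyfun r"
      "\<And>i x. of_int (polar f (map (\<lambda>y. y + x) ys @ [axis i 1])) =
        of_int (polar f (replicate r x @ [axis i 1])) + F i (cvec x)" by metis
    have "G i (cvec x) = - 1 * F i (cvec x)" if "x \<in> Z" for x i
    proof -
      have "of_int (polar f (replicate r x @ [axis i 1])) = G i (cvec x)"
        unfolding polar_gradient[OF hom d] G_def cvec_def mpoly_eval_of_int by simp
      then show ?thesis using F(2)[of x i] that by (simp add: Z_def eq_neg_iff_add_eq_0)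
    qed
    then have "finite (cvec ` Z) \<and> card (cvec ` Z) \<le> D"
      by (intro D[of "\<lambda>i z. - 1 * F i z"] polyfun_cmult F) auto
    then have "finite Z \<and> card Z \<le> D"
      using card_image[of cvec Z] finite_imageD[of cvec Z] inj_cvec by (metis inj_on_subset subset_UNIV)
    then show "finite {x. \<forall>i. polar f (map (\<lambda>y. y + x) ys @ [axis i 1]) = 0} \<and>
      card {x. \<forall>i. polar f (map (\<lambda>y. y + x) ys @ [axis i 1]) = 0} \<le> D"
      unfolding Z_def .
  qed
qed

text \<open>This saves \<open>R ^ CARD('n)\<close> over the trivial count: once the differences to
  the first vector are fixed, boundedly many first vectors remain.\<close>

lemma polar_zeros_count:
  fixes f :: "('n::finite) int_mpoly"
  assumes hom: "homogeneous_of_degree d f" and smooth: "smooth_form f" and d: "d = Suc (Suc k)"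
  shows "\<exists>D. \<forall>R. card {hs \<in> vec_lists (Suc k) R. \<forall>i. polar f (hs @ [axis i 1]) = 0}
           \<le> D * (4 * R + 1) ^ (CARD('n) * k)"
proof -
  obtain D where D: "\<And>ys. length ys = Suc k \<Longrightarrow>
    finite {x. \<forall>i. polar f (map (\<lambda>y. y + x) ys @ [axis i 1]) = 0} \<and>
    card {x. \<forall>i. polar f (map (\<lambda>y. y + x) ys @ [axis i 1]) = 0} \<le> D"
    using polar_zeros_fibre[OF hom smooth d] by auto
  have "card {hs \<in> vec_lists (Suc k) R. \<forall>i. polar f (hs @ [axis i 1]) = 0} \<le> D * (4 * R + 1) ^ (CARD('n) * k)" for R
  proof -
    \<comment> \<open>The leading 0 stands for the first vector itself. Thus \<open>x\<close> runs
      over first vectors and \<open>ys\<close> over the differences to it, which lie in the box of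
      radius \<open>2 * R\<close>.\<close>
    define Z where "Z ys = {x. \<forall>i. polar f (map (\<lambda>y. y + x) (0 # ys) @ [axis i 1]) = 0}" for ys
    have Z: "finite (Z ys)" "card (Z ys) \<le> D" if "ys \<in> vec_lists k (2 * R)" for ys
      using D[of "0 # ys"] that by (auto simp: Z_def vec_lists_def)
    have sub: "{hs \<in> vec_lists (Suc k) R. \<forall>i. polar f (hs @ [axis i 1]) = 0} \<subseteq>
        (\<Union>ys\<in>vec_lists k (2 * R). (\<lambda>x. map (\<lambda>y. y + x) (0 # ys)) ` Z ys)"
    proof
      fix hs assume hs: "hs \<in> {hs \<in> vec_lists (Suc k) R. \<forall>i. polar f (hs @ [axis i 1]) = 0}"
      then obtain x gs where gs: "hs = x # gs" "length gs = k" "x \<in> int_box R" "set gs \<subseteq> int_box R"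
        by (auto simp: vec_lists_def length_Suc_conv)
      define ys where "ys = map (\<lambda>y. y - x) gs"
      have eq: "hs = map (\<lambda>y. y + x) (0 # ys)" by (simp add: gs ys_def map_idI)
      have "ys \<in> vec_lists k (2 * R)"
        unfolding vec_lists_def
      proof (intro CollectI conjI subsetI)
        fix y assume "y \<in> set ys"
        then obtain g where g: "g \<in> set gs" "y = g - x" by (auto simp: ys_def)
        show "y \<in> int_box (2 * R)"
          unfolding int_box_def
        proof (intro CollectI allI)
          fix i
          have "\<bar>g $ i\<bar> \<le> int R" "\<bar>x $ i\<bar> \<le> int R" using g gs by (auto simp: int_box_def)
          then show "\<bar>y $ i\<bar> \<le> int (2 * R)" by (simp add: g)
        qed
      qed (simp add: ys_def gs)
      moreover have "\<forall>i. polar f (map (\<lambda>y. y + x) (0 # ys) @ [axis i 1]) = 0"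
        using hs unfolding eq[symmetric] by blast
      then have "x \<in> Z ys" unfolding Z_def by blast
      ultimately show "hs \<in> (\<Union>ys\<in>vec_lists k (2 * R). (\<lambda>x. map (\<lambda>y. y + x) (0 # ys)) ` Z ys)"
        using eq by blast
    qed
    have "card {hs \<in> vec_lists (Suc k) R. \<forall>i. polar f (hs @ [axis i 1]) = 0} \<le>
        card (\<Union>ys\<in>vec_lists k (2 * R). (\<lambda>x. map (\<lambda>y. y + x) (0 # ys)) ` Z ys)"
      using Z by (intro card_mono sub) auto
    also have "\<dots> \<le> (\<Sum>ys\<in>vec_lists k (2 * R). card ((\<lambda>x. map (\<lambda>y. y + x) (0 # ys)) ` Z ys))"
      by (rule card_UN_le) simp
    also have "\<dots> \<le> (\<Sum>ys\<in>(vec_lists k (2 * R) :: (int ^ 'n) list set). D)"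
    proof (rule sum_mono)
      fix ys :: "(int ^ 'n) list" assume ys: "ys \<in> vec_lists k (2 * R)"
      show "card ((\<lambda>x. map (\<lambda>y. y + x) (0 # ys)) ` Z ys) \<le> D"
        using card_image_le[OF Z(1)[OF ys], of "\<lambda>x. map (\<lambda>y. y + x) (0 # ys)"] Z(2)[OF ys] by linarith
    qed
    also have "\<dots> = D * (4 * R + 1) ^ (CARD('n) * k)" by (simp add: card_vec_lists)
    finally show ?thesis .
  qed
  then show ?thesis by blast
qed

section \<open>The shrinking lemma\<close>

lemma card_le_fibres:
  assumes "finite S" "finite K" "g ` S \<subseteq> K" "\<And>k. k \<in> K \<Longrightarrow> card {x\<in>S. g x = k} \<le> N"
  shows "card S \<le> card K * N"
proof -
  have "card S \<le> card (\<Union>k\<in>K. {x\<in>S. g x = k})"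
    using assms by (intro card_mono finite_UN_I) auto
  also have "\<dots> \<le> (\<Sum>k\<in>K. card {x\<in>S. g x = k})"
    by (rule card_UN_le[OF assms(2)])
  also have "\<dots> \<le> card K * N"
    using sum_bounded_above[of K "\<lambda>k. card {x\<in>S. g x = k}" N] assms(4) by simp
  finally show ?thesis .
qed

definition sympl :: "(real ^ 'n::finite) \<times> (real ^ 'n) \<Rightarrow> (real ^ 'n) \<times> (real ^ 'n) \<Rightarrow> real" where
  "sympl v w = fst v \<bullet> snd w - snd v \<bullet> fst w"

text \<open>The rotation \<open>J\<close> turns the symplectic form into the inner product, so the
  image of an isotropic set is orthogonal to the set. Both have the same dimension, inside a space
  of dimension \<open>2 * n\<close>.\<close>

lemma isotropic_dim_le:
  fixes S :: "((real ^ 'n::finite) \<times> (real ^ 'n)) set"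
  assumes "\<And>v w. v \<in> S \<Longrightarrow> w \<in> S \<Longrightarrow> sympl v w = 0"
  shows "dim S \<le> CARD('n)"
proof -
  define J where "J v = (- snd v, fst v)" for v :: "(real ^ 'n) \<times> (real ^ 'n)"
  have "linear J" unfolding J_def by (auto intro!: linearI)
  moreover have "inj_on J (span S)" by (auto simp: inj_on_def J_def prod_eq_iff)
  ultimately have d: "dim (J ` S) = dim S" by (rule dim_image_eq)
  have "dim (J ` S \<union> S) = dim (J ` S) + dim S"
  proof (rule dim_orthogonal_sum)
    fix x y assume "x \<in> J ` S" "y \<in> S"
    then obtain v where "x = J v" "v \<in> S" by auto
    then show "x \<bullet> y = 0"
      using assms[of v y] \<open>y \<in> S\<close> by (simp add: J_def inner_prod_def sympl_def)
  qed
  moreover have "dim (J ` S \<union> S) \<le> DIM((real ^ 'n) \<times> (real ^ 'n))"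
    by (rule dim_subset_UNIV)
  ultimately show ?thesis using d by simp
qed

text \<open>The distance to the nearest integer, usually written \<open>||t||\<close>.\<close>

definition dint :: "real \<Rightarrow> real" where
  "dint t = \<bar>t - of_int (round t)\<bar>"

lemma dint_le: "dint t \<le> \<bar>t - of_int k\<bar>"
  unfolding dint_def by (rule round_diff_minimal)

lemma dint_le_half: "dint t \<le> 1 / 2"
  unfolding dint_def using of_int_round_abs_le[of t] by (simp add: abs_minus_commute)

lemma dint_nonneg: "0 \<le> dint t"
  by (simp add: dint_def)

definition rbox :: "real \<Rightarrow> (int ^ 'n::finite) set" where
  "rbox U = {x. \<forall>i. real_of_int \<bar>x $ i\<bar> \<le> U}"

lemma rbox_eq_int_box: "0 \<le> U \<Longrightarrow> rbox U = int_box (nat \<lfloor>U\<rfloor>)"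
  unfolding rbox_def int_box_def by (simp add: le_floor_iff)

lemma finite_rbox [simp]: "finite (rbox U :: (int ^ 'n::finite) set)"
proof (cases "0 \<le> U")
  case False
  then have "rbox U = ({} :: (int ^ 'n) set)" by (auto simp: rbox_def)
  then show ?thesis by simp
qed (simp add: rbox_eq_int_box)

lemma rbox_mono: "U \<le> V \<Longrightarrow> rbox U \<subseteq> rbox V"
  unfolding rbox_def by (auto intro: order_trans)

text \<open>Solutions with small \<open>u\<close> and small fractional parts pair to integers of absolute value
  less than one under the symplectic form, hence span an isotropic subspace. Its dimension is at
  most \<open>n\<close> instead of the trivial \<open>2n\<close>, which is what the box principle gains from.\<close>
lemma davenport_shrinking:
  fixes L :: "int ^ 'n::finite \<Rightarrow> 'n \<Rightarrow> real" and U \<delta> z :: real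
  assumes U: "0 < U" and \<delta>: "0 < \<delta>" and small: "2 * real CARD('n) * (U * \<delta>) < 1"
    and z: "0 < z" "z \<le> 1"
    and diff: "\<And>u v i. L (u - v) i = L u i - L v i"
    and sym: "\<And>u v. (\<Sum>i\<in>UNIV. v $ i * L u i) = (\<Sum>i\<in>UNIV. u $ i * L v i)"
  shows "real (card {u \<in> rbox U. \<forall>i. dint (L u i) \<le> \<delta>}) \<le>
    ((4 * real CARD('n) ^ 2 + 3) / z) ^ CARD('n) * real (card {u \<in> rbox (z * U). \<forall>i. dint (L u i) \<le> z * \<delta>})"
proof -
  let ?n = "CARD('n)"
  define S where "S = {u \<in> rbox U. \<forall>i. dint (L u i) \<le> \<delta>}"
  define S' where "S' = {u \<in> rbox (z * U). \<forall>i. dint (L u i) \<le> z * \<delta>}"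
  have fin: "finite S" "finite S'" by (simp_all add: S_def S'_def)
  define r where "r u i = L u i - of_int (round (L u i))" for u i
  \<comment> \<open>On \<open>S\<close> both halves are normalised to entries of absolute value at
    most 1, so \<open>U * \<delta>\<close> becomes the scale of the symplectic form.\<close>
  define \<Phi> where "\<Phi> u = ((\<chi> i. of_int (u $ i) / U), (\<chi> i. r u i / \<delta>))" for u
  have bnd: "\<bar>of_int (u $ i)\<bar> \<le> U" "\<bar>r u i\<bar> \<le> \<delta>" if "u \<in> S" for u i
    using that by (auto simp: S_def rbox_def r_def dint_def)
  have iso: "sympl (\<Phi> u) (\<Phi> v) = 0" if uv: "u \<in> S" "v \<in> S" for u v
  proof -
    \<comment> \<open>By the symmetry of \<open>L\<close> the values of \<open>L\<close> cancel, and
      the integer \<open>k\<close> pairs entries with fractional parts. Its absolute value is at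
      most \<open>2 * n * (U * \<delta>) < 1\<close>.\<close>
    define k where "k = (\<Sum>i\<in>UNIV. v $ i * round (L u i)) - (\<Sum>i\<in>UNIV. u $ i * round (L v i))"
    have "of_int k = (\<Sum>i\<in>UNIV. of_int (v $ i) * (L u i - r u i)) - (\<Sum>i\<in>UNIV. of_int (u $ i) * (L v i - r v i))"
      by (simp add: k_def r_def)
    also have "\<dots> = (\<Sum>i\<in>UNIV. of_int (u $ i) * r v i) - (\<Sum>i\<in>UNIV. r u i * of_int (v $ i))"
      using sym[of v u] by (simp add: right_diff_distrib sum_subtractf mult.commute)
    finally have k1: "of_int k = (\<Sum>i\<in>UNIV. of_int (u $ i) * r v i) - (\<Sum>i\<in>UNIV. r u i * of_int (v $ i))" .
    also have "\<dots> = U * \<delta> * sympl (\<Phi> u) (\<Phi> v)"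
      using U \<delta> by (simp add: sympl_def \<Phi>_def inner_vec_def sum_distrib_left right_diff_distrib)
    finally have k: "of_int k = U * \<delta> * sympl (\<Phi> u) (\<Phi> v)" .
    have "\<bar>(\<Sum>i\<in>UNIV. of_int (u $ i) * r v i) - (\<Sum>i\<in>UNIV. r u i * of_int (v $ i))\<bar> \<le>
        (\<Sum>i\<in>UNIV. \<bar>of_int (u $ i) * r v i\<bar>) + (\<Sum>i\<in>UNIV. \<bar>r u i * of_int (v $ i)\<bar>)"
      using sum_abs[of "\<lambda>i. of_int (u $ i) * r v i" UNIV] sum_abs[of "\<lambda>i. r u i * of_int (v $ i)" UNIV]
      by linarith
    also have "\<dots> \<le> (\<Sum>i\<in>(UNIV :: 'n set). U * \<delta>) + (\<Sum>i\<in>(UNIV :: 'n set). \<delta> * U)"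
      using bnd uv U \<delta> unfolding abs_mult by (intro add_mono sum_mono mult_mono) auto
    also have "\<dots> < 1" using small by (simp add: mult_ac)
    finally have "\<bar>real_of_int k\<bar> < 1"
      unfolding k1 .
    then have "k = 0" by linarith
    then show ?thesis using k U \<delta> by simp
  qed
  define W where "W = span (\<Phi> ` S)"
  have dimW: "dim W \<le> ?n"
    unfolding W_def dim_span by (rule isotropic_dim_le) (use iso in auto)
  obtain B where B: "B \<subseteq> W" "pairwise orthogonal B" "\<And>x. x \<in> B \<Longrightarrow> norm x = 1"
    "independent B" "card B = dim W" "span B = W"
    using orthonormal_basis_subspace[of W] by (auto simp: W_def)
  have finB: "finite B" using B(4) independent_imp_finite by blast
  \<comment> \<open>\<open>W\<close> has at most \<open>n\<close> orthonormal basis vectors, and two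
    points of one cell differ by at most \<open>\<eta>\<close> along each, hence by at most
    \<open>z\<close> in norm.\<close>
  define \<eta> where "\<eta> = z / real ?n"
  have \<eta>: "0 < \<eta>" using z by (simp add: \<eta>_def)
  define m where "m = \<lceil>2 * real ?n / \<eta>\<rceil>"
  define cell where "cell u = restrict (\<lambda>b. \<lfloor>(\<Phi> u \<bullet> b) / \<eta>\<rfloor>) B" for u
  have norm\<Phi>: "norm (\<Phi> u) \<le> 2 * real ?n" if "u \<in> S" for u
  proof -
    have "norm (fst (\<Phi> u)) \<le> (\<Sum>i\<in>UNIV. \<bar>fst (\<Phi> u) $ i\<bar>)" by (rule norm_le_l1_cart)
    also have "\<dots> \<le> (\<Sum>i\<in>(UNIV :: 'n set). 1)"
      using bnd[OF that] U by (intro sum_mono) (simp add: \<Phi>_def)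
    finally have 1: "norm (fst (\<Phi> u)) \<le> real ?n" by simp
    have "norm (snd (\<Phi> u)) \<le> (\<Sum>i\<in>UNIV. \<bar>snd (\<Phi> u) $ i\<bar>)" by (rule norm_le_l1_cart)
    also have "\<dots> \<le> (\<Sum>i\<in>(UNIV :: 'n set). 1)"
      using bnd[OF that] \<delta> by (intro sum_mono) (simp add: \<Phi>_def)
    finally have 2: "norm (snd (\<Phi> u)) \<le> real ?n" by simp
    have "norm (\<Phi> u) \<le> norm (fst (\<Phi> u)) + norm (snd (\<Phi> u))"
      using norm_Pair_le[of "fst (\<Phi> u)" "snd (\<Phi> u)"] by simp
    then show ?thesis using 1 2 by simp
  qed
  have cellK: "cell ` S \<subseteq> PiE B (\<lambda>_. {-m..m})"
  proof (intro image_subsetI PiE_I)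
    fix u b assume u: "u \<in> S" and b: "b \<in> B"
    have "\<bar>\<Phi> u \<bullet> b\<bar> \<le> norm (\<Phi> u) * norm b" by (rule Cauchy_Schwarz_ineq2)
    then have "\<bar>\<Phi> u \<bullet> b\<bar> \<le> 2 * real ?n" using norm\<Phi>[OF u] B(3)[OF b] by simp
    then have "\<bar>(\<Phi> u \<bullet> b) / \<eta>\<bar> \<le> 2 * real ?n / \<eta>"
      using \<eta> by (simp add: divide_right_mono)
    then have "\<lfloor>(\<Phi> u \<bullet> b) / \<eta>\<rfloor> \<le> m" "- m \<le> \<lfloor>(\<Phi> u \<bullet> b) / \<eta>\<rfloor>"
      unfolding m_def by linarith+
    then show "cell u b \<in> {-m..m}" using b by (simp add: cell_def)
  qed (auto simp: cell_def)
  have fibre: "card {u\<in>S. cell u = k} \<le> card S'" for k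
  proof (cases "{u\<in>S. cell u = k} = {}")
    case False
    then obtain u0 where u0: "u0 \<in> S" "cell u0 = k" by blast
    have "(\<lambda>u. u - u0) ` {u\<in>S. cell u = k} \<subseteq> S'"
    proof (intro image_subsetI)
      fix u assume "u \<in> {u\<in>S. cell u = k}"
      then have u: "u \<in> S" "cell u = cell u0" using u0 by auto
      define w where "w = \<Phi> u - \<Phi> u0"
      have "w \<in> W" unfolding w_def W_def using u u0 by (intro span_diff span_base) auto
      have wb: "\<bar>w \<bullet> b\<bar> \<le> \<eta>" if "b \<in> B" for b
      proof -
        have "\<lfloor>(\<Phi> u \<bullet> b) / \<eta>\<rfloor> = \<lfloor>(\<Phi> u0 \<bullet> b) / \<eta>\<rfloor>"
          using fun_cong[OF u(2), of b] that by (simp add: cell_def)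
        then have "\<bar>(\<Phi> u \<bullet> b) / \<eta> - (\<Phi> u0 \<bullet> b) / \<eta>\<bar> \<le> 1" by linarith
        then have "\<bar>(w \<bullet> b) / \<eta>\<bar> \<le> 1" by (simp add: w_def inner_diff_left diff_divide_distrib)
        then show ?thesis using \<eta> by (simp add: abs_divide)
      qed
      have wB: "w \<in> span B" using \<open>w \<in> W\<close> B(6) by blast
      have w: "(\<Sum>b\<in>B. (w \<bullet> b) *\<^sub>R b) = w"
        by (rule orthonormal_basis_expand[OF B(2) _ wB finB]) (rule B(3))
      have "norm w = norm (\<Sum>b\<in>B. (w \<bullet> b) *\<^sub>R b)" by (simp only: w)
      also have "\<dots> \<le> (\<Sum>b\<in>B. norm ((w \<bullet> b) *\<^sub>R b))" by (rule norm_sum)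
      also have "\<dots> \<le> (\<Sum>b\<in>B. \<eta>)" using wb B(3) by (intro sum_mono) simp
      also have "\<dots> \<le> real ?n * \<eta>" using B(5) dimW \<eta> by simp
      also have "\<dots> = z" by (simp add: \<eta>_def)
      finally have nw: "norm w \<le> z" .
      have w1: "\<bar>fst w $ i\<bar> \<le> z" and w2: "\<bar>snd w $ i\<bar> \<le> z" for i
        using component_le_norm_cart[of "fst w" i] norm_fst_le[of "fst w" "snd w"]
          component_le_norm_cart[of "snd w" i] norm_snd_le[of "snd w" "fst w"] nw by auto
      have "real_of_int \<bar>(u - u0) $ i\<bar> \<le> z * U" for i
      proof -
        have "fst w $ i = of_int ((u - u0) $ i) / U" by (simp add: w_def \<Phi>_def diff_divide_distrib)
        then show ?thesis using w1[of i] U by (simp add: abs_divide divide_le_eq)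
      qed
      moreover have "dint (L (u - u0) i) \<le> z * \<delta>" for i
      proof -
        have "snd w $ i = (r u i - r u0 i) / \<delta>" by (simp add: w_def \<Phi>_def diff_divide_distrib)
        then have "\<bar>r u i - r u0 i\<bar> \<le> z * \<delta>" using w2[of i] \<delta> by (simp add: abs_divide divide_le_eq)
        moreover have "r u i - r u0 i = L (u - u0) i - of_int (round (L u i) - round (L u0 i))"
          by (simp add: r_def diff)
        ultimately show ?thesis using dint_le[of "L (u - u0) i" "round (L u i) - round (L u0 i)"] by simp
      qed
      ultimately show "u - u0 \<in> S'" by (simp add: S'_def rbox_def)
    qed
    moreover have "inj_on (\<lambda>u. u - u0) {u\<in>S. cell u = k}" by (auto simp: inj_on_def)
    ultimately show ?thesis using fin(2) card_inj_on_le by blast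
  next
    case True
    show ?thesis unfolding True by simp
  qed
  have "card S \<le> card (PiE B (\<lambda>_. {-m..m})) * card S'"
    using card_le_fibres[OF fin(1) _ cellK fibre] finB by (simp add: finite_PiE)
  then have "real (card S) \<le> real (card (PiE B (\<lambda>_. {-m..m}))) * real (card S')"
    by (metis of_nat_le_iff of_nat_mult)
  also have "real (card (PiE B (\<lambda>_. {-m..m}))) \<le> ((4 * real ?n ^ 2 + 3) / z) ^ ?n"
  proof -
    have "0 \<le> 2 * real ?n / \<eta>" using \<eta> by simp
    then have m0: "0 \<le> m" unfolding m_def by linarith
    have "real_of_int m \<le> 2 * real ?n / \<eta> + 1" unfolding m_def by linarith
    then have "2 * real_of_int m + 1 \<le> 4 * real ?n / \<eta> + 3" by simp
    also have "\<dots> = 4 * real ?n ^ 2 / z + 3" by (simp add: \<eta>_def power2_eq_square)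
    also have "\<dots> \<le> (4 * real ?n ^ 2 + 3) / z" using z by (simp add: field_simps)
    finally have c: "2 * real_of_int m + 1 \<le> (4 * real ?n ^ 2 + 3) / z" .
    have "1 \<le> (4 * real ?n ^ 2 + 3) / z" using c m0 by linarith
    have "real (card (PiE B (\<lambda>_. {-m..m}))) = (2 * real_of_int m + 1) ^ card B"
      using finB m0 by (simp add: card_PiE)
    also have "\<dots> \<le> ((4 * real ?n ^ 2 + 3) / z) ^ card B"
      using c m0 by (intro power_mono) auto
    also have "\<dots> \<le> ((4 * real ?n ^ 2 + 3) / z) ^ ?n"
      using \<open>1 \<le> _\<close> B(5) dimW by (intro power_increasing) auto
    finally show ?thesis .
  qed
  finally show ?thesis unfolding S_def[symmetric] S'_def[symmetric]
    by (simp add: mult_right_mono)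
qed

section \<open>Shrinking the arguments of a multilinear form\<close>

context sym_multilinear
begin

text \<open>With the other vectors fixed, the form is a symmetric matrix in \<open>u\<close> and the
  last argument, which is the symmetry that the shrinking lemma asks for.\<close>

lemma card_shrink_step:
  fixes \<alpha> U \<delta> z :: real
  assumes U: "0 < U" and \<delta>: "0 < \<delta>" and small: "2 * real CARD('n) * (U * \<delta>) < 1"
    and z: "0 < z" "z \<le> 1" and d: "length rest + 2 = d"
  shows "real (card {u \<in> rbox U. \<forall>i. dint (\<alpha> * M (u # rest @ [axis i 1])) \<le> \<delta>}) \<le>
    ((4 * real CARD('n) ^ 2 + 3) / z) ^ CARD('n) *
    real (card {u \<in> rbox (z * U). \<forall>i. dint (\<alpha> * M (u # rest @ [axis i 1])) \<le> z * \<delta>})"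
proof (rule davenport_shrinking[OF U \<delta> small z])
  fix u v i
  show "\<alpha> * M ((u - v) # rest @ [axis i 1]) = \<alpha> * M (u # rest @ [axis i 1]) - \<alpha> * M (v # rest @ [axis i 1])"
    using M_diff[of "rest @ [axis i 1]" u v] d by (simp add: right_diff_distrib)
next
  fix u v
  have lin: "(\<Sum>i\<in>UNIV. v $ i * M (u # rest @ [axis i 1])) = M (u # rest @ [v])" for u v
  proof -
    have "M (u # rest @ [w]) = M (w # u # rest)" for w by (rule M_mset) simp
    then show ?thesis using M_expand[of "u # rest" v] d by simp
  qed
  have "M (u # rest @ [v]) = M (v # rest @ [u])" by (rule M_mset) simp
  then have "(\<Sum>i\<in>UNIV. v $ i * M (u # rest @ [axis i 1])) = (\<Sum>i\<in>UNIV. u $ i * M (v # rest @ [axis i 1]))"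
    by (simp add: lin)
  then have "\<alpha> * of_int (\<Sum>i\<in>UNIV. v $ i * M (u # rest @ [axis i 1])) =
      \<alpha> * of_int (\<Sum>i\<in>UNIV. u $ i * M (v # rest @ [axis i 1]))" by simp
  then show "(\<Sum>i\<in>UNIV. of_int (v $ i) * (\<alpha> * of_int (M (u # rest @ [axis i 1])))) =
      (\<Sum>i\<in>UNIV. of_int (u $ i) * (\<alpha> * of_int (M (v # rest @ [axis i 1]))))"
    by (simp add: sum_distrib_left mult.left_commute)
qed

definition near_lists :: "real \<Rightarrow> nat \<Rightarrow> real \<Rightarrow> real \<Rightarrow> (int ^ 'n) list set" where
  "near_lists \<alpha> m U \<delta> = {hs. set hs \<subseteq> rbox U \<and> length hs = m \<and>
     (\<forall>i. dint (\<alpha> * M (hs @ [axis i 1])) \<le> \<delta>)}"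

text \<open>The vectors are shrunk one at a time, and each step multiplies the tolerance by
  \<open>z\<close>. Since the tolerance only decreases, the smallness condition persists for the
  vectors still in the large box.\<close>

lemma card_near_lists_shrink:
  assumes U: "0 < U" and \<delta>: "0 < \<delta>" and small: "2 * real CARD('n) * (U * \<delta>) < 1"
    and z: "0 < z" "z \<le> 1" and d: "Suc m = d"
  shows "real (card (near_lists \<alpha> m U \<delta>)) \<le>
    ((4 * real CARD('n) ^ 2 + 3) / z) ^ (CARD('n) * m) * real (card (near_lists \<alpha> m (z * U) (z ^ m * \<delta>)))"
proof -
  define C where "C = ((4 * real CARD('n) ^ 2 + 3) / z) ^ CARD('n)"
  have C: "0 \<le> C" using z by (simp add: C_def)
  \<comment> \<open>The state after \<open>j\<close> steps: \<open>ks\<close> are the vectors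
    already confined to the small box, \<open>hs\<close> those still to come.\<close>
  define A where "A j = {(ks, hs). set ks \<subseteq> rbox (z * U) \<and> length ks = j \<and> set hs \<subseteq> rbox U \<and> length hs = m - j \<and>
     (\<forall>i. dint (\<alpha> * M (ks @ hs @ [axis i 1])) \<le> z ^ j * \<delta>)}" for j
  define P where "P j = {(ks, hs). set ks \<subseteq> (rbox (z * U) :: (int ^ 'n) set) \<and> length ks = j \<and> set hs \<subseteq> (rbox U :: (int ^ 'n) set) \<and> length hs = m - Suc j}" for j
  define T where "T V \<epsilon> p = {u \<in> rbox V. \<forall>i. dint (\<alpha> * M (u # (fst p @ snd p) @ [axis i 1])) \<le> \<epsilon>}" for V \<epsilon> p
  have finT: "finite (T V \<epsilon> p)" for V \<epsilon> p by (simp add: T_def)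
  have finP: "finite (P j)" for j
  proof (rule finite_subset)
    show "P j \<subseteq> {ks. set ks \<subseteq> rbox (z * U) \<and> length ks = j} \<times> {hs. set hs \<subseteq> rbox U \<and> length hs = m - Suc j}"
      by (auto simp: P_def)
  qed (intro finite_cartesian_product finite_lists_length_eq finite_rbox)
  have step: "real (card (A j)) \<le> C * real (card (A (Suc j)))" if j: "j < m" for j
  proof -
    have "A j = (\<lambda>((ks, hs), u). (ks, u # hs)) ` Sigma (P j) (T U (z ^ j * \<delta>))"
    proof (intro set_eqI iffI)
      fix x assume "x \<in> A j"
      then obtain ks gs where x: "x = (ks, gs)" "set ks \<subseteq> rbox (z * U)" "length ks = j" "set gs \<subseteq> rbox U"
        "length gs = m - j" "\<forall>i. dint (\<alpha> * M (ks @ gs @ [axis i 1])) \<le> z ^ j * \<delta>" by (auto simp: A_def)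
      then obtain u hs where gs: "gs = u # hs" using j by (cases gs) auto
      have "((ks, hs), u) \<in> Sigma (P j) (T U (z ^ j * \<delta>))"
        using x gs by (auto simp: P_def T_def M_swap)
      then show "x \<in> (\<lambda>((ks, hs), u). (ks, u # hs)) ` Sigma (P j) (T U (z ^ j * \<delta>))"
        using x gs by force
    next
      fix x assume "x \<in> (\<lambda>((ks, hs), u). (ks, u # hs)) ` Sigma (P j) (T U (z ^ j * \<delta>))"
      then show "x \<in> A j" using j by (auto simp: A_def P_def T_def M_swap)
    qed
    moreover have "inj_on (\<lambda>((ks, hs), u). (ks, u # hs)) (Sigma (P j) (T U (z ^ j * \<delta>)))"
      by (auto simp: inj_on_def)
    ultimately have 1: "card (A j) = (\<Sum>p\<in>P j. card (T U (z ^ j * \<delta>) p))"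
      using finP finT by (simp add: card_image card_SigmaI)
    have "A (Suc j) = (\<lambda>((ks, hs), u). (u # ks, hs)) ` Sigma (P j) (T (z * U) (z ^ Suc j * \<delta>))"
    proof (intro set_eqI iffI)
      fix x assume "x \<in> A (Suc j)"
      then obtain ks' hs where x: "x = (ks', hs)" "set ks' \<subseteq> rbox (z * U)" "length ks' = Suc j" "set hs \<subseteq> rbox U"
        "length hs = m - Suc j" "\<forall>i. dint (\<alpha> * M (ks' @ hs @ [axis i 1])) \<le> z ^ Suc j * \<delta>" by (auto simp: A_def)
      then obtain u ks where gs: "ks' = u # ks" by (cases ks') auto
      have "((ks, hs), u) \<in> Sigma (P j) (T (z * U) (z ^ Suc j * \<delta>))"
        using x gs by (auto simp: P_def T_def)
      then show "x \<in> (\<lambda>((ks, hs), u). (u # ks, hs)) ` Sigma (P j) (T (z * U) (z ^ Suc j * \<delta>))"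
        using x gs by force
    next
      fix x assume "x \<in> (\<lambda>((ks, hs), u). (u # ks, hs)) ` Sigma (P j) (T (z * U) (z ^ Suc j * \<delta>))"
      then show "x \<in> A (Suc j)" by (auto simp: A_def P_def T_def)
    qed
    moreover have "inj_on (\<lambda>((ks, hs), u). (u # ks, hs)) (Sigma (P j) (T (z * U) (z ^ Suc j * \<delta>)))"
      by (auto simp: inj_on_def)
    ultimately have 2: "card (A (Suc j)) = (\<Sum>p\<in>P j. card (T (z * U) (z ^ Suc j * \<delta>) p))"
      using finP finT by (simp add: card_image card_SigmaI)
    have "real (card (T U (z ^ j * \<delta>) p)) \<le> C * real (card (T (z * U) (z ^ Suc j * \<delta>) p))" if p: "p \<in> P j" for p
    proof -
      have "z ^ j \<le> 1" using z by (simp add: power_le_one)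
      then have "U * (z ^ j * \<delta>) \<le> U * \<delta>" using U \<delta> by (simp add: mult_left_le_one_le)
      then have "2 * real CARD('n) * (U * (z ^ j * \<delta>)) \<le> 2 * real CARD('n) * (U * \<delta>)"
        by (rule mult_left_mono) simp
      then have s: "2 * real CARD('n) * (U * (z ^ j * \<delta>)) < 1" using small by linarith
      have l: "length (fst p @ snd p) + 2 = d" using p d j by (auto simp: P_def)
      have "0 < z ^ j * \<delta>" using z \<delta> by simp
      from card_shrink_step[OF U this s z l, of \<alpha>] show ?thesis
        by (simp add: T_def C_def mult.assoc)
    qed
    then have "(\<Sum>p\<in>P j. real (card (T U (z ^ j * \<delta>) p))) \<le> (\<Sum>p\<in>P j. C * real (card (T (z * U) (z ^ Suc j * \<delta>) p)))"
      by (rule sum_mono)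
    then show ?thesis unfolding 1 2 by (simp add: sum_distrib_left)
  qed
  have iter: "real (card (A 0)) \<le> C ^ j * real (card (A j))" if "j \<le> m" for j
    using that
  proof (induction j)
    case (Suc j)
    then have "real (card (A 0)) \<le> C ^ j * real (card (A j))" by simp
    also have "\<dots> \<le> C ^ j * (C * real (card (A (Suc j))))"
      using step[of j] Suc.prems C by (intro mult_left_mono) auto
    finally show ?case by (simp add: mult.commute mult.left_commute)
  qed simp
  have "A 0 = Pair [] ` near_lists \<alpha> m U \<delta>" by (auto simp: A_def near_lists_def)
  then have a0: "card (A 0) = card (near_lists \<alpha> m U \<delta>)" by (simp add: card_image inj_on_def)
  have "A m = (\<lambda>hs. (hs, [])) ` near_lists \<alpha> m (z * U) (z ^ m * \<delta>)" by (auto simp: A_def near_lists_def)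
  then have "card (A m) = card (near_lists \<alpha> m (z * U) (z ^ m * \<delta>))" by (simp add: card_image inj_on_def)
  then show ?thesis using iter[of m] a0 by (simp add: C_def power_mult)
qed

text \<open>This size bound, together with near integrality at a fraction, will force the form to
  vanish.\<close>

lemma M_bound: "\<exists>K>0. \<forall>U hs i. 0 \<le> U \<longrightarrow> set hs \<subseteq> rbox U \<longrightarrow> Suc (length hs) = d \<longrightarrow>
   \<bar>real_of_int (M (hs @ [axis i 1]))\<bar> \<le> K * U ^ length hs"
proof -
  define ax where "ax = {hs. set hs \<subseteq> range (\<lambda>i::'n. axis i (1::int)) \<and> length hs = d}"
  have fin: "finite ax" unfolding ax_def by (intro finite_lists_length_eq) simp
  define K0 where "K0 = (\<Sum>hs\<in>ax. \<bar>real_of_int (M hs)\<bar>)"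
  have K0: "\<bar>real_of_int (M hs)\<bar> \<le> K0" if "hs \<in> ax" for hs
    unfolding K0_def using member_le_sum[OF that, of "\<lambda>hs. \<bar>real_of_int (M hs)\<bar>"] fin by simp
  have K0n: "0 \<le> K0" by (simp add: K0_def sum_nonneg)
  have main: "\<bar>real_of_int (M (hs @ rest))\<bar> \<le> K0 * (real CARD('n) * U) ^ length hs"
    if "0 \<le> U" "set hs \<subseteq> rbox U" "set rest \<subseteq> range (\<lambda>i::'n. axis i (1::int))" "length hs + length rest = d" for U :: real and hs rest
    using that(2-)
  proof (induction hs arbitrary: rest)
    case Nil
    then show ?case using K0[of rest] by (simp add: ax_def)
  next
    case (Cons h hs)
    have "\<bar>real_of_int (M ((h # hs) @ rest))\<bar> = \<bar>\<Sum>i\<in>UNIV. real_of_int (h $ i) * real_of_int (M (hs @ axis i 1 # rest))\<bar>"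
      using Cons.prems by (simp add: M_expand[of _ h] M_swap)
    also have "\<dots> \<le> (\<Sum>i\<in>UNIV. \<bar>real_of_int (h $ i) * real_of_int (M (hs @ axis i 1 # rest))\<bar>)"
      by (rule sum_abs)
    also have "\<dots> \<le> (\<Sum>i\<in>(UNIV :: 'n set). U * (K0 * (real CARD('n) * U) ^ length hs))"
      unfolding abs_mult
    proof (intro sum_mono mult_mono)
      fix i
      show "\<bar>real_of_int (h $ i)\<bar> \<le> U" using Cons.prems by (auto simp: rbox_def)
      show "\<bar>real_of_int (M (hs @ axis i 1 # rest))\<bar> \<le> K0 * (real CARD('n) * U) ^ length hs"
        using Cons.prems by (intro Cons.IH) auto
    qed (use that in auto)
    also have "\<dots> = K0 * (real CARD('n) * U) ^ length (h # hs)" by simp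
    finally show ?case .
  qed
  show ?thesis
  proof (intro exI[of _ "(K0 + 1) * real CARD('n) ^ d"] conjI allI impI)
    fix U :: real and hs :: "(int ^ 'n) list" and i :: 'n assume U: "0 \<le> U" and hs: "set hs \<subseteq> rbox U" "Suc (length hs) = d"
    have "\<bar>real_of_int (M (hs @ [axis i 1]))\<bar> \<le> K0 * (real CARD('n) * U) ^ length hs"
      using main[OF U hs(1), of "[axis i 1]"] hs(2) by simp
    also have "\<dots> = (K0 * real CARD('n) ^ length hs) * U ^ length hs" by (simp add: power_mult_distrib)
    also have "\<dots> \<le> ((K0 + 1) * real CARD('n) ^ d) * U ^ length hs"
      using K0n U hs(2) by (intro mult_right_mono mult_mono power_increasing) auto
    finally show "\<bar>real_of_int (M (hs @ [axis i 1]))\<bar> \<le> (K0 + 1) * real CARD('n) ^ d * U ^ length hs" .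
  qed (use K0n in \<open>auto intro!: mult_pos_pos\<close>)
qed

end

section \<open>Weyl differencing\<close>

definition unit_exp :: "real \<Rightarrow> complex" where
  "unit_exp t = cis (2 * pi * t)"

lemma unit_exp_add: "unit_exp (s + t) = unit_exp s * unit_exp t"
  by (simp add: unit_exp_def cis_mult algebra_simps)

lemma unit_exp_0 [simp]: "unit_exp 0 = 1"
  by (simp add: unit_exp_def)

lemma norm_unit_exp [simp]: "norm (unit_exp t) = 1"
  by (simp add: unit_exp_def)

lemma unit_exp_sum: "unit_exp (\<Sum>i\<in>A. t i) = (\<Prod>i\<in>A. unit_exp (t i))"
  by (induction A rule: infinite_finite_induct) (auto simp: unit_exp_add)

lemma unit_exp_cnj: "cnj (unit_exp t) = unit_exp (- t)"
  by (simp add: unit_exp_def cis_cnj)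

lemma unit_exp_of_int [simp]: "unit_exp (of_int k) = 1"
  by (simp add: unit_exp_def cis_multiple_2pi)

lemma unit_exp_minus_one_lower: "2 * dint t \<le> norm (unit_exp t - 1)"
proof -
  define s where "s = t - of_int (round t)"
  have "unit_exp t = unit_exp s * unit_exp (of_int (round t))"
    unfolding unit_exp_add[symmetric] by (simp add: s_def)
  then have ts: "unit_exp t = unit_exp s" by simp
  define x where "x = pi * s"
  have s: "\<bar>s\<bar> \<le> 1 / 2" using dint_le_half[of t] by (simp add: dint_def s_def)
  \<comment> \<open>The cubic Taylor bound gives
    \<open>\<bar>sin x\<bar> \<ge> \<bar>x\<bar> / 2\<close> for
    \<open>\<bar>x\<bar> \<le> 8 / 5\<close>, a range that contains \<open>pi / 2\<close>.\<close>
  have "\<bar>sin x - x\<bar> \<le> \<bar>x\<bar> ^ 3 / 6"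
    using Maclaurin_sin_bound[of x 3] by (simp add: lessThan_nat_numeral sin_coeff_def numeral_eq_Suc field_simps)
  then have 1: "\<bar>x\<bar> - \<bar>x\<bar> ^ 3 / 6 \<le> \<bar>sin x\<bar>" by linarith
  have "\<bar>x\<bar> = pi * \<bar>s\<bar>" by (simp add: x_def abs_mult)
  also have "\<dots> \<le> 16 / 5 * (1 / 2)" using s pi_less_4 pi_approx by (intro mult_mono) auto
  finally have "\<bar>x\<bar> \<le> 8 / 5" by simp
  then have "\<bar>x\<bar> ^ 2 \<le> (64 / 25)" using power_mono[of "\<bar>x\<bar>" "8 / 5" 2] by (simp add: power2_eq_square)
  then have "\<bar>x\<bar> * \<bar>x\<bar> ^ 2 \<le> \<bar>x\<bar> * (64 / 25)" by (rule mult_left_mono) simp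
  then have "\<bar>x\<bar> ^ 3 \<le> \<bar>x\<bar> * (64 / 25)" by (simp add: power3_eq_cube power2_eq_square)
  then have "\<bar>x\<bar> / 2 \<le> \<bar>sin x\<bar>" using 1 by linarith
  moreover have "2 * \<bar>s\<bar> \<le> \<bar>x\<bar>"
    unfolding x_def abs_mult using pi_ge_two by (intro mult_right_mono) auto
  ultimately have 2: "\<bar>s\<bar> \<le> \<bar>sin x\<bar>" by linarith
  have "norm (unit_exp s - 1) ^ 2 = (cos (2 * x) - 1) ^ 2 + (sin (2 * x)) ^ 2"
    by (simp add: unit_exp_def x_def cmod_power2 mult.assoc)
  also have "\<dots> = 2 - 2 * cos (2 * x)"
    using sin_cos_squared_add[of "2 * x"] by (simp add: power2_eq_square algebra_simps)
  also have "\<dots> = (2 * sin x) ^ 2"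
    unfolding cos_double_sin by (simp add: power2_eq_square)
  finally have "norm (unit_exp s - 1) = \<bar>2 * sin x\<bar>"
    by (metis norm_ge_zero real_sqrt_abs real_sqrt_pow2_iff real_sqrt_unique)
  then show ?thesis using 2 ts by (simp add: dint_def s_def abs_mult)
qed

text \<open>A single weight in place of the minimum of \<open>N\<close> and
  \<open>1 / dint \<beta>\<close>, comparable to it up to a constant; the cell argument below sums
  it without distinguishing cases.\<close>

lemma geometric_unit_exp_bound:
  fixes l u :: int
  assumes "u - l < int N" "0 < N"
  shows "norm (\<Sum>t\<in>{l..u}. unit_exp (\<beta> * of_int t)) \<le> 2 * real N / (1 + real N * dint \<beta>)"
proof -
  let ?S = "\<Sum>t\<in>{l..u}. unit_exp (\<beta> * of_int t)"
  have "norm ?S \<le> (\<Sum>t\<in>{l..u}. norm (unit_exp (\<beta> * of_int t)))" by (rule norm_sum)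
  also have "\<dots> = real (card {l..u})" by simp
  also have "\<dots> \<le> real N" using assms by simp
  finally have 1: "norm ?S \<le> real N" .
  show ?thesis
  proof (cases "real N * dint \<beta> \<le> 1")
    case True
    then have "real N * (1 + real N * dint \<beta>) \<le> real N * 2" by (intro mult_left_mono) auto
    moreover have "0 < 1 + real N * dint \<beta>" using dint_nonneg[of \<beta>] by (simp add: add_pos_nonneg)
    ultimately have "real N \<le> 2 * real N / (1 + real N * dint \<beta>)"
      by (simp only: pos_le_divide_eq mult.commute[of 2])
    then show ?thesis using 1 by linarith
  next
    case False
    then have d: "0 < dint \<beta>" using dint_nonneg[of \<beta>] by (cases "dint \<beta> = 0") auto
    have tel: "(\<Sum>t\<in>{l..u}. g (t + 1) - g t) = g (u + 1) - g l" if "l \<le> u" for g :: "int \<Rightarrow> complex" and u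
      using that
    proof (induction u rule: int_ge_induct)
      case (step i)
      have "{l..i + 1} = insert (i + 1) {l..i}" using step by auto
      then show ?case using step by simp
    qed simp
    have "norm ((unit_exp \<beta> - 1) * ?S) \<le> 2"
    proof (cases "l \<le> u")
      case True
      have "(unit_exp \<beta> - 1) * ?S = (\<Sum>t\<in>{l..u}. unit_exp (\<beta> * of_int (t + 1)) - unit_exp (\<beta> * of_int t))"
        by (simp add: sum_distrib_left left_diff_distrib unit_exp_add[symmetric] algebra_simps)
      also have "\<dots> = unit_exp (\<beta> * of_int (u + 1)) - unit_exp (\<beta> * of_int l)" by (rule tel[OF True])
      finally show ?thesis
        using norm_triangle_ineq4[of "unit_exp (\<beta> * of_int (u + 1))" "unit_exp (\<beta> * of_int l)"] by simp
    qed simp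
    then have "2 * dint \<beta> * norm ?S \<le> 2"
      using mult_right_mono[OF unit_exp_minus_one_lower[of \<beta>], of "norm ?S"] by (simp add: norm_mult)
    then have "norm ?S \<le> 1 / dint \<beta>" using d by (simp add: field_simps)
    also have "\<dots> \<le> 2 * real N / (1 + real N * dint \<beta>)"
      using False d by (simp add: field_simps add_pos_nonneg)
    finally show ?thesis .
  qed
qed

text \<open>Each side holds at most \<open>N\<close> integers, the location is free and empty boxes
  are allowed. This makes the class stable under intersection with translates, which Weyl
  differencing produces.\<close>

definition boxes :: "nat \<Rightarrow> (int ^ 'n::finite) set set" where
  "boxes N = {X. \<exists>l u. X = {x. \<forall>i. x $ i \<in> {l i..u i}} \<and> (\<forall>i. u i - l i < int N)}"

lemma finite_boxes: "X \<in> boxes N \<Longrightarrow> finite X"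
  using card_vec_box[of "\<lambda>i. {l i..u i}" for l u :: "_ \<Rightarrow> int"] by (auto simp: boxes_def)

lemma card_boxes:
  fixes X :: "(int ^ 'n::finite) set"
  assumes "X \<in> boxes N"
  shows "card X \<le> N ^ CARD('n)"
proof -
  obtain l u where X: "X = {x. \<forall>i. x $ i \<in> {l i..u i}}" "\<And>i. u i - l i < int N"
    using assms by (auto simp: boxes_def)
  have "card X = (\<Prod>i\<in>UNIV. card {l i..u i})"
    unfolding X(1) using card_vec_box[of "\<lambda>i. {l i..u i}"] by simp
  also have "\<dots> \<le> (\<Prod>i\<in>(UNIV :: 'n set). N)"
  proof (rule prod_mono)
    fix i show "0 \<le> card {l i..u i} \<and> card {l i..u i} \<le> N" using X(2)[of i] by simp
  qed
  finally show ?thesis by simp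
qed

lemma boxes_translate_Int:
  assumes "X \<in> boxes N"
  shows "{x \<in> X. x + h \<in> X} \<in> boxes N"
proof -
  obtain l u where X: "X = {x. \<forall>i. x $ i \<in> {l i..u i}}" "\<And>i. u i - l i < int N"
    using assms by (auto simp: boxes_def)
  have "{x \<in> X. x + h \<in> X} = {x. \<forall>i. x $ i \<in> {max (l i) (l i - h $ i)..min (u i) (u i - h $ i)}}"
    unfolding X(1) by (force simp: algebra_simps)
  moreover have "min (u i) (u i - h $ i) - max (l i) (l i - h $ i) < int N" for i
    using X(2)[of i] by linarith
  ultimately show ?thesis
    unfolding boxes_def
    by (intro CollectI exI[of _ "\<lambda>i. max (l i) (l i - h $ i)"] exI[of _ "\<lambda>i. min (u i) (u i - h $ i)"] conjI allI)
qed

definition expsum :: "real \<Rightarrow> ('v \<Rightarrow> int) \<Rightarrow> 'v set \<Rightarrow> complex" where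
  "expsum \<alpha> u X = (\<Sum>x\<in>X. unit_exp (\<alpha> * of_int (u x)))"

text \<open>The pairs of points are sorted by their difference \<open>h\<close>; for fixed
  \<open>h\<close> the starting points fill a box again.\<close>

lemma expsum_square_le:
  fixes u :: "int ^ 'n::finite \<Rightarrow> int"
  assumes X: "X \<in> boxes N"
  shows "norm (expsum \<alpha> u X) ^ 2 \<le> (\<Sum>h\<in>int_box N. norm (expsum \<alpha> (fdiff h u) {x \<in> X. x + h \<in> X}))"
proof -
  have fin: "finite X" by (rule finite_boxes[OF X])
  obtain l r where lr: "X = {x. \<forall>i. x $ i \<in> {l i..r i}}" "\<And>i. r i - l i < int N"
    using X by (auto simp: boxes_def)
  have diff: "y - x \<in> int_box N" if "x \<in> X" "y \<in> X" for x y
    unfolding int_box_def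
  proof (intro CollectI allI)
    fix i
    have "l i \<le> x $ i" "x $ i \<le> r i" "l i \<le> y $ i" "y $ i \<le> r i" using that by (auto simp: lr)
    then show "\<bar>(y - x) $ i\<bar> \<le> int N" using lr(2)[of i] by simp
  qed
  let ?g = "\<lambda>x y. unit_exp (\<alpha> * of_int (u y - u x))"
  have "of_real (norm (expsum \<alpha> u X) ^ 2) = expsum \<alpha> u X * cnj (expsum \<alpha> u X)"
    by (rule complex_norm_square)
  also have "\<dots> = (\<Sum>y\<in>X. \<Sum>x\<in>X. ?g x y)"
    by (simp add: expsum_def sum_product unit_exp_cnj unit_exp_add[symmetric] algebra_simps)
  also have "\<dots> = (\<Sum>x\<in>X. \<Sum>y\<in>X. ?g x y)" by (rule sum.swap)
  also have "\<dots> = (\<Sum>x\<in>X. \<Sum>h\<in>{h\<in>int_box N. x + h \<in> X}. ?g x (x + h))"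
  proof (rule sum.cong[OF refl])
    fix x assume "x \<in> X"
    then show "(\<Sum>y\<in>X. ?g x y) = (\<Sum>h\<in>{h\<in>int_box N. x + h \<in> X}. ?g x (x + h))"
      using diff by (intro sum.reindex_bij_witness[of _ "\<lambda>h. x + h" "\<lambda>y. y - x"]) auto
  qed
  also have "\<dots> = (\<Sum>h\<in>int_box N. \<Sum>x\<in>{x\<in>X. x + h \<in> X}. ?g x (x + h))"
    using sum.swap_restrict[OF fin finite_int_box[of N], of "\<lambda>x h. ?g x (x + h)" "\<lambda>x h. x + h \<in> X"] by simp
  also have "\<dots> = (\<Sum>h\<in>int_box N. expsum \<alpha> (fdiff h u) {x \<in> X. x + h \<in> X})"
    by (simp add: expsum_def fdiff_def)
  finally have "complex_of_real (norm (expsum \<alpha> u X) ^ 2) =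
      (\<Sum>h\<in>int_box N. expsum \<alpha> (fdiff h u) {x \<in> X. x + h \<in> X})" .
  then have "norm (complex_of_real (norm (expsum \<alpha> u X) ^ 2)) =
      norm (\<Sum>h\<in>int_box N. expsum \<alpha> (fdiff h u) {x \<in> X. x + h \<in> X})" by (rule arg_cong)
  also have "\<dots> \<le> (\<Sum>h\<in>int_box N. norm (expsum \<alpha> (fdiff h u) {x \<in> X. x + h \<in> X}))"
    by (rule norm_sum)
  finally show ?thesis by (simp add: norm_power)
qed

lemma vec_lists_Suc: "vec_lists (Suc k) N = (\<lambda>(h, hs). h # hs) ` (int_box N \<times> vec_lists k N)"
  by (force simp: vec_lists_def length_Suc_conv image_iff)

lemma sum_vec_lists_Suc:
  "(\<Sum>hs\<in>vec_lists (Suc k) N. F hs) = (\<Sum>h\<in>int_box N. \<Sum>hs\<in>vec_lists k N. F (h # hs))"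
  unfolding vec_lists_Suc
  by (subst sum.reindex) (auto simp: inj_on_def sum.cartesian_product case_prod_unfold)

lemma sum_square_le_card:
  fixes f :: "'a \<Rightarrow> real"
  shows "(\<Sum>x\<in>A. f x) ^ 2 \<le> real (card A) * (\<Sum>x\<in>A. f x ^ 2)"
  using Cauchy_Schwarz_ineq_sum[of f "\<lambda>_. 1" A] by (simp add: mult.commute)

text \<open>Squaring and Cauchy-Schwarz over the lists of \<open>k\<close> differences. The exponent
  of the trivial factor comes from \<open>2 * (2 ^ k - k - 1) + k = 2 ^ Suc k - Suc k - 1\<close>.
  The domains \<open>Y hs\<close> stay unspecified, as only their membership in
  \<open>boxes N\<close> matters.\<close>

lemma weyl_differencing:
  fixes u :: "int ^ 'n::finite \<Rightarrow> int"
  assumes X: "X \<in> boxes N"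
  shows "\<exists>Y. (\<forall>hs. Y hs \<in> boxes N) \<and> norm (expsum \<alpha> u X) ^ (2 ^ k) \<le>
     real ((2 * N + 1) ^ CARD('n)) ^ (2 ^ k - k - 1) * (\<Sum>hs\<in>vec_lists k N. norm (expsum \<alpha> (fdiffs hs u) (Y hs)))"
proof (induction k)
  case 0
  have "(vec_lists 0 N :: (int ^ 'n) list set) = {[]}" by (auto simp: vec_lists_def)
  then show ?case using X by (intro exI[of _ "\<lambda>_. X"]) simp
next
  case (Suc k)
  let ?H = "real ((2 * N + 1) ^ CARD('n))"
  obtain Y where Y: "\<And>hs. Y hs \<in> boxes N" and IH: "norm (expsum \<alpha> u X) ^ (2 ^ k) \<le>
     ?H ^ (2 ^ k - k - 1) * (\<Sum>hs\<in>vec_lists k N. norm (expsum \<alpha> (fdiffs hs u) (Y hs)))" using Suc by blast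
  \<comment> \<open>The new difference is put at the head of the list, so its domain is cut out of
    the domain of the tail.\<close>
  define Y' where "Y' hs = {x \<in> Y (tl hs). x + hd hs \<in> Y (tl hs)}" for hs
  have k: "k + 1 \<le> 2 ^ k" by (induction k) auto
  have "norm (expsum \<alpha> u X) ^ (2 ^ Suc k) = (norm (expsum \<alpha> u X) ^ (2 ^ k)) ^ 2"
    by (simp add: power_mult[symmetric] mult.commute)
  also have "\<dots> \<le> (?H ^ (2 ^ k - k - 1) * (\<Sum>hs\<in>vec_lists k N. norm (expsum \<alpha> (fdiffs hs u) (Y hs)))) ^ 2"
    using IH by (intro power_mono) auto
  also have "\<dots> = ?H ^ (2 * (2 ^ k - k - 1)) * (\<Sum>hs\<in>vec_lists k N. norm (expsum \<alpha> (fdiffs hs u) (Y hs))) ^ 2"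
    by (simp only: power_mult_distrib power_even_eq)
  also have "\<dots> \<le> ?H ^ (2 * (2 ^ k - k - 1)) * (?H ^ k * (\<Sum>hs\<in>vec_lists k N. norm (expsum \<alpha> (fdiffs hs u) (Y hs)) ^ 2))"
    using sum_square_le_card[of "\<lambda>hs. norm (expsum \<alpha> (fdiffs hs u) (Y hs))" "vec_lists k N"]
    by (intro mult_left_mono) (auto simp: card_vec_lists power_mult)
  also have "\<dots> \<le> ?H ^ (2 * (2 ^ k - k - 1)) * (?H ^ k * (\<Sum>hs\<in>vec_lists k N.
      \<Sum>h\<in>int_box N. norm (expsum \<alpha> (fdiff h (fdiffs hs u)) {x \<in> Y hs. x + h \<in> Y hs})))"
    by (intro mult_left_mono sum_mono expsum_square_le Y) auto
  also have "\<dots> = ?H ^ (2 * (2 ^ k - k - 1) + k) * (\<Sum>hs\<in>vec_lists k N.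
      \<Sum>h\<in>int_box N. norm (expsum \<alpha> (fdiffs (h # hs) u) (Y' (h # hs))))"
    by (simp add: power_add Y'_def fdiffs_fdiff mult.assoc)
  also have "2 * (2 ^ k - k - 1) + k = 2 ^ Suc k - Suc k - 1" using k by simp
  also have "(\<Sum>hs\<in>vec_lists k N. \<Sum>h\<in>int_box N. norm (expsum \<alpha> (fdiffs (h # hs) u) (Y' (h # hs)))) =
      (\<Sum>hs\<in>vec_lists (Suc k) N. norm (expsum \<alpha> (fdiffs hs u) (Y' hs)))"
    unfolding sum_vec_lists_Suc by (rule sum.swap)
  finally have "norm (expsum \<alpha> u X) ^ (2 ^ Suc k) \<le> ?H ^ (2 ^ Suc k - Suc k - 1) *
      (\<Sum>hs\<in>vec_lists (Suc k) N. norm (expsum \<alpha> (fdiffs hs u) (Y' hs)))" .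
  moreover have "Y' hs \<in> boxes N" for hs
    unfolding Y'_def by (rule boxes_translate_Int[OF Y])
  ultimately show ?case by blast
qed

lemma expsum_linear_prod:
  fixes b :: "'n::finite \<Rightarrow> int"
  assumes u: "\<And>x. u x = c + (\<Sum>i\<in>UNIV. x $ i * b i)"
  shows "expsum \<alpha> u {x. \<forall>i. x $ i \<in> {l i..r i}} =
    unit_exp (\<alpha> * of_int c) * (\<Prod>i\<in>UNIV. \<Sum>t\<in>{l i..r i}. unit_exp (\<alpha> * b i * of_int t))"
proof -
  let ?X = "{x :: int ^ 'n. \<forall>i. x $ i \<in> {l i..r i}}"
  have bij: "bij_betw vec_lambda (PiE UNIV (\<lambda>i. {l i..r i})) ?X"
    by (rule bij_betwI[where g = vec_nth]) (auto simp: vec_lambda_beta vec_nth_inverse PiE_UNIV_domain)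
  have "expsum \<alpha> u ?X = (\<Sum>x\<in>?X. unit_exp (\<alpha> * of_int c) * (\<Prod>i\<in>UNIV. unit_exp (\<alpha> * b i * of_int (x $ i))))"
    unfolding expsum_def u
    by (simp add: unit_exp_add unit_exp_sum[symmetric] sum_distrib_left algebra_simps)
  also have "\<dots> = unit_exp (\<alpha> * of_int c) * (\<Sum>g\<in>PiE UNIV (\<lambda>i. {l i..r i}). \<Prod>i\<in>UNIV. unit_exp (\<alpha> * b i * of_int (g i)))"
    unfolding sum_distrib_left[symmetric] sum.reindex_bij_betw[OF bij, symmetric] by simp
  also have "(\<Sum>g\<in>PiE UNIV (\<lambda>i. {l i..r i}). \<Prod>i\<in>UNIV. unit_exp (\<alpha> * b i * of_int (g i))) =
      (\<Prod>i\<in>UNIV. \<Sum>t\<in>{l i..r i}. unit_exp (\<alpha> * b i * of_int t))"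
    by (rule prod_sum_PiE[symmetric]) auto
  finally show ?thesis .
qed

lemma expsum_linear_bound:
  fixes b :: "'n::finite \<Rightarrow> int"
  assumes X: "X \<in> boxes N" and N: "0 < N" and u: "\<And>x. u x = c + (\<Sum>i\<in>UNIV. x $ i * b i)"
  shows "norm (expsum \<alpha> u X) \<le> (\<Prod>i\<in>UNIV. 2 * real N / (1 + real N * dint (\<alpha> * b i)))"
proof -
  obtain l r where lr: "X = {x. \<forall>i. x $ i \<in> {l i..r i}}" "\<And>i. r i - l i < int N"
    using X by (auto simp: boxes_def)
  have "norm (expsum \<alpha> u X) = (\<Prod>i\<in>UNIV. norm (\<Sum>t\<in>{l i..r i}. unit_exp (\<alpha> * b i * of_int t)))"
    unfolding lr(1) expsum_linear_prod[of u, OF u] by (simp add: norm_mult prod_norm)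
  also have "\<dots> \<le> (\<Prod>i\<in>UNIV. 2 * real N / (1 + real N * dint (\<alpha> * b i)))"
    by (intro prod_mono conjI geometric_unit_exp_bound lr(2) N) simp
  finally show ?thesis .
qed

section \<open>From exponential sums to counting near-integral values\<close>

lemma harm_le_ln: "1 \<le> K \<Longrightarrow> harm K \<le> 1 + ln (real K)"
proof (induction K rule: nat_induct_at_least)
  case base
  then show ?case by (simp add: harm_def)
next
  case (Suc K)
  have "ln (real K / real (Suc K)) \<le> real K / real (Suc K) - 1"
    using Suc by (intro ln_le_minus_one) auto
  then have "inverse (real (Suc K)) \<le> ln (real (Suc K)) - ln (real K)"
    using Suc by (simp add: ln_div field_simps)
  then show ?case using Suc.IH unfolding harm_Suc by linarith
qed

lemma harmonic_sum_bound:
  assumes "0 < \<epsilon>"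
  shows "\<exists>C>0. \<forall>K\<ge>1. (\<Sum>c\<in>{-int K..int K}. 1 / (1 + real_of_int \<bar>c\<bar>)) \<le> C * real K powr \<epsilon>"
proof -
  have "\<exists>C>0. \<forall>K\<ge>1. harm K \<le> C * real K powr \<epsilon>"
  proof (intro exI[of _ "1 + 1 / \<epsilon>"] conjI allI impI)
    fix K :: nat assume K: "1 \<le> K"
    have 1: "harm K \<le> 1 + ln (real K)" using K by (rule harm_le_ln)
    have "\<epsilon> * ln (real K) = ln (real K powr \<epsilon>)" using K by (simp add: ln_powr)
    also have "\<dots> \<le> real K powr \<epsilon>" using K ln_le_minus_one[of "real K powr \<epsilon>"] by simp
    finally have 2: "ln (real K) \<le> 1 / \<epsilon> * real K powr \<epsilon>" using assms by (simp add: field_simps)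
    have "1 \<le> real K powr \<epsilon>" using K assms by (simp add: ge_one_powr_ge_zero)
    then show "harm K \<le> (1 + 1 / \<epsilon>) * real K powr \<epsilon>" using 1 2 by (simp add: distrib_right)
  qed (use assms in \<open>auto intro: add_pos_pos\<close>)
  then obtain C where C: "0 < C" "\<And>K. 1 \<le> K \<Longrightarrow> harm K \<le> C * real K powr \<epsilon>" by blast
  show ?thesis
  proof (intro exI[of _ "1 + 2 * C"] conjI allI impI)
    fix K :: nat assume K: "1 \<le> K"
    define A where "A = (\<lambda>k. int k) ` {1..K}"
    define B where "B = (\<lambda>k. - int k) ` {1..K}"
    have "{-int K..int K} = insert 0 (A \<union> B)"
    proof (intro set_eqI iffI)
      fix c assume "c \<in> {-int K..int K}"
      then show "c \<in> insert 0 (A \<union> B)"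
        unfolding A_def B_def by (cases "c \<ge> 0") (auto simp: image_iff intro!: bexI[of _ "nat \<bar>c\<bar>"])
    qed (auto simp: A_def B_def)
    moreover have "A \<inter> B = {}" "0 \<notin> A" "0 \<notin> B" "finite A" "finite B" by (auto simp: A_def B_def)
    ultimately have "(\<Sum>c\<in>{-int K..int K}. 1 / (1 + real_of_int \<bar>c\<bar>)) = 1 +
       ((\<Sum>c\<in>A. 1 / (1 + real_of_int \<bar>c\<bar>)) + (\<Sum>c\<in>B. 1 / (1 + real_of_int \<bar>c\<bar>)))"
      by (simp add: sum.union_disjoint)
    also have "\<dots> = 1 + 2 * (\<Sum>k\<in>{1..K}. 1 / (1 + real k))"
      unfolding A_def B_def by (subst (1 2) sum.reindex) (auto simp: inj_on_def)
    also have "\<dots> \<le> 1 + 2 * harm K"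
      unfolding harm_def by (intro add_mono mult_left_mono sum_mono) (auto simp: field_simps)
    also have "\<dots> \<le> real K powr \<epsilon> + 2 * (C * real K powr \<epsilon>)"
      using C(2)[OF K] K assms by (intro add_mono mult_left_mono ge_one_powr_ge_zero) auto
    finally show "(\<Sum>c\<in>{-int K..int K}. 1 / (1 + real_of_int \<bar>c\<bar>)) \<le> (1 + 2 * C) * real K powr \<epsilon>"
      by (simp add: distrib_right)
  qed (use C in simp)
qed

text \<open>The range of each fractional part is cut into cells of width \<open>\<kappa> / N\<close>. Within a cell the
  weight is essentially constant, and differences of two solutions lie in the set on the right.\<close>
lemma weight_sum_le_count:
  fixes L :: "int ^ 'n::finite \<Rightarrow> 'n \<Rightarrow> real" and \<kappa> :: real
  assumes N: "1 \<le> N" and \<kappa>: "0 < \<kappa>" "\<kappa> \<le> 1 / 4"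
    and K: "real N \<le> \<kappa> * real K"
    and diff: "\<And>u v i. L (u - v) i = L u i - L v i"
  shows "(\<Sum>u\<in>int_box N. \<Prod>i\<in>UNIV. 2 * real N / (1 + real N * dint (L u i))) \<le>
    real (card {u \<in> rbox (2 * real N). \<forall>i. dint (L u i) \<le> \<kappa> / real N}) *
    (2 * real N / \<kappa> * (\<Sum>c\<in>{-int K..int K}. 1 / (1 + real_of_int \<bar>c\<bar>))) ^ CARD('n)"
proof -
  define S where "S = {u \<in> rbox (2 * real N). \<forall>i. dint (L u i) \<le> \<kappa> / real N}"
  have finS: "finite S" by (simp add: S_def)
  define r where "r u i = L u i - of_int (round (L u i))" for u i
  have r_half: "\<bar>r u i\<bar> \<le> 1 / 2" for u i using dint_le_half[of "L u i"] by (simp add: r_def dint_def)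
  define cell where "cell u = (\<lambda>i. \<lfloor>r u i * real N / \<kappa>\<rfloor>)" for u
  define w where "w c = 2 * real N / \<kappa> * (1 / (1 + real_of_int \<bar>c\<bar>))" for c :: int
  have w0: "0 \<le> w c" for c using \<kappa> by (simp add: w_def)
  have K1: "real N / (2 * \<kappa>) + 1 \<le> real K"
  proof -
    have "real N / \<kappa> \<le> real K" using K \<kappa> by (simp add: field_simps)
    moreover have "1 \<le> real N / (2 * \<kappa>)" using N \<kappa> by (simp add: field_simps)
    moreover have "real N / \<kappa> = real N / (2 * \<kappa>) + real N / (2 * \<kappa>)" using \<kappa> by (simp add: field_simps)
    ultimately show ?thesis by linarith
  qed
  have cellK: "cell u \<in> PiE UNIV (\<lambda>_. {-int K..int K})" for u
  proof (intro PiE_I)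
    fix i
    have "\<bar>r u i * real N / \<kappa>\<bar> = \<bar>r u i\<bar> * (real N / \<kappa>)" using \<kappa> by (simp add: abs_mult)
    also have "\<dots> \<le> 1 / 2 * (real N / \<kappa>)" using r_half \<kappa> by (intro mult_right_mono) auto
    finally have "\<bar>r u i * real N / \<kappa>\<bar> \<le> real N / (2 * \<kappa>)" by simp
    then have "- real K \<le> r u i * real N / \<kappa>" "r u i * real N / \<kappa> \<le> real K" using K1 by linarith+
    then show "cell u i \<in> {-int K..int K}" unfolding cell_def by (auto simp: le_floor_iff floor_le_iff)
  qed auto
  \<comment> \<open>In cell \<open>c\<close> the distance is at least
    \<open>\<kappa> * (\<bar>c\<bar> - 1) / N\<close>, and \<open>\<kappa> \<le> 1 / 4\<close> lets
    the 1 in the denominator absorb the missing \<open>2 * \<kappa>\<close>.\<close>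
  have weight: "2 * real N / (1 + real N * dint (L u i)) \<le> w (cell u i)" for u i
  proof -
    define c where "c = cell u i"
    have c: "of_int c \<le> r u i * real N / \<kappa>" "r u i * real N / \<kappa> < of_int c + 1"
      by (auto simp: c_def cell_def)
    have "real_of_int \<bar>c\<bar> - 1 \<le> \<bar>r u i * real N / \<kappa>\<bar>" using c by linarith
    also have "\<dots> = real N * dint (L u i) / \<kappa>" using \<kappa> by (simp add: dint_def r_def abs_mult)
    finally have "(real_of_int \<bar>c\<bar> - 1) * \<kappa> \<le> real N * dint (L u i)" using \<kappa> by (simp add: field_simps)
    then have "\<kappa> * (1 + real_of_int \<bar>c\<bar>) \<le> 1 + real N * dint (L u i)" using \<kappa> by (simp add: algebra_simps)
    then have "2 * real N / (1 + real N * dint (L u i)) \<le> 2 * real N / (\<kappa> * (1 + real_of_int \<bar>c\<bar>))"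
      using \<kappa> dint_nonneg[of "L u i"] by (intro divide_left_mono mult_pos_pos) (auto simp: add_pos_nonneg)
    then show ?thesis by (simp add: w_def c_def)
  qed
  have fibre: "card {u\<in>int_box N. cell u = k} \<le> card S" for k
  proof (cases "{u\<in>int_box N. cell u = k} = {}")
    case True
    show ?thesis unfolding True by simp
  next
    case False
    then obtain u0 where u0: "u0 \<in> int_box N" "cell u0 = k" by blast
    have "(\<lambda>u. u - u0) ` {u\<in>int_box N. cell u = k} \<subseteq> S"
    proof (intro image_subsetI)
      fix u assume "u \<in> {u\<in>int_box N. cell u = k}"
      then have u: "u \<in> int_box N" "cell u = cell u0" using u0 by auto
      have "real_of_int \<bar>(u - u0) $ i\<bar> \<le> 2 * real N" for i
      proof -
        have "\<bar>u $ i\<bar> \<le> int N" "\<bar>u0 $ i\<bar> \<le> int N" using u u0 by (auto simp: int_box_def)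
        then have "\<bar>(u - u0) $ i\<bar> \<le> 2 * int N" by simp
        then show ?thesis by linarith
      qed
      moreover have "dint (L (u - u0) i) \<le> \<kappa> / real N" for i
      proof -
        have "\<lfloor>r u i * real N / \<kappa>\<rfloor> = \<lfloor>r u0 i * real N / \<kappa>\<rfloor>"
          using fun_cong[OF u(2), of i] by (simp add: cell_def)
        then have "\<bar>r u i * real N / \<kappa> - r u0 i * real N / \<kappa>\<bar> \<le> 1" by linarith
        moreover have "r u i * real N / \<kappa> - r u0 i * real N / \<kappa> = (r u i - r u0 i) / (\<kappa> / real N)"
          by (simp add: diff_divide_distrib left_diff_distrib)
        ultimately have "\<bar>r u i - r u0 i\<bar> \<le> \<kappa> / real N"
          using \<kappa> N by (simp add: abs_divide abs_mult divide_le_eq pos_le_divide_eq)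
        moreover have "r u i - r u0 i = L (u - u0) i - of_int (round (L u i) - round (L u0 i))"
          by (simp add: r_def diff)
        ultimately show ?thesis using dint_le[of "L (u - u0) i" "round (L u i) - round (L u0 i)"] by simp
      qed
      ultimately show "u - u0 \<in> S" by (simp add: S_def rbox_def)
    qed
    moreover have "inj_on (\<lambda>u. u - u0) {u\<in>int_box N. cell u = k}" by (auto simp: inj_on_def)
    ultimately show ?thesis using finS card_inj_on_le by blast
  qed
  have "(\<Sum>u\<in>int_box N. \<Prod>i\<in>UNIV. 2 * real N / (1 + real N * dint (L u i))) \<le>
      (\<Sum>u\<in>int_box N. \<Prod>i\<in>UNIV. w (cell u i))"
    using dint_nonneg by (intro sum_mono prod_mono conjI weight divide_nonneg_nonneg) (auto intro!: add_nonneg_nonneg mult_nonneg_nonneg)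
  also have "\<dots> = (\<Sum>k\<in>PiE UNIV (\<lambda>_. {-int K..int K}). \<Sum>u\<in>{u\<in>int_box N. cell u = k}. \<Prod>i\<in>UNIV. w (cell u i))"
    using cellK by (intro sum.group[symmetric]) (auto intro!: finite_PiE)
  also have "\<dots> = (\<Sum>k\<in>PiE UNIV (\<lambda>_. {-int K..int K}). real (card {u\<in>int_box N. cell u = k}) * (\<Prod>i\<in>UNIV. w (k i)))"
    by (intro sum.cong refl) simp
  also have "\<dots> \<le> (\<Sum>k\<in>PiE UNIV (\<lambda>_. {-int K..int K}). real (card S) * (\<Prod>i\<in>(UNIV :: 'n set). w (k i)))"
    using fibre w0 by (intro sum_mono mult_right_mono prod_nonneg) auto
  also have "\<dots> = real (card S) * (\<Prod>i\<in>(UNIV :: 'n set). \<Sum>c\<in>{-int K..int K}. w c)"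
    unfolding sum_distrib_left[symmetric] by (subst prod_sum_PiE) auto
  also have "\<dots> = real (card S) * (2 * real N / \<kappa> * (\<Sum>c\<in>{-int K..int K}. 1 / (1 + real_of_int \<bar>c\<bar>))) ^ CARD('n)"
    by (simp only: w_def sum_distrib_left[symmetric] prod_constant)
  finally show ?thesis unfolding S_def .
qed

text \<open>The number of cells is a fixed multiple of \<open>N\<close>, so the harmonic sum costs
  only \<open>N powr \<epsilon>\<close> per coordinate.\<close>

lemma weight_sum_bound:
  fixes \<kappa> \<epsilon> :: real
  assumes \<kappa>: "0 < \<kappa>" "\<kappa> \<le> 1 / 4" and \<epsilon>: "0 < \<epsilon>"
  shows "\<exists>C>0. \<forall>N\<ge>1. \<forall>L :: int ^ 'n::finite \<Rightarrow> 'n \<Rightarrow> real. (\<forall>u v i. L (u - v) i = L u i - L v i) \<longrightarrow>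
    (\<Sum>u\<in>int_box N. \<Prod>i\<in>UNIV. 2 * real N / (1 + real N * dint (L u i))) \<le>
    real (card {u \<in> rbox (2 * real N). \<forall>i. dint (L u i) \<le> \<kappa> / real N}) * (C * real N powr (1 + \<epsilon>)) ^ CARD('n)"
proof -
  obtain C where C: "0 < C" "\<And>K. 1 \<le> K \<Longrightarrow> (\<Sum>c\<in>{-int K..int K}. 1 / (1 + real_of_int \<bar>c\<bar>)) \<le> C * real K powr \<epsilon>"
    using harmonic_sum_bound[OF \<epsilon>] by blast
  define k where "k = nat \<lceil>1 / \<kappa>\<rceil>"
  have k: "1 \<le> \<kappa> * real k"
  proof -
    have "1 / \<kappa> \<le> real k" unfolding k_def by (rule real_nat_ceiling_ge)
    then show ?thesis using \<kappa> by (simp add: field_simps)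
  qed
  then have k1: "1 \<le> k" by (cases k) auto
  define C' where "C' = 2 / \<kappa> * (C * real k powr \<epsilon>)"
  show ?thesis
  proof (intro exI[of _ C'] conjI allI impI)
    show "0 < C'" using C \<kappa> k1 by (auto simp: C'_def intro!: mult_pos_pos divide_pos_pos)
  next
    fix N :: nat and L :: "int ^ 'n \<Rightarrow> 'n \<Rightarrow> real"
    assume N: "1 \<le> N" and L: "\<forall>u v i. L (u - v) i = L u i - L v i"
    have K: "real N \<le> \<kappa> * real (k * N)" using mult_right_mono[OF k, of "real N"] by simp
    have "(\<Sum>c\<in>{-int (k * N)..int (k * N)}. 1 / (1 + real_of_int \<bar>c\<bar>)) \<le> C * real (k * N) powr \<epsilon>"
      using k1 N by (intro C) simp
    also have "\<dots> = C * real k powr \<epsilon> * real N powr \<epsilon>" by (simp add: powr_mult)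
    finally have "2 * real N / \<kappa> * (\<Sum>c\<in>{-int (k * N)..int (k * N)}. 1 / (1 + real_of_int \<bar>c\<bar>)) \<le>
        2 * real N / \<kappa> * (C * real k powr \<epsilon> * real N powr \<epsilon>)"
      using \<kappa> by (intro mult_left_mono) auto
    also have "\<dots> = C' * real N powr (1 + \<epsilon>)" using N by (simp add: C'_def powr_add)
    finally have 1: "2 * real N / \<kappa> * (\<Sum>c\<in>{-int (k * N)..int (k * N)}. 1 / (1 + real_of_int \<bar>c\<bar>)) \<le> C' * real N powr (1 + \<epsilon>)" .
    have "(\<Sum>u\<in>int_box N. \<Prod>i\<in>UNIV. 2 * real N / (1 + real N * dint (L u i))) \<le>
      real (card {u \<in> rbox (2 * real N). \<forall>i. dint (L u i) \<le> \<kappa> / real N}) *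
      (2 * real N / \<kappa> * (\<Sum>c\<in>{-int (k * N)..int (k * N)}. 1 / (1 + real_of_int \<bar>c\<bar>))) ^ CARD('n)"
      by (rule weight_sum_le_count[OF N \<kappa> K]) (use L in blast)
    also have "\<dots> \<le> real (card {u \<in> rbox (2 * real N). \<forall>i. dint (L u i) \<le> \<kappa> / real N}) * (C' * real N powr (1 + \<epsilon>)) ^ CARD('n)"
      using \<kappa> by (intro mult_left_mono power_mono 1 mult_nonneg_nonneg sum_nonneg divide_nonneg_nonneg) auto
    finally show "(\<Sum>u\<in>int_box N. \<Prod>i\<in>UNIV. 2 * real N / (1 + real N * dint (L u i))) \<le>
      real (card {u \<in> rbox (2 * real N). \<forall>i. dint (L u i) \<le> \<kappa> / real N}) * (C' * real N powr (1 + \<epsilon>)) ^ CARD('n)" .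
  qed
qed

text \<open>The weight sum runs over one difference vector with the other \<open>k\<close> fixed.
  Subtracting two vectors of the same cell doubles the radius of that one; the others are put into
  the doubled box as well, so that all vectors range over the same box.\<close>

lemma weyl_count_bound:
  fixes f :: "('n::finite) int_mpoly" and \<kappa> \<epsilon> :: real
  assumes hom: "homogeneous_of_degree d f" and d: "d = Suc (Suc k)"
    and \<kappa>: "0 < \<kappa>" "\<kappa> \<le> 1 / 4" and \<epsilon>: "0 < \<epsilon>"
  shows "\<exists>C>0. \<forall>N\<ge>1. \<forall>\<alpha>. \<forall>X\<in>boxes N.
    norm (expsum \<alpha> (mpoly_eval f) X) ^ (2 ^ Suc k) \<le>
      (3 * real N) ^ (CARD('n) * (2 ^ Suc k - Suc k - 1)) * (C * real N powr (1 + \<epsilon>)) ^ CARD('n) *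
      real (card (sym_multilinear.near_lists (polar f) \<alpha> (Suc k) (2 * real N) (\<kappa> / real N)))"
proof -
  interpret sym_multilinear d "polar f" by (rule polar_sym_multilinear[OF hom])
  obtain C where C: "0 < C" "\<forall>N\<ge>1. \<forall>L :: int ^ 'n \<Rightarrow> 'n \<Rightarrow> real. (\<forall>u v i. L (u - v) i = L u i - L v i) \<longrightarrow>
    (\<Sum>u\<in>int_box N. \<Prod>i\<in>(UNIV :: 'n set). 2 * real N / (1 + real N * dint (L u i))) \<le>
    real (card {u \<in> rbox (2 * real N). \<forall>i. dint (L u i) \<le> \<kappa> / real N}) * (C * real N powr (1 + \<epsilon>)) ^ CARD('n)"
    using weight_sum_bound[where 'n = 'n, OF \<kappa> \<epsilon>] by (elim exE conjE) (rule that)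
  show ?thesis
  proof (intro exI[of _ C] conjI allI impI ballI)
    show "0 < C" by (rule C)
  next
    fix N :: nat and \<alpha> :: real and X :: "(int ^ 'n) set"
    assume N: "1 \<le> N" and X: "X \<in> boxes N"
    let ?V = "\<lambda>hs. \<Prod>i\<in>UNIV. 2 * real N / (1 + real N * dint (\<alpha> * polar f (hs @ [axis i 1])))"
    let ?T = "\<lambda>hs. {u \<in> rbox (2 * real N). \<forall>i. dint (\<alpha> * polar f (u # hs @ [axis i 1])) \<le> \<kappa> / real N}"
    obtain Y where Y: "\<And>hs. Y hs \<in> boxes N" and W: "norm (expsum \<alpha> (mpoly_eval f) X) ^ (2 ^ Suc k) \<le>
      real ((2 * N + 1) ^ CARD('n)) ^ (2 ^ Suc k - Suc k - 1) *
      (\<Sum>hs\<in>vec_lists (Suc k) N. norm (expsum \<alpha> (fdiffs hs (mpoly_eval f)) (Y hs)))"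
      using weyl_differencing[OF X, of \<alpha> "mpoly_eval f" "Suc k"] by blast
    have lin: "norm (expsum \<alpha> (fdiffs hs (mpoly_eval f)) (Y hs)) \<le> ?V hs" if hs: "hs \<in> vec_lists (Suc k) N" for hs
    proof (rule expsum_linear_bound[OF Y])
      show "0 < N" using N by simp
      fix x
      have len: "length hs = Suc k" using hs by (simp add: vec_lists_def)
      have "polar f (x # hs) = (\<Sum>i\<in>UNIV. x $ i * polar f (axis i 1 # hs))"
        using len d by (intro M_expand) simp
      also have "\<dots> = (\<Sum>i\<in>UNIV. x $ i * polar f (hs @ [axis i 1]))"
        by (simp add: M_swap)
      finally show "fdiffs hs (mpoly_eval f) x =
          fdiffs hs (mpoly_eval f) 0 + (\<Sum>i\<in>UNIV. x $ i * polar f (hs @ [axis i 1]))"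
        using fdiffs_homogeneous_affine[OF hom, of hs x] len d by simp
    qed
    have "(\<Sum>hs\<in>vec_lists (Suc k) N. norm (expsum \<alpha> (fdiffs hs (mpoly_eval f)) (Y hs))) \<le>
        (\<Sum>hs\<in>vec_lists (Suc k) N. ?V hs)"
      by (intro sum_mono lin)
    also have "\<dots> = (\<Sum>hs\<in>vec_lists k N. \<Sum>u\<in>int_box N. ?V (u # hs))"
      unfolding sum_vec_lists_Suc by (rule sum.swap)
    also have "\<dots> \<le> (\<Sum>hs\<in>vec_lists k N. real (card (?T hs)) * (C * real N powr (1 + \<epsilon>)) ^ CARD('n))"
    proof (rule sum_mono)
      fix hs :: "(int ^ 'n) list" assume hs: "hs \<in> vec_lists k N"
      have "\<alpha> * polar f ((u - v) # hs @ [axis i 1]) =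
          \<alpha> * polar f (u # hs @ [axis i 1]) - \<alpha> * polar f (v # hs @ [axis i 1])" for u v i
        using M_diff[of "hs @ [axis i 1]" u v] hs d by (simp add: vec_lists_def right_diff_distrib)
      then show "(\<Sum>u\<in>int_box N. ?V (u # hs)) \<le> real (card (?T hs)) * (C * real N powr (1 + \<epsilon>)) ^ CARD('n)"
        using C(2)[rule_format, OF N, of "\<lambda>u i. \<alpha> * polar f (u # hs @ [axis i 1])"] by simp
    qed
    also have "\<dots> = (C * real N powr (1 + \<epsilon>)) ^ CARD('n) * (\<Sum>hs\<in>vec_lists k N. real (card (?T hs)))"
      by (simp add: sum_distrib_left mult.commute)
    also have "\<dots> \<le> (C * real N powr (1 + \<epsilon>)) ^ CARD('n) *
        real (card (near_lists \<alpha> (Suc k) (2 * real N) (\<kappa> / real N)))"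
    proof (rule mult_left_mono)
      have fin: "finite (near_lists \<alpha> (Suc k) (2 * real N) (\<kappa> / real N))"
        by (rule finite_subset[OF _ finite_lists_length_eq[OF finite_rbox[of "2 * real N"], of "Suc k"]])
           (auto simp: near_lists_def)
      have ib: "int_box N \<subseteq> (rbox (2 * real N) :: (int ^ 'n) set)"
        using rbox_mono[of "real N" "2 * real N"] rbox_eq_int_box[of "real N"] by auto
      have "(\<Sum>hs\<in>vec_lists k N. card (?T hs)) = card (Sigma (vec_lists k N) ?T)"
        by (subst card_SigmaI) auto
      also have "\<dots> = card ((\<lambda>(hs, u). u # hs) ` Sigma (vec_lists k N) ?T)"
        by (rule card_image[symmetric]) (auto simp: inj_on_def)
      also have "\<dots> \<le> card (near_lists \<alpha> (Suc k) (2 * real N) (\<kappa> / real N))"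
      proof (rule card_mono[OF fin], rule image_subsetI)
        fix p assume "p \<in> Sigma (vec_lists k N) ?T"
        then obtain hs u where p: "p = (hs, u)" "hs \<in> vec_lists k N" "u \<in> ?T hs" by auto
        then have "set (u # hs) \<subseteq> rbox (2 * real N)" using ib by (auto simp: vec_lists_def)
        then show "(case p of (hs, u) \<Rightarrow> u # hs) \<in> near_lists \<alpha> (Suc k) (2 * real N) (\<kappa> / real N)"
          using p by (auto simp: near_lists_def vec_lists_def)
      qed
      finally have "real (\<Sum>hs\<in>vec_lists k N. card (?T hs)) \<le>
          real (card (near_lists \<alpha> (Suc k) (2 * real N) (\<kappa> / real N)))" by (rule of_nat_mono)
      then show "(\<Sum>hs\<in>vec_lists k N. real (card (?T hs))) \<le>
          real (card (near_lists \<alpha> (Suc k) (2 * real N) (\<kappa> / real N)))" by (simp only: of_nat_sum)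
      show "0 \<le> (C * real N powr (1 + \<epsilon>)) ^ CARD('n)" using C by simp
    qed
    finally have 1: "(\<Sum>hs\<in>vec_lists (Suc k) N. norm (expsum \<alpha> (fdiffs hs (mpoly_eval f)) (Y hs))) \<le>
       (C * real N powr (1 + \<epsilon>)) ^ CARD('n) * real (card (near_lists \<alpha> (Suc k) (2 * real N) (\<kappa> / real N)))" .
    have "real ((2 * N + 1) ^ CARD('n)) \<le> (3 * real N) ^ CARD('n)"
      unfolding of_nat_power using N by (intro power_mono) auto
    then have "real ((2 * N + 1) ^ CARD('n)) ^ (2 ^ Suc k - Suc k - 1) \<le> (3 * real N) ^ (CARD('n) * (2 ^ Suc k - Suc k - 1))"
      unfolding power_mult by (rule power_mono) simp
    then have "norm (expsum \<alpha> (mpoly_eval f) X) ^ (2 ^ Suc k) \<le>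
      (3 * real N) ^ (CARD('n) * (2 ^ Suc k - Suc k - 1)) * ((C * real N powr (1 + \<epsilon>)) ^ CARD('n) *
       real (card (near_lists \<alpha> (Suc k) (2 * real N) (\<kappa> / real N))))"
      using order_trans[OF W mult_mono[OF _ 1]] by (simp add: sum_nonneg)
    then show "norm (expsum \<alpha> (mpoly_eval f) X) ^ (2 ^ Suc k) \<le>
      (3 * real N) ^ (CARD('n) * (2 ^ Suc k - Suc k - 1)) * (C * real N powr (1 + \<epsilon>)) ^ CARD('n) *
      real (card (near_lists \<alpha> (Suc k) (2 * real N) (\<kappa> / real N)))" by (simp only: mult.assoc)
  qed
qed

text \<open>A fraction \<open>a M / q\<close> closer than \<open>1 / q\<close> to an integer is an integer; for \<open>\<bar>M\<bar> < q\<close> this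
  forces \<open>M = 0\<close>.\<close>
lemma dint_rational_small:
  fixes a M :: int
  assumes "coprime a (int q)" "0 < q" "dint (of_int a / real q * of_int M) < 1 / real q" "\<bar>real_of_int M\<bar> < real q"
  shows "M = 0"
proof -
  define r where "r = round (of_int a / real q * of_int M)"
  have "\<bar>of_int a / real q * of_int M - of_int r\<bar> * real q < 1 / real q * real q"
    using assms(2,3) unfolding dint_def r_def by (intro mult_strict_right_mono) auto
  then have "\<bar>of_int a / real q * of_int M * real q - of_int r * real q\<bar> < 1"
    using assms(2) by (simp add: abs_mult_pos left_diff_distrib)
  then have "\<bar>real_of_int (a * M - r * int q)\<bar> < 1" using assms(2) by simp
  then have "a * M - r * int q = 0" by linarith
  then have "int q dvd a * M" by simp
  then have "int q dvd M" using assms(1) by (simp add: coprime_commute coprime_dvd_mult_right_iff)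
  then show ?thesis using assms(4) zdvd_imp_le[of "int q" "\<bar>M\<bar>"] by (cases "M = 0") auto
qed

text \<open>At radius \<open>R\<close> the near-integral lists are exact zeros of the polar system,
  of which there are \<open>O(R ^ (n * k))\<close>. Shrinking to that radius costs a constant times
  \<open>(N / R) ^ (n * (k + 1))\<close>, so compared with the trivial bound \<open>R ^ n\<close> is
  saved.\<close>

lemma weyl_bound:
  fixes f :: "('n::finite) int_mpoly" and Q0 \<epsilon> :: real
  assumes hom: "homogeneous_of_degree d f" and smooth: "smooth_form f" and d: "d = Suc (Suc k)"
    and n: "2 ^ d * (d - 1) < CARD('n)" and Q0: "0 < Q0" and \<epsilon>: "0 < \<epsilon>"
  shows "\<exists>C>0. \<forall>N\<ge>1. \<forall>q\<ge>1. \<forall>a. coprime a (int q) \<longrightarrow> real q ^ 2 \<le> Q0 * real N ^ d \<longrightarrow>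
    (\<forall>X\<in>boxes N. norm (expsum (of_int a / real q) (mpoly_eval f) X) \<le>
       C * real N powr (real CARD('n) + \<epsilon>) * real q powr (-2))"
proof -
  interpret sym_multilinear d "polar f" by (rule polar_sym_multilinear[OF hom])
  let ?n = "CARD('n)"
  define m where "m = Suc k"
  have m: "d = Suc m" "1 \<le> m" using d by (auto simp: m_def)
  have n0: "0 < ?n" by simp
  \<comment> \<open>Small enough to shrink from radius \<open>2 * N\<close> and tolerance
    \<open>\<kappa> / N\<close>: there
    \<open>2 * n * (2 * N * (\<kappa> / N)) = 1 / 2\<close>.\<close>
  define \<kappa> where "\<kappa> = 1 / (8 * real ?n)"
  have n1: "1 \<le> real ?n" using n0 by linarith
  then have "1 / (8 * real ?n) \<le> 1 / 8" by (intro divide_left_mono) auto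
  then have "\<kappa> \<le> 1 / 8" unfolding \<kappa>_def .
  moreover have "0 < \<kappa>" using n0 by (simp add: \<kappa>_def)
  ultimately have \<kappa>: "0 < \<kappa>" "\<kappa> \<le> 1 / 4" "\<kappa> < 1" by linarith+
  define \<epsilon>' where "\<epsilon>' = \<epsilon> / real ?n"
  have \<epsilon>': "0 < \<epsilon>'" using \<epsilon> by (simp add: \<epsilon>'_def)
  obtain C1 where C1: "0 < C1" "\<forall>N\<ge>1. \<forall>\<alpha>. \<forall>X\<in>boxes N.
      norm (expsum \<alpha> (mpoly_eval f) X) ^ (2 ^ m) \<le>
      (3 * real N) ^ (?n * (2 ^ m - m - 1)) * (C1 * real N powr (1 + \<epsilon>')) ^ ?n *
      real (card (near_lists \<alpha> m (2 * real N) (\<kappa> / real N)))"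
    using weyl_count_bound[OF hom d \<kappa>(1,2) \<epsilon>', folded m_def] by (elim exE conjE) (rule that)
  obtain K where K: "0 < K" "\<forall>U hs i. 0 \<le> U \<longrightarrow> set hs \<subseteq> rbox U \<longrightarrow> Suc (length hs) = d \<longrightarrow>
     \<bar>real_of_int (polar f (hs @ [axis i 1]))\<bar> \<le> K * U ^ length hs"
    using M_bound by (elim exE conjE) (rule that)
  obtain D where D: "\<forall>R. card {hs \<in> vec_lists m R. \<forall>i. polar f (hs @ [axis i 1]) = 0} \<le> D * (4 * R + 1) ^ (?n * k)"
    using polar_zeros_count[OF hom smooth d, folded m_def] by (elim exE conjE) (rule that)
  \<comment> \<open>This constant secures three things at once: \<open>R \<le> N\<close>, a polar
    form below \<open>q\<close> in absolute value on the box of radius \<open>R\<close>, and a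
    shrunken tolerance below \<open>1 / q\<close>.\<close>
  define c1 where "c1 = 1 / (2 + 2 * K + Q0)"
  have c1: "0 < c1" "c1 \<le> 1" "K * c1 < 1" "c1 * (1 + Q0) \<le> 1" "c1 * Q0 \<le> 1"
    using K(1) Q0 by (auto simp: c1_def field_simps)
  have c1m: "c1 ^ m \<le> c1" "0 < c1 ^ m"
    using c1(1,2) m power_decreasing[of 1 m c1] by auto
  define C2 where "C2 = 4 * real ?n ^ 2 + 3"
  define Ct where "Ct = 3 ^ (?n * (2 ^ m - m - 1)) * C1 ^ ?n * (2 * C2) ^ (?n * m) * real D * 5 ^ (?n * k)"
  have Ct0: "0 \<le> Ct" using C1(1) by (simp add: Ct_def C2_def)
  define Cc where "Cc = 1 + Ct / c1 ^ ?n + 1 / c1 ^ (2 * m)"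
  have Cc1: "1 \<le> Cc" "Ct / c1 ^ ?n \<le> Cc" "1 / c1 ^ (2 * m) \<le> Cc" using Ct0 c1 by (auto simp: Cc_def)
  show ?thesis
  proof (intro exI[of _ Cc] conjI allI impI ballI)
    show "0 < Cc" using Cc1 by simp
  next
    fix N q :: nat and a :: int and X :: "(int ^ 'n) set"
    assume N: "1 \<le> N" and q: "1 \<le> q" and a: "coprime a (int q)" and qN: "real q ^ 2 \<le> Q0 * real N ^ d"
      and X: "X \<in> boxes N"
    define S where "S = norm (expsum (of_int a / real q) (mpoly_eval f) X)"
    \<comment> \<open>Up to a constant, the largest radius at which the size bound still keeps the
      polar form below \<open>q\<close>.\<close>
    define R where "R = c1 * real q powr (1 / real m)"
    have R0: "0 < R" using c1 q by (simp add: R_def)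
    have Rm: "R ^ m = c1 ^ m * real q"
      using q m by (simp add: R_def power_mult_distrib powr_power)
    have S_triv: "S \<le> real N powr real ?n"
    proof -
      have "S \<le> (\<Sum>x\<in>X. norm (unit_exp (of_int a / real q * of_int (mpoly_eval f x))))"
        unfolding S_def expsum_def by (rule norm_sum)
      also have "\<dots> = real (card X)" by simp
      also have "\<dots> \<le> real N ^ ?n" using of_nat_mono[OF card_boxes[OF X], where 'a = real] by simp
      finally show ?thesis using N by (simp add: powr_realpow)
    qed
    show "norm (expsum (of_int a / real q) (mpoly_eval f) X) \<le> Cc * real N powr (real ?n + \<epsilon>) * real q powr (-2)"
    proof (cases "1 \<le> R")
      \<comment> \<open>Here \<open>q\<close> is bounded, so \<open>q powr (-2)\<close> is bounded
        below and the trivial estimate suffices.\<close>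
      case False
      then have "R ^ m \<le> 1" using R0 by (intro power_le_one) auto
      then have "(c1 ^ m * real q) ^ 2 \<le> 1" using Rm c1m by (intro power_le_one) auto
      then have "c1 ^ (2 * m) * real q ^ 2 \<le> 1" by (simp add: power_mult_distrib power_mult[symmetric] mult.commute)
      then have "1 \<le> 1 / c1 ^ (2 * m) * real q powr (-2)"
        using q c1 by (simp add: powr_minus powr_realpow field_simps)
      also have "\<dots> \<le> Cc * real q powr (-2)" by (intro mult_right_mono Cc1) auto
      finally have 1: "1 \<le> Cc * real q powr (-2)" .
      have "S \<le> real N powr (real ?n + \<epsilon>)" using S_triv N \<epsilon> by (smt (verit) powr_mono of_nat_1 of_nat_le_iff)
      also have "\<dots> * 1 \<le> real N powr (real ?n + \<epsilon>) * (Cc * real q powr (-2))"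
        by (intro mult_left_mono 1) auto
      finally show ?thesis unfolding S_def by (simp add: mult_ac)
    next
      case True
      \<comment> \<open>Shrinking by this factor takes the radius \<open>2 * N\<close> to
        \<open>R\<close>.\<close>
      define z where "z = R / (2 * real N)"
      define \<delta> where "\<delta> = \<kappa> / real N"
      have qm: "real q \<le> (1 + Q0) * real N ^ m"
      proof (rule power2_le_imp_le)
        have "real N ^ d \<le> real N ^ (2 * m)" using N m by (intro power_increasing) auto
        then have "real q ^ 2 \<le> Q0 * real N ^ (2 * m)" using qN Q0 by (smt (verit) mult_left_mono)
        also have "\<dots> \<le> (1 + Q0) ^ 2 * real N ^ (2 * m)"
          using Q0 by (intro mult_right_mono) (auto simp: power2_eq_square algebra_simps)
        also have "\<dots> = ((1 + Q0) * real N ^ m) ^ 2" by (simp add: power_mult_distrib power_mult[symmetric] mult.commute)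
        finally show "real q ^ 2 \<le> ((1 + Q0) * real N ^ m) ^ 2" .
      qed (use Q0 in simp)
      have "R ^ m \<le> real N ^ m"
      proof -
        have "R ^ m \<le> c1 * ((1 + Q0) * real N ^ m)"
          unfolding Rm using c1 c1m qm by (intro mult_mono) auto
        also have "\<dots> = c1 * (1 + Q0) * real N ^ m" by simp
        also have "\<dots> \<le> 1 * real N ^ m" using c1 by (intro mult_right_mono) auto
        finally show ?thesis by simp
      qed
      then have RN: "R \<le> real N" using m R0 by (subst (asm) power_mono_iff) auto
      have z: "0 < z" "z \<le> 1" using R0 RN N by (auto simp: z_def)
      have \<delta>: "0 < \<delta>" using \<kappa> N by (simp add: \<delta>_def)
      have small: "2 * real ?n * (2 * real N * \<delta>) < 1" using N n0 by (simp add: \<delta>_def \<kappa>_def)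
      have zU: "z * (2 * real N) = R" using N by (simp add: z_def)
      have "card (near_lists (of_int a / real q) m (z * (2 * real N)) (z ^ m * \<delta>)) \<le>
          card {hs \<in> vec_lists m (nat \<lfloor>R\<rfloor>). \<forall>i. polar f (hs @ [axis i 1]) = 0}"
      proof (rule card_mono, simp, rule subsetI)
        fix hs assume "hs \<in> near_lists (of_int a / real q) m (z * (2 * real N)) (z ^ m * \<delta>)"
        then have hs: "set hs \<subseteq> rbox R" "length hs = m"
          "\<And>i. dint (of_int a / real q * of_int (polar f (hs @ [axis i 1]))) \<le> z ^ m * \<delta>"
          unfolding near_lists_def zU by auto
        \<comment> \<open>Multiplied out this is
          \<open>q * R ^ m * \<kappa> < 2 ^ m * N ^ d\<close>, and \<open>q * R ^ m\<close> is a
          small multiple of \<open>q ^ 2\<close>, which the hypothesis bounds by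
          \<open>Q0 * N ^ d\<close>.\<close>
        have "z ^ m * \<delta> < 1 / real q"
        proof -
          have "real q * R ^ m * \<kappa> < 2 ^ m * real N ^ d"
          proof -
            have "real q * R ^ m = c1 ^ m * real q ^ 2" by (simp add: Rm power2_eq_square)
            also have "\<dots> \<le> c1 * (Q0 * real N ^ d)" using c1m c1 qN by (intro mult_mono) auto
            also have "\<dots> = (c1 * Q0) * real N ^ d" by simp
            also have "\<dots> \<le> 1 * real N ^ d" using c1 by (intro mult_right_mono) auto
            finally have "real q * R ^ m \<le> real N ^ d" by simp
            then have "real q * R ^ m * \<kappa> \<le> real N ^ d * \<kappa>" using \<kappa> by (intro mult_right_mono) auto
            also have "\<dots> < real N ^ d * 1" using \<kappa> N by (intro mult_strict_left_mono) auto
            also have "\<dots> \<le> 2 ^ m * real N ^ d"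
              using mult_right_mono[of 1 "2 ^ m" "real N ^ d"] by simp
            finally show ?thesis .
          qed
          then show ?thesis
            using N q by (simp add: z_def \<delta>_def power_divide power_mult_distrib field_simps m)
        qed
        moreover have "\<bar>real_of_int (polar f (hs @ [axis i 1]))\<bar> < real q" for i
        proof -
          have "\<bar>real_of_int (polar f (hs @ [axis i 1]))\<bar> \<le> K * R ^ m"
            using K(2)[rule_format, of R hs i] R0 hs m by auto
          also have "\<dots> \<le> K * (c1 * real q)" unfolding Rm using K c1m by (intro mult_left_mono mult_right_mono) auto
          also have "\<dots> = (K * c1) * real q" by simp
          also have "\<dots> < 1 * real q" using c1 q by (intro mult_strict_right_mono) auto
          finally show ?thesis by simp
        qed
        ultimately have "polar f (hs @ [axis i 1]) = 0" for i
          using hs(3)[of i] q by (intro dint_rational_small[OF a]) (auto intro: le_less_trans)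
        moreover have "set hs \<subseteq> int_box (nat \<lfloor>R\<rfloor>)" using hs(1) rbox_eq_int_box[of R] R0 by auto
        ultimately show "hs \<in> {hs \<in> vec_lists m (nat \<lfloor>R\<rfloor>). \<forall>i. polar f (hs @ [axis i 1]) = 0}"
          using hs(2) by (simp add: vec_lists_def)
      qed
      also have "\<dots> \<le> D * (4 * nat \<lfloor>R\<rfloor> + 1) ^ (?n * k)" by (rule D[rule_format])
      finally have "real (card (near_lists (of_int a / real q) m (z * (2 * real N)) (z ^ m * \<delta>))) \<le>
          real (D * (4 * nat \<lfloor>R\<rfloor> + 1) ^ (?n * k))" by (rule of_nat_mono)
      also have "\<dots> = real D * (4 * real (nat \<lfloor>R\<rfloor>) + 1) ^ (?n * k)" by (simp add: add.commute)
      also have "\<dots> \<le> real D * (5 * R) ^ (?n * k)"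
      proof (intro mult_left_mono power_mono)
        have "real (nat \<lfloor>R\<rfloor>) \<le> R" using R0 by simp
        then show "4 * real (nat \<lfloor>R\<rfloor>) + 1 \<le> 5 * R" using True by linarith
      qed auto
      finally have zeros: "real (card (near_lists (of_int a / real q) m (z * (2 * real N)) (z ^ m * \<delta>))) \<le> real D * (5 * R) ^ (?n * k)" .
      have "real (card (near_lists (of_int a / real q) m (2 * real N) \<delta>)) \<le>
          (C2 / z) ^ (?n * m) * real (card (near_lists (of_int a / real q) m (z * (2 * real N)) (z ^ m * \<delta>)))"
        unfolding C2_def using N m by (intro card_near_lists_shrink \<delta> small z) auto
      also have "\<dots> \<le> (C2 / z) ^ (?n * m) * (real D * (5 * R) ^ (?n * k))"
        using z by (intro mult_left_mono zeros) (auto simp: C2_def)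
      finally have near: "real (card (near_lists (of_int a / real q) m (2 * real N) \<delta>)) \<le>
          (C2 / z) ^ (?n * m) * (real D * (5 * R) ^ (?n * k))" .
      have "S ^ (2 ^ m) \<le> (3 * real N) ^ (?n * (2 ^ m - m - 1)) * (C1 * real N powr (1 + \<epsilon>')) ^ ?n *
         real (card (near_lists (of_int a / real q) m (2 * real N) \<delta>))"
        unfolding S_def \<delta>_def by (rule C1(2)[rule_format, OF N X])
      also have "\<dots> \<le> (3 * real N) ^ (?n * (2 ^ m - m - 1)) * (C1 * real N powr (1 + \<epsilon>')) ^ ?n *
         ((C2 / z) ^ (?n * m) * (real D * (5 * R) ^ (?n * k)))"
        using C1(1) by (intro mult_left_mono near) auto
      also have "\<dots> = Ct * real N powr (real ?n * 2 ^ m + \<epsilon>) * R powr (- real ?n)"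
      proof -
        have m2: "m + 1 \<le> 2 ^ m" by (induction m) auto
        have e1: "(3 * real N) ^ (?n * (2 ^ m - m - 1)) = 3 ^ (?n * (2 ^ m - m - 1)) * real N powr (real ?n * (2 ^ m - real m - 1))"
        proof -
          have "real (2 ^ m - m - 1) = 2 ^ m - real m - 1" using m2 by (simp add: of_nat_diff)
          then show ?thesis using N by (simp add: power_mult_distrib powr_realpow[symmetric])
        qed
        have e2: "(C1 * real N powr (1 + \<epsilon>')) ^ ?n = C1 ^ ?n * real N powr (real ?n + \<epsilon>)"
        proof -
          have "real ?n * (1 + \<epsilon>') = real ?n + \<epsilon>" using n0 by (simp add: \<epsilon>'_def distrib_left)
          then show ?thesis using N by (simp add: power_mult_distrib powr_power)
        qed
        have e3: "(C2 / z) ^ (?n * m) = (2 * C2) ^ (?n * m) * real N powr (real ?n * real m) * R powr (- (real ?n * real m))"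
          using N R0 by (simp add: z_def power_mult_distrib power_divide powr_minus powr_realpow[symmetric] field_simps)
        have e4: "(5 * R) ^ (?n * k) = 5 ^ (?n * k) * R powr (real ?n * real k)"
          using R0 by (simp add: power_mult_distrib powr_realpow[symmetric])
        have p1: "real N powr (real ?n * (2 ^ m - real m - 1)) * real N powr (real ?n + \<epsilon>) * real N powr (real ?n * real m) =
            real N powr (real ?n * 2 ^ m + \<epsilon>)"
          unfolding powr_add[symmetric] by (simp add: algebra_simps)
        \<comment> \<open>Shrinking contributes the exponent \<open>- n * m\<close> and the zero
          count \<open>n * k\<close>; with \<open>m = Suc k\<close> exactly
          \<open>R powr (- n)\<close> remains.\<close>
        have p2: "R powr (- (real ?n * real m)) * R powr (real ?n * real k) = R powr (- real ?n)"
          unfolding powr_add[symmetric] by (simp add: algebra_simps m_def)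
        have "3 ^ (?n * (2 ^ m - m - 1)) * real N powr (real ?n * (2 ^ m - real m - 1)) * (C1 ^ ?n * real N powr (real ?n + \<epsilon>)) *
            ((2 * C2) ^ (?n * m) * real N powr (real ?n * real m) * R powr (- (real ?n * real m)) *
              (real D * (5 ^ (?n * k) * R powr (real ?n * real k)))) =
            Ct * (real N powr (real ?n * (2 ^ m - real m - 1)) * real N powr (real ?n + \<epsilon>) * real N powr (real ?n * real m)) *
            (R powr (- (real ?n * real m)) * R powr (real ?n * real k))"
          unfolding Ct_def by (simp only: mult_ac)
        then show ?thesis unfolding e1 e2 e3 e4 p1 p2 .
      qed
      also have "\<dots> \<le> Ct * real N powr (real ?n * 2 ^ m + 2 ^ m * \<epsilon>) * (1 / c1 ^ ?n * real q powr (- (2 * 2 ^ m)))"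
      proof (intro mult_mono)
        have "1 \<le> (2::real) ^ m" by simp
        then have "\<epsilon> \<le> 2 ^ m * \<epsilon>" using \<epsilon> by simp
        then show "real N powr (real ?n * 2 ^ m + \<epsilon>) \<le> real N powr (real ?n * 2 ^ m + 2 ^ m * \<epsilon>)"
          using N by (intro powr_mono) auto
        \<comment> \<open>Here the number of variables enters: \<open>n / m\<close> is at least
          \<open>2 * 2 ^ m\<close>, and the \<open>2 ^ m\<close>-th root turns this exponent into
          \<open>q powr (-2)\<close>.\<close>
        have "2 ^ d * (d - 1) \<le> ?n" using n by simp
        then have "real (2 ^ d * (d - 1)) \<le> real ?n" by (rule of_nat_mono)
        then have nm: "2 * 2 ^ m \<le> real ?n / real m" using m by (simp add: field_simps)
        have "R powr (- real ?n) = c1 powr (- real ?n) * real q powr (- (real ?n / real m))"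
          unfolding R_def using c1 q by (simp add: powr_mult powr_powr)
        also have "\<dots> \<le> c1 powr (- real ?n) * real q powr (- (2 * 2 ^ m))"
          using nm q by (intro mult_left_mono powr_mono) auto
        also have "c1 powr (- real ?n) = 1 / c1 ^ ?n" using c1 by (simp add: powr_minus powr_realpow divide_inverse)
        finally show "R powr (- real ?n) \<le> 1 / c1 ^ ?n * real q powr (- (2 * 2 ^ m))" .
      qed (use Ct0 in auto)
      also have "\<dots> = (Ct / c1 ^ ?n) * ((real N powr (real ?n + \<epsilon>)) ^ (2 ^ m) * (real q powr (-2)) ^ (2 ^ m))"
      proof -
        have "(real N powr (real ?n + \<epsilon>)) ^ (2 ^ m) = real N powr ((real ?n + \<epsilon>) * real (2 ^ m))"
          using N by (subst powr_realpow[symmetric]) (simp_all add: powr_powr)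
        moreover have "(real q powr (-2)) ^ (2 ^ m) = real q powr (-2 * real (2 ^ m))"
          using q by (subst powr_realpow[symmetric]) (simp_all add: powr_powr)
        ultimately show ?thesis by (simp add: algebra_simps)
      qed
      also have "\<dots> \<le> Cc ^ (2 ^ m) * ((real N powr (real ?n + \<epsilon>)) ^ (2 ^ m) * (real q powr (-2)) ^ (2 ^ m))"
      proof (rule mult_right_mono)
        have "Cc ^ 1 \<le> Cc ^ (2 ^ m)" using Cc1(1) by (intro power_increasing) auto
        then show "Ct / c1 ^ ?n \<le> Cc ^ (2 ^ m)" using Cc1(2) by simp
      qed auto
      also have "\<dots> = (Cc * real N powr (real ?n + \<epsilon>) * real q powr (-2)) ^ (2 ^ m)"
        by (simp only: power_mult_distrib mult.assoc)
      finally have "S ^ (2 ^ m) \<le> (Cc * real N powr (real ?n + \<epsilon>) * real q powr (-2)) ^ (2 ^ m)" .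
      moreover have "0 \<le> S" "0 \<le> Cc * real N powr (real ?n + \<epsilon>) * real q powr (-2)"
        using Cc1(1) by (auto simp: S_def)
      ultimately have "S \<le> Cc * real N powr (real ?n + \<epsilon>) * real q powr (-2)"
        by (subst (asm) power_mono_iff) auto
      then show ?thesis unfolding S_def .
    qed
  qed
qed

section \<open>Ramanujan sums\<close>

definition ramanujan :: "nat \<Rightarrow> int \<Rightarrow> real" where
  "ramanujan q m = (\<Sum>a | a < q \<and> coprime a q. cos (2 * pi * (real a / real q * of_int m)))"

lemma unit_exp_eq_1_iff: "unit_exp t = 1 \<longleftrightarrow> t \<in> \<int>"
proof
  assume "unit_exp t = 1"
  then have "dint t = 0" using unit_exp_minus_one_lower[of t] dint_nonneg[of t] by simp
  then have "t = of_int (round t)" by (simp add: dint_def)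
  then show "t \<in> \<int>" by (metis Ints_of_int)
qed (auto elim: Ints_cases)

lemma unit_exp_power: "unit_exp t ^ k = unit_exp (real k * t)"
proof (induction k)
  case (Suc k)
  have "real (Suc k) * t = t + real k * t" by (simp add: distrib_right)
  then show ?case using Suc by (simp only: power_Suc unit_exp_add)
qed simp

lemma unit_exp_cong:
  assumes "[m = m'] (mod (int q))" "0 < q"
  shows "unit_exp (of_int a / real q * of_int m) = unit_exp (of_int a / real q * of_int m')"
proof -
  obtain k where "m' = m + int q * k" using assms(1) unfolding cong_iff_lin by blast
  then have "of_int a / real q * of_int m' = of_int a / real q * of_int m + real_of_int (a * k)"
    using assms(2) by (simp add: field_simps)
  then show ?thesis by (simp only: unit_exp_add unit_exp_of_int mult_1_right)
qed

lemma unit_exp_complete_sum: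
  assumes "0 < q"
  shows "(\<Sum>b<q. unit_exp (real b / real q * of_int m)) = (if int q dvd m then of_nat q else 0)"
proof -
  define x where "x = unit_exp (of_int m / real q)"
  have x: "unit_exp (real b / real q * of_int m) = x ^ b" for b
    by (simp add: x_def unit_exp_power field_simps)
  have "x ^ q = 1" using assms by (simp add: x_def unit_exp_power)
  show ?thesis
  proof (cases "int q dvd m")
    case True
    then have "x = 1" using assms by (auto simp: x_def unit_exp_eq_1_iff elim!: dvdE)
    then show ?thesis using True unfolding x by simp
  next
    case False
    have "x \<noteq> 1"
    proof
      assume "x = 1"
      then obtain k where k: "of_int m / real q = of_int k" by (auto simp: x_def unit_exp_eq_1_iff elim: Ints_cases)
      then have "real_of_int m = real_of_int (k * int q)" using assms by (simp add: field_simps)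
      then have "m = k * int q" by linarith
      then show False using False by simp
    qed
    then show ?thesis using False \<open>x ^ q = 1\<close> unfolding x by (simp add: sum_gp_strict)
  qed
qed

text \<open>Each \<open>b / q\<close> has a unique form in lowest terms, with denominator
  \<open>q div gcd b q\<close>.\<close>

lemma sum_fractions_by_denominator:
  fixes F :: "real \<Rightarrow> 'a::comm_monoid_add"
  assumes "0 < q"
  shows "(\<Sum>b<q. F (real b / real q)) = (\<Sum>q' | q' dvd q. \<Sum>a | a < q' \<and> coprime a q'. F (real a / real q'))"
proof -
  have "(\<Sum>q' | q' dvd q. \<Sum>a | a < q' \<and> coprime a q'. F (real a / real q')) =
      (\<Sum>(q', a)\<in>Sigma {q'. q' dvd q} (\<lambda>q'. {a. a < q' \<and> coprime a q'}). F (real a / real q'))"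
    using assms by (subst sum.Sigma) auto
  also have "\<dots> = (\<Sum>b<q. F (real b / real q))"
  proof (rule sum.reindex_bij_witness[where i = "\<lambda>b. (q div gcd b q, b div gcd b q)" and j = "\<lambda>(q', a). a * (q div q')"])
    fix p assume "p \<in> Sigma {q'. q' dvd q} (\<lambda>q'. {a. a < q' \<and> coprime a q'})"
    then obtain q' a k where p: "p = (q', a)" "q = q' * k" "a < q'" "coprime a q'" by (auto elim!: dvdE)
    then have k: "0 < k" "0 < q'" using assms by (auto intro: Nat.gr0I)
    have dv: "q div q' = k" using p k by simp
    have "gcd (k * a) (k * q') = k" using p(4) by (simp add: gcd_mult_distrib_nat[symmetric])
    then have "gcd (a * k) (q' * k) = k" by (simp add: mult.commute)
    then show "(q div gcd (case p of (q', a) \<Rightarrow> a * (q div q')) q, (case p of (q', a) \<Rightarrow> a * (q div q')) div gcd (case p of (q', a) \<Rightarrow> a * (q div q')) q) = p"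
      using p k dv by simp
    show "(case p of (q', a) \<Rightarrow> a * (q div q')) \<in> {..<q}" using p k dv by simp
    show "F (real (case p of (q', a) \<Rightarrow> a * (q div q')) / real q) = (case p of (q', a) \<Rightarrow> F (real a / real q'))"
      using p k dv by simp
  next
    fix b assume b: "b \<in> {..<q}"
    define g where "g = gcd b q"
    have g: "0 < g" "g dvd b" "g dvd q" using assms by (auto simp: g_def)
    obtain b' q' where bq: "b = g * b'" "q = g * q'" using g by (auto elim!: dvdE)
    have q': "0 < q'" using assms bq by (auto intro: Nat.gr0I)
    have dv: "q div g = q'" "b div g = b'" using bq g by auto
    have "coprime (b div g) (q div g)" unfolding g_def using assms by (intro div_gcd_coprime) auto
    then have c: "coprime b' q'" by (simp add: dv)
    have "q div q' = g" using bq q' by simp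
    then show "(case (q div gcd b q, b div gcd b q) of (q', a) \<Rightarrow> a * (q div q')) = b"
      unfolding g_def[symmetric] dv using bq by (simp add: mult.commute)
    show "(q div gcd b q, b div gcd b q) \<in> Sigma {q'. q' dvd q} (\<lambda>q'. {a. a < q' \<and> coprime a q'})"
      unfolding g_def[symmetric] dv using bq b g c by auto
  qed
  finally show ?thesis by simp
qed

definition ramanujan_complex :: "nat \<Rightarrow> int \<Rightarrow> complex" where
  "ramanujan_complex q m = (\<Sum>a | a < q \<and> coprime a q. unit_exp (real a / real q * of_int m))"

lemma sum_ramanujan_complex:
  assumes "0 < q"
  shows "(\<Sum>q' | q' dvd q. ramanujan_complex q' m) = (if int q dvd m then of_nat q else 0)"
  unfolding ramanujan_complex_def
  using sum_fractions_by_denominator[OF assms, of "\<lambda>t. unit_exp (t * of_int m)"] unit_exp_complete_sum[OF assms, of m]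
  by simp

text \<open>The exponential sum is real by induction: the sum over all divisors of \<open>q\<close>
  is real, and so are the terms of the proper divisors.\<close>

lemma of_real_ramanujan: "complex_of_real (ramanujan q m) = ramanujan_complex q m"
proof -
  have Re: "Re (ramanujan_complex q m) = ramanujan q m" for q
    by (simp add: ramanujan_complex_def ramanujan_def unit_exp_def)
  have "ramanujan_complex q m \<in> \<real>"
  proof (induction q rule: less_induct)
    case (less q)
    show ?case
    proof (cases "q = 0")
      case True
      then show ?thesis by (simp add: ramanujan_complex_def)
    next
      case False
      then have q: "0 < q" by simp
      have fin: "finite {q'. q' dvd q}" using q by simp
      have "(\<Sum>q' | q' dvd q. ramanujan_complex q' m) =
          ramanujan_complex q m + (\<Sum>q'\<in>{q'. q' dvd q} - {q}. ramanujan_complex q' m)"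
        using fin by (intro sum.remove) auto
      then have "ramanujan_complex q m = (if int q dvd m then of_nat q else 0) -
          (\<Sum>q'\<in>{q'. q' dvd q} - {q}. ramanujan_complex q' m)"
        using sum_ramanujan_complex[OF q, of m] by (simp add: algebra_simps)
      moreover have "(\<Sum>q'\<in>{q'. q' dvd q} - {q}. ramanujan_complex q' m) \<in> \<real>"
        using q less by (intro sum_in_Reals) (auto dest: dvd_imp_le simp: le_less)
      ultimately show ?thesis by auto
    qed
  qed
  then show ?thesis using Re by (metis of_real_Re)
qed

lemma sum_ramanujan:
  assumes "0 < q"
  shows "(\<Sum>q' | q' dvd q. ramanujan q' m) = (if int q dvd m then real q else 0)"
proof -
  have "complex_of_real (\<Sum>q' | q' dvd q. ramanujan q' m) = complex_of_real (if int q dvd m then real q else 0)"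
    using sum_ramanujan_complex[OF assms, of m] by (simp add: of_real_ramanujan)
  then show ?thesis by (simp only: of_real_eq_iff)
qed

lemma ramanujan_cong:
  assumes "[m = m'] (mod (int q))"
  shows "ramanujan q m = ramanujan q m'"
proof (cases "q = 0")
  case False
  then have "ramanujan_complex q m = ramanujan_complex q m'"
    unfolding ramanujan_complex_def
    using unit_exp_cong[OF assms, of "int a" for a] by (intro sum.cong) auto
  then show ?thesis by (metis of_real_ramanujan of_real_eq_iff)
qed (simp add: ramanujan_def)

lemma ramanujan_1 [simp]: "ramanujan (Suc 0) m = 1"
  by (simp add: ramanujan_def)

text \<open>The fractions \<open>a / q1 + b / q2\<close> run modulo 1 through the reduced fractions
  with denominator \<open>q1 * q2\<close>. Surjectivity is obtained by counting, from the
  multiplicativity of the totient.\<close>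

lemma ramanujan_mult:
  assumes "coprime q1 q2"
  shows "ramanujan (q1 * q2) m = ramanujan q1 m * ramanujan q2 m"
proof (cases "q1 = 0 \<or> q2 = 0")
  case True
  then show ?thesis by (auto simp: ramanujan_def)
next
  case False
  then have q: "0 < q1" "0 < q2" by auto
  define U where "U q = {a. a < q \<and> coprime a q}" for q :: nat
  have finU: "finite (U q)" for q by (simp add: U_def)
  have cardU: "card (U q) = totient q" if "0 < q" for q
  \<comment> \<open>The representatives differ for \<open>q = 1\<close>: \<open>U 1 = {0}\<close>,
    while \<open>totatives\<close> uses 1.\<close>
  proof (cases "q = 1")
    case True
    then show ?thesis by (simp add: U_def)
  next
    case False
    then have "U q = totatives q"
      using that by (auto simp: U_def in_totatives_iff le_less intro!: Nat.gr0I)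
    then show ?thesis by (simp add: totient_def)
  qed
  define \<phi> where "\<phi> = (\<lambda>(a, b). (a * q2 + b * q1) mod (q1 * q2))"
  have inj: "inj_on \<phi> (U q1 \<times> U q2)"
  proof (rule inj_onI, clarify)
    fix a b a' b' assume *: "a \<in> U q1" "b \<in> U q2" "a' \<in> U q1" "b' \<in> U q2" "\<phi> (a, b) = \<phi> (a', b')"
    have e: "[a * q2 + b * q1 = a' * q2 + b' * q1] (mod (q1 * q2))"
      using *(5) by (simp add: \<phi>_def cong_def)
    have "[a * q2 + b * q1 = a' * q2 + b' * q1] (mod q1)" by (rule cong_dvd_modulus_nat[OF e]) simp
    then have "[a * q2 = a' * q2] (mod q1)" by (simp add: cong_def)
    then have "[a = a'] (mod q1)" using assms by (simp add: cong_mult_rcancel_nat coprime_commute)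
    then have 1: "a = a'" using *(1,3) by (simp add: U_def cong_def)
    have "[a * q2 + b * q1 = a' * q2 + b' * q1] (mod q2)" by (rule cong_dvd_modulus_nat[OF e]) simp
    then have "[b * q1 = b' * q1] (mod q2)" by (simp add: cong_def)
    then have "[b = b'] (mod q2)" using assms by (simp add: cong_mult_rcancel_nat)
    then have 2: "b = b'" using *(2,4) by (simp add: U_def cong_def)
    show "a = a' \<and> b = b'" using 1 2 by simp
  qed
  have sub: "\<phi> ` (U q1 \<times> U q2) \<subseteq> U (q1 * q2)"
  proof (rule image_subsetI, clarify)
    fix a b assume ab: "a \<in> U q1" "b \<in> U q2"
    have "coprime (a * q2 + b * q1) q1"
    proof -
      have "coprime (a * q2) q1" using ab assms by (simp add: U_def coprime_commute)
      then show ?thesis by (metis coprime_iff_gcd_eq_1 gcd_add_mult gcd.commute add.commute mult.commute)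
    qed
    moreover have "coprime (a * q2 + b * q1) q2"
    proof -
      have "coprime (b * q1) q2" using ab assms by (simp add: U_def coprime_commute)
      then show ?thesis by (metis coprime_iff_gcd_eq_1 gcd_add_mult gcd.commute add.commute mult.commute)
    qed
    ultimately have c: "coprime (a * q2 + b * q1) (q1 * q2)" by simp
    have "q1 * q2 \<noteq> 0" using q by simp
    from coprime_mod_left_iff[OF this, THEN iffD2, OF c] q
    show "\<phi> (a, b) \<in> U (q1 * q2)" unfolding \<phi>_def U_def by simp
  qed
  have "card (\<phi> ` (U q1 \<times> U q2)) = card (U (q1 * q2))"
    using card_image[OF inj] q assms by (simp add: cardU card_cartesian_product totient_mult_coprime)
  then have im: "\<phi> ` (U q1 \<times> U q2) = U (q1 * q2)" by (intro card_subset_eq finU sub)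
  have "ramanujan_complex (q1 * q2) m = (\<Sum>c\<in>\<phi> ` (U q1 \<times> U q2). unit_exp (real c / real (q1 * q2) * of_int m))"
    unfolding im by (simp add: ramanujan_complex_def U_def)
  also have "\<dots> = (\<Sum>p\<in>U q1 \<times> U q2. unit_exp (real (\<phi> p) / real (q1 * q2) * of_int m))"
    by (subst sum.reindex[OF inj]) simp
  also have "\<dots> = (\<Sum>(a, b)\<in>U q1 \<times> U q2. unit_exp (real a / real q1 * of_int m) * unit_exp (real b / real q2 * of_int m))"
  proof (rule sum.cong[OF refl], clarify)
    fix a b
    define c where "c = a * q2 + b * q1"
    have "real c = real (\<phi> (a, b)) + real (c div (q1 * q2)) * real (q1 * q2)"
      by (metis \<phi>_def c_def case_prod_conv mod_mult_div_eq mult.commute of_nat_add of_nat_mult)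
    then have "real c / real (q1 * q2) * of_int m = real (\<phi> (a, b)) / real (q1 * q2) * of_int m + of_int (int (c div (q1 * q2)) * m)"
      using q by (simp add: add_divide_distrib distrib_right)
    then have "unit_exp (real c / real (q1 * q2) * of_int m) = unit_exp (real (\<phi> (a, b)) / real (q1 * q2) * of_int m)"
      by (simp only: unit_exp_add unit_exp_of_int mult_1_right)
    moreover have "real c / real (q1 * q2) * of_int m = real a / real q1 * of_int m + real b / real q2 * of_int m"
      using q by (simp add: c_def field_simps)
    ultimately show "unit_exp (real (\<phi> (a, b)) / real (q1 * q2) * of_int m) =
        unit_exp (real a / real q1 * of_int m) * unit_exp (real b / real q2 * of_int m)"
      by (metis unit_exp_add)
  qed
  also have "\<dots> = ramanujan_complex q1 m * ramanujan_complex q2 m"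
    by (simp add: ramanujan_complex_def U_def sum_product sum.cartesian_product)
  finally have "complex_of_real (ramanujan (q1 * q2) m) = complex_of_real (ramanujan q1 m * ramanujan q2 m)"
    by (simp add: of_real_ramanujan)
  then show ?thesis by (simp only: of_real_eq_iff)
qed

section \<open>Means over residue vectors and the local averages\<close>

definition residue_vecs :: "nat \<Rightarrow> (int ^ 'n::finite) set" where
  "residue_vecs q = {t. \<forall>i. t $ i \<in> {0..<int q}}"

definition residue_mean :: "nat \<Rightarrow> (int ^ 'n::finite \<Rightarrow> real) \<Rightarrow> real" where
  "residue_mean q F = (\<Sum>t\<in>residue_vecs q. F t) / real q ^ CARD('n)"

definition periodic_mod :: "nat \<Rightarrow> (int ^ 'n::finite \<Rightarrow> 'a) \<Rightarrow> bool" where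
  "periodic_mod q F \<longleftrightarrow> (\<forall>s t. (\<forall>i. [s $ i = t $ i] (mod (int q))) \<longrightarrow> F s = F t)"

lemma finite_residue_vecs [simp]: "finite (residue_vecs q :: (int ^ 'n::finite) set)"
  and card_residue_vecs: "card (residue_vecs q :: (int ^ 'n::finite) set) = q ^ CARD('n)"
  unfolding residue_vecs_def using card_vec_box[of "\<lambda>_::'n. {0..<int q}"] by auto

lemma residue_mean_multiple:
  fixes F :: "int ^ 'n::finite \<Rightarrow> real"
  assumes F: "periodic_mod q F" and q: "0 < q" and k: "0 < k"
  shows "residue_mean (q * k) F = residue_mean q F"
proof -
  have "(\<Sum>t\<in>residue_vecs (q * k). F t) = (\<Sum>(t, s)\<in>residue_vecs q \<times> (residue_vecs k :: (int ^ 'n) set). F t)"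
  proof (rule sum.reindex_bij_witness[where
      i = "\<lambda>(t, s). \<chi> i. t $ i + int q * s $ i" and j = "\<lambda>u. (\<chi> i. u $ i mod int q, \<chi> i. u $ i div int q)"])
    fix u :: "int ^ 'n" assume u: "u \<in> residue_vecs (q * k)"
    show "(case (\<chi> i. u $ i mod int q, \<chi> i. u $ i div int q) of (t, s) \<Rightarrow> \<chi> i. t $ i + int q * s $ i) = u"
      by (simp add: vec_eq_iff)
    have "u $ i div int q < int k" for i
    proof -
      have "u $ i < int q * int k" using u by (auto simp: residue_vecs_def)
      moreover have "int q * (u $ i div int q) \<le> u $ i"
        using pos_mod_sign[of "int q" "u $ i"] mult_div_mod_eq[of "int q" "u $ i"] q by linarith
      ultimately have "int q * (u $ i div int q) < int q * int k" by linarith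
      then show ?thesis using q by simp
    qed
    moreover have "0 \<le> u $ i div int q" for i
      using u q by (auto simp: residue_vecs_def pos_imp_zdiv_nonneg_iff)
    ultimately show "(\<chi> i. u $ i mod int q, \<chi> i. u $ i div int q) \<in> residue_vecs q \<times> residue_vecs k"
      using q by (simp add: residue_vecs_def)
    have "F (\<chi> i. u $ i mod int q) = F u"
      using F[unfolded periodic_mod_def, rule_format, of "\<chi> i. u $ i mod int q" u] by (simp add: cong_def)
    then show "(case (\<chi> i. u $ i mod int q, \<chi> i. u $ i div int q) of (t, s) \<Rightarrow> F t) = F u" by simp
  next
    fix p :: "(int ^ 'n) \<times> (int ^ 'n)" assume "p \<in> residue_vecs q \<times> residue_vecs k"
    then obtain t s where p: "p = (t, s)" "t \<in> residue_vecs q" "s \<in> residue_vecs k" by auto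
    have t: "0 \<le> t $ i" "t $ i < int q" "0 \<le> s $ i" "s $ i < int k" for i
      using p by (auto simp: residue_vecs_def)
    have "t $ i + int q * s $ i < int q * int k" for i
    proof -
      have "int q * (s $ i + 1) \<le> int q * int k" using t(4)[of i] by (intro mult_left_mono) auto
      moreover
      have "int q * (s $ i + 1) = int q * s $ i + int q" by (simp add: distrib_left)
      ultimately show ?thesis using t(2)[of i] by linarith
    qed
    then show "(case p of (t, s) \<Rightarrow> \<chi> i. t $ i + int q * s $ i) \<in> residue_vecs (q * k)"
      using p t by (simp add: residue_vecs_def)
    show "(\<chi> i. (case p of (t, s) \<Rightarrow> \<chi> i. t $ i + int q * s $ i) $ i mod int q,
        \<chi> i. (case p of (t, s) \<Rightarrow> \<chi> i. t $ i + int q * s $ i) $ i div int q) = p"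
      using t q by (simp add: p vec_eq_iff mod_pos_pos_trivial div_pos_pos_trivial)
  qed
  also have "\<dots> = real k ^ CARD('n) * (\<Sum>t\<in>residue_vecs q. F t)"
    by (simp add: sum.cartesian_product[symmetric] card_residue_vecs sum_distrib_left)
  finally show ?thesis using k by (simp add: residue_mean_def power_mult_distrib)
qed

text \<open>Chinese remainder theorem in every coordinate: \<open>\<phi>\<close> is injective, and
  counting makes it surjective.\<close>

lemma residue_mean_mult:
  fixes F G :: "int ^ 'n::finite \<Rightarrow> real"
  assumes F: "periodic_mod q1 F" and G: "periodic_mod q2 G" and q: "0 < q1" "0 < q2" and c: "coprime q1 q2"
  shows "residue_mean (q1 * q2) (\<lambda>t. F t * G t) = residue_mean q1 F * residue_mean q2 G"
proof -
  define red where "red q t = (\<chi> i. t $ i mod int q)" for q and t :: "int ^ 'n"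
  have red: "[red q t $ i = t $ i] (mod (int q))" for q t i by (simp add: red_def cong_def)
  have redF: "F (red q1 t) = F t" and redG: "G (red q2 t) = G t" for t
    using F G red unfolding periodic_mod_def by blast+
  define \<phi> where "\<phi> t = (red q1 t, red q2 t)" for t
  have inj: "inj_on \<phi> (residue_vecs (q1 * q2))"
  proof (rule inj_onI)
    fix s t assume st: "s \<in> residue_vecs (q1 * q2)" "t \<in> residue_vecs (q1 * q2)" "\<phi> s = \<phi> t"
    have "s $ i = t $ i" for i
    proof -
      have e: "red q1 s $ i = red q1 t $ i" "red q2 s $ i = red q2 t $ i" using st(3) by (auto simp: \<phi>_def)
      then have "[s $ i = t $ i] (mod (int q1))" "[s $ i = t $ i] (mod (int q2))" by (auto simp: red_def cong_def)
      then have "[s $ i = t $ i] (mod (int q1 * int q2))" using c by (intro coprime_cong_mult) auto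
      then show ?thesis using st(1,2) by (simp add: residue_vecs_def cong_def)
    qed
    then show "s = t" by (simp add: vec_eq_iff)
  qed
  have "\<phi> ` residue_vecs (q1 * q2) \<subseteq> residue_vecs q1 \<times> residue_vecs q2"
    using q by (auto simp: \<phi>_def red_def residue_vecs_def)
  moreover have "card (\<phi> ` residue_vecs (q1 * q2)) = card ((residue_vecs q1 :: (int ^ 'n) set) \<times> (residue_vecs q2 :: (int ^ 'n) set))"
    using card_image[OF inj] by (simp add: card_cartesian_product card_residue_vecs power_mult_distrib)
  ultimately have im: "\<phi> ` residue_vecs (q1 * q2) = residue_vecs q1 \<times> residue_vecs q2"
    by (intro card_subset_eq) auto
  have "(\<Sum>t\<in>residue_vecs (q1 * q2). F t * G t) = (\<Sum>t\<in>residue_vecs (q1 * q2). (\<lambda>(s, t). F s * G t) (\<phi> t))"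
    by (simp add: \<phi>_def redF redG)
  also have "\<dots> = (\<Sum>(s, t)\<in>residue_vecs q1 \<times> residue_vecs q2. F s * G t)"
    unfolding im[symmetric] by (subst sum.reindex[OF inj]) simp
  also have "\<dots> = (\<Sum>t\<in>residue_vecs q1. F t) * (\<Sum>t\<in>residue_vecs q2. G t)"
    by (simp add: sum_product sum.cartesian_product)
  finally show ?thesis by (simp add: residue_mean_def power_mult_distrib)
qed

text \<open>The coefficient \<open>A(q)\<close>: complete exponential sums modulo \<open>q\<close>,
  summed over the reduced fractions and averaged over the residues.\<close>

definition arith_coeff :: "('n::finite) int_mpoly \<Rightarrow> nat \<Rightarrow> real" where
  "arith_coeff f q = residue_mean q (\<lambda>t. ramanujan q (mpoly_eval f t))"

lemma periodic_ramanujan: "periodic_mod q (\<lambda>t. ramanujan q (mpoly_eval f t))"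
  unfolding periodic_mod_def by (auto intro!: ramanujan_cong mpoly_eval_cong)

lemma arith_coeff_mult:
  assumes "coprime q1 q2" "0 < q1" "0 < q2"
  shows "arith_coeff f (q1 * q2) = arith_coeff f q1 * arith_coeff f q2"
  unfolding arith_coeff_def ramanujan_mult[OF assms(1)]
  by (intro residue_mean_mult periodic_ramanujan assms)

lemma arith_coeff_1 [simp]: "arith_coeff f (Suc 0) = 1"
  by (simp add: arith_coeff_def residue_mean_def card_residue_vecs)

text \<open>\<open>tau_prime_power p m l\<close> counts the \<open>k \<le> m\<close> for which
  \<open>p ^ k\<close> divides \<open>l\<close>, and each such divisibility is detected by the
  Ramanujan sums for \<open>p ^ j\<close> with \<open>j \<le> k\<close>. By periodicity their means
  modulo \<open>p ^ m\<close> are means modulo \<open>p ^ j\<close>.\<close>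

lemma local_average_eq:
  fixes f :: "('n::finite) int_mpoly"
  assumes p: "prime p"
  shows "local_average f p m = (\<Sum>k\<le>m. 1 / real p ^ k * (\<Sum>j\<le>k. arith_coeff f (p ^ j)))"
proof -
  have p0: "0 < p" using p by (simp add: prime_gt_0_nat)
  have ind: "real (tau_prime_power p m l) = (\<Sum>k\<le>m. 1 / real p ^ k * (\<Sum>j\<le>k. ramanujan (p ^ j) l))" for l
  proof -
    have "real (tau_prime_power p m l) = 1 + (\<Sum>k\<in>{1..m}. if int p ^ k dvd l then 1 else 0)"
      using tau_prime_power_altdef[OF p, of m l] by (simp add: sum.If_cases Int_def)
    also have "\<dots> = (\<Sum>k\<in>{0..m}. if int p ^ k dvd l then 1 else 0)"
      by (subst sum.atLeast_Suc_atMost[of 0]) auto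
    also have "\<dots> = (\<Sum>k\<le>m. 1 / real p ^ k * (\<Sum>j\<le>k. ramanujan (p ^ j) l))"
    proof (intro sum.cong)
      fix k
      have "{q'. q' dvd p ^ k} = (\<lambda>j. p ^ j) ` {..k}"
        using divides_primepow_nat[OF p] by auto
      moreover have "inj_on (\<lambda>j. p ^ j) {..k}"
        using prime_gt_1_nat[OF p] by (auto simp: inj_on_def)
      ultimately have "(\<Sum>q' | q' dvd p ^ k. ramanujan q' l) = (\<Sum>j\<le>k. ramanujan (p ^ j) l)"
        by (simp add: sum.reindex)
      then have "(\<Sum>j\<le>k. ramanujan (p ^ j) l) = (if int p ^ k dvd l then real p ^ k else 0)"
        using sum_ramanujan[of "p ^ k" l] p0 by (simp split: if_splits)
      then show "(if int p ^ k dvd l then 1 else 0) = 1 / real p ^ k * (\<Sum>j\<le>k. ramanujan (p ^ j) l)"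
        using p0 by simp
    qed auto
    finally show ?thesis .
  qed
  have mean: "residue_mean (p ^ m) (\<lambda>t. ramanujan (p ^ j) (mpoly_eval f t)) = arith_coeff f (p ^ j)" if "j \<le> m" for j
  proof -
    have "p ^ m = p ^ j * p ^ (m - j)" using that by (simp add: power_add[symmetric])
    then show ?thesis
      unfolding arith_coeff_def using residue_mean_multiple[OF periodic_ramanujan, of "p ^ j" "p ^ (m - j)" f] p0 by simp
  qed
  have "local_average f p m = residue_mean (p ^ m) (\<lambda>t. real (tau_prime_power p m (mpoly_eval f t)))"
    by (simp add: local_average_def residue_mean_def residue_vecs_def power_mult[symmetric] mult.commute)
  also have "\<dots> = (\<Sum>k\<le>m. 1 / real p ^ k * (\<Sum>j\<le>k. residue_mean (p ^ m) (\<lambda>t. ramanujan (p ^ j) (mpoly_eval f t))))"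
  proof -
    have "(\<Sum>t\<in>residue_vecs (p ^ m). real (tau_prime_power p m (mpoly_eval f t))) =
        (\<Sum>k\<le>m. \<Sum>t\<in>residue_vecs (p ^ m). 1 / real p ^ k * (\<Sum>j\<le>k. ramanujan (p ^ j) (mpoly_eval f t)))"
      unfolding ind by (rule sum.swap)
    also have "\<dots> = (\<Sum>k\<le>m. 1 / real p ^ k * (\<Sum>j\<le>k. \<Sum>t\<in>residue_vecs (p ^ m). ramanujan (p ^ j) (mpoly_eval f t)))"
      unfolding sum_distrib_left[symmetric] by (subst sum.swap) simp
    finally show ?thesis
      by (simp add: residue_mean_def sum_divide_distrib mult.commute)
  qed
  also have "\<dots> = (\<Sum>k\<le>m. 1 / real p ^ k * (\<Sum>j\<le>k. arith_coeff f (p ^ j)))"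
    using mean by (intro sum.cong refl arg_cong2[where f = "(*)"]) auto
  finally show ?thesis .
qed

text \<open>The local averages are partial sums of a Cauchy product with the geometric series in
  \<open>1 / p\<close>; the value of that series is what the factor \<open>1 - 1 / p\<close> in the
  Euler product removes.\<close>

lemma local_average_limit:
  fixes f :: "('n::finite) int_mpoly"
  assumes p: "prime p" and s: "summable (\<lambda>q. \<bar>arith_coeff f q / real q\<bar>)"
  shows "summable (\<lambda>j. \<bar>arith_coeff f (p ^ j) / real p ^ j\<bar>)"
    and "local_average f p \<longlonglongrightarrow> suminf (\<lambda>j. arith_coeff f (p ^ j) / real p ^ j) / (1 - 1 / real p)"
proof -
  have p1: "1 < p" using prime_gt_1_nat[OF p] .
  have mono: "strict_mono (\<lambda>j. p ^ j)" using p1 by (auto simp: strict_mono_def)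
  have "summable (\<lambda>j. (\<lambda>q. \<bar>arith_coeff f q / real q\<bar>) (p ^ j))"
    by (rule summable_reindex[OF s, unfolded o_def]) (use strict_mono_imp_inj_on[OF mono] in auto)
  then show s': "summable (\<lambda>j. \<bar>arith_coeff f (p ^ j) / real p ^ j\<bar>)" by simp
  have gp: "(\<lambda>i. (1 / real p) ^ i) sums (1 / (1 - 1 / real p))"
    using p1 by (intro geometric_sums) simp
  have "(\<lambda>k. \<Sum>i\<le>k. arith_coeff f (p ^ i) / real p ^ i * (1 / real p) ^ (k - i)) sums
      (suminf (\<lambda>j. arith_coeff f (p ^ j) / real p ^ j) * suminf (\<lambda>i. (1 / real p) ^ i))"
    using s' gp p1 by (intro Cauchy_product_sums) (auto simp: norm_power summable_geometric)
  moreover have "(\<Sum>i\<le>k. arith_coeff f (p ^ i) / real p ^ i * (1 / real p) ^ (k - i)) =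
      1 / real p ^ k * (\<Sum>j\<le>k. arith_coeff f (p ^ j))" for k
    unfolding sum_distrib_left
  proof (rule sum.cong[OF refl])
    fix i assume "i \<in> {..k}"
    then have "real p ^ k = real p ^ i * real p ^ (k - i)" by (simp add: power_add[symmetric])
    then show "arith_coeff f (p ^ i) / real p ^ i * (1 / real p) ^ (k - i) = 1 / real p ^ k * arith_coeff f (p ^ i)"
      by (simp add: power_divide)
  qed
  ultimately have "(\<lambda>k. 1 / real p ^ k * (\<Sum>j\<le>k. arith_coeff f (p ^ j))) sums
      (suminf (\<lambda>j. arith_coeff f (p ^ j) / real p ^ j) / (1 - 1 / real p))"
    using sums_unique[OF gp, symmetric] by simp
  then have "(\<lambda>m. \<Sum>k\<le>m. 1 / real p ^ k * (\<Sum>j\<le>k. arith_coeff f (p ^ j))) \<longlonglongrightarrow>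
      suminf (\<lambda>j. arith_coeff f (p ^ j) / real p ^ j) / (1 - 1 / real p)"
    by (simp add: sums_def_le)
  moreover have "local_average f p = (\<lambda>m. \<Sum>k\<le>m. 1 / real p ^ k * (\<Sum>j\<le>k. arith_coeff f (p ^ j)))"
    by (rule ext) (rule local_average_eq[OF p])
  ultimately show "local_average f p \<longlonglongrightarrow> suminf (\<lambda>j. arith_coeff f (p ^ j) / real p ^ j) / (1 - 1 / real p)"
    by simp
qed

section \<open>The singular series\<close>

definition supported_on :: "nat set \<Rightarrow> nat set" where
  "supported_on P = {q. 0 < q \<and> (\<forall>p. prime p \<and> p dvd q \<longrightarrow> p \<in> P)}"

lemma supported_on_empty: "supported_on {} = {Suc 0}"
proof -
  have "q = 1" if "0 < q" "\<forall>p::nat. prime p \<longrightarrow> \<not> p dvd q" for q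
    using that prime_factor_nat[of q] by auto
  then show ?thesis by (auto simp: supported_on_def)
qed

lemma inj_on_prime_power_mult:
  assumes "prime p" "p \<notin> P"
  shows "inj_on (\<lambda>(q, k). q * p ^ k) (supported_on P \<times> UNIV)"
proof -
  have p: "1 < p" using prime_gt_1_nat[OF assms(1)] .
  have nd: "\<not> p dvd q" if "q \<in> supported_on P" for q
    using that assms by (auto simp: supported_on_def)
  have le: "k' \<le> k" if "q \<in> supported_on P" "q' \<in> supported_on P" "q * p ^ k = q' * p ^ k'" for q k q' k'
  proof (rule ccontr)
    assume "\<not> k' \<le> k"
    then obtain j where j: "k' = k + Suc j" using less_iff_Suc_add[of k k'] by auto
    have "q * p ^ k = (q' * p ^ Suc j) * p ^ k" using that(3) j by (simp add: power_add mult_ac)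
    then have "q = q' * p ^ Suc j" using p by simp
    then have "p dvd q" by simp
    then show False using nd that(1) by blast
  qed
  show ?thesis
  proof (rule inj_onI, clarify)
    fix q k q' k' assume *: "q \<in> supported_on P" "q' \<in> supported_on P" "q * p ^ k = q' * p ^ k'"
    then have "k = k'" using le[of q q' k k'] le[of q' q k' k] by simp
    then show "q = q' \<and> k = k'" using *(3) p by simp
  qed
qed

lemma supported_on_insert:
  assumes "prime p" "p \<notin> P"
  shows "supported_on (insert p P) = (\<lambda>(q, k). q * p ^ k) ` (supported_on P \<times> UNIV)"
proof (intro set_eqI iffI)
  fix q assume q: "q \<in> supported_on (insert p P)"
  then have q0: "q \<noteq> 0" by (simp add: supported_on_def)
  obtain r where r: "q = p ^ multiplicity p q * r" "\<not> p dvd r"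
    using multiplicity_decompose'[of q p] q0 assms(1) by (metis not_prime_unit)
  have "r \<in> supported_on P"
    unfolding supported_on_def
  proof (intro CollectI conjI allI impI)
    show "0 < r" using r(1) q0 by (auto intro: Nat.gr0I)
    fix l :: nat assume l: "prime l \<and> l dvd r"
    then have "l dvd q" using r(1) by (metis dvd_mult)
    then have "l \<in> insert p P" using q l by (auto simp: supported_on_def)
    then show "l \<in> P" using l r(2) by auto
  qed
  then show "q \<in> (\<lambda>(q, k). q * p ^ k) ` (supported_on P \<times> UNIV)"
    using r(1) by (intro image_eqI[of _ _ "(r, multiplicity p q)"]) (auto simp: mult.commute)
next
  fix q assume "q \<in> (\<lambda>(q, k). q * p ^ k) ` (supported_on P \<times> UNIV)"
  then obtain r k where rk: "q = r * p ^ k" "r \<in> supported_on P" by auto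
  have "l \<in> insert p P" if "prime l" "l dvd q" for l
  proof (cases "l dvd r")
    case False
    then have "l dvd p ^ k" using that rk(1) prime_dvd_mult_iff by blast
    then have "l dvd p" using that(1) prime_dvd_power by blast
    then show ?thesis using that(1) assms(1) primes_dvd_imp_eq by blast
  qed (use that rk in \<open>auto simp: supported_on_def\<close>)
  then show "q \<in> supported_on (insert p P)"
    using rk prime_gt_0_nat[OF assms(1)] by (simp add: supported_on_def)
qed

text \<open>\<open>F_0\<close> is present because the series runs over all natural numbers, while
  \<open>supported_on\<close> contains only positive ones.\<close>

locale multiplicative_summable =
  fixes F :: "nat \<Rightarrow> real"
  assumes F_1: "F (Suc 0) = 1" and F_0: "F 0 = 0"
    and F_mult: "\<And>a b. coprime a b \<Longrightarrow> 0 < a \<Longrightarrow> 0 < b \<Longrightarrow> F (a * b) = F a * F b"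
    and F_summable: "summable (\<lambda>q. \<bar>F q\<bar>)"
begin

lemma F_on: "F summable_on A" and F_abs_on: "(\<lambda>q. \<bar>F q\<bar>) summable_on A"
proof -
  have "F summable_on UNIV" using F_summable by (intro norm_summable_imp_summable_on) simp
  then show "F summable_on A" by (rule summable_on_subset) simp
  have "(\<lambda>q. \<bar>F q\<bar>) summable_on UNIV" using F_summable by (intro norm_summable_imp_summable_on) simp
  then show "(\<lambda>q. \<bar>F q\<bar>) summable_on A" by (rule summable_on_subset) simp
qed

lemma infsum_nat_eq_suminf:
  assumes "G summable_on (UNIV :: nat set)"
  shows "infsum G UNIV = (suminf G :: real)"
  using has_sum_infsum[OF assms] by (intro sums_unique has_sum_imp_sums)

definition euler_factor :: "nat \<Rightarrow> real" where
  "euler_factor p = suminf (\<lambda>k. F (p ^ k))"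

lemma prime_power_summable_on:
  assumes "prime p"
  shows "(\<lambda>k. F (p ^ k)) summable_on UNIV"
proof -
  have "inj (\<lambda>k. p ^ k)" using prime_gt_1_nat[OF assms] by (auto simp: inj_on_def)
  then have "F summable_on range (\<lambda>k. p ^ k) \<longleftrightarrow> (F \<circ> (\<lambda>k. p ^ k)) summable_on UNIV" by (rule summable_on_reindex)
  then show ?thesis using F_on by (simp add: o_def)
qed

text \<open>Adding a prime \<open>p\<close> splits off the power of \<open>p\<close> by unique
  factorisation, and the resulting double sum factors.\<close>

lemma infsum_supported_on:
  assumes "finite P" "\<And>p. p \<in> P \<Longrightarrow> prime p"
  shows "infsum F (supported_on P) = (\<Prod>p\<in>P. euler_factor p)"
  using assms
proof (induction P rule: finite_induct)
  case empty
  then show ?case by (simp add: supported_on_empty F_1)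
next
  case (insert p P)
  have p: "prime p" using insert.prems by simp
  let ?g = "\<lambda>(q, k). q * p ^ k"
  have inj: "inj_on ?g (supported_on P \<times> UNIV)" by (rule inj_on_prime_power_mult[OF p insert.hyps(2)])
  have eq: "F (?g x) = (\<lambda>(q, k). F q * F (p ^ k)) x" if "x \<in> supported_on P \<times> UNIV" for x
  proof -
    obtain q k where x: "x = (q, k)" "q \<in> supported_on P" using \<open>x \<in> _\<close> by auto
    have "\<not> p dvd q" using x(2) p insert.hyps(2) by (auto simp: supported_on_def)
    then have "coprime q p" using p by (simp add: prime_imp_coprime coprime_commute)
    then have "coprime q (p ^ k)" by simp
    then show ?thesis using x prime_gt_0_nat[OF p] by (auto simp: supported_on_def intro: F_mult)
  qed
  have "F summable_on (?g ` (supported_on P \<times> UNIV))" by (rule F_on)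
  then have "(F \<circ> ?g) summable_on (supported_on P \<times> UNIV)" using summable_on_reindex[OF inj] by blast
  then have sm: "(\<lambda>(q, k). F q * F (p ^ k)) summable_on (supported_on P \<times> UNIV)"
    using eq by (subst summable_on_cong[of _ _ "F \<circ> ?g"]) auto
  have "infsum F (supported_on (insert p P)) = infsum (F \<circ> ?g) (supported_on P \<times> UNIV)"
    unfolding supported_on_insert[OF p insert.hyps(2)] by (rule infsum_reindex[OF inj])
  also have "\<dots> = infsum (\<lambda>(q, k). F q * F (p ^ k)) (supported_on P \<times> UNIV)"
    using eq by (intro infsum_cong) auto
  also have "\<dots> = infsum (\<lambda>q. infsum (\<lambda>k. F q * F (p ^ k)) UNIV) (supported_on P)"
    using infsum_Sigma'_banach[of "\<lambda>q k. F q * F (p ^ k)" "supported_on P" "\<lambda>_. UNIV"] sm by simp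
  also have "\<dots> = infsum F (supported_on P) * infsum (\<lambda>k. F (p ^ k)) UNIV"
    by (simp add: infsum_cmult_right' infsum_cmult_left')
  also have "infsum (\<lambda>k. F (p ^ k)) UNIV = euler_factor p"
    unfolding euler_factor_def by (rule infsum_nat_eq_suminf[OF prime_power_summable_on[OF p]])
  finally show ?case using insert by (simp add: mult.commute)
qed

text \<open>All \<open>q\<close> with \<open>1 \<le> q \<le> N\<close> are supported on the primes
  up to \<open>N\<close>, so the error is at most the tail of the absolute series beyond
  \<open>N\<close>.\<close>

lemma euler_product_limit:
  "(\<lambda>N. \<Prod>p\<le>N. if prime p then euler_factor p else 1) \<longlonglongrightarrow> suminf F"
proof -
  have prod: "(\<Prod>p\<le>N. if prime p then euler_factor p else 1) = infsum F (supported_on {p. p \<le> N \<and> prime p})" for N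
  proof -
    have "infsum F (supported_on {p. p \<le> N \<and> prime p}) = (\<Prod>p | p \<le> N \<and> prime p. euler_factor p)"
      by (rule infsum_supported_on) auto
    also have "\<dots> = (\<Prod>p\<le>N. if prime p then euler_factor p else 1)"
      by (rule prod.mono_neutral_cong_left) auto
    finally show ?thesis by simp
  qed
  have bound: "\<bar>(\<Prod>p\<le>N. if prime p then euler_factor p else 1) - suminf F\<bar> \<le>
      suminf (\<lambda>q. \<bar>F q\<bar>) - (\<Sum>q\<le>N. \<bar>F q\<bar>)" for N
  proof -
    define S where "S = supported_on {p. p \<le> N \<and> prime p}"
    have S: "q \<in> S" if "0 < q" "q \<le> N" for q
      using that unfolding S_def supported_on_def by (auto dest: dvd_imp_le)
    have "suminf F - infsum F S = infsum F (UNIV - S)"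
      using infsum_Diff[of F UNIV S] F_on by (simp add: infsum_nat_eq_suminf)
    moreover have "\<bar>infsum F (UNIV - S)\<bar> \<le> infsum (\<lambda>q. \<bar>F q\<bar>) (UNIV - S)"
      using norm_infsum_bound[of F "UNIV - S"] F_abs_on by simp
    moreover have "infsum (\<lambda>q. \<bar>F q\<bar>) (UNIV - S) \<le> infsum (\<lambda>q. \<bar>F q\<bar>) (UNIV - {..N})"
    proof (rule infsum_mono_neutral[OF F_abs_on F_abs_on])
      fix q assume "q \<in> UNIV - S - (UNIV - {..N})"
      then have "q = 0" using S[of q] by (cases "q = 0") auto
      then show "\<bar>F q\<bar> \<le> 0" by (simp add: F_0)
    qed auto
    moreover have "infsum (\<lambda>q. \<bar>F q\<bar>) (UNIV - {..N}) = suminf (\<lambda>q. \<bar>F q\<bar>) - (\<Sum>q\<le>N. \<bar>F q\<bar>)"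
      using infsum_Diff[of "\<lambda>q. \<bar>F q\<bar>" UNIV "{..N}"] F_abs_on by (simp add: infsum_nat_eq_suminf)
    ultimately show ?thesis unfolding prod S_def[symmetric] by linarith
  qed
  have "(\<lambda>N. suminf (\<lambda>q. \<bar>F q\<bar>) - (\<Sum>q\<le>N. \<bar>F q\<bar>)) \<longlonglongrightarrow> suminf (\<lambda>q. \<bar>F q\<bar>) - suminf (\<lambda>q. \<bar>F q\<bar>)"
    using summable_LIMSEQ'[OF F_summable] by (intro tendsto_diff tendsto_const)
  then have lim0: "(\<lambda>N. suminf (\<lambda>q. \<bar>F q\<bar>) - (\<Sum>q\<le>N. \<bar>F q\<bar>)) \<longlonglongrightarrow> 0" by simp
  have "(\<lambda>N. (\<Prod>p\<le>N. if prime p then euler_factor p else 1) - suminf F) \<longlonglongrightarrow> 0"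
    by (rule Lim_null_comparison[OF _ lim0]) (use bound in auto)
  then show ?thesis by (simp add: LIM_zero_iff)
qed

text \<open>A limit of the partial products is not enough: \<open>convergent_prod\<close> asks for a
  nonzero limit once finitely many factors are dropped. Absolute convergence gives it, since the
  prime powers \<open>p ^ Suc k\<close> are distinct and the deviations of the factors from 1 are
  bounded by a part of the absolute series.\<close>

lemma euler_product_convergent: "convergent_prod (\<lambda>p. if prime p then euler_factor p else 1)"
proof -
  let ?P = "{p::nat. prime p}"
  let ?g = "\<lambda>(p, k). p ^ Suc k :: nat"
  have inj: "inj_on ?g (?P \<times> UNIV)"
  proof (rule inj_onI, clarify)
    fix p k p' k' :: nat assume p: "prime p" "prime p'" and eq: "p ^ Suc k = p' ^ Suc k'"
    have "p dvd p' ^ Suc k'" using eq by (metis dvd_triv_left power_Suc)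
    then have "p dvd p'" using p(1) prime_dvd_power by blast
    then have pp: "p = p'" using p primes_dvd_imp_eq by blast
    then show "p = p' \<and> k = k'" using eq prime_gt_1_nat[OF p(1)] power_inject_exp[of p "Suc k" "Suc k'"] by simp
  qed
  have "((\<lambda>q. \<bar>F q\<bar>) \<circ> ?g) summable_on (?P \<times> UNIV)"
    using summable_on_reindex[OF inj, of "\<lambda>q. \<bar>F q\<bar>"] F_abs_on by blast
  then have sm: "(\<lambda>(p, k). \<bar>F (p ^ Suc k)\<bar>) summable_on (?P \<times> UNIV)"
    by (simp add: o_def case_prod_unfold)
  define e where "e p = infsum (\<lambda>k. \<bar>F (p ^ Suc k)\<bar>) UNIV" for p
  have "e summable_on ?P"
    unfolding e_def using summable_on_Sigma_banach[of "\<lambda>p k. \<bar>F (p ^ Suc k)\<bar>" ?P "\<lambda>_. UNIV"] sm by simp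
  moreover have "e summable_on ?P \<longleftrightarrow> (\<lambda>p. if prime p then e p else 0) summable_on UNIV"
    by (rule summable_on_cong_neutral) auto
  ultimately have "(\<lambda>p. if prime p then e p else 0) summable_on UNIV" by simp
  then have sum_e: "summable (\<lambda>p. if prime p then e p else 0)" by (rule summable_on_imp_summable)
  have le: "\<bar>euler_factor p - 1\<bar> \<le> e p" if p: "prime p" for p
  proof -
    have s: "summable (\<lambda>k. F (p ^ k))" using prime_power_summable_on[OF p] by (rule summable_on_imp_summable)
    have "inj (\<lambda>k. p ^ Suc k)" using prime_gt_1_nat[OF p] by (auto simp: inj_on_def)
    then have "(\<lambda>q. \<bar>F q\<bar>) summable_on range (\<lambda>k. p ^ Suc k) \<longleftrightarrow> ((\<lambda>q. \<bar>F q\<bar>) \<circ> (\<lambda>k. p ^ Suc k)) summable_on UNIV"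
      by (rule summable_on_reindex)
    then have on: "(\<lambda>k. \<bar>F (p ^ Suc k)\<bar>) summable_on UNIV" using F_abs_on by (simp add: o_def)
    then have sa: "summable (\<lambda>k. \<bar>F (p ^ Suc k)\<bar>)" by (rule summable_on_imp_summable)
    have "euler_factor p - 1 = suminf (\<lambda>k. F (p ^ Suc k))"
      unfolding euler_factor_def using suminf_split_head[OF s] F_1 by simp
    also have "\<bar>\<dots>\<bar> \<le> suminf (\<lambda>k. \<bar>F (p ^ Suc k)\<bar>)" by (rule summable_rabs[OF sa])
    also have "\<dots> = e p" unfolding e_def by (rule infsum_nat_eq_suminf[OF on, symmetric])
    finally show ?thesis .
  qed
  have "summable (\<lambda>p. norm ((if prime p then euler_factor p else 1) - 1))"
    by (rule summable_comparison_test[OF _ sum_e]) (use le in auto)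
  then have "abs_convergent_prod (\<lambda>p. if prime p then euler_factor p else 1)"
    by (simp add: abs_convergent_prod_conv_summable)
  then show ?thesis by (rule abs_convergent_prod_imp_convergent_prod)
qed

lemma euler_product: "prodinf (\<lambda>p. if prime p then euler_factor p else 1) = suminf F"
  using LIMSEQ_unique[OF convergent_prod_LIMSEQ[OF euler_product_convergent] euler_product_limit] .

end

lemma singular_series:
  fixes f :: "('n::finite) int_mpoly"
  assumes s: "summable (\<lambda>q. \<bar>arith_coeff f q / real q\<bar>)"
  shows "prime p \<Longrightarrow> convergent (local_average f p)"
    and "convergent_prod (\<lambda>p. if prime p then (1 - 1 / real p) * lim (local_average f p) else 1)"
    and "prodinf (\<lambda>p. if prime p then (1 - 1 / real p) * lim (local_average f p) else 1) =
      suminf (\<lambda>q. arith_coeff f q / real q)"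
proof -
  interpret multiplicative_summable "\<lambda>q. arith_coeff f q / real q"
    by standard (use s in \<open>auto simp: arith_coeff_mult\<close>)
  have lim: "local_average f p \<longlonglongrightarrow> euler_factor p / (1 - 1 / real p)" if "prime p" for p
    using local_average_limit(2)[OF that s] by (simp add: euler_factor_def)
  show "convergent (local_average f p)" if "prime p" for p
    using lim[OF that] by (rule convergentI)
  have "(1 - 1 / real p) * lim (local_average f p) = euler_factor p" if "prime p" for p
    using limI[OF lim[OF that]] prime_gt_1_nat[OF that] by simp
  then have eq: "(\<lambda>p. if prime p then (1 - 1 / real p) * lim (local_average f p) else 1) =
      (\<lambda>p. if prime p then euler_factor p else 1)" by auto
  show "convergent_prod (\<lambda>p. if prime p then (1 - 1 / real p) * lim (local_average f p) else 1)"
    unfolding eq by (rule euler_product_convergent)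
  show "prodinf (\<lambda>p. if prime p then (1 - 1 / real p) * lim (local_average f p) else 1) =
      suminf (\<lambda>q. arith_coeff f q / real q)"
    unfolding eq by (rule euler_product)
qed

section \<open>Lattice points in residue classes\<close>

lemma lattice_points_cbox:
  fixes a a' :: "real ^ 'n::finite"
  assumes "0 < P"
  shows "lattice_points (cbox a a') P = {x. \<forall>i. x $ i \<in> {\<lceil>P * a $ i\<rceil>..\<lfloor>P * a' $ i\<rfloor>}}"
proof (intro set_eqI iffI)
  fix x assume "x \<in> lattice_points (cbox a a') P"
  then obtain t where t: "t \<in> cbox a a'" "(\<chi> i. real_of_int (x $ i)) = P *\<^sub>R t"
    by (auto simp: lattice_points_def)
  have "real_of_int (x $ i) = P * t $ i" for i using arg_cong[OF t(2), of "\<lambda>v. v $ i"] by simp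
  moreover have "P * a $ i \<le> P * t $ i \<and> P * t $ i \<le> P * a' $ i" for i
    using t(1) assms by (auto simp: mem_box_cart)
  ultimately show "x \<in> {x. \<forall>i. x $ i \<in> {\<lceil>P * a $ i\<rceil>..\<lfloor>P * a' $ i\<rfloor>}}"
    by (simp add: ceiling_le_iff le_floor_iff)
next
  fix x assume "x \<in> {x. \<forall>i. x $ i \<in> {\<lceil>P * a $ i\<rceil>..\<lfloor>P * a' $ i\<rfloor>}}"
  then have x: "P * a $ i \<le> real_of_int (x $ i)" "real_of_int (x $ i) \<le> P * a' $ i" for i
    by (auto simp: ceiling_le_iff le_floor_iff)
  define t :: "real ^ 'n" where "t = (\<chi> i. real_of_int (x $ i) / P)"
  have "t \<in> cbox a a'" using x assms by (auto simp: mem_box_cart t_def field_simps)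
  moreover have "(\<chi> i. real_of_int (x $ i)) = P *\<^sub>R t" using assms by (simp add: t_def vec_eq_iff)
  ultimately show "x \<in> lattice_points (cbox a a') P" by (auto simp: lattice_points_def)
qed

lemma card_int_interval_cong:
  fixes \<alpha> \<beta> :: real and t :: int
  assumes "\<alpha> \<le> \<beta>" "0 < q"
  shows "\<bar>real (card {k\<in>{\<lceil>\<alpha>\<rceil>..\<lfloor>\<beta>\<rfloor>}. [k = t] (mod (int q))}) - (\<beta> - \<alpha>) / real q\<bar> \<le> 1"
proof -
  define x where "x = (\<alpha> - of_int t) / real q"
  define y where "y = (\<beta> - of_int t) / real q"
  have xy: "x \<le> y" using assms by (simp add: x_def y_def divide_right_mono)
  have "{k\<in>{\<lceil>\<alpha>\<rceil>..\<lfloor>\<beta>\<rfloor>}. [k = t] (mod (int q))} = (\<lambda>j. t + int q * j) ` {\<lceil>x\<rceil>..\<lfloor>y\<rfloor>}"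
  proof (intro set_eqI iffI)
    fix k assume k: "k \<in> {k\<in>{\<lceil>\<alpha>\<rceil>..\<lfloor>\<beta>\<rfloor>}. [k = t] (mod (int q))}"
    then have "[t = k] (mod (int q))" by (simp add: cong_sym_eq)
    then obtain j where j: "k = t + int q * j" unfolding cong_iff_lin by blast
    then have "real_of_int k = of_int t + real q * of_int j" by simp
    moreover have "\<alpha> \<le> of_int k" "of_int k \<le> \<beta>" using k by (auto simp: ceiling_le_iff le_floor_iff)
    ultimately have "x \<le> of_int j" "of_int j \<le> y" using assms by (auto simp: x_def y_def field_simps)
    then show "k \<in> (\<lambda>j. t + int q * j) ` {\<lceil>x\<rceil>..\<lfloor>y\<rfloor>}" using j by (auto simp: ceiling_le_iff le_floor_iff)
  next
    fix k assume "k \<in> (\<lambda>j. t + int q * j) ` {\<lceil>x\<rceil>..\<lfloor>y\<rfloor>}"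
    then obtain j where "j \<in> {\<lceil>x\<rceil>..\<lfloor>y\<rfloor>}" "k = t + int q * j" by blast
    then have j: "k = t + int q * j" "x \<le> of_int j" "of_int j \<le> y"
      by (auto simp: ceiling_le_iff le_floor_iff)
    have "real_of_int k = of_int t + real q * of_int j" using j by simp
    moreover have "\<alpha> - of_int t \<le> real q * of_int j" "real q * of_int j \<le> \<beta> - of_int t"
      using j(2,3) assms by (auto simp: x_def y_def field_simps)
    ultimately have "\<alpha> \<le> of_int k" "of_int k \<le> \<beta>" by linarith+
    moreover have "[t = k] (mod (int q))" using j(1) unfolding cong_iff_lin by blast
    ultimately show "k \<in> {k\<in>{\<lceil>\<alpha>\<rceil>..\<lfloor>\<beta>\<rfloor>}. [k = t] (mod (int q))}"
      by (simp add: ceiling_le_iff le_floor_iff cong_sym_eq)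
  qed
  moreover have "inj_on (\<lambda>j. t + int q * j) {\<lceil>x\<rceil>..\<lfloor>y\<rfloor>}" using assms by (auto simp: inj_on_def)
  ultimately have "card {k\<in>{\<lceil>\<alpha>\<rceil>..\<lfloor>\<beta>\<rfloor>}. [k = t] (mod (int q))} = nat (\<lfloor>y\<rfloor> - \<lceil>x\<rceil> + 1)"
    by (simp add: card_image)
  \<comment> \<open>An interval without integers gives exactly 0 here, so \<open>nat\<close> does
    not truncate.\<close>
  moreover have "0 \<le> \<lfloor>y\<rfloor> - \<lceil>x\<rceil> + 1" using xy by linarith
  ultimately have "real (card {k\<in>{\<lceil>\<alpha>\<rceil>..\<lfloor>\<beta>\<rfloor>}. [k = t] (mod (int q))}) = of_int (\<lfloor>y\<rfloor> - \<lceil>x\<rceil> + 1)" by simp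
  moreover have "\<bar>of_int (\<lfloor>y\<rfloor> - \<lceil>x\<rceil> + 1) - (y - x)\<bar> \<le> 1" by linarith
  moreover have "y - x = (\<beta> - \<alpha>) / real q" by (simp add: x_def y_def diff_divide_distrib)
  ultimately show ?thesis by simp
qed

text \<open>One factor is exchanged at a time. Both sides carry an extra \<open>M\<close>, which
  avoids the exponent \<open>card A - 1\<close>.\<close>

lemma prod_diff_bound:
  fixes c v :: "'i \<Rightarrow> real"
  assumes "finite A" "1 \<le> M" "\<And>i. i \<in> A \<Longrightarrow> 0 \<le> c i \<and> c i \<le> M \<and> 0 \<le> v i \<and> v i \<le> M \<and> \<bar>c i - v i\<bar> \<le> 1"
  shows "\<bar>(\<Prod>i\<in>A. c i) - (\<Prod>i\<in>A. v i)\<bar> * M \<le> real (card A) * M ^ card A"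
  using assms(1,3)
proof (induction A rule: finite_induct)
  case (insert j A)
  have v: "\<bar>\<Prod>i\<in>A. v i\<bar> \<le> M ^ card A"
  proof -
    have "(\<Prod>i\<in>A. v i) \<le> (\<Prod>i\<in>A. M)" using insert.prems by (intro prod_mono) auto
    moreover have "0 \<le> (\<Prod>i\<in>A. v i)" using insert.prems by (intro prod_nonneg) auto
    ultimately show ?thesis by simp
  qed
  have "(\<Prod>i\<in>insert j A. c i) - (\<Prod>i\<in>insert j A. v i) =
      c j * ((\<Prod>i\<in>A. c i) - (\<Prod>i\<in>A. v i)) + (c j - v j) * (\<Prod>i\<in>A. v i)"
    using insert.hyps by (simp add: algebra_simps)
  then have "\<bar>(\<Prod>i\<in>insert j A. c i) - (\<Prod>i\<in>insert j A. v i)\<bar> \<le>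
      \<bar>c j\<bar> * \<bar>(\<Prod>i\<in>A. c i) - (\<Prod>i\<in>A. v i)\<bar> + \<bar>c j - v j\<bar> * \<bar>\<Prod>i\<in>A. v i\<bar>"
    by (metis abs_mult abs_triangle_ineq)
  also have "\<dots> \<le> M * \<bar>(\<Prod>i\<in>A. c i) - (\<Prod>i\<in>A. v i)\<bar> + 1 * M ^ card A"
    using insert.prems[of j] v by (intro add_mono mult_mono) auto
  finally have "\<bar>(\<Prod>i\<in>insert j A. c i) - (\<Prod>i\<in>insert j A. v i)\<bar> * M \<le>
      (M * \<bar>(\<Prod>i\<in>A. c i) - (\<Prod>i\<in>A. v i)\<bar> + M ^ card A) * M"
    using assms(2) by (intro mult_right_mono) auto
  also have "\<dots> = M * (\<bar>(\<Prod>i\<in>A. c i) - (\<Prod>i\<in>A. v i)\<bar> * M) + M ^ Suc (card A)" by (simp add: algebra_simps)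
  also have "\<dots> \<le> M * (real (card A) * M ^ card A) + M ^ Suc (card A)"
    using insert.IH insert.prems assms(2) by (intro add_mono mult_left_mono) auto
  also have "\<dots> = real (card (insert j A)) * M ^ card (insert j A)"
    using insert.hyps by (simp add: algebra_simps)
  finally show ?case .
qed simp

locale scaled_box =
  fixes a a' :: "real ^ 'n::finite" and P :: real
  assumes box: "\<And>i. a $ i \<le> a' $ i" "\<And>i. a' $ i - a $ i \<le> 1" and P: "1 \<le> P"
begin

definition "points = lattice_points (cbox a a') P"
definition "vol = (\<Prod>i\<in>UNIV. a' $ i - a $ i)"

lemma points_eq: "points = {x. \<forall>i. x $ i \<in> {\<lceil>P * a $ i\<rceil>..\<lfloor>P * a' $ i\<rfloor>}}"
  unfolding points_def using P by (intro lattice_points_cbox) simp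

lemma points_boxes: "points \<in> boxes (nat \<lfloor>P\<rfloor> + 1)"
proof -
  have "\<lfloor>P * a' $ i\<rfloor> - \<lceil>P * a $ i\<rceil> < int (nat \<lfloor>P\<rfloor> + 1)" for i
  proof -
    have "P * (a' $ i - a $ i) \<le> P * 1" using box[of i] P by (intro mult_left_mono) auto
    then have "P * a' $ i - P * a $ i \<le> P" by (simp add: right_diff_distrib)
    then have "of_int (\<lfloor>P * a' $ i\<rfloor> - \<lceil>P * a $ i\<rceil>) \<le> P" by linarith
    then have "\<lfloor>P * a' $ i\<rfloor> - \<lceil>P * a $ i\<rceil> \<le> \<lfloor>P\<rfloor>" by (simp add: le_floor_iff)
    then show ?thesis using P by simp
  qed
  then show ?thesis
    unfolding points_eq boxes_def
    by (intro CollectI exI[of _ "\<lambda>i. \<lceil>P * a $ i\<rceil>"] exI[of _ "\<lambda>i. \<lfloor>P * a' $ i\<rfloor>"] conjI refl allI)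
qed

lemma finite_points: "finite points"
  by (rule finite_boxes[OF points_boxes])

lemma vol_bounds: "0 \<le> vol" "vol \<le> 1"
proof -
  show "0 \<le> vol" unfolding vol_def using box by (intro prod_nonneg) simp
  show "vol \<le> 1" unfolding vol_def using box by (intro prod_le_1) simp
qed

lemma card_points_cong:
  assumes q: "0 < q"
  shows "\<bar>real (card {x\<in>points. \<forall>i. [x $ i = t $ i] (mod (int q))}) - vol * (P / real q) ^ CARD('n)\<bar> * (P / real q + 1)
    \<le> real CARD('n) * (P / real q + 1) ^ CARD('n)"
proof -
  define c where "c i = real (card {k\<in>{\<lceil>P * a $ i\<rceil>..\<lfloor>P * a' $ i\<rfloor>}. [k = t $ i] (mod (int q))})" for i
  define v where "v i = (a' $ i - a $ i) * (P / real q)" for i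
  define K where "K i = {k\<in>{\<lceil>P * a $ i\<rceil>..\<lfloor>P * a' $ i\<rfloor>}. [k = t $ i] (mod (int q))}" for i
  have "finite (K i)" for i
    by (rule finite_subset[of _ "{\<lceil>P * a $ i\<rceil>..\<lfloor>P * a' $ i\<rfloor>}"]) (auto simp: K_def)
  then have "card {x. \<forall>i. x $ i \<in> K i} = (\<Prod>i\<in>UNIV. card (K i))"
    using card_vec_box[of K] by blast
  moreover have "{x\<in>points. \<forall>i. [x $ i = t $ i] (mod (int q))} = {x. \<forall>i. x $ i \<in> K i}"
    by (auto simp: points_eq K_def)
  ultimately have 1: "real (card {x\<in>points. \<forall>i. [x $ i = t $ i] (mod (int q))}) = (\<Prod>i\<in>UNIV. c i)"
    by (simp add: c_def K_def)
  have 2: "vol * (P / real q) ^ CARD('n) = (\<Prod>i\<in>UNIV. v i)"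
    by (simp only: vol_def v_def prod.distrib prod_constant)
  have cv: "\<bar>c i - v i\<bar> \<le> 1" for i
  proof -
    have "P * a $ i \<le> P * a' $ i" using box[of i] P by (intro mult_left_mono) auto
    moreover have "(P * a' $ i - P * a $ i) / real q = v i"
      by (simp add: v_def right_diff_distrib[symmetric] mult.commute)
    ultimately show ?thesis
      using card_int_interval_cong[OF _ q, of "P * a $ i" "P * a' $ i" "t $ i"] by (simp only: c_def)
  qed
  have v: "0 \<le> v i" "v i \<le> P / real q" for i
  proof -
    show "0 \<le> v i" using box[of i] P by (simp add: v_def)
    have "v i \<le> 1 * (P / real q)" unfolding v_def using box[of i] P by (intro mult_right_mono) auto
    then show "v i \<le> P / real q" by simp
  qed
  show ?thesis
    unfolding 1 2
  proof (rule prod_diff_bound)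
    fix i
    show "0 \<le> c i \<and> c i \<le> P / real q + 1 \<and> 0 \<le> v i \<and> v i \<le> P / real q + 1 \<and> \<bar>c i - v i\<bar> \<le> 1"
      using cv[of i] v[of i] by (auto simp: c_def)
  qed (use P in auto)
qed

text \<open>Each of the \<open>q ^ n\<close> residue classes has its expected share of points up to
  \<open>O((P / q + 1) ^ (n - 1))\<close>, which adds up to \<open>O(q * (P + q) ^ (n - 1))\<close>.
  The factor \<open>P + q\<close> on the left again replaces the exponent
  \<open>n - 1\<close>.\<close>

lemma points_sum_periodic:
  fixes F :: "int ^ 'n \<Rightarrow> real"
  assumes q: "0 < q" and F: "periodic_mod q F" "\<And>x. \<bar>F x\<bar> \<le> C"
  shows "\<bar>(\<Sum>x\<in>points. F x) - vol * P ^ CARD('n) * residue_mean q F\<bar> * (P + real q) \<le>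
    real CARD('n) * C * real q * (P + real q) ^ CARD('n)"
proof -
  let ?n = "CARD('n)"
  let ?N = "\<lambda>t. real (card {x\<in>points. \<forall>i. [x $ i = t $ i] (mod (int q))})"
  define red where "red x = (\<chi> i. x $ i mod int q)" for x :: "int ^ 'n"
  have red: "red x \<in> residue_vecs q" for x using q by (simp add: red_def residue_vecs_def)
  have red_eq: "red x = t \<longleftrightarrow> (\<forall>i. [x $ i = t $ i] (mod (int q)))" if "t \<in> residue_vecs q" for x t :: "int ^ 'n"
    using that by (auto simp: red_def residue_vecs_def vec_eq_iff cong_def)
  have "(\<Sum>x\<in>points. F x) = (\<Sum>t\<in>residue_vecs q. \<Sum>x\<in>{x\<in>points. red x = t}. F x)"
    using red finite_points by (intro sum.group[symmetric]) auto
  also have "\<dots> = (\<Sum>t\<in>residue_vecs q. \<Sum>x\<in>{x\<in>points. \<forall>i. [x $ i = t $ i] (mod (int q))}. F t)"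
  proof (rule sum.cong[OF refl])
    fix t :: "int ^ 'n" assume t: "t \<in> residue_vecs q"
    show "(\<Sum>x\<in>{x\<in>points. red x = t}. F x) = (\<Sum>x\<in>{x\<in>points. \<forall>i. [x $ i = t $ i] (mod (int q))}. F t)"
    proof (rule sum.cong)
      show "{x\<in>points. red x = t} = {x\<in>points. \<forall>i. [x $ i = t $ i] (mod (int q))}"
        using red_eq[OF t] by blast
      fix x assume "x \<in> {x\<in>points. \<forall>i. [x $ i = t $ i] (mod (int q))}"
      then show "F x = F t" using F(1) unfolding periodic_mod_def by blast
    qed
  qed
  finally have s: "(\<Sum>x\<in>points. F x) = (\<Sum>t\<in>residue_vecs q. ?N t * F t)" by simp
  have m: "vol * P ^ ?n * residue_mean q F = (\<Sum>t\<in>residue_vecs q. vol * (P / real q) ^ ?n * F t)"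
    unfolding residue_mean_def sum_distrib_left[symmetric] by (simp add: power_divide)
  have "\<bar>(\<Sum>x\<in>points. F x) - vol * P ^ ?n * residue_mean q F\<bar> * (P / real q + 1) =
      \<bar>\<Sum>t\<in>residue_vecs q. (?N t - vol * (P / real q) ^ ?n) * F t\<bar> * (P / real q + 1)"
    unfolding s m by (simp only: sum_subtractf[symmetric] left_diff_distrib)
  also have "\<dots> \<le> (\<Sum>t\<in>residue_vecs q. \<bar>(?N t - vol * (P / real q) ^ ?n) * F t\<bar>) * (P / real q + 1)"
    using P by (intro mult_right_mono sum_abs) auto
  also have "\<dots> = (\<Sum>t\<in>residue_vecs q. (\<bar>?N t - vol * (P / real q) ^ ?n\<bar> * (P / real q + 1)) * \<bar>F t\<bar>)"
    unfolding sum_distrib_right by (rule sum.cong[OF refl]) (simp only: abs_mult mult_ac)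
  also have "\<dots> \<le> (\<Sum>t\<in>(residue_vecs q :: (int ^ 'n) set). (real ?n * (P / real q + 1) ^ ?n) * C)"
    using P by (intro sum_mono mult_mono card_points_cong q F) auto
  also have "\<dots> = real ?n * C * (real q * (P / real q + 1)) ^ ?n"
    by (simp add: card_residue_vecs power_mult_distrib)
  also have "real q * (P / real q + 1) = P + real q" using q by (simp add: distrib_left)
  finally have "\<bar>(\<Sum>x\<in>points. F x) - vol * P ^ ?n * residue_mean q F\<bar> * (P / real q + 1) \<le> real ?n * C * (P + real q) ^ ?n" .
  then have le: "\<bar>(\<Sum>x\<in>points. F x) - vol * P ^ ?n * residue_mean q F\<bar> * (P / real q + 1) * real q \<le>
     real ?n * C * (P + real q) ^ ?n * real q"
    by (rule mult_right_mono) simp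
  have e: "(P / real q + 1) * real q = P + real q" using q by (simp add: distrib_right)
  have "\<bar>(\<Sum>x\<in>points. F x) - vol * P ^ ?n * residue_mean q F\<bar> * (P + real q) =
      \<bar>(\<Sum>x\<in>points. F x) - vol * P ^ ?n * residue_mean q F\<bar> * (P / real q + 1) * real q"
    by (simp only: mult.assoc e)
  also note le
  also have "real ?n * C * (P + real q) ^ ?n * real q = real ?n * C * real q * (P + real q) ^ ?n" by simp
  finally show ?thesis .
qed

end

section \<open>Bounds for sums of Ramanujan sums and for the arithmetic coefficients\<close>

lemma abs_ramanujan_le: "\<bar>ramanujan q m\<bar> \<le> real q"
proof -
  have "\<bar>ramanujan q m\<bar> \<le> (\<Sum>a | a < q \<and> coprime a q. \<bar>cos (2 * pi * (real a / real q * of_int m))\<bar>)"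
    unfolding ramanujan_def by (rule sum_abs)
  also have "\<dots> \<le> (\<Sum>a | a < q \<and> coprime a q. 1)" by (intro sum_mono) (simp add: abs_cos_le_one)
  also have "\<dots> = real (card {a. a < q \<and> coprime a q})" by simp
  also have "\<dots> \<le> real (card {..<q})" by (intro of_nat_mono card_mono) auto
  finally show ?thesis by simp
qed

lemma sum_ramanujan_le_expsum:
  assumes "finite X" and "\<And>a. a < q \<Longrightarrow> coprime a q \<Longrightarrow> norm (expsum (real a / real q) u X) \<le> B" and "0 \<le> B"
  shows "\<bar>\<Sum>x\<in>X. ramanujan q (u x)\<bar> \<le> real q * B"
proof -
  have eq: "complex_of_real (\<Sum>x\<in>X. ramanujan q (u x)) = (\<Sum>a | a < q \<and> coprime a q. expsum (real a / real q) u X)"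
    unfolding expsum_def by (subst sum.swap) (simp add: of_real_ramanujan ramanujan_complex_def)
  have "\<bar>\<Sum>x\<in>X. ramanujan q (u x)\<bar> = norm (complex_of_real (\<Sum>x\<in>X. ramanujan q (u x)))"
    by (simp only: norm_of_real)
  also have "\<dots> = norm (\<Sum>a | a < q \<and> coprime a q. expsum (real a / real q) u X)"
    by (simp only: eq)
  also have "\<dots> \<le> (\<Sum>a | a < q \<and> coprime a q. norm (expsum (real a / real q) u X))" by (rule norm_sum)
  also have "\<dots> \<le> (\<Sum>a | a < q \<and> coprime a q. B)" using assms(2) by (intro sum_mono) auto
  also have "\<dots> = real (card {a. a < q \<and> coprime a q}) * B" by simp
  also have "\<dots> \<le> real q * B"
  proof -
    have "card {a. a < q \<and> coprime a q} \<le> card {..<q}" by (intro card_mono) auto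
    then show ?thesis using assms(3) by (intro mult_right_mono) auto
  qed
  finally show ?thesis .
qed

lemma residue_vecs_boxes: "residue_vecs q \<in> boxes q"
  unfolding residue_vecs_def boxes_def
  by (rule CollectI, rule exI[of _ "\<lambda>_. 0"], rule exI[of _ "\<lambda>_. int q - 1"]) auto

text \<open>Only \<open>d \<ge> 2\<close>: in the linear case the exponential sums do not decay in \<open>q\<close>, but
  the arithmetic coefficients vanish eventually.\<close>
lemma weyl_ramanujan_bound:
  fixes f :: "('n::finite) int_mpoly" and Q0 \<epsilon> :: real
  assumes hom: "homogeneous_of_degree d f" and smooth: "smooth_form f" and d: "2 \<le> d"
    and n: "2 ^ d * (d - 1) < CARD('n)" and Q0: "0 < Q0" and \<epsilon>: "0 < \<epsilon>"
  shows "\<exists>C>0. \<forall>N\<ge>1. \<forall>q\<ge>1. real q ^ 2 \<le> Q0 * real N ^ d \<longrightarrow>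
    (\<forall>X\<in>boxes N. \<bar>\<Sum>x\<in>X. ramanujan q (mpoly_eval f x)\<bar> \<le>
       C * real N powr (real CARD('n) + \<epsilon>) * real q powr (-1))"
proof -
  obtain k where "d = 2 + k" using d le_Suc_ex by blast
  then have k: "d = Suc (Suc k)" by simp
  obtain C where C: "0 < C" "\<forall>N\<ge>1. \<forall>q\<ge>1. \<forall>a. coprime a (int q) \<longrightarrow> real q ^ 2 \<le> Q0 * real N ^ d \<longrightarrow>
    (\<forall>X\<in>boxes N. norm (expsum (of_int a / real q) (mpoly_eval f) X) \<le>
       C * real N powr (real CARD('n) + \<epsilon>) * real q powr (-2))"
    using weyl_bound[OF hom smooth k n Q0 \<epsilon>] by (elim exE conjE) (rule that)
  show ?thesis
  proof (intro exI[of _ C] conjI allI impI ballI)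
    show "0 < C" by (rule C)
    fix N q :: nat and X :: "(int ^ 'n) set"
    assume N: "1 \<le> N" and q: "1 \<le> q" and qN: "real q ^ 2 \<le> Q0 * real N ^ d" and X: "X \<in> boxes N"
    have "\<bar>\<Sum>x\<in>X. ramanujan q (mpoly_eval f x)\<bar> \<le> real q * (C * real N powr (real CARD('n) + \<epsilon>) * real q powr (-2))"
    proof (rule sum_ramanujan_le_expsum[OF finite_boxes[OF X]])
      fix a assume "a < q" "coprime a q"
      then have "coprime (int a) (int q)" by simp
      from C(2)[rule_format, OF N q this qN X]
      show "norm (expsum (real a / real q) (mpoly_eval f) X) \<le> C * real N powr (real CARD('n) + \<epsilon>) * real q powr (-2)"
        by simp
    qed (use C in simp)
    also have "\<dots> = C * real N powr (real CARD('n) + \<epsilon>) * (real q powr 1 * real q powr (-2))" using q by simp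
    also have "real q powr 1 * real q powr (-2) = real q powr (-1)" by (simp only: powr_add[symmetric]) simp
    finally show "\<bar>\<Sum>x\<in>X. ramanujan q (mpoly_eval f x)\<bar> \<le> C * real N powr (real CARD('n) + \<epsilon>) * real q powr (-1)" .
  qed
qed

text \<open>A complete set of residues is itself a box of side \<open>q\<close>, so Weyl's bound
  applies with \<open>N = q\<close>; the condition \<open>q ^ 2 \<le> q ^ d\<close> is where
  \<open>d \<ge> 2\<close> is used.\<close>

lemma arith_coeff_bound:
  fixes f :: "('n::finite) int_mpoly" and \<epsilon> :: real
  assumes hom: "homogeneous_of_degree d f" and smooth: "smooth_form f" and d: "2 \<le> d"
    and n: "2 ^ d * (d - 1) < CARD('n)" and \<epsilon>: "0 < \<epsilon>"
  shows "\<exists>C>0. \<forall>q\<ge>1. \<bar>arith_coeff f q\<bar> \<le> C * real q powr (\<epsilon> - 1)"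
proof -
  obtain C where C: "0 < C" "\<forall>N\<ge>1. \<forall>q\<ge>1. real q ^ 2 \<le> 1 * real N ^ d \<longrightarrow>
    (\<forall>X\<in>boxes N. \<bar>\<Sum>x\<in>X. ramanujan q (mpoly_eval f x)\<bar> \<le>
       C * real N powr (real CARD('n) + \<epsilon>) * real q powr (-1))"
    using weyl_ramanujan_bound[OF hom smooth d n zero_less_one \<epsilon>] by (elim exE conjE) (rule that)
  show ?thesis
  proof (intro exI[of _ C] conjI allI impI)
    show "0 < C" by (rule C)
    fix q :: nat assume q: "1 \<le> q"
    have "real q ^ 2 \<le> 1 * real q ^ d" using q d by (simp add: power_increasing)
    from C(2)[rule_format, OF q q this residue_vecs_boxes]
    have "\<bar>\<Sum>t\<in>residue_vecs q. ramanujan q (mpoly_eval f t)\<bar> \<le>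
        C * real q powr (real CARD('n) + \<epsilon>) * real q powr (-1)" .
    also have "\<dots> = C * (real q powr (real CARD('n) + \<epsilon>) * real q powr (-1))" by simp
    also have "real q powr (real CARD('n) + \<epsilon>) * real q powr (-1) = real q ^ CARD('n) * real q powr (\<epsilon> - 1)"
    proof -
      have "real CARD('n) + \<epsilon> + (-1) = real CARD('n) + (\<epsilon> - 1)" by simp
      then have "real q powr (real CARD('n) + \<epsilon>) * real q powr (-1) = real q powr real CARD('n) * real q powr (\<epsilon> - 1)"
        by (simp only: powr_add[symmetric])
      then show ?thesis using q by (simp add: powr_realpow)
    qed
    finally have "\<bar>\<Sum>t\<in>residue_vecs q. ramanujan q (mpoly_eval f t)\<bar> / real q ^ CARD('n) \<le> C * real q powr (\<epsilon> - 1)"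
      using q by (simp add: field_simps)
    then show "\<bar>arith_coeff f q\<bar> \<le> C * real q powr (\<epsilon> - 1)"
      by (simp add: arith_coeff_def residue_mean_def)
  qed
qed

lemma summable_powr_nat: "s < -1 \<Longrightarrow> summable (\<lambda>q. real q powr s)"
  using summable_real_powr_iff[of s] by simp

text \<open>Some coefficient \<open>b i\<close> is nonzero. For \<open>q\<close> beyond
  \<open>\<bar>b i\<bar>\<close> and \<open>a\<close> prime to \<open>q\<close>,
  \<open>a * b i\<close> is not divisible by \<open>q\<close>, so the complete sum over coordinate
  \<open>i\<close> is zero.\<close>

lemma linear_form_arith_coeff_eq_0:
  fixes f :: "('n::finite) int_mpoly"
  assumes hom: "homogeneous_of_degree (Suc 0) f" and smooth: "smooth_form f"
  shows "\<exists>q0. \<forall>q>q0. arith_coeff f q = 0"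
proof -
  interpret sym_multilinear "Suc 0" "polar f" by (rule polar_sym_multilinear[OF hom])
  \<comment> \<open>The partial derivatives of a linear form are constants, so the all-ones vector
    serves as the nonzero test point.\<close>
  have "\<exists>i. polar f [axis i 1] \<noteq> 0"
  proof (rule ccontr)
    assume "\<not> ?thesis"
    then have "mpoly_eval (mpoly_pderiv i f) ((\<chi> i. 1) :: int ^ 'n) = 0" for i
      using polar_gradient[OF hom, of 0 "\<chi> i. 1" i] by simp
    moreover have "mpoly_eval (mpoly_pderiv i f) ((\<chi> j. of_int (((\<chi> i. 1) :: int ^ 'n) $ j)) :: complex ^ 'n) =
        of_int (mpoly_eval (mpoly_pderiv i f) ((\<chi> i. 1) :: int ^ 'n))" for i
      by (rule mpoly_eval_of_int)
    ultimately have "mpoly_eval (mpoly_pderiv i f) ((\<chi> i. 1) :: complex ^ 'n) = 0" for i by simp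
    moreover have "(\<chi> i. 1) \<noteq> (0 :: complex ^ 'n)" by (simp add: vec_eq_iff)
    ultimately show False using smooth unfolding smooth_form_def by blast
  qed
  then obtain i where i: "polar f [axis i 1] \<noteq> 0" by blast
  define b where "b j = polar f [axis j 1]" for j
  have lin: "mpoly_eval f x = mpoly_eval f 0 + (\<Sum>j\<in>UNIV. x $ j * b j)" for x :: "int ^ 'n"
    using fdiffs_homogeneous_affine[OF hom, of "[]" x] M_expand[of "[]" x] by (simp add: b_def)
  show ?thesis
  proof (intro exI[of _ "nat \<bar>b i\<bar>"] allI impI)
    fix q :: nat assume q: "nat \<bar>b i\<bar> < q"
    have "expsum (real a / real q) (mpoly_eval f) (residue_vecs q) = 0" if a: "a < q" "coprime a q" for a
    proof -
      have nd: "\<not> int q dvd int a * b i"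
      proof
        assume "int q dvd int a * b i"
        then have "int q dvd b i" using a(2) by (simp add: coprime_commute coprime_dvd_mult_right_iff)
        then show False using q i zdvd_imp_le[of "int q" "\<bar>b i\<bar>"] by (auto simp: b_def)
      qed
      have "(\<Sum>t\<in>{0..int q - 1}. unit_exp (real a / real q * b i * of_int t)) =
          (\<Sum>t<q. unit_exp (real t / real q * of_int (int a * b i)))"
        by (rule sum.reindex_bij_witness[of _ int nat]) (auto simp: mult_ac)
      also have "\<dots> = 0" using unit_exp_complete_sum[of q "int a * b i"] nd q by simp
      finally have z: "(\<Sum>t\<in>{0..int q - 1}. unit_exp (real a / real q * b i * of_int t)) = 0" .
      have "residue_vecs q = {x :: int ^ 'n. \<forall>j. x $ j \<in> {0..int q - 1}}" by (auto simp: residue_vecs_def)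
      then have "expsum (real a / real q) (mpoly_eval f) (residue_vecs q) =
          unit_exp (real a / real q * of_int (mpoly_eval f 0)) *
          (\<Prod>j\<in>UNIV. \<Sum>t\<in>{0..int q - 1}. unit_exp (real a / real q * b j * of_int t))"
        using expsum_linear_prod[OF lin, of "real a / real q" "\<lambda>_. 0" "\<lambda>_. int q - 1"] by simp
      also have "(\<Prod>j\<in>UNIV. \<Sum>t\<in>{0..int q - 1}. unit_exp (real a / real q * b j * of_int t)) = 0"
        using z by (intro prod_zero) auto
      finally show ?thesis by simp
    qed
    then have "\<bar>\<Sum>t\<in>residue_vecs q. ramanujan q (mpoly_eval f t)\<bar> \<le> real q * 0"
      by (intro sum_ramanujan_le_expsum) auto
    then show "arith_coeff f q = 0" by (simp add: arith_coeff_def residue_mean_def)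
  qed
qed

lemma summable_arith_coeff:
  fixes f :: "('n::finite) int_mpoly"
  assumes hom: "homogeneous_of_degree d f" and smooth: "smooth_form f" and d: "1 \<le> d"
    and n: "2 ^ d * (d - 1) < CARD('n)"
  shows "summable (\<lambda>q. \<bar>arith_coeff f q / real q\<bar>)"
proof (cases "d = 1")
  case True
  then obtain q0 where "\<forall>q>q0. arith_coeff f q = 0"
    using linear_form_arith_coeff_eq_0 hom smooth by auto
  then show ?thesis by (intro summable_finite[of "{..q0}"]) auto
next
  case False
  then have d2: "2 \<le> d" using d by simp
  obtain C where C: "\<forall>q\<ge>1. \<bar>arith_coeff f q\<bar> \<le> C * real q powr (1/2 - 1)"
    using arith_coeff_bound[OF hom smooth d2 n, of "1/2"] by auto
  have "\<bar>arith_coeff f q / real q\<bar> \<le> C * real q powr (-3/2)" if "1 \<le> q" for q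
  proof -
    have "\<bar>arith_coeff f q / real q\<bar> = \<bar>arith_coeff f q\<bar> * real q powr (-1)"
      using that by (simp add: abs_mult powr_minus divide_inverse)
    also have "\<dots> \<le> C * real q powr (1/2 - 1) * real q powr (-1)"
      using C that by (intro mult_right_mono) auto
    also have "\<dots> = C * real q powr (-3/2)" by (simp only: mult.assoc powr_add[symmetric]) simp
    finally show ?thesis .
  qed
  then have "norm \<bar>arith_coeff f q / real q\<bar> \<le> C * real q powr (-3/2)" if "1 \<le> q" for q
    using that by simp
  moreover have "summable (\<lambda>q. C * real q powr (-3/2))"
    by (rule summable_mult[OF summable_powr_nat]) simp
  ultimately show ?thesis by (rule summable_comparison_test'[rotated])
qed

section \<open>Divisor bound and sublevel sets\<close>

lemma card_divisors_prime_power_mult: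
  assumes p: "prime p" and m: "\<not> p dvd m" "0 < m"
  shows "divisor_tau (p ^ k * m) = Suc k * divisor_tau m"
proof -
  have p0: "0 < p" using p by (simp add: prime_gt_0_nat)
  have "{d. d dvd p ^ k * m} = (\<lambda>(j, e). p ^ j * e) ` ({..k} \<times> {e. e dvd m})"
  proof (intro set_eqI iffI)
    fix d assume "d \<in> {d. d dvd p ^ k * m}"
    then obtain a b where ab: "d = a * b" "a dvd p ^ k" "b dvd m" by (auto elim: dvd_productE)
    then obtain j where "j \<le> k" "a = p ^ j" using divides_primepow_nat[OF p] by blast
    then show "d \<in> (\<lambda>(j, e). p ^ j * e) ` ({..k} \<times> {e. e dvd m})" using ab by auto
  next
    fix d assume "d \<in> (\<lambda>(j, e). p ^ j * e) ` ({..k} \<times> {e. e dvd m})"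
    then show "d \<in> {d. d dvd p ^ k * m}" by (auto intro!: mult_dvd_mono le_imp_power_dvd)
  qed
  moreover have "inj_on (\<lambda>(j, e). p ^ j * e) ({..k} \<times> {e. e dvd m})"
  proof (rule inj_onI, clarify)
    fix j e j' e' assume *: "e dvd m" "e' dvd m" "p ^ j * e = p ^ j' * e'"
    have nd: "\<not> p dvd e" "\<not> p dvd e'" using * m(1) dvd_trans by blast+
    have le: "i' \<le> i" if "p ^ i * a = p ^ i' * b" "\<not> p dvd a" for i i' a b
    proof (rule ccontr)
      assume "\<not> i' \<le> i"
      then obtain l where "i' = i + Suc l" using less_iff_Suc_add[of i i'] by auto
      then have "p ^ i * a = p ^ i * (p ^ Suc l * b)" using that(1) by (simp add: power_add mult_ac)
      then have "a = p ^ Suc l * b" using p0 by simp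
      then show False using that(2) by simp
    qed
    have "j = j'" using le[OF *(3) nd(1)] le[OF *(3)[symmetric] nd(2)] by simp
    then show "j = j' \<and> e = e'" using *(3) p0 by simp
  qed
  ultimately show ?thesis by (simp add: divisor_tau_def card_image card_cartesian_product)
qed

text \<open>Each prime contributes at most \<open>C\<close> to \<open>\<tau>(m) / m powr \<epsilon>\<close>, and the primes
  \<open>p \<ge> 2 powr (1 / \<epsilon>)\<close> contribute at most \<open>1\<close>.\<close>
lemma divisor_bound:
  fixes \<epsilon> :: real
  assumes \<epsilon>: "0 < \<epsilon>"
  shows "\<exists>C>0. \<forall>m\<ge>1. real (divisor_tau m) \<le> C * real m powr \<epsilon>"
proof -
  \<comment> \<open>From \<open>2 powr x \<ge> 1 + x * ln 2\<close> this gives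
    \<open>k + 1 \<le> C * 2 powr (\<epsilon> * k)\<close> for all \<open>k\<close>, the price of
    one prime up to \<open>Y\<close>.\<close>
  define C where "C = 2 / (\<epsilon> * ln 2) + 2"
  have ln2: "0 < ln (2 :: real)" by simp
  have C1: "1 \<le> C" using \<epsilon> by (simp add: C_def)
  have e2: "2 powr x \<ge> 1 + x * ln 2" for x :: real
    using exp_ge_add_one_self[of "x * ln 2"] by (simp add: powr_def)
  have pw: "real (Suc k) \<le> C * 2 powr (\<epsilon> * real k)" for k
  proof -
    have "real k * (\<epsilon> * ln 2) \<le> 2 powr (\<epsilon> * real k)" using e2[of "\<epsilon> * real k"] by (simp add: mult_ac)
    then have "real k \<le> 2 powr (\<epsilon> * real k) / (\<epsilon> * ln 2)" using \<epsilon> ln2 by (simp add: pos_le_divide_eq)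
    moreover have "1 \<le> 2 powr (\<epsilon> * real k)" using \<epsilon> by (simp add: ge_one_powr_ge_zero)
    moreover have "0 \<le> 2 powr (\<epsilon> * real k) / (\<epsilon> * ln 2)" using \<epsilon> ln2 by simp
    ultimately have "real (Suc k) \<le> 2 * (2 powr (\<epsilon> * real k) / (\<epsilon> * ln 2)) + 2 * 2 powr (\<epsilon> * real k)" by simp
    then show ?thesis by (simp add: C_def distrib_right)
  qed
  have pw': "real (Suc k) \<le> 2 ^ k" for k by (induction k) auto
  define Y where "Y = nat \<lceil>2 powr (1 / \<epsilon>)\<rceil>"
  \<comment> \<open>The primes that may cost a factor \<open>C\<close>; their number is bounded
    independently of \<open>m\<close>.\<close>
  define S where "S m = {p. prime p \<and> p dvd m \<and> p \<le> Y}" for m :: nat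
  have main: "real (divisor_tau m) \<le> C ^ card (S m) * real m powr \<epsilon>" if "0 < m" for m
    using that
  proof (induction m rule: less_induct)
    case (less m)
    show ?case
    proof (cases "m = 1")
      case True
      have "{d::nat. d dvd 1} = {1}" by auto
      then have "divisor_tau m = 1" using True by (simp add: divisor_tau_def)
      then show ?thesis using C1 True by simp
    next
      case False
      then obtain p where p: "prime p" "p dvd m" using prime_factor_nat by blast
      have p1: "1 < p" using prime_gt_1_nat[OF p(1)] .
      obtain r where r: "m = p ^ multiplicity p m * r" "\<not> p dvd r"
        using multiplicity_decompose'[of m p] less.prems p(1) by (metis not_prime_unit not_gr_zero)
      define k where "k = multiplicity p m"
      have mk: "m = p ^ k * r" using r(1) by (simp add: k_def)
      have k0: "k \<noteq> 0" using mk r(2) p(2) by (intro notI) simp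
      have r0: "0 < r" using mk less.prems by (auto intro: Nat.gr0I)
      have "1 < p ^ k" by (rule one_less_power[OF p1]) (use k0 in simp)
      then have "1 * r < p ^ k * r" using r0 by (intro mult_strict_right_mono)
      then have "r < m" by (simp add: mk)
      then have IH: "real (divisor_tau r) \<le> C ^ card (S r) * real r powr \<epsilon>" using less.IH r0 by blast
      have tau: "real (divisor_tau m) = real (Suc k) * real (divisor_tau r)"
        unfolding mk card_divisors_prime_power_mult[OF p(1) r(2) r0] by (rule of_nat_mult)
      have mp: "real m powr \<epsilon> = real p powr (\<epsilon> * real k) * real r powr \<epsilon>"
      proof -
        have "real m = real p powr real k * real r" using p1 by (simp add: mk powr_realpow)
        then show ?thesis by (simp add: powr_mult powr_powr mult.commute)
      qed
      have fin: "finite (S m)" by (rule finite_subset[of _ "{..Y}"]) (auto simp: S_def)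
      show ?thesis
      proof (cases "p \<le> Y")
        case True
        have "S r \<subseteq> S m" using mk by (auto simp: S_def)
        moreover have "p \<in> S m" "p \<notin> S r" using p True r(2) by (auto simp: S_def)
        ultimately have "card (S r) < card (S m)" using fin by (intro psubset_card_mono) auto
        then have card: "Suc (card (S r)) \<le> card (S m)" by simp
        have "2 powr (\<epsilon> * real k) \<le> real p powr (\<epsilon> * real k)" using p1 \<epsilon> by (intro powr_mono2) auto
        then have "real (Suc k) \<le> C * real p powr (\<epsilon> * real k)"
          using pw[of k] C1 by (meson mult_left_mono order_trans zero_le_one)
        then have "real (divisor_tau m) \<le> (C * real p powr (\<epsilon> * real k)) * (C ^ card (S r) * real r powr \<epsilon>)"
          unfolding tau using IH C1 by (intro mult_mono) auto
        also have "\<dots> = C ^ Suc (card (S r)) * real m powr \<epsilon>" by (simp add: mp)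
        also have "\<dots> \<le> C ^ card (S m) * real m powr \<epsilon>"
          using C1 card by (intro mult_right_mono power_increasing) auto
        finally show ?thesis .
      next
        case False
        then have "2 powr (1 / \<epsilon>) \<le> real p" unfolding Y_def by linarith
        then have "(2 powr (1 / \<epsilon>)) powr (\<epsilon> * real k) \<le> real p powr (\<epsilon> * real k)"
          using \<epsilon> by (intro powr_mono2) auto
        then have "2 ^ k \<le> real p powr (\<epsilon> * real k)" using \<epsilon> by (simp add: powr_powr powr_realpow)
        then have "real (Suc k) \<le> real p powr (\<epsilon> * real k)" using pw'[of k] by linarith
        then have "real (divisor_tau m) \<le> real p powr (\<epsilon> * real k) * (C ^ card (S r) * real r powr \<epsilon>)"
          unfolding tau using IH C1 by (intro mult_mono) auto
        also have "\<dots> = C ^ card (S r) * real m powr \<epsilon>" by (simp add: mp)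
        also have "\<dots> \<le> C ^ card (S m) * real m powr \<epsilon>"
        proof -
          have "S r \<subseteq> S m" using mk by (auto simp: S_def)
          then show ?thesis using C1 fin by (intro mult_right_mono power_increasing card_mono) auto
        qed
        finally show ?thesis .
      qed
    qed
  qed
  show ?thesis
  proof (intro exI[of _ "C ^ Suc Y"] conjI allI impI)
    show "0 < C ^ Suc Y" using C1 by simp
    fix m :: nat assume m: "1 \<le> m"
    have "card (S m) \<le> card {..Y}" by (intro card_mono) (auto simp: S_def)
    then have "C ^ card (S m) \<le> C ^ Suc Y" using C1 by (intro power_increasing) auto
    then have "C ^ card (S m) * real m powr \<epsilon> \<le> C ^ Suc Y * real m powr \<epsilon>" by (rule mult_right_mono) simp
    moreover have "real (divisor_tau m) \<le> C ^ card (S m) * real m powr \<epsilon>" by (rule main) (use m in simp)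
    ultimately show "real (divisor_tau m) \<le> C ^ Suc Y * real m powr \<epsilon>" by linarith
  qed
qed

text \<open>If \<open>t\<close> has distance more than \<open>T powr (1 / d)\<close> from every
  root, the product over the roots exceeds \<open>T\<close>. Hence \<open>t\<close> lies in one of
  at most \<open>d\<close> intervals of half that width constant around the real parts of the
  roots.\<close>

lemma poly_sublevel_card:
  fixes p :: "complex poly" and T :: real
  assumes deg: "degree p = d" and d: "0 < d" and lc: "1 \<le> norm (lead_coeff p)" and T: "0 \<le> T"
  shows "finite {t::int. norm (poly p (of_int t)) \<le> T}"
    and "real (card {t::int. norm (poly p (of_int t)) \<le> T}) \<le> real d * (2 * T powr (1 / real d) + 1)"
proof -
  define s where "s = T powr (1 / real d)"
  have s0: "0 \<le> s" by (simp add: s_def)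
  have sd: "s ^ d = T" using d T by (cases "T = 0") (auto simp: s_def powr_power)
  have "p \<noteq> 0" using lc by auto
  then obtain A where A: "size A = degree p" "p = smult (lead_coeff p) (\<Prod>x\<in>#A. [:-x, 1:])"
    using alg_closed_imp_factorization by blast
  have ev: "norm (poly p w) = norm (lead_coeff p) * (\<Prod>r\<in>#A. norm (w - r))" for w
  proof -
    have "norm (poly (\<Prod>x\<in>#A. [:-x, 1:]) w) = (\<Prod>r\<in>#A. norm (w - r))"
      by (induction A) (auto simp: norm_mult left_diff_distrib[symmetric])
    then show ?thesis by (subst A(2)) (simp add: norm_mult)
  qed
  have prod_gt: "s ^ size B < (\<Prod>r\<in>#B. norm (w - r))" if "B \<noteq> {#}" "\<And>r. r \<in># B \<Longrightarrow> s < norm (w - r)" for B and w :: complex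
    using that
  proof (induction B)
    case (add r B)
    show ?case
    proof (cases "B = {#}")
      case True
      then show ?thesis using add.prems by simp
    next
      case False
      then have "s ^ size B < (\<Prod>r\<in>#B. norm (w - r))" using add by simp
      then have "s * s ^ size B < norm (w - r) * (\<Prod>r\<in>#B. norm (w - r))"
        using add.prems(2)[of r] s0 by (intro mult_strict_mono') auto
      then show ?thesis by simp
    qed
  qed simp
  define I where "I r = {\<lceil>Re r - s\<rceil>..\<lfloor>Re r + s\<rfloor>}" for r :: complex
  have sub: "{t::int. norm (poly p (of_int t)) \<le> T} \<subseteq> (\<Union>r\<in>set_mset A. I r)"
  proof
    fix t :: int assume t: "t \<in> {t. norm (poly p (of_int t)) \<le> T}"
    have "\<exists>r\<in>#A. norm (of_int t - r) \<le> s"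
    proof (rule ccontr)
      assume "\<not> ?thesis"
      then have gt: "\<And>r. r \<in># A \<Longrightarrow> s < norm (of_int t - r)" by force
      have "A \<noteq> {#}" using A(1) deg d by auto
      then have "T < (\<Prod>r\<in>#A. norm (of_int t - r))" using prod_gt[of A "of_int t"] gt A(1) deg sd by simp
      also have "\<dots> = 1 * (\<Prod>r\<in>#A. norm (of_int t - r))" by simp
      also have "\<dots> \<le> norm (poly p (of_int t))"
      proof -
        have "0 \<le> (\<Prod>r\<in>#A. norm (of_int t - r))" by (induction A) auto
        then show ?thesis unfolding ev using lc by (intro mult_right_mono) auto
      qed
      finally show False using t by simp
    qed
    then obtain r where r: "r \<in># A" "norm (of_int t - r) \<le> s" by blast
    have "\<bar>of_int t - Re r\<bar> \<le> s" using abs_Re_le_cmod[of "of_int t - r"] r(2) by simp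
    then have "t \<in> I r" by (auto simp: I_def ceiling_le_iff le_floor_iff)
    then show "t \<in> (\<Union>r\<in>set_mset A. I r)" using r(1) by blast
  qed
  show fin: "finite {t::int. norm (poly p (of_int t)) \<le> T}"
    by (rule finite_subset[OF sub]) (simp add: I_def)
  have cI: "real (card (I r)) \<le> 2 * s + 1" for r
  proof -
    have "real (card (I r)) = of_int (max 0 (\<lfloor>Re r + s\<rfloor> - \<lceil>Re r - s\<rceil> + 1))" by (simp add: I_def)
    also have "\<dots> \<le> 2 * s + 1" using s0 by (simp add: max_def) linarith
    finally show ?thesis .
  qed
  have "real (card {t::int. norm (poly p (of_int t)) \<le> T}) \<le> real (card (\<Union>r\<in>set_mset A. I r))"
    by (intro of_nat_mono card_mono sub) (simp add: I_def)
  also have "\<dots> \<le> real (\<Sum>r\<in>set_mset A. card (I r))" by (intro of_nat_mono card_UN_le) simp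
  also have "\<dots> \<le> (\<Sum>r\<in>set_mset A. 2 * s + 1)" unfolding of_nat_sum by (intro sum_mono cI)
  also have "\<dots> = real (card (set_mset A)) * (2 * s + 1)" by simp
  also have "\<dots> \<le> real d * (2 * s + 1)"
  proof -
    have "card (set_mset A) \<le> size A" by (induction A) (auto simp: card_insert_if)
    then show ?thesis using A(1) deg s0 by (intro mult_right_mono) auto
  qed
  finally show "real (card {t::int. norm (poly p (of_int t)) \<le> T}) \<le> real d * (2 * T powr (1 / real d) + 1)"
    unfolding s_def .
qed

section \<open>Divisors up to a cutoff\<close>

definition divisor_count :: "('n::finite) int_mpoly \<Rightarrow> (int ^ 'n) set \<Rightarrow> nat \<Rightarrow> real" where
  "divisor_count f X Q = (\<Sum>q\<in>{1..Q}. real (card {x\<in>X. int q dvd mpoly_eval f x}))"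

lemma harm_le_self: "harm K \<le> real K"
proof -
  have "harm K \<le> (\<Sum>k\<in>{1..K}. 1 :: real)" unfolding harm_def by (intro sum_mono) (auto simp: field_simps)
  then show ?thesis by simp
qed

text \<open>Writing the multiples of \<open>q'\<close> up to \<open>Q\<close> as
  \<open>q' * k\<close> with \<open>k \<le> Q div q'\<close> leaves a harmonic sum over
  \<open>k\<close>.\<close>

lemma sum_divisors_harm:
  fixes G :: "nat \<Rightarrow> real"
  shows "(\<Sum>q\<in>{1..Q}. 1 / real q * (\<Sum>q' | q' dvd q. G q')) = (\<Sum>q\<in>{1..Q}. G q / real q * harm (Q div q))"
proof -
  have "(\<Sum>q\<in>{1..Q}. 1 / real q * (\<Sum>q' | q' dvd q. G q')) =
      (\<Sum>(q, q')\<in>Sigma {1..Q} (\<lambda>q. {q'. q' dvd q}). 1 / real q * G q')"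
    unfolding sum_distrib_left by (subst sum.Sigma) auto
  also have "\<dots> = (\<Sum>(q, k)\<in>Sigma {1..Q} (\<lambda>q. {1..Q div q}). 1 / real (q * k) * G q)"
  proof (rule sum.reindex_bij_witness[where i = "\<lambda>(q, k). (q * k, q)" and j = "\<lambda>(q, q'). (q', q div q')"])
    fix p assume "p \<in> Sigma {1..Q} (\<lambda>q. {q'. q' dvd q})"
    then obtain q' k where p: "p = (q' * k, q')" "1 \<le> q' * k" "q' * k \<le> Q" by (auto elim!: dvdE)
    then have k: "0 < q'" "0 < k" by auto
    then have "k \<le> Q div q'" using p(3) by (simp add: less_eq_div_iff_mult_less_eq mult.commute)
    moreover have "q' \<le> Q" by (rule le_trans[OF _ p(3)]) (use k in simp)
    ultimately show "(case p of (q, q') \<Rightarrow> (q', q div q')) \<in> Sigma {1..Q} (\<lambda>q. {1..Q div q})" using p k by simp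
    show "(case case p of (q, q') \<Rightarrow> (q', q div q') of (q, k) \<Rightarrow> (q * k, q)) = p" using p k by simp
    show "(case case p of (q, q') \<Rightarrow> (q', q div q') of (q, k) \<Rightarrow> 1 / real (q * k) * G q) = (case p of (q, q') \<Rightarrow> 1 / real q * G q')"
      using p k by simp
  next
    fix p assume "p \<in> Sigma {1..Q} (\<lambda>q. {1..Q div q})"
    then obtain q k where p: "p = (q, k)" "1 \<le> q" "q \<le> Q" "1 \<le> k" "k \<le> Q div q" by auto
    then have "q * k \<le> Q" by (simp add: less_eq_div_iff_mult_less_eq mult.commute)
    then show "(case p of (q, k) \<Rightarrow> (q * k, q)) \<in> Sigma {1..Q} (\<lambda>q. {q'. q' dvd q})" using p by simp
    show "(case case p of (q, k) \<Rightarrow> (q * k, q) of (q, q') \<Rightarrow> (q', q div q')) = p" using p by simp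
  qed
  also have "\<dots> = (\<Sum>q\<in>{1..Q}. \<Sum>k\<in>{1..Q div q}. 1 / real (q * k) * G q)"
    by (subst sum.Sigma) auto
  also have "\<dots> = (\<Sum>q\<in>{1..Q}. G q / real q * harm (Q div q))"
    unfolding harm_def sum_distrib_left by (intro sum.cong refl) (simp add: field_simps)
  finally show ?thesis .
qed

lemma divisor_count_eq:
  assumes "finite X"
  shows "divisor_count f X Q = (\<Sum>q\<in>{1..Q}. (\<Sum>x\<in>X. ramanujan q (mpoly_eval f x)) / real q * harm (Q div q))"
proof -
  have "real (card {x\<in>X. int q dvd mpoly_eval f x}) = 1 / real q * (\<Sum>q' | q' dvd q. \<Sum>x\<in>X. ramanujan q' (mpoly_eval f x))"
    if "q \<in> {1..Q}" for q
  proof -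
    have "real (card {x\<in>X. int q dvd mpoly_eval f x}) = (\<Sum>x\<in>X. if int q dvd mpoly_eval f x then 1 else 0)"
      using assms by (simp add: sum.If_cases Int_def)
    also have "\<dots> = (\<Sum>x\<in>X. 1 / real q * (\<Sum>q' | q' dvd q. ramanujan q' (mpoly_eval f x)))"
      using that by (intro sum.cong refl) (subst sum_ramanujan, auto)
    also have "\<dots> = 1 / real q * (\<Sum>q' | q' dvd q. \<Sum>x\<in>X. ramanujan q' (mpoly_eval f x))"
      unfolding sum_distrib_left[symmetric] by (subst sum.swap) (rule refl)
    finally show ?thesis .
  qed
  then show ?thesis
    unfolding divisor_count_def sum_divisors_harm[symmetric] by (intro sum.cong refl)
qed

lemma abs_arith_coeff_le: "\<bar>arith_coeff f q\<bar> \<le> real q" if "0 < q"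
proof -
  have "\<bar>\<Sum>t\<in>residue_vecs q. ramanujan q (mpoly_eval f t)\<bar> \<le> (\<Sum>t\<in>residue_vecs q. \<bar>ramanujan q (mpoly_eval f t)\<bar>)"
    by (rule sum_abs)
  also have "\<dots> \<le> (\<Sum>t\<in>(residue_vecs q :: (int ^ 'a) set). real q)" by (intro sum_mono abs_ramanujan_le)
  finally have "\<bar>\<Sum>t\<in>residue_vecs q. ramanujan q (mpoly_eval f t)\<bar> \<le> real q ^ CARD('a) * real q"
    by (simp add: card_residue_vecs)
  then show ?thesis using that by (simp add: arith_coeff_def residue_mean_def abs_divide pos_divide_le_eq mult.commute)
qed

text \<open>Unlike in \<open>scaled_box\<close> the scale \<open>P\<close> is not fixed, since
  limits in \<open>P\<close> are taken here.\<close>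

locale unit_box =
  fixes a a' :: "real ^ 'n::finite" and f :: "'n int_mpoly"
  assumes unit_box: "\<And>i. a $ i \<le> a' $ i" "\<And>i. a' $ i - a $ i \<le> 1"
begin

lemma scaled: "1 \<le> P \<Longrightarrow> scaled_box a a' P"
  using unit_box by unfold_locales auto

definition "points P = scaled_box.points a a' P"
definition "vol = scaled_box.vol a a'"

definition ram_sum :: "real \<Rightarrow> nat \<Rightarrow> real" where
  "ram_sum P q = (\<Sum>x\<in>points P. ramanujan q (mpoly_eval f x))"

definition err :: "real \<Rightarrow> nat \<Rightarrow> real" where
  "err P q = \<bar>ram_sum P q - vol * P ^ CARD('n) * arith_coeff f q\<bar>"

lemma vol_bounds: "0 \<le> vol" "vol \<le> 1"
  using scaled_box.vol_bounds[OF scaled[of 1]] by (auto simp: vol_def)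

lemma points_boxes: "1 \<le> P \<Longrightarrow> points P \<in> boxes (nat \<lfloor>P\<rfloor> + 1)"
  unfolding points_def by (rule scaled_box.points_boxes[OF scaled])

lemma finite_points: "1 \<le> P \<Longrightarrow> finite (points P)"
  using finite_boxes[OF points_boxes] .

lemma card_points_le:
  assumes "1 \<le> P"
  shows "real (card (points P)) \<le> (2 * P) ^ CARD('n)"
proof -
  have "real (card (points P)) \<le> real (nat \<lfloor>P\<rfloor> + 1) ^ CARD('n)"
    using of_nat_mono[OF card_boxes[OF points_boxes[OF assms]], where 'a = real] by simp
  also have "real (nat \<lfloor>P\<rfloor> + 1) ^ CARD('n) \<le> (2 * P) ^ CARD('n)"
    using assms by (intro power_mono) linarith+
  finally show ?thesis .
qed

lemma err_trivial:
  assumes P: "1 \<le> P" and q: "1 \<le> q"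
  shows "err P q \<le> (2 ^ CARD('n) + 1) * real q * P ^ CARD('n)"
proof -
  have "\<bar>ram_sum P q\<bar> \<le> (\<Sum>x\<in>points P. \<bar>ramanujan q (mpoly_eval f x)\<bar>)" unfolding ram_sum_def by (rule sum_abs)
  also have "\<dots> \<le> (\<Sum>x\<in>points P. real q)" by (intro sum_mono abs_ramanujan_le)
  also have "\<dots> \<le> (2 * P) ^ CARD('n) * real q" using card_points_le[OF P] by (simp add: mult_right_mono)
  finally have 1: "\<bar>ram_sum P q\<bar> \<le> 2 ^ CARD('n) * real q * P ^ CARD('n)" by (simp add: power_mult_distrib mult_ac)
  have "\<bar>vol * P ^ CARD('n) * arith_coeff f q\<bar> \<le> 1 * P ^ CARD('n) * real q"
    unfolding abs_mult using vol_bounds P q by (intro mult_mono abs_arith_coeff_le) auto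
  then show ?thesis using 1 unfolding err_def by (simp add: distrib_right mult.commute[of "real q"])
qed

text \<open>For \<open>q \<le> P\<close> this is the residue count; for \<open>q > P\<close> the
  trivial bound \<open>O(q * P ^ n)\<close> is already smaller than the claim.\<close>

lemma err_small_modulus: "\<exists>K>0. \<forall>P\<ge>1. \<forall>q\<ge>1. err P q \<le> K * P ^ (CARD('n) - 1) * real q ^ 2"
proof (intro exI[of _ "real CARD('n) * 2 ^ CARD('n) + (2 ^ CARD('n) + 1)"] conjI allI impI)
  fix P :: real and q :: nat assume P: "1 \<le> P" and q: "1 \<le> q"
  let ?n = "CARD('n)"
  have n: "P ^ ?n = P ^ (?n - 1) * P" by (rule power_minus_mult[symmetric]) simp
  have K: "0 \<le> real ?n * 2 ^ ?n" "(0::real) \<le> 2 ^ ?n + 1" by auto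
  show "err P q \<le> (real ?n * 2 ^ ?n + (2 ^ ?n + 1)) * P ^ (?n - 1) * real q ^ 2"
  proof (cases "real q \<le> P")
    case True
    have "err P q * (P + real q) \<le> real ?n * real q * real q * (P + real q) ^ ?n"
      unfolding err_def ram_sum_def arith_coeff_def points_def vol_def
      using q by (intro scaled_box.points_sum_periodic[OF scaled[OF P]] periodic_ramanujan abs_ramanujan_le) auto
    also have "(P + real q) ^ ?n = (P + real q) ^ (?n - 1) * (P + real q)"
      by (rule power_minus_mult[symmetric]) simp
    finally have "err P q * (P + real q) \<le> (real ?n * real q * real q * (P + real q) ^ (?n - 1)) * (P + real q)"
      by (simp only: mult.assoc)
    then have "err P q \<le> real ?n * real q * real q * (P + real q) ^ (?n - 1)"
      using P by (simp add: mult_le_cancel_right)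
    also have "\<dots> \<le> real ?n * real q * real q * (2 ^ ?n * P ^ (?n - 1))"
    proof (rule mult_left_mono)
      have "(P + real q) ^ (?n - 1) \<le> (2 * P) ^ (?n - 1)" using True P by (intro power_mono) auto
      also have "\<dots> \<le> 2 ^ ?n * P ^ (?n - 1)"
        unfolding power_mult_distrib using P by (intro mult_right_mono power_increasing) auto
      finally show "(P + real q) ^ (?n - 1) \<le> 2 ^ ?n * P ^ (?n - 1)" .
    qed simp
    also have "\<dots> = (real ?n * 2 ^ ?n) * (P ^ (?n - 1) * real q ^ 2)" by (simp add: power2_eq_square)
    also have "\<dots> \<le> (real ?n * 2 ^ ?n + (2 ^ ?n + 1)) * (P ^ (?n - 1) * real q ^ 2)"
      using P by (intro mult_right_mono) auto
    finally show ?thesis by (simp only: mult.assoc)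
  next
    case False
    have "err P q \<le> (2 ^ ?n + 1) * real q * P ^ ?n" by (rule err_trivial[OF P q])
    also have "\<dots> = (2 ^ ?n + 1) * (P ^ (?n - 1) * (real q * P))" unfolding n by simp
    also have "\<dots> \<le> (2 ^ ?n + 1) * (P ^ (?n - 1) * (real q * real q))"
      using False P by (intro mult_left_mono) auto
    also have "\<dots> \<le> (real ?n * 2 ^ ?n + (2 ^ ?n + 1)) * (P ^ (?n - 1) * (real q * real q))"
      using P by (intro mult_right_mono) auto
    finally show ?thesis by (simp only: mult.assoc power2_eq_square)
  qed
qed (simp add: add_pos_pos add_nonneg_pos)

text \<open>No cancellation between the sum and its expected value is used: each is small by itself.
  The range \<open>q \<le> c * P powr (d / 2)\<close> is the condition on \<open>q ^ 2\<close> in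
  the Weyl bound, with \<open>Q0 = c ^ 2\<close>.\<close>

lemma err_large_modulus:
  fixes c \<epsilon> :: real
  assumes hom: "homogeneous_of_degree d f" and smooth: "smooth_form f" and d: "2 \<le> d"
    and n: "2 ^ d * (d - 1) < CARD('n)" and c: "0 < c" and \<epsilon>: "0 < \<epsilon>"
  shows "\<exists>K>0. \<forall>P\<ge>1. \<forall>q\<ge>1. real q \<le> c * P powr (real d / 2) \<longrightarrow>
    err P q \<le> K * P powr (real CARD('n) + \<epsilon>) * real q powr (\<epsilon> - 1)"
proof -
  let ?n = "real CARD('n)"
  have c2: "0 < c ^ 2" using c by simp
  obtain C where C: "0 < C" "\<forall>N\<ge>1. \<forall>q\<ge>1. real q ^ 2 \<le> c ^ 2 * real N ^ d \<longrightarrow>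
    (\<forall>X\<in>boxes N. \<bar>\<Sum>x\<in>X. ramanujan q (mpoly_eval f x)\<bar> \<le> C * real N powr (?n + \<epsilon>) * real q powr (-1))"
    using weyl_ramanujan_bound[OF hom smooth d n c2 \<epsilon>] by (elim exE conjE) (rule that)
  obtain C' where C': "0 < C'" "\<forall>q\<ge>1. \<bar>arith_coeff f q\<bar> \<le> C' * real q powr (\<epsilon> - 1)"
    using arith_coeff_bound[OF hom smooth d n \<epsilon>] by (elim exE conjE) (rule that)
  show ?thesis
  proof (intro exI[of _ "C * 2 powr (?n + \<epsilon>) + C'"] conjI allI impI)
    show "0 < C * 2 powr (?n + \<epsilon>) + C'" using C(1) C'(1) by (intro add_pos_pos mult_pos_pos) auto
    fix P :: real and q :: nat assume P: "1 \<le> P" and q: "1 \<le> q" and qP: "real q \<le> c * P powr (real d / 2)"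
    define N where "N = nat \<lfloor>P\<rfloor> + 1"
    have N: "1 \<le> N" "P \<le> real N" "real N \<le> 2 * P" using P unfolding N_def by linarith+
    have "real q ^ 2 \<le> (c * P powr (real d / 2)) ^ 2" using qP by (intro power_mono) auto
    also have "\<dots> = c ^ 2 * P ^ d" using P by (simp add: power_mult_distrib powr_power powr_realpow)
    also have "\<dots> \<le> c ^ 2 * real N ^ d" using N P by (intro mult_left_mono power_mono) auto
    finally have "real q ^ 2 \<le> c ^ 2 * real N ^ d" .
    from C(2)[rule_format, OF N(1) q this points_boxes[OF P, folded N_def]]
    have "\<bar>ram_sum P q\<bar> \<le> C * real N powr (?n + \<epsilon>) * real q powr (-1)" by (simp add: ram_sum_def)
    also have "\<dots> \<le> C * (2 powr (?n + \<epsilon>) * P powr (?n + \<epsilon>)) * real q powr (\<epsilon> - 1)"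
    proof (intro mult_mono)
      have "real N powr (?n + \<epsilon>) \<le> (2 * P) powr (?n + \<epsilon>)" using N P \<epsilon> by (intro powr_mono2) auto
      then show "real N powr (?n + \<epsilon>) \<le> 2 powr (?n + \<epsilon>) * P powr (?n + \<epsilon>)" using P by (simp add: powr_mult)
      show "real q powr (-1) \<le> real q powr (\<epsilon> - 1)" using q \<epsilon> by (intro powr_mono) auto
    qed (use C in auto)
    finally have 1: "\<bar>ram_sum P q\<bar> \<le> (C * 2 powr (?n + \<epsilon>)) * (P powr (?n + \<epsilon>) * real q powr (\<epsilon> - 1))" by (simp only: mult.assoc)
    have "\<bar>vol * P ^ CARD('n) * arith_coeff f q\<bar> \<le> (1 * P powr (?n + \<epsilon>)) * (C' * real q powr (\<epsilon> - 1))"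
      unfolding abs_mult
    proof (intro mult_mono)
      have "P ^ CARD('n) = P powr ?n" using P by (simp add: powr_realpow)
      also have "\<dots> \<le> P powr (?n + \<epsilon>)" using P \<epsilon> by (intro powr_mono) auto
      finally show "\<bar>P ^ CARD('n)\<bar> \<le> P powr (?n + \<epsilon>)" using P by simp
    qed (use vol_bounds C' q in auto)
    then have "\<bar>vol * P ^ CARD('n) * arith_coeff f q\<bar> \<le> C' * (P powr (?n + \<epsilon>) * real q powr (\<epsilon> - 1))" by (simp add: mult_ac)
    then have "err P q \<le> (C * 2 powr (?n + \<epsilon>)) * (P powr (?n + \<epsilon>) * real q powr (\<epsilon> - 1)) +
        C' * (P powr (?n + \<epsilon>) * real q powr (\<epsilon> - 1))"
      using 1 unfolding err_def by linarith
    then show "err P q \<le> (C * 2 powr (?n + \<epsilon>) + C') * P powr (?n + \<epsilon>) * real q powr (\<epsilon> - 1)"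
      by (simp only: distrib_right mult.assoc)
  qed
qed

lemma geometric_mean_bound:
  fixes x A B \<theta> :: real
  assumes "0 \<le> x" "x \<le> A" "x \<le> B" "0 < \<theta>" "\<theta> < 1"
  shows "x \<le> A powr \<theta> * B powr (1 - \<theta>)"
proof (cases "x = 0")
  case False
  then have "x = x powr \<theta> * x powr (1 - \<theta>)" using assms(1) by (simp add: powr_add[symmetric])
  also have "\<dots> \<le> A powr \<theta> * B powr (1 - \<theta>)" using assms by (intro mult_mono powr_mono2) auto
  finally show ?thesis .
qed simp

text \<open>The weights \<open>1/8\<close> and \<open>7/8\<close> with
  \<open>\<epsilon> = 1/14\<close> give \<open>P\<close> the exponent
  \<open>(n - 1) / 8 + (n + 1/14) * 7/8 = n - 1/16\<close> and \<open>q\<close> the exponent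
  \<open>1/4 - 13/16 = - 9/16\<close>. After division by \<open>q\<close> the latter is
  \<open>- 25/16\<close>, below -1, so both a power saving in \<open>P\<close> and summability in
  \<open>q\<close> remain.\<close>

lemma err_interpolated:
  fixes c :: real
  assumes hom: "homogeneous_of_degree d f" and smooth: "smooth_form f" and d: "2 \<le> d"
    and n: "2 ^ d * (d - 1) < CARD('n)" and c: "0 < c"
  shows "\<exists>K>0. \<forall>P\<ge>1. \<forall>q\<ge>1. real q \<le> c * P powr (real d / 2) \<longrightarrow>
    err P q / real q \<le> K * P powr (real CARD('n) - 1 / 16) * real q powr (- 25 / 16)"
proof -
  let ?n = "real CARD('n)"
  obtain K1 where K1: "0 < K1" "\<forall>P\<ge>1. \<forall>q\<ge>1. err P q \<le> K1 * P ^ (CARD('n) - 1) * real q ^ 2"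
    using err_small_modulus by (elim exE conjE) (rule that)
  have \<epsilon>: "(0::real) < 1 / 14" by simp
  obtain K2 where K2: "0 < K2" "\<forall>P\<ge>1. \<forall>q\<ge>1. real q \<le> c * P powr (real d / 2) \<longrightarrow>
    err P q \<le> K2 * P powr (?n + 1 / 14) * real q powr (1 / 14 - 1)"
    using err_large_modulus[OF hom smooth d n c \<epsilon>] by (elim exE conjE) (rule that)
  show ?thesis
  proof (intro exI[of _ "K1 powr (1/8) * K2 powr (7/8)"] conjI allI impI)
    show "0 < K1 powr (1/8) * K2 powr (7/8)" using K1 K2 by simp
    fix P :: real and q :: nat assume P: "1 \<le> P" and q: "1 \<le> q" and qP: "real q \<le> c * P powr (real d / 2)"
    have n1: "real (CARD('n) - 1) = ?n - 1" using zero_less_card_finite[where 'a = 'n] by (simp add: of_nat_diff Suc_leI)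
    have A: "err P q \<le> K1 * P powr (?n - 1) * real q powr 2"
    proof -
      have "P powr (?n - 1) = P ^ (CARD('n) - 1)" unfolding n1[symmetric] using P by (intro powr_realpow) simp
      moreover have "real q powr 2 = real q ^ 2" using q by simp
      ultimately show ?thesis using K1(2)[rule_format, OF P q] by simp
    qed
    have B: "err P q \<le> K2 * P powr (?n + 1 / 14) * real q powr (- 13 / 14)"
      using K2(2)[rule_format, OF P q qP] by simp
    have "0 \<le> err P q" by (simp add: err_def)
    from geometric_mean_bound[OF this A B, of "1/8"]
    have "err P q \<le> (K1 * P powr (?n - 1) * real q powr 2) powr (1/8) * (K2 * P powr (?n + 1 / 14) * real q powr (- 13 / 14)) powr (7/8)"
      by simp
    also have "\<dots> = (K1 powr (1/8) * K2 powr (7/8)) * (P powr ((?n - 1) * (1/8)) * P powr ((?n + 1 / 14) * (7/8))) *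
        (real q powr (2 * (1/8)) * real q powr (- 13 / 14 * (7/8)))"
      by (simp only: powr_mult powr_powr mult_ac)
    also have "P powr ((?n - 1) * (1/8)) * P powr ((?n + 1 / 14) * (7/8)) = P powr (?n - 1 / 16)"
      unfolding powr_add[symmetric] by (rule arg_cong[where f = "\<lambda>s. P powr s"]) (simp add: field_simps)
    also have "real q powr (2 * (1/8)) * real q powr (- 13 / 14 * (7/8)) = real q powr (- 9 / 16)"
      unfolding powr_add[symmetric] by (rule arg_cong[where f = "\<lambda>s. real q powr s"]) simp
    finally have le: "err P q * real q powr (-1) \<le> K1 powr (1/8) * K2 powr (7/8) * P powr (?n - 1 / 16) * real q powr (- 9 / 16) * real q powr (-1)"
      by (rule mult_right_mono) simp
    have "- 9 / 16 + - 1 = (- 25 / 16 :: real)" by simp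
    then have e: "real q powr (- 9 / 16) * real q powr (-1) = real q powr (- 25 / 16)"
      by (simp only: powr_add[symmetric])
    have "err P q / real q = err P q * real q powr (-1)"
      using q by (simp only: powr_minus_divide) simp
    also note le
    also have "K1 powr (1/8) * K2 powr (7/8) * P powr (?n - 1 / 16) * real q powr (- 9 / 16) * real q powr (-1) =
        K1 powr (1/8) * K2 powr (7/8) * P powr (?n - 1 / 16) * real q powr (- 25 / 16)"
      by (simp only: mult.assoc e)
    finally show "err P q / real q \<le> K1 powr (1/8) * K2 powr (7/8) * P powr (?n - 1 / 16) * real q powr (- 25 / 16)" .
  qed
qed

end

section \<open>Asymptotics of the divisor count at a cutoff\<close>

context unit_box
begin

definition cutoff :: "real \<Rightarrow> real \<Rightarrow> real \<Rightarrow> nat" where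
  "cutoff c \<kappa> P = nat \<lfloor>c * P powr \<kappa>\<rfloor>"

lemma cutoff_le: "0 < c \<Longrightarrow> real (cutoff c \<kappa> P) \<le> c * P powr \<kappa>"
  by (simp add: cutoff_def)

lemma harm_cutoff_le:
  assumes c: "0 < c" and \<kappa>: "0 < \<kappa>" and P: "1 \<le> P"
  shows "harm (cutoff c \<kappa> P) \<le> 1 + \<bar>ln c\<bar> + \<kappa> * ln P"
proof (cases "cutoff c \<kappa> P = 0")
  case True
  then show ?thesis using \<kappa> P by (simp add: harm_def)
next
  case False
  then have "harm (cutoff c \<kappa> P) \<le> 1 + ln (real (cutoff c \<kappa> P))" by (intro harm_le_ln) simp
  also have "\<dots> \<le> 1 + ln (c * P powr \<kappa>)" using False cutoff_le[OF c, of \<kappa> P] c P by (intro add_mono) auto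
  also have "\<dots> = 1 + ln c + \<kappa> * ln P" using c P by (simp add: ln_mult ln_powr)
  finally show ?thesis by linarith
qed

text \<open>For fixed \<open>k\<close> the constant \<open>c\<close>, the divisor \<open>k\<close>
  and the two roundings change the logarithm by a bounded amount only.\<close>

lemma harm_cutoff_asymptotic:
  assumes c: "0 < c" and \<kappa>: "0 < \<kappa>" and k: "1 \<le> k"
  shows "((\<lambda>P. harm (cutoff c \<kappa> P div k) / ln P) \<longlongrightarrow> \<kappa>) at_top"
proof (rule tendsto_sandwich)
  have "filterlim (\<lambda>P::real. c * P powr \<kappa>) at_top at_top"
    using c \<kappa> by real_asymp
  then have "eventually (\<lambda>P::real. 2 \<le> c * P powr \<kappa>) at_top" by (simp add: filterlim_at_top)
  moreover have "eventually (\<lambda>P::real. 1 < P) at_top" by (rule eventually_gt_at_top)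
  ultimately show "eventually (\<lambda>P. (ln (c / (2 * real k)) + \<kappa> * ln P) / ln P \<le> harm (cutoff c \<kappa> P div k) / ln P) at_top"
  proof eventually_elim
    case (elim P)
    define Q where "Q = cutoff c \<kappa> P"
    have "c * P powr \<kappa> / 2 \<le> real Q" using elim unfolding Q_def cutoff_def by linarith
    then have "c * P powr \<kappa> / 2 / real k \<le> real Q / real k" using k by (intro divide_right_mono) auto
    also have "\<dots> \<le> real (Q div k) + 1"
    proof -
      have "Q \<le> (Q div k + 1) * k" using dividend_less_div_times[of k Q] k by simp
      then have "real Q \<le> real ((Q div k + 1) * k)" by (rule of_nat_mono)
      then show ?thesis using k by (simp add: pos_divide_le_eq distrib_right)
    qed
    finally have 1: "c / (2 * real k) * P powr \<kappa> \<le> real (Q div k) + 1" by simp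
    have "ln (c / (2 * real k)) + \<kappa> * ln P = ln (c / (2 * real k) * P powr \<kappa>)"
      using c k elim by (subst ln_mult) (auto simp: ln_powr)
    also have "\<dots> \<le> ln (real (Q div k) + 1)" using 1 c k elim by (intro ln_mono) auto
    also have "\<dots> \<le> harm (Q div k)" by (rule harm_ge_ln)
    finally show ?case unfolding Q_def using elim by (intro divide_right_mono) auto
  qed
  show "eventually (\<lambda>P. harm (cutoff c \<kappa> P div k) / ln P \<le> (1 + \<bar>ln c\<bar> + \<kappa> * ln P) / ln P) at_top"
    using eventually_gt_at_top[of 1]
  proof eventually_elim
    case (elim P)
    have "harm (cutoff c \<kappa> P div k) \<le> (harm (cutoff c \<kappa> P) :: real)" by (intro harm_mono div_le_dividend)
    also have "\<dots> \<le> 1 + \<bar>ln c\<bar> + \<kappa> * ln P" using elim by (intro harm_cutoff_le c \<kappa>) simp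
    finally show ?case using elim by (intro divide_right_mono) auto
  qed
  show "((\<lambda>P. (ln (c / (2 * real k)) + \<kappa> * ln P) / ln P) \<longlongrightarrow> \<kappa>) at_top" by real_asymp
  show "((\<lambda>P. (1 + \<bar>ln c\<bar> + \<kappa> * ln P) / ln P) \<longlongrightarrow> \<kappa>) at_top" by real_asymp
qed

text \<open>Uniform in \<open>k\<close>, as domination requires; \<open>P \<ge> exp 1\<close> makes
  \<open>ln P \<ge> 1\<close>, which absorbs the constants.\<close>

lemma harm_cutoff_le_ln:
  assumes c: "0 < c" and \<kappa>: "0 < \<kappa>" and P: "exp 1 \<le> P"
  shows "harm (cutoff c \<kappa> P div k) \<le> (1 + \<bar>ln c\<bar> + \<kappa>) * ln P"
proof -
  have "1 \<le> exp (1::real)" by simp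
  then have P1: "1 \<le> P" using P by linarith
  have l: "1 \<le> ln P" using P P1 by (simp add: ln_ge_iff)
  have "harm (cutoff c \<kappa> P div k) \<le> (harm (cutoff c \<kappa> P) :: real)" by (intro harm_mono div_le_dividend)
  also have "\<dots> \<le> (1 + \<bar>ln c\<bar>) * 1 + \<kappa> * ln P" using harm_cutoff_le[OF c \<kappa> P1] by simp
  also have "\<dots> \<le> (1 + \<bar>ln c\<bar>) * ln P + \<kappa> * ln P" using l by (intro add_right_mono mult_left_mono) auto
  finally show ?thesis by (simp add: distrib_right)
qed

definition err_sum :: "real \<Rightarrow> real \<Rightarrow> real \<Rightarrow> real" where
  "err_sum c \<kappa> P = (\<Sum>q\<in>{1..cutoff c \<kappa> P}. err P q / real q * harm (cutoff c \<kappa> P div q))"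

lemma err_sum_nonneg: "0 \<le> err_sum c \<kappa> P"
  unfolding err_sum_def err_def by (intro sum_nonneg mult_nonneg_nonneg) (auto simp: harm_nonneg)

lemma err_sum_negligible:
  assumes hom: "homogeneous_of_degree d f" and smooth: "smooth_form f" and d: "1 \<le> d"
    and n: "2 ^ d * (d - 1) < CARD('n)" and c: "0 < c" and \<kappa>: "0 < \<kappa>" "\<kappa> \<le> real d / 2"
  shows "((\<lambda>P. err_sum c \<kappa> P / (P ^ CARD('n) * ln P)) \<longlongrightarrow> 0) at_top"
proof -
  have "\<exists>g. (g \<longlongrightarrow> 0) at_top \<and> eventually (\<lambda>P. err_sum c \<kappa> P / (P ^ CARD('n) * ln P) \<le> g P) at_top"
  proof (cases "d = 1")
    \<comment> \<open>In the linear case the cutoff is at most \<open>c * sqrt P\<close>. With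
      \<open>harm (Q div q) \<le> Q / q\<close> the errors add up to \<open>O(P ^ n)\<close>, so the
      factor \<open>ln P\<close> alone makes them negligible.\<close>
    case True
    obtain K where K: "0 < K" "\<forall>P\<ge>1. \<forall>q\<ge>1. err P q \<le> K * P ^ (CARD('n) - 1) * real q ^ 2"
      using err_small_modulus by (elim exE conjE) (rule that)
    have "err_sum c \<kappa> P / (P ^ CARD('n) * ln P) \<le> K * c ^ 2 / ln P" if P: "1 < P" for P
    proof -
      define Q where "Q = cutoff c \<kappa> P"
      have "err_sum c \<kappa> P \<le> (\<Sum>q\<in>{1..Q}. K * P ^ (CARD('n) - 1) * real Q)"
        unfolding err_sum_def Q_def[symmetric]
      proof (rule sum_mono)
        fix q assume q: "q \<in> {1..Q}"
        have "err P q / real q \<le> K * P ^ (CARD('n) - 1) * real q ^ 2 / real q"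
          using K(2)[rule_format, of P q] P q by (intro divide_right_mono) auto
        also have "\<dots> = K * P ^ (CARD('n) - 1) * real q" using q by (simp add: power2_eq_square)
        finally have 1: "err P q / real q \<le> K * P ^ (CARD('n) - 1) * real q" .
        have "harm (Q div q) \<le> real (Q div q)" by (rule harm_le_self)
        also have "\<dots> \<le> real Q / real q" by (rule of_nat_div_le_of_nat)
        finally have "err P q / real q * harm (Q div q) \<le> (K * P ^ (CARD('n) - 1) * real q) * (real Q / real q)"
          using 1 K P by (intro mult_mono) (auto simp: harm_nonneg)
        then show "err P q / real q * harm (Q div q) \<le> K * P ^ (CARD('n) - 1) * real Q" using q by simp
      qed
      also have "\<dots> = K * P ^ (CARD('n) - 1) * real Q ^ 2" by (simp add: power2_eq_square)
      also have "\<dots> \<le> K * P ^ (CARD('n) - 1) * (c ^ 2 * P)"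
      proof (intro mult_left_mono)
        have "real Q ^ 2 \<le> (c * P powr \<kappa>) ^ 2" unfolding Q_def by (intro power_mono cutoff_le c) simp
        also have "\<dots> = c ^ 2 * P powr (2 * \<kappa>)" using P by (simp add: power_mult_distrib powr_power mult.commute)
        also have "\<dots> \<le> c ^ 2 * P powr 1" using P \<kappa> True by (intro mult_left_mono powr_mono) auto
        finally show "real Q ^ 2 \<le> c ^ 2 * P" using P by simp
      qed (use K P in auto)
      also have "\<dots> = K * c ^ 2 * (P ^ (CARD('n) - 1) * P)" by simp
      also have "P ^ (CARD('n) - 1) * P = P ^ CARD('n)" by (rule power_minus_mult) simp
      finally show ?thesis using P by (simp add: field_simps)
    qed
    then have "eventually (\<lambda>P. err_sum c \<kappa> P / (P ^ CARD('n) * ln P) \<le> K * c ^ 2 / ln P) at_top"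
      using eventually_gt_at_top[of 1] by (rule eventually_mono[rotated])
    moreover have "((\<lambda>P. K * c ^ 2 / ln P) \<longlongrightarrow> 0) at_top" by real_asymp
    ultimately show ?thesis by blast
  next
    case False
    then have d2: "2 \<le> d" using d by simp
    obtain K where K: "0 < K" "\<forall>P\<ge>1. \<forall>q\<ge>1. real q \<le> c * P powr (real d / 2) \<longrightarrow>
      err P q / real q \<le> K * P powr (real CARD('n) - 1 / 16) * real q powr (- 25 / 16)"
      using err_interpolated[OF hom smooth d2 n c] by (elim exE conjE) (rule that)
    define Z where "Z = suminf (\<lambda>q. real q powr (- 25 / 16))"
    define M where "M = 1 + \<bar>ln c\<bar> + \<kappa>"
    have M0: "0 \<le> M" using \<kappa> by (simp add: M_def)
    have "err_sum c \<kappa> P / (P ^ CARD('n) * ln P) \<le> K * M * Z * P powr (- 1 / 16)" if P: "exp 1 \<le> P" for P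
    proof -
      define Q where "Q = cutoff c \<kappa> P"
      have "1 < exp (1::real)" by simp
      then have P1: "1 < P" using P by linarith
      have "err_sum c \<kappa> P \<le> (\<Sum>q\<in>{1..Q}. K * P powr (real CARD('n) - 1 / 16) * M * ln P * real q powr (- 25 / 16))"
        unfolding err_sum_def Q_def[symmetric]
      proof (rule sum_mono)
        fix q assume q: "q \<in> {1..Q}"
        have "real q \<le> c * P powr \<kappa>" using q cutoff_le[OF c, of \<kappa> P] unfolding Q_def by auto
        also have "\<dots> \<le> c * P powr (real d / 2)" using c \<kappa> P1 by (intro mult_left_mono powr_mono) auto
        finally have "err P q / real q \<le> K * P powr (real CARD('n) - 1 / 16) * real q powr (- 25 / 16)"
          using K(2) P1 q by auto
        then have "err P q / real q * harm (Q div q) \<le>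
            (K * P powr (real CARD('n) - 1 / 16) * real q powr (- 25 / 16)) * (M * ln P)"
          using harm_cutoff_le_ln[OF c \<kappa>(1) P, of q] K(1) unfolding Q_def M_def
          by (intro mult_mono) (auto simp: harm_nonneg)
        then show "err P q / real q * harm (Q div q) \<le> K * P powr (real CARD('n) - 1 / 16) * M * ln P * real q powr (- 25 / 16)"
          by (simp only: mult_ac)
      qed
      also have "\<dots> = K * P powr (real CARD('n) - 1 / 16) * M * ln P * (\<Sum>q\<in>{1..Q}. real q powr (- 25 / 16))"
        by (simp only: sum_distrib_left)
      also have "\<dots> \<le> K * P powr (real CARD('n) - 1 / 16) * M * ln P * Z"
        unfolding Z_def using K M0 P1 by (intro mult_left_mono sum_le_suminf summable_powr_nat) auto
      also have "P powr (real CARD('n) - 1 / 16) = P ^ CARD('n) * P powr (- 1 / 16)"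
      proof -
        have "real CARD('n) - 1 / 16 = real CARD('n) + (- 1 / 16)" by simp
        then show ?thesis using P1 by (simp only: powr_add) (simp add: powr_realpow)
      qed
      finally show ?thesis using P1 by (simp add: pos_divide_le_eq mult_ac)
    qed
    then have "eventually (\<lambda>P. err_sum c \<kappa> P / (P ^ CARD('n) * ln P) \<le> K * M * Z * P powr (- 1 / 16)) at_top"
      using eventually_ge_at_top[of "exp 1"] by (rule eventually_mono[rotated])
    moreover have "((\<lambda>P. K * M * Z * P powr (- 1 / 16)) \<longlongrightarrow> 0) at_top" by real_asymp
    ultimately show ?thesis by blast
  qed
  then obtain g where g: "(g \<longlongrightarrow> 0) at_top" "eventually (\<lambda>P. err_sum c \<kappa> P / (P ^ CARD('n) * ln P) \<le> g P) at_top"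
    by blast
  have "eventually (\<lambda>P. 0 \<le> err_sum c \<kappa> P / (P ^ CARD('n) * ln P)) at_top"
    using eventually_gt_at_top[of 1]
    by eventually_elim (auto intro!: divide_nonneg_nonneg mult_nonneg_nonneg err_sum_nonneg)
  from tendsto_sandwich[OF this g(2) tendsto_const g(1)] show ?thesis .
qed

definition main_sum :: "real \<Rightarrow> real \<Rightarrow> real \<Rightarrow> real" where
  "main_sum c \<kappa> P = (\<Sum>q\<in>{1..cutoff c \<kappa> P}. arith_coeff f q / real q * harm (cutoff c \<kappa> P div q))"

text \<open>Tannery's theorem: every harmonic number divided by \<open>ln P\<close> tends to
  \<open>\<kappa>\<close> and stays below the constant \<open>M\<close>, so the absolutely
  convergent series may be passed to the limit termwise.\<close>

lemma main_sum_asymptotic: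
  assumes s: "summable (\<lambda>q. \<bar>arith_coeff f q / real q\<bar>)" and c: "0 < c" and \<kappa>: "0 < \<kappa>"
  shows "((\<lambda>P. main_sum c \<kappa> P / ln P) \<longlongrightarrow> \<kappa> * suminf (\<lambda>q. arith_coeff f q / real q)) at_top"
proof -
  define M where "M = 1 + \<bar>ln c\<bar> + \<kappa>"
  let ?a = "\<lambda>q P. arith_coeff f q / real q * (harm (cutoff c \<kappa> P div q) / ln P)"
  have lim: "((\<lambda>P. ?a q P) \<longlongrightarrow> arith_coeff f q / real q * \<kappa>) at_top" for q
  proof (cases "q = 0")
    case False
    then show ?thesis by (intro tendsto_mult tendsto_const harm_cutoff_asymptotic c \<kappa>) simp
  qed simp
  have bd: "norm (?a q P) \<le> \<bar>arith_coeff f q / real q\<bar> * M" if P: "exp 1 \<le> P" for q P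
  proof -
    have "1 < exp (1::real)" by simp
    then have "1 < P" using P by linarith
    then have "0 < ln P" by simp
    then have "harm (cutoff c \<kappa> P div q) / ln P \<le> M"
      using harm_cutoff_le_ln[OF c \<kappa> P, of q] by (simp add: M_def pos_divide_le_eq)
    moreover have "0 \<le> harm (cutoff c \<kappa> P div q) / ln P" using \<open>0 < ln P\<close> by (simp add: harm_nonneg)
    ultimately show ?thesis by (simp only: real_norm_def abs_mult) (intro mult_left_mono, auto)
  qed
  have "eventually (\<lambda>(q, P). norm (?a q P) \<le> \<bar>arith_coeff f q / real q\<bar> * M) (at_top \<times>\<^sub>F at_top)"
    unfolding eventually_prod_filter
    by (intro exI[of _ "\<lambda>_. True"] exI[of _ "\<lambda>P. exp 1 \<le> P"]) (use bd in \<open>auto simp: eventually_ge_at_top\<close>)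
  moreover have "summable (\<lambda>q. \<bar>arith_coeff f q / real q\<bar> * M)" by (rule summable_mult2[OF s])
  ultimately have "((\<lambda>P. suminf (\<lambda>q. ?a q P)) \<longlongrightarrow> suminf (\<lambda>q. arith_coeff f q / real q * \<kappa>)) at_top"
    using tannerys_theorem[of ?a "\<lambda>q. arith_coeff f q / real q * \<kappa>" at_top "\<lambda>q. \<bar>arith_coeff f q / real q\<bar> * M"] lim
    by simp
  moreover have "suminf (\<lambda>q. ?a q P) = main_sum c \<kappa> P / ln P" for P
  proof -
    \<comment> \<open>Beyond the cutoff \<open>cutoff c \<kappa> P div q = 0\<close> makes the
      harmonic number zero, and the term at \<open>q = 0\<close> is zero as a division by
      zero.\<close>
    have "suminf (\<lambda>q. ?a q P) = (\<Sum>q\<in>{1..cutoff c \<kappa> P}. ?a q P)"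
    proof (rule suminf_finite)
      fix q assume "q \<notin> {1..cutoff c \<kappa> P}"
      then have "q = 0 \<or> cutoff c \<kappa> P div q = 0" by auto
      then show "?a q P = 0" by (auto simp: harm_def)
    qed simp
    then show ?thesis by (simp add: main_sum_def sum_divide_distrib)
  qed
  moreover have "suminf (\<lambda>q. arith_coeff f q / real q * \<kappa>) = \<kappa> * suminf (\<lambda>q. arith_coeff f q / real q)"
  proof -
    have "summable (\<lambda>q. arith_coeff f q / real q)" using s by (rule summable_rabs_cancel)
    from suminf_mult2[OF this, of \<kappa>, symmetric] show ?thesis by (simp only: mult.commute[of \<kappa>])
  qed
  ultimately show ?thesis by simp
qed

lemma divisor_count_asymptotic:
  assumes hom: "homogeneous_of_degree d f" and smooth: "smooth_form f" and d: "1 \<le> d"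
    and n: "2 ^ d * (d - 1) < CARD('n)" and c: "0 < c" and \<kappa>: "0 < \<kappa>" "\<kappa> \<le> real d / 2"
  shows "((\<lambda>P. divisor_count f (points P) (cutoff c \<kappa> P) / (P ^ CARD('n) * ln P)) \<longlongrightarrow>
    \<kappa> * vol * suminf (\<lambda>q. arith_coeff f q / real q)) at_top"
proof -
  have s: "summable (\<lambda>q. \<bar>arith_coeff f q / real q\<bar>)" by (rule summable_arith_coeff[OF hom smooth d n])
  let ?r = "\<lambda>P. divisor_count f (points P) (cutoff c \<kappa> P) - vol * P ^ CARD('n) * main_sum c \<kappa> P"
  have r: "\<bar>?r P\<bar> \<le> err_sum c \<kappa> P" if P: "1 \<le> P" for P
  proof -
    define Q where "Q = cutoff c \<kappa> P"
    have "?r P = (\<Sum>q\<in>{1..Q}. (ram_sum P q - vol * P ^ CARD('n) * arith_coeff f q) / real q * harm (Q div q))"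
      unfolding divisor_count_eq[OF finite_points[OF P]] main_sum_def Q_def[symmetric] ram_sum_def[symmetric]
        sum_distrib_left sum_subtractf[symmetric]
      by (intro sum.cong refl) (simp add: diff_divide_distrib left_diff_distrib)
    also have "\<bar>\<dots>\<bar> \<le> (\<Sum>q\<in>{1..Q}. \<bar>(ram_sum P q - vol * P ^ CARD('n) * arith_coeff f q) / real q * harm (Q div q)\<bar>)"
      by (rule sum_abs)
    also have "\<dots> = err_sum c \<kappa> P"
      unfolding err_sum_def Q_def[symmetric] err_def
      by (intro sum.cong refl) (simp add: abs_mult abs_divide harm_nonneg)
    finally show ?thesis .
  qed
  have "((\<lambda>P. ?r P / (P ^ CARD('n) * ln P)) \<longlongrightarrow> 0) at_top"
  proof (rule Lim_null_comparison)
    show "eventually (\<lambda>P. norm (?r P / (P ^ CARD('n) * ln P)) \<le> err_sum c \<kappa> P / (P ^ CARD('n) * ln P)) at_top"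
      using eventually_gt_at_top[of 1]
    proof eventually_elim
      case (elim P)
      then have "0 < P ^ CARD('n) * ln P" by simp
      then show ?case using r[of P] elim by (simp add: abs_divide divide_right_mono)
    qed
  qed (rule err_sum_negligible[OF assms])
  moreover have "((\<lambda>P. vol * (main_sum c \<kappa> P / ln P)) \<longlongrightarrow> vol * (\<kappa> * suminf (\<lambda>q. arith_coeff f q / real q))) at_top"
    by (intro tendsto_mult tendsto_const main_sum_asymptotic s c \<kappa>)
  ultimately have "((\<lambda>P. ?r P / (P ^ CARD('n) * ln P) + vol * (main_sum c \<kappa> P / ln P)) \<longlongrightarrow>
      0 + vol * (\<kappa> * suminf (\<lambda>q. arith_coeff f q / real q))) at_top" by (rule tendsto_add)
  moreover have "eventually (\<lambda>P. ?r P / (P ^ CARD('n) * ln P) + vol * (main_sum c \<kappa> P / ln P) =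
      divisor_count f (points P) (cutoff c \<kappa> P) / (P ^ CARD('n) * ln P)) at_top"
    using eventually_gt_at_top[of 1]
  proof eventually_elim
    case (elim P)
    then have "vol * P ^ CARD('n) * main_sum c \<kappa> P / (P ^ CARD('n) * ln P) = vol * (main_sum c \<kappa> P / ln P)" by simp
    then show ?case by (simp add: diff_divide_distrib)
  qed
  ultimately have "((\<lambda>P. divisor_count f (points P) (cutoff c \<kappa> P) / (P ^ CARD('n) * ln P)) \<longlongrightarrow>
      0 + vol * (\<kappa> * suminf (\<lambda>q. arith_coeff f q / real q))) at_top"
    by (rule Lim_transform_eventually)
  then show ?thesis by (simp add: mult_ac)
qed

end

section \<open>Small values of the form\<close>

text \<open>Stated for degree bounds instead of degrees, because a coordinate may be constant along
  a line and the top coefficient of its factor zero.\<close>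

lemma coeff_mult_top:
  fixes p q :: "'a::comm_semiring_0 poly"
  assumes "degree p \<le> a" "degree q \<le> b"
  shows "coeff (p * q) (a + b) = coeff p a * coeff q b"
proof -
  have "coeff (p * q) (a + b) = (\<Sum>i\<le>a + b. coeff p i * coeff q (a + b - i))" by (rule coeff_mult)
  also have "\<dots> = (\<Sum>i\<in>{a}. coeff p i * coeff q (a + b - i))"
  proof (rule sum.mono_neutral_right)
    show "\<forall>i\<in>{..a + b} - {a}. coeff p i * coeff q (a + b - i) = 0"
    proof
      fix i assume i: "i \<in> {..a + b} - {a}"
      show "coeff p i * coeff q (a + b - i) = 0"
      proof (cases "i < a")
        case True
        then have "degree q < a + b - i" using assms(2) by linarith
        then show ?thesis by (simp add: coeff_eq_0)
      next
        case False
        then have "degree p < i" using assms(1) i by auto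
        then show ?thesis by (simp add: coeff_eq_0)
      qed
    qed
  qed auto
  finally show ?thesis by simp
qed

lemma linear_power_top:
  fixes y v :: "'a::comm_semiring_1"
  shows "degree ([:y, v:] ^ m) \<le> m \<and> coeff ([:y, v:] ^ m) m = v ^ m"
proof (induction m)
  case (Suc m)
  have 1: "degree [:y, v:] \<le> 1" by simp
  have "degree ([:y, v:] * [:y, v:] ^ m) \<le> 1 + m"
    using degree_mult_le[of "[:y, v:]" "[:y, v:] ^ m"] Suc 1 by linarith
  moreover have "coeff ([:y, v:] * [:y, v:] ^ m) (1 + m) = coeff [:y, v:] 1 * coeff ([:y, v:] ^ m) m"
    by (rule coeff_mult_top[OF 1]) (use Suc in blast)
  ultimately show ?case using Suc by simp
qed simp

lemma prod_top:
  fixes p :: "'i \<Rightarrow> 'a::comm_semiring_1 poly"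
  assumes "finite A" "\<And>i. i \<in> A \<Longrightarrow> degree (p i) \<le> m i"
  shows "degree (\<Prod>i\<in>A. p i) \<le> (\<Sum>i\<in>A. m i) \<and> coeff (\<Prod>i\<in>A. p i) (\<Sum>i\<in>A. m i) = (\<Prod>i\<in>A. coeff (p i) (m i))"
  using assms
proof (induction A rule: finite_induct)
  case (insert j A)
  have IH: "degree (\<Prod>i\<in>A. p i) \<le> (\<Sum>i\<in>A. m i)" "coeff (\<Prod>i\<in>A. p i) (\<Sum>i\<in>A. m i) = (\<Prod>i\<in>A. coeff (p i) (m i))"
    using insert by auto
  have j: "degree (p j) \<le> m j" using insert by simp
  have "degree (p j * (\<Prod>i\<in>A. p i)) \<le> m j + (\<Sum>i\<in>A. m i)"
    using degree_mult_le[of "p j" "\<Prod>i\<in>A. p i"] IH(1) j by linarith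
  moreover have "coeff (p j * (\<Prod>i\<in>A. p i)) (m j + (\<Sum>i\<in>A. m i)) = coeff (p j) (m j) * (\<Prod>i\<in>A. coeff (p i) (m i))"
    using coeff_mult_top[OF j IH(1)] IH(2) by simp
  ultimately show ?case using insert.hyps by simp
qed simp

section \<open>Restriction of the form to a line\<close>

definition line_poly :: "('n::finite) int_mpoly \<Rightarrow> int ^ 'n \<Rightarrow> int ^ 'n \<Rightarrow> complex poly" where
  "line_poly f y v = (\<Sum>e\<in>Poly_Mapping.keys f. smult (of_int (Poly_Mapping.lookup f e))
     (\<Prod>i\<in>UNIV. [:of_int (y $ i), of_int (v $ i):] ^ Poly_Mapping.lookup e i))"

lemma poly_line_poly: "poly (line_poly f y v) (of_int t) = of_int (mpoly_eval f (y + t *s v))"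
  by (simp add: line_poly_def mpoly_eval_def poly_sum poly_prod poly_power algebra_simps)

text \<open>The coefficient of \<open>t ^ d\<close> in direction \<open>v\<close> is
  \<open>f v\<close>, a nonzero integer, hence at least 1 in absolute value for every base point
  \<open>y\<close>.\<close>

lemma line_poly_degree:
  assumes hom: "homogeneous_of_degree d f" and v: "mpoly_eval f v \<noteq> 0"
  shows "degree (line_poly f y v) = d" "1 \<le> norm (lead_coeff (line_poly f y v))"
proof -
  let ?p = "\<lambda>e. \<Prod>i\<in>UNIV. [:of_int (y $ i), of_int (v $ i) :: complex:] ^ Poly_Mapping.lookup e i"
  have p: "degree (?p e) \<le> d \<and> coeff (?p e) d = (\<Prod>i\<in>UNIV. of_int (v $ i) ^ Poly_Mapping.lookup e i)"
    if "e \<in> Poly_Mapping.keys f" for e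
  proof -
    have "(\<Sum>i\<in>UNIV. Poly_Mapping.lookup e i) = d"
      using homogeneous_exp_degree[OF hom that] by (simp add: exp_degree_def)
    then show ?thesis
      using prod_top[of UNIV "\<lambda>i. [:of_int (y $ i), of_int (v $ i) :: complex:] ^ Poly_Mapping.lookup e i" "Poly_Mapping.lookup e",
          OF finite linear_power_top[THEN conjunct1]]
      by (simp add: linear_power_top[THEN conjunct2])
  qed
  have deg: "degree (line_poly f y v) \<le> d"
    unfolding line_poly_def using p by (intro degree_sum_le finite_keys order_trans[OF degree_smult_le]) auto
  have c: "coeff (line_poly f y v) d = of_int (mpoly_eval f v)"
    unfolding line_poly_def mpoly_eval_def using p by (simp add: coeff_sum)
  then have "coeff (line_poly f y v) d \<noteq> 0" using v by simp
  then show 1: "degree (line_poly f y v) = d" using deg le_degree le_antisym by blast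
  have "1 \<le> \<bar>mpoly_eval f v\<bar>" using v by linarith
  then have "1 \<le> \<bar>real_of_int (mpoly_eval f v)\<bar>" by linarith
  then show "1 \<le> norm (lead_coeff (line_poly f y v))" unfolding 1 c by simp
qed

text \<open>If \<open>f\<close> vanished at all integer points, so would its differences and with
  them the gradient at the all-ones vector.\<close>

lemma smooth_form_nonzero_value:
  fixes f :: "('n::finite) int_mpoly"
  assumes hom: "homogeneous_of_degree d f" and smooth: "smooth_form f" and d: "1 \<le> d"
  shows "\<exists>v :: int ^ 'n. mpoly_eval f v \<noteq> 0"
proof (rule ccontr)
  assume "\<not> ?thesis"
  then have "mpoly_eval f = (\<lambda>x :: int ^ 'n. 0)" by auto
  then have "polar f hs = 0" for hs by (simp add: polar_def fdiffs_zero)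
  moreover obtain k where k: "d = Suc k" using d by (cases d) auto
  ultimately have "mpoly_eval (mpoly_pderiv i f) ((\<chi> i. 1) :: int ^ 'n) = 0" for i
    using polar_gradient[OF hom k, of "\<chi> i. 1" i] by simp
  moreover have "mpoly_eval (mpoly_pderiv i f) ((\<chi> j. of_int (((\<chi> i. 1) :: int ^ 'n) $ j)) :: complex ^ 'n) =
      of_int (mpoly_eval (mpoly_pderiv i f) ((\<chi> i. 1) :: int ^ 'n))" for i
    by (rule mpoly_eval_of_int)
  ultimately have "mpoly_eval (mpoly_pderiv i f) ((\<chi> i. 1) :: complex ^ 'n) = 0" for i by simp
  moreover have "(\<chi> i. 1) \<noteq> (0 :: complex ^ 'n)" by (simp add: vec_eq_iff)
  ultimately show False using smooth unfolding smooth_form_def by blast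
qed

lemma homogeneous_eval_zero:
  assumes hom: "homogeneous_of_degree d f" and d: "1 \<le> d"
  shows "mpoly_eval f (0 :: int ^ 'n::finite) = 0"
proof -
  have *: "(\<Prod>i\<in>UNIV. (0::int) ^ Poly_Mapping.lookup e i) = 0" if "e \<in> Poly_Mapping.keys f" for e
  proof -
    have "(\<Sum>i\<in>UNIV. Poly_Mapping.lookup e i) \<noteq> 0"
      using homogeneous_exp_degree[OF hom that] d by (simp add: exp_degree_def)
    then obtain i where "Poly_Mapping.lookup e i \<noteq> 0" by (metis sum.neutral)
    then show ?thesis by (intro prod_zero) auto
  qed
  show ?thesis
    unfolding mpoly_eval_def by (intro sum.neutral ballI) (simp only: zero_index * mult_zero_right)
qed

text \<open>Slicing along a direction \<open>v\<close> with \<open>f v \<noteq> 0\<close> reduces to one variable.\<close>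
lemma sublevel_card:
  fixes f :: "('n::finite) int_mpoly"
  assumes hom: "homogeneous_of_degree d f" and smooth: "smooth_form f" and d: "1 \<le> d"
  shows "\<exists>C>0. \<forall>N\<ge>1. \<forall>T\<ge>1. real (card {x\<in>int_box N. \<bar>real_of_int (mpoly_eval f x)\<bar> \<le> T}) \<le>
    C * real N ^ (CARD('n) - 1) * T powr (1 / real d)"
proof -
  obtain v :: "int ^ 'n" where v: "mpoly_eval f v \<noteq> 0" using smooth_form_nonzero_value[OF assms] by blast
  then have "v \<noteq> 0" using homogeneous_eval_zero[OF hom d] by auto
  then obtain i0 where i0: "v $ i0 \<noteq> 0" by (auto simp: vec_eq_iff)
  define w where "w = v $ i0"
  define V where "V = (\<Sum>i\<in>UNIV. nat \<bar>v $ i\<bar>)"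
  have V: "\<bar>v $ i\<bar> \<le> int V" for i
  proof -
    have "nat \<bar>v $ i\<bar> \<le> V" unfolding V_def by (rule member_le_sum) auto
    then show ?thesis by linarith
  qed
  \<comment> \<open>Subtracting \<open>t *s v\<close> with \<open>\<bar>t\<bar> \<le> N + V\<close>
    keeps the coordinates within \<open>N + (N + V) * V \<le> N * L\<close>.\<close>
  define L where "L = 1 + (1 + V) * V"
  show ?thesis
  proof (intro exI[of _ "(2 * real V + 1) * (3 * real L) ^ (CARD('n) - 1) * (3 * real d)"] conjI allI impI)
    show "0 < (2 * real V + 1) * (3 * real L) ^ (CARD('n) - 1) * (3 * real d)"
      using d by (intro mult_pos_pos zero_less_power) (auto simp: L_def intro!: add_pos_nonneg)
    fix N :: nat and T :: real assume N: "1 \<le> N" and T: "1 \<le> T"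
    define S where "S = {x\<in>int_box N. \<bar>real_of_int (mpoly_eval f x)\<bar> \<le> T}"
    have finS: "finite (S :: (int ^ 'n) set)" by (simp add: S_def)
    define Y where "Y = {y :: int ^ 'n. \<forall>i. y $ i \<in> (if i = i0 then {- int V..int V} else {- int (N * L)..int (N * L)})}"
    \<comment> \<open>A base point on the line through \<open>x\<close> in direction
      \<open>v\<close>. Its coordinate \<open>i0\<close> is reduced modulo \<open>w\<close> and
      takes boundedly many values, so only \<open>O(N ^ (n - 1))\<close> lines occur.\<close>
    define \<pi> where "\<pi> x = x - (x $ i0 div w) *s v" for x :: "int ^ 'n"
    have finY: "finite Y" and cardY: "card Y = (2 * V + 1) * (2 * (N * L) + 1) ^ (CARD('n) - 1)"
    proof -
      let ?A = "\<lambda>i. if i = i0 then {- int V..int V} else {- int (N * L)..int (N * L)}"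
      have "finite (?A i)" for i by simp
      then have *: "finite Y \<and> card Y = (\<Prod>i\<in>UNIV. card (?A i))" unfolding Y_def by (rule card_vec_box)
      then show "finite Y" by simp
      have "(\<Prod>i\<in>UNIV. card (?A i)) = card (?A i0) * (\<Prod>i\<in>UNIV - {i0}. card (?A i))" by (rule prod.remove) auto
      also have "card (?A i0) = 2 * V + 1" by simp
      also have "(\<Prod>i\<in>UNIV - {i0}. card (?A i)) = (\<Prod>i\<in>UNIV - {i0}. 2 * (N * L) + 1)"
        by (intro prod.cong refl) (auto simp: nat_add_distrib nat_mult_distrib)
      also have "\<dots> = (2 * (N * L) + 1) ^ (CARD('n) - 1)" by simp
      finally show "card Y = (2 * V + 1) * (2 * (N * L) + 1) ^ (CARD('n) - 1)" using * by simp
    qed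
    have im: "\<pi> ` S \<subseteq> Y"
    proof (rule image_subsetI)
      fix x assume "x \<in> S"
      then have x: "\<bar>x $ i\<bar> \<le> int N" for i by (auto simp: S_def int_box_def)
      define t where "t = x $ i0 div w"
      have tw: "x $ i0 = t * w + x $ i0 mod w" by (simp add: t_def)
      have w0: "w \<noteq> 0" using i0 by (simp add: w_def)
      have wV: "\<bar>w\<bar> \<le> int V" using V[of i0] by (simp add: w_def)
      have md: "\<bar>x $ i0 mod w\<bar> \<le> int V" using abs_mod_less[OF w0, of "x $ i0"] wV by linarith
      have "\<bar>t\<bar> * 1 \<le> \<bar>t\<bar> * \<bar>w\<bar>" using w0 by (intro mult_left_mono) auto
      also have "\<dots> = \<bar>t * w\<bar>" by (simp add: abs_mult)
      also have "\<dots> \<le> int N + int V" using tw x[of i0] md by linarith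
      finally have t: "\<bar>t\<bar> \<le> int N + int V" by simp
      have "\<pi> x $ i \<in> (if i = i0 then {- int V..int V} else {- int (N * L)..int (N * L)})" for i
      proof (cases "i = i0")
        case True
        have "\<pi> x $ i = x $ i0 mod w" using tw True by (simp add: \<pi>_def t_def[symmetric] w_def[symmetric])
        then show ?thesis using md True by (auto simp: abs_le_iff)
      next
        case False
        have "\<bar>t * v $ i\<bar> \<le> (int N + int V) * int V" unfolding abs_mult using t V by (intro mult_mono) auto
        moreover have "\<pi> x $ i = x $ i - t * v $ i" by (simp add: \<pi>_def t_def)
        ultimately have "\<bar>\<pi> x $ i\<bar> \<le> int N + (int N + int V) * int V" using x[of i] by linarith
        also have "\<dots> \<le> int N * int L"
        proof -
          have "int V * 1 \<le> int V * int N" using N by (intro mult_left_mono) auto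
          then have "(int N + int V) * int V \<le> (int N + int V * int N) * int V" by (intro mult_right_mono) auto
          then show ?thesis by (simp add: L_def algebra_simps)
        qed
        finally show ?thesis using False by (simp add: abs_le_iff)
      qed
      then show "\<pi> x \<in> Y" by (simp add: Y_def)
    qed
    have T0: "0 \<le> T" "1 \<le> T powr (1 / real d)" using T by (auto simp: ge_one_powr_ge_zero)
    define M where "M = nat \<lfloor>3 * real d * T powr (1 / real d)\<rfloor>"
    have fib: "card {x\<in>S. \<pi> x = y} \<le> M" for y
    proof -
      define Z where "Z = {t::int. norm (poly (line_poly f y v) (of_int t)) \<le> T}"
      have Z: "finite Z" "real (card Z) \<le> real d * (2 * T powr (1 / real d) + 1)"
        unfolding Z_def using poly_sublevel_card[OF line_poly_degree(1)[OF hom v] _ line_poly_degree(2)[OF hom v] T0(1)] d by auto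
      have "{x\<in>S. \<pi> x = y} \<subseteq> (\<lambda>t. y + t *s v) ` Z"
      proof
        fix x assume x: "x \<in> {x\<in>S. \<pi> x = y}"
        then have eq: "x = y + (x $ i0 div w) *s v" by (auto simp: \<pi>_def)
        have "poly (line_poly f y v) (of_int (x $ i0 div w)) = of_int (mpoly_eval f x)"
          unfolding poly_line_poly by (subst (2) eq) (rule refl)
        then have "x $ i0 div w \<in> Z" using x by (simp add: Z_def S_def)
        then show "x \<in> (\<lambda>t. y + t *s v) ` Z" using eq by blast
      qed
      then have "card {x\<in>S. \<pi> x = y} \<le> card ((\<lambda>t. y + t *s v) ` Z)" using Z(1) by (intro card_mono) auto
      also have "\<dots> \<le> card Z" using Z(1) by (rule card_image_le)
      finally have "real (card {x\<in>S. \<pi> x = y}) \<le> real (card Z)" by (rule of_nat_mono)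
      also have "\<dots> \<le> real d * (2 * T powr (1 / real d) + 1)" by (rule Z(2))
      also have "\<dots> \<le> real d * (3 * T powr (1 / real d))" using T0 by (intro mult_left_mono) auto
      finally show ?thesis unfolding M_def by (simp add: le_nat_floor mult_ac)
    qed
    have "card S \<le> card Y * M" by (rule card_le_fibres[OF finS finY im fib])
    then have "real (card S) \<le> real (card Y * M)" by (rule of_nat_mono)
    also have "\<dots> = (2 * real V + 1) * (2 * (real N * real L) + 1) ^ (CARD('n) - 1) * real M" by (simp add: cardY algebra_simps)
    also have "\<dots> \<le> (2 * real V + 1) * ((3 * real L) ^ (CARD('n) - 1) * real N ^ (CARD('n) - 1)) * (3 * real d * T powr (1 / real d))"
    proof (intro mult_mono)
      have "1 \<le> L" by (simp add: L_def)
      then have "1 * 1 \<le> N * L" using N by (intro mult_le_mono) auto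
      then have "1 \<le> real (N * L)" by linarith
      then have "2 * (real N * real L) + 1 \<le> 3 * real L * real N" by (simp add: mult.commute)
      then show "(2 * (real N * real L) + 1) ^ (CARD('n) - 1) \<le> (3 * real L) ^ (CARD('n) - 1) * real N ^ (CARD('n) - 1)"
        unfolding power_mult_distrib[symmetric] by (rule power_mono) simp
      have "0 \<le> 3 * real d * T powr (1 / real d)" by simp
      then show "real M \<le> 3 * real d * T powr (1 / real d)" unfolding M_def by simp
    qed auto
    also have "\<dots> = (2 * real V + 1) * (3 * real L) ^ (CARD('n) - 1) * (3 * real d) * real N ^ (CARD('n) - 1) * T powr (1 / real d)"
      by (simp only: mult_ac)
    finally show "real (card {x\<in>int_box N. \<bar>real_of_int (mpoly_eval f x)\<bar> \<le> T}) \<le>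
       (2 * real V + 1) * (3 * real L) ^ (CARD('n) - 1) * (3 * real d) * real N ^ (CARD('n) - 1) * T powr (1 / real d)"
      unfolding S_def .
  qed
qed

text \<open>Of two complementary divisors one is at most the square root.\<close>

lemma divisor_tau_le_twice:
  assumes m: "0 < m" and Q: "\<And>q. q * q \<le> m \<Longrightarrow> q \<le> Q"
  shows "divisor_tau m \<le> 2 * card {q\<in>{1..Q}. q dvd m}"
proof -
  define A where "A = {q\<in>{1..Q}. q dvd m}"
  have finA: "finite A" by (simp add: A_def)
  have "{k. k dvd m} \<subseteq> A \<union> (\<lambda>k. m div k) ` A"
  proof
    fix k assume "k \<in> {k. k dvd m}"
    then obtain l where kl: "m = k * l" by (auto elim: dvdE)
    then have pos: "0 < k" "0 < l" using m by auto
    show "k \<in> A \<union> (\<lambda>k. m div k) ` A"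
    proof (cases "k \<le> l")
      case True
      then have "k * k \<le> m" by (simp add: kl)
      then show ?thesis using Q[of k] pos kl by (auto simp: A_def)
    next
      case False
      then have "l * l \<le> m" by (simp add: kl)
      then have "l \<in> A" using Q[of l] pos kl by (auto simp: A_def)
      moreover have "k = m div l" using kl pos by simp
      ultimately show ?thesis by blast
    qed
  qed
  then have "divisor_tau m \<le> card (A \<union> (\<lambda>k. m div k) ` A)"
    unfolding divisor_tau_def using finA by (intro card_mono) auto
  also have "\<dots> \<le> card A + card ((\<lambda>k. m div k) ` A)" by (rule card_Un_le)
  also have "\<dots> \<le> card A + card A" using card_image_le[OF finA] by simp
  finally show ?thesis by (simp add: A_def)
qed

text \<open>As long as \<open>Q\<close> stays below the square root, the complementary divisors are
  distinct and all exceed \<open>Q\<close>.\<close>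

lemma twice_le_divisor_tau:
  assumes m: "0 < m" and Q: "\<And>q. q \<le> Q \<Longrightarrow> q * q < m"
  shows "2 * card {q\<in>{1..Q}. q dvd m} \<le> divisor_tau m"
proof -
  define A where "A = {q\<in>{1..Q}. q dvd m}"
  have finA: "finite A" by (simp add: A_def)
  have inj: "inj_on (\<lambda>k. m div k) A"
  proof (rule inj_onI)
    fix k l assume kl: "k \<in> A" "l \<in> A" "m div k = m div l"
    then have "k dvd m" "l dvd m" by (auto simp: A_def)
    then have "m = k * (m div k)" "m = l * (m div l)" by auto
    then show "k = l" using kl(3) m by (metis mult_cancel2 mult_0_right less_irrefl)
  qed
  have "A \<inter> (\<lambda>k. m div k) ` A = {}"
  proof (rule ccontr)
    assume "\<not> ?thesis"
    then obtain k l where kl: "k \<in> A" "l \<in> A" "k = m div l" by blast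
    then have "m = k * l" by (auto simp: A_def)
    moreover have "k * k < m" "l * l < m" using Q kl by (auto simp: A_def)
    ultimately have "k < l" "l < k" by auto
    then show False by simp
  qed
  then have "card (A \<union> (\<lambda>k. m div k) ` A) = card A + card A"
    using finA card_image[OF inj] by (simp add: card_Un_disjoint)
  moreover have "A \<union> (\<lambda>k. m div k) ` A \<subseteq> {k. k dvd m}" by (auto simp: A_def dest: dvd_div_mult_self intro: dvdI[OF dvd_div_mult_self[symmetric]])
  moreover have "finite {k. k dvd m}" using m by simp
  ultimately have "card A + card A \<le> divisor_tau m" unfolding divisor_tau_def by (metis card_mono)
  then show ?thesis by (simp add: A_def)
qed

lemma int_dvd_iff_dvd_nat_abs: "int q dvd z \<longleftrightarrow> q dvd nat \<bar>z\<bar>"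
proof -
  have "int q dvd z \<longleftrightarrow> int q dvd int (nat \<bar>z\<bar>)" by simp
  then show ?thesis by (simp only: int_dvd_int_iff)
qed

lemma divisor_count_swap:
  assumes "finite X"
  shows "divisor_count f X Q = (\<Sum>x\<in>X. real (card {q\<in>{1..Q}. q dvd nat \<bar>mpoly_eval f x\<bar>}))"
proof -
  have "divisor_count f X Q = (\<Sum>q\<in>{1..Q}. \<Sum>x\<in>X. if int q dvd mpoly_eval f x then 1 else 0)"
    unfolding divisor_count_def using assms by (simp add: sum.If_cases Int_def)
  also have "\<dots> = (\<Sum>x\<in>X. \<Sum>q\<in>{1..Q}. if int q dvd mpoly_eval f x then 1 else 0)" by (rule sum.swap)
  also have "\<dots> = (\<Sum>x\<in>X. real (card {q\<in>{1..Q}. q dvd nat \<bar>mpoly_eval f x\<bar>}))"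
    unfolding int_dvd_iff_dvd_nat_abs by (simp add: sum.If_cases Int_def)
  finally show ?thesis .
qed

section \<open>The divisor sum\<close>

lemma eval_abs_le:
  fixes f :: "('n::finite) int_mpoly"
  assumes hom: "homogeneous_of_degree d f"
  shows "\<exists>C\<ge>1. \<forall>P\<ge>0. \<forall>x :: int ^ 'n. (\<forall>i. \<bar>real_of_int (x $ i)\<bar> \<le> P) \<longrightarrow>
    \<bar>real_of_int (mpoly_eval f x)\<bar> \<le> C * P ^ d"
proof (intro exI[of _ "1 + (\<Sum>e\<in>Poly_Mapping.keys f. \<bar>real_of_int (Poly_Mapping.lookup f e)\<bar>)"] conjI allI impI)
  fix P :: real and x :: "int ^ 'n"
  assume P: "0 \<le> P" and x: "\<forall>i. \<bar>real_of_int (x $ i)\<bar> \<le> P"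
  have "\<bar>\<Prod>i\<in>UNIV. real_of_int (x $ i) ^ Poly_Mapping.lookup e i\<bar> \<le> P ^ d" if "e \<in> Poly_Mapping.keys f" for e
  proof -
    have "\<bar>\<Prod>i\<in>UNIV. real_of_int (x $ i) ^ Poly_Mapping.lookup e i\<bar> = (\<Prod>i\<in>UNIV. \<bar>real_of_int (x $ i)\<bar> ^ Poly_Mapping.lookup e i)"
      by (simp add: abs_prod power_abs)
    also have "\<dots> \<le> (\<Prod>i\<in>UNIV. P ^ Poly_Mapping.lookup e i)"
      using x by (intro prod_mono conjI power_mono) auto
    also have "\<dots> = P ^ d"
      using homogeneous_exp_degree[OF hom that] by (simp add: exp_degree_def power_sum[symmetric])
    finally show ?thesis .
  qed
  then have "\<bar>real_of_int (mpoly_eval f x)\<bar> \<le> (\<Sum>e\<in>Poly_Mapping.keys f. \<bar>real_of_int (Poly_Mapping.lookup f e)\<bar> * P ^ d)"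
    unfolding mpoly_eval_def of_int_sum
    by (intro order_trans[OF sum_abs] sum_mono) (simp add: abs_mult mult_left_mono)
  also have "\<dots> \<le> (1 + (\<Sum>e\<in>Poly_Mapping.keys f. \<bar>real_of_int (Poly_Mapping.lookup f e)\<bar>)) * P ^ d"
    using P by (simp add: sum_distrib_right[symmetric] mult_right_mono)
  finally show "\<bar>real_of_int (mpoly_eval f x)\<bar> \<le> (1 + (\<Sum>e\<in>Poly_Mapping.keys f. \<bar>real_of_int (Poly_Mapping.lookup f e)\<bar>)) * P ^ d" .
qed (simp add: sum_nonneg)

context unit_box
begin

lemma divisor_sum_points:
  assumes P: "1 \<le> P"
  shows "divisor_sum f (cbox a a') P =
    (\<Sum>x\<in>points P. if mpoly_eval f x = 0 then 0 else real (divisor_tau (nat \<bar>mpoly_eval f x\<bar>)))"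
proof -
  have "{x. x \<in> lattice_points (cbox a a') P \<and> mpoly_eval f x \<noteq> 0} = {x\<in>points P. mpoly_eval f x \<noteq> 0}"
    unfolding points_def scaled_box.points_def[OF scaled[OF P]] by simp
  then show ?thesis
    unfolding divisor_sum_def using finite_points[OF P] by (simp add: sum.If_cases Int_def)
qed

lemma points_abs_le:
  assumes c: "cbox a a' \<subseteq> {t. \<forall>j. -1 \<le> t $ j \<and> t $ j \<le> 1}" and P: "1 \<le> P" and x: "x \<in> points P"
  shows "\<bar>real_of_int (x $ i)\<bar> \<le> P"
proof -
  from x obtain t where t: "t \<in> cbox a a'" "(\<chi> i. real_of_int (x $ i)) = P *\<^sub>R t"
    unfolding points_def scaled_box.points_def[OF scaled[OF P]] by (auto simp: lattice_points_def)
  have "-1 \<le> t $ i \<and> t $ i \<le> 1" using subsetD[OF c t(1)] by simp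
  then have "\<bar>t $ i\<bar> \<le> 1" by (simp add: abs_le_iff)
  moreover have "real_of_int (x $ i) = P * t $ i" using arg_cong[OF t(2), of "\<lambda>v. v $ i"] by simp
  ultimately show ?thesis using P by (simp add: abs_mult mult_left_le)
qed

text \<open>Since \<open>\<bar>f x\<bar> \<le> C * P ^ d\<close>, every divisor up to the square
  root is caught by the cutoff \<open>sqrt C * P powr (d / 2)\<close>. Zeros of \<open>f\<close>
  contribute to the right side only.\<close>

lemma divisor_sum_le:
  assumes C: "0 < C" "\<And>x. x \<in> points P \<Longrightarrow> \<bar>real_of_int (mpoly_eval f x)\<bar> \<le> C * P ^ d" and P: "1 \<le> P"
  shows "divisor_sum f (cbox a a') P \<le> 2 * divisor_count f (points P) (cutoff (sqrt C) (real d / 2) P)"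
  unfolding divisor_sum_points[OF P] divisor_count_swap[OF finite_points[OF P]] sum_distrib_left
proof (rule sum_mono)
  fix x assume x: "x \<in> points P"
  let ?m = "nat \<bar>mpoly_eval f x\<bar>" and ?Q = "cutoff (sqrt C) (real d / 2) P"
  have "q \<le> ?Q" if q: "q * q \<le> ?m" for q
  proof -
    have "real (q * q) \<le> real ?m" using q by (rule of_nat_mono)
    also have "\<dots> \<le> C * P ^ d" using C(2)[OF x] by simp
    also have "\<dots> = (sqrt C * P powr (real d / 2))\<^sup>2"
      using C(1) P by (simp add: power_mult_distrib power2_eq_square[of "P powr _"] powr_add[symmetric] powr_realpow)
    finally have "(real q)\<^sup>2 \<le> (sqrt C * P powr (real d / 2))\<^sup>2" by (simp add: power2_eq_square)
    then have "real q \<le> sqrt C * P powr (real d / 2)" by (rule power2_le_imp_le) (use C(1) in simp)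
    then show ?thesis unfolding cutoff_def by (simp add: le_nat_floor)
  qed
  then have "divisor_tau ?m \<le> 2 * card {q\<in>{1..?Q}. q dvd ?m}" if "mpoly_eval f x \<noteq> 0"
    using that by (intro divisor_tau_le_twice) auto
  then show "(if mpoly_eval f x = 0 then 0 else real (divisor_tau ?m)) \<le> 2 * real (card {q\<in>{1..?Q}. q dvd ?m})"
    by (auto dest!: of_nat_mono[where 'a = real])
qed

text \<open>Twice the number of divisors up to \<open>Q\<close> can exceed \<open>\<tau>\<close>
  only where \<open>\<bar>f x\<bar> \<le> T\<close>. A nonzero small value is repaired by counting
  its \<open>\<tau>\<close> a second time, and a zero by the full \<open>2 * Q\<close>.\<close>

lemma divisor_sum_ge:
  assumes P: "1 \<le> P" and Q: "real Q * real Q \<le> T"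
  shows "2 * divisor_count f (points P) Q \<le> divisor_sum f (cbox a a') P
    + 2 * real Q * real (card {x\<in>points P. mpoly_eval f x = 0})
    + (\<Sum>x\<in>{x\<in>points P. mpoly_eval f x \<noteq> 0 \<and> \<bar>real_of_int (mpoly_eval f x)\<bar> \<le> T}. real (divisor_tau (nat \<bar>mpoly_eval f x\<bar>)))"
proof -
  let ?m = "\<lambda>x. nat \<bar>mpoly_eval f x\<bar>"
  let ?c = "\<lambda>x. card {q\<in>{1..Q}. q dvd ?m x}"
  let ?S = "\<lambda>x. mpoly_eval f x \<noteq> 0 \<and> \<bar>real_of_int (mpoly_eval f x)\<bar> \<le> T"
  have "2 * real (?c x) \<le> (if mpoly_eval f x = 0 then 0 else real (divisor_tau (?m x)))
      + (if mpoly_eval f x = 0 then 2 * real Q else 0) + (if ?S x then real (divisor_tau (?m x)) else 0)" for x :: "int ^ 'n"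
  proof (cases "mpoly_eval f x = 0")
    case True
    have "?c x \<le> card {1..Q}" by (intro card_mono) auto
    then show ?thesis using True by simp
  next
    case nz: False
    show ?thesis
    proof (cases "\<bar>real_of_int (mpoly_eval f x)\<bar> \<le> T")
      case True
      have "?c x \<le> divisor_tau (?m x)" unfolding divisor_tau_def using nz by (intro card_mono finite_divisors_nat) auto
      then show ?thesis using nz True by simp
    next
      case False
      have "q * q < ?m x" if "q \<le> Q" for q
      proof -
        have "real (q * q) \<le> real Q * real Q" unfolding of_nat_mult using that by (intro mult_mono) auto
        then have "real (q * q) < real (?m x)" using Q False by simp
        then show ?thesis by (rule of_nat_less_imp_less)
      qed
      then have "2 * ?c x \<le> divisor_tau (?m x)" using nz by (intro twice_le_divisor_tau) auto
      then show ?thesis using nz False by (auto dest!: of_nat_mono[where 'a = real])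
    qed
  qed
  then have "2 * divisor_count f (points P) Q \<le> (\<Sum>x\<in>points P. (if mpoly_eval f x = 0 then 0 else real (divisor_tau (?m x)))
      + (if mpoly_eval f x = 0 then 2 * real Q else 0) + (if ?S x then real (divisor_tau (?m x)) else 0))"
    unfolding divisor_count_swap[OF finite_points[OF P]] sum_distrib_left by (intro sum_mono)
  then show ?thesis
    unfolding divisor_sum_points[OF P] sum.distrib using finite_points[OF P]
    by (simp add: sum.If_cases Int_def mult_ac)
qed

lemma zeros_le:
  assumes P: "1 \<le> P" and \<kappa>: "0 < \<kappa>"
  shows "P powr \<kappa> * real (card {x\<in>points P. mpoly_eval f x = 0}) \<le> 2 * divisor_count f (points P) (cutoff 1 \<kappa> P)"
proof -
  let ?Z = "{x\<in>points P. mpoly_eval f x = 0}" and ?Q = "cutoff 1 \<kappa> P"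
  \<comment> \<open>Rounding down costs at most a factor 2, since the power is at least 1.\<close>
  have "1 \<le> P powr \<kappa>" using P \<kappa> by (simp add: ge_one_powr_ge_zero)
  then have "1 \<le> \<lfloor>P powr \<kappa>\<rfloor>" by (simp add: le_floor_iff)
  then have "1 \<le> real_of_int \<lfloor>P powr \<kappa>\<rfloor>" "real ?Q = real_of_int \<lfloor>P powr \<kappa>\<rfloor>" by (simp_all add: cutoff_def)
  then have "P powr \<kappa> \<le> 2 * real ?Q" using floor_correct[of "P powr \<kappa>"] by linarith
  then have *: "P powr \<kappa> * real (card ?Z) \<le> 2 * real ?Q * real (card ?Z)" by (intro mult_right_mono) auto
  have "real ?Q * real (card ?Z) = (\<Sum>q\<in>{1..?Q}. real (card ?Z))" by simp
  also have "\<dots> \<le> divisor_count f (points P) ?Q"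
    unfolding divisor_count_def using finite_points[OF P] by (intro sum_mono of_nat_mono card_mono) auto
  finally show ?thesis using * by simp
qed

lemma small_values_le:
  assumes hom: "homogeneous_of_degree d f" and smooth: "smooth_form f" and d: "1 \<le> d"
    and c: "cbox a a' \<subseteq> {t. \<forall>j. -1 \<le> t $ j \<and> t $ j \<le> 1}" and \<epsilon>: "0 < \<epsilon>" "\<epsilon> < real d / 2"
  shows "\<exists>C. \<forall>P\<ge>1. (\<Sum>x\<in>{x\<in>points P. mpoly_eval f x \<noteq> 0 \<and>
      \<bar>real_of_int (mpoly_eval f x)\<bar> \<le> P powr (real d - 2 * \<epsilon>)}. real (divisor_tau (nat \<bar>mpoly_eval f x\<bar>)))
    \<le> C * P ^ CARD('n) * P powr (- \<epsilon> / real d)"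
proof -
  \<comment> \<open>The sublevel bound saves \<open>P powr (2 * \<epsilon> / d)\<close>. With this
    \<open>\<eta>\<close> the divisor bound gives back at most
    \<open>P powr (\<epsilon> / d)\<close>, half of that saving in the exponent.\<close>
  define \<eta> where "\<eta> = \<epsilon> / (real d * real d)"
  have \<eta>: "0 < \<eta>" using \<epsilon> d by (simp add: \<eta>_def)
  obtain C1 where C1: "0 < C1" "\<forall>m\<ge>1. real (divisor_tau m) \<le> C1 * real m powr \<eta>"
    using divisor_bound[OF \<eta>] by (elim exE conjE) (rule that)
  obtain C2 where C2: "0 < C2" "\<forall>N\<ge>1. \<forall>T\<ge>1. real (card {x\<in>int_box N. \<bar>real_of_int (mpoly_eval f x)\<bar> \<le> T}) \<le>
      C2 * real N ^ (CARD('n) - 1) * T powr (1 / real d)"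
    using sublevel_card[OF hom smooth d] by (elim exE conjE) (rule that)
  show ?thesis
  proof (intro exI[of _ "C2 * 2 ^ (CARD('n) - 1) * C1"] allI impI)
    fix P :: real assume P: "1 \<le> P"
    define T where "T = P powr (real d - 2 * \<epsilon>)"
    define N where "N = nat \<lceil>P\<rceil>"
    have T: "1 \<le> T" using P \<epsilon> by (simp add: T_def ge_one_powr_ge_zero)
    have N: "1 \<le> N" "real N \<le> 2 * P" using P unfolding N_def by linarith+
    let ?S = "{x\<in>points P. mpoly_eval f x \<noteq> 0 \<and> \<bar>real_of_int (mpoly_eval f x)\<bar> \<le> T}"
    have "x \<in> int_box N" if "x \<in> points P" for x
    proof -
      have "\<bar>x $ i\<bar> \<le> int N" for i using points_abs_le[OF c P that, of i] P unfolding N_def by linarith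
      then show ?thesis by (simp add: int_box_def)
    qed
    then have "card ?S \<le> card {x\<in>int_box N. \<bar>real_of_int (mpoly_eval f x)\<bar> \<le> T}"
      by (intro card_mono) auto
    then have "real (card ?S) \<le> real (card {x\<in>int_box N. \<bar>real_of_int (mpoly_eval f x)\<bar> \<le> T})" by (rule of_nat_mono)
    also have "\<dots> \<le> C2 * real N ^ (CARD('n) - 1) * T powr (1 / real d)" using C2(2)[rule_format, OF N(1) T] .
    also have "\<dots> \<le> C2 * (2 * P) ^ (CARD('n) - 1) * T powr (1 / real d)"
      using C2(1) N(2) by (intro mult_right_mono mult_left_mono power_mono) auto
    finally have card: "real (card ?S) \<le> C2 * (2 * P) ^ (CARD('n) - 1) * T powr (1 / real d)" .
    have "(\<Sum>x\<in>?S. real (divisor_tau (nat \<bar>mpoly_eval f x\<bar>))) \<le> (\<Sum>x\<in>?S. C1 * T powr \<eta>)"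
    proof (rule sum_mono)
      fix x assume x: "x \<in> ?S"
      then have "1 \<le> nat \<bar>mpoly_eval f x\<bar>" by auto
      then have "real (divisor_tau (nat \<bar>mpoly_eval f x\<bar>)) \<le> C1 * real (nat \<bar>mpoly_eval f x\<bar>) powr \<eta>" using C1(2) by blast
      also have "\<dots> \<le> C1 * T powr \<eta>" using x C1(1) \<eta> by (intro mult_left_mono powr_mono2) auto
      finally show "real (divisor_tau (nat \<bar>mpoly_eval f x\<bar>)) \<le> C1 * T powr \<eta>" .
    qed
    also have "\<dots> = real (card ?S) * (C1 * T powr \<eta>)" by simp
    also have "\<dots> \<le> C2 * (2 * P) ^ (CARD('n) - 1) * T powr (1 / real d) * (C1 * T powr \<eta>)"
      using card C1(1) by (intro mult_right_mono) auto
    also have "\<dots> = C2 * 2 ^ (CARD('n) - 1) * C1 * (P ^ (CARD('n) - 1) * (T powr (1 / real d) * T powr \<eta>))"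
      by (simp add: power_mult_distrib mult_ac)
    also have "\<dots> \<le> C2 * 2 ^ (CARD('n) - 1) * C1 * (P ^ CARD('n) * P powr (- \<epsilon> / real d))"
    proof (intro mult_left_mono)
      have "T powr (1 / real d) * T powr \<eta> = P powr ((real d - 2 * \<epsilon>) * (1 / real d + \<eta>))"
        by (simp add: T_def powr_powr powr_add[symmetric] distrib_left)
      also have "\<dots> \<le> P powr (1 + - \<epsilon> / real d)"
      proof (rule powr_mono[OF _ P])
        have "(real d - 2 * \<epsilon>) * (1 / real d + \<eta>) = 1 - \<epsilon> / real d - 2 * \<epsilon> * \<eta>"
          using d by (simp add: \<eta>_def field_simps)
        also have "\<dots> \<le> 1 + - \<epsilon> / real d" using \<epsilon> \<eta> by simp
        finally show "(real d - 2 * \<epsilon>) * (1 / real d + \<eta>) \<le> 1 + - \<epsilon> / real d" .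
      qed
      also have "\<dots> = P * P powr (- \<epsilon> / real d)" using P powr_add[of P 1 "- \<epsilon> / real d"] by simp
      finally have "P ^ (CARD('n) - 1) * (T powr (1 / real d) * T powr \<eta>) \<le> P ^ (CARD('n) - 1) * (P * P powr (- \<epsilon> / real d))"
        using P by (intro mult_left_mono) auto
      also have "\<dots> = P ^ CARD('n) * P powr (- \<epsilon> / real d)"
        using power_eq_if[of P "CARD('n)"] by simp
      finally show "P ^ (CARD('n) - 1) * (T powr (1 / real d) * T powr \<eta>) \<le> P ^ CARD('n) * P powr (- \<epsilon> / real d)" .
    qed (use C1(1) C2(1) in auto)
    finally show "(\<Sum>x\<in>{x\<in>points P. mpoly_eval f x \<noteq> 0 \<and>
        \<bar>real_of_int (mpoly_eval f x)\<bar> \<le> P powr (real d - 2 * \<epsilon>)}. real (divisor_tau (nat \<bar>mpoly_eval f x\<bar>)))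
      \<le> C2 * 2 ^ (CARD('n) - 1) * C1 * P ^ CARD('n) * P powr (- \<epsilon> / real d)"
      by (simp add: T_def mult_ac)
  qed
qed

lemma divisor_sum_asymptotic:
  assumes hom: "homogeneous_of_degree d f" and smooth: "smooth_form f" and d: "1 \<le> d"
    and n: "2 ^ d * (d - 1) < CARD('n)"
    and c: "cbox a a' \<subseteq> {t. \<forall>j. -1 \<le> t $ j \<and> t $ j \<le> 1}"
  shows "((\<lambda>P. divisor_sum f (cbox a a') P / (P ^ CARD('n) * ln P)) \<longlongrightarrow>
    real d * vol * suminf (\<lambda>q. arith_coeff f q / real q)) at_top"
proof -
  define K where "K = vol * suminf (\<lambda>q. arith_coeff f q / real q)"
  let ?g = "\<lambda>P :: real. P ^ CARD('n) * ln P"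
  let ?D = "\<lambda>P. divisor_sum f (cbox a a') P / ?g P"
  let ?dc = "\<lambda>c \<kappa> P. divisor_count f (points P) (cutoff c \<kappa> P)"
  have lim: "((\<lambda>P. ?dc c \<kappa> P / ?g P) \<longlongrightarrow> \<kappa> * K) at_top" if "0 < c" "0 < \<kappa>" "\<kappa> \<le> real d / 2" for c \<kappa>
    using divisor_count_asymptotic[OF hom smooth d n that] by (simp add: K_def mult.assoc)
  have d2: "0 < real d / 2" "real d / 2 \<le> real d / 2" using d by auto
  obtain C where C: "1 \<le> C" "\<forall>P\<ge>0. \<forall>x :: int ^ 'n. (\<forall>i. \<bar>real_of_int (x $ i)\<bar> \<le> P) \<longrightarrow>
      \<bar>real_of_int (mpoly_eval f x)\<bar> \<le> C * P ^ d"
    using eval_abs_le[OF hom] by (elim exE conjE) (rule that)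
  have g: "eventually (\<lambda>P. 0 < ?g P \<and> 1 \<le> P) at_top"
    using eventually_gt_at_top[of 1] by eventually_elim simp
  have upper: "eventually (\<lambda>P. ?D P \<le> 2 * (?dc (sqrt C) (real d / 2) P / ?g P)) at_top"
    using g
  proof eventually_elim
    case (elim P)
    have "divisor_sum f (cbox a a') P \<le> 2 * ?dc (sqrt C) (real d / 2) P"
      using elim C points_abs_le[OF c] by (intro divisor_sum_le) auto
    from divide_right_mono[OF this less_imp_le[OF conjunct1[OF elim]]]
    show ?case unfolding times_divide_eq_right .
  qed
  have ulim: "((\<lambda>P. 2 * (?dc (sqrt C) (real d / 2) P / ?g P)) \<longlongrightarrow> real d * K) at_top"
    using tendsto_mult_left[OF lim[OF _ d2, of "sqrt C"], of 2] C(1) by simp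
  have lower: "eventually (\<lambda>P. y < ?D P) at_top" if y: "y < real d * K" for y
  proof -
    \<comment> \<open>The cutoff exponent \<open>d / 2 - \<epsilon>\<close> yields only
      \<open>(d - 2 * \<epsilon>) * K\<close>; by continuity in \<open>\<epsilon>\<close> this still
      exceeds \<open>y\<close> for a suitable \<open>\<epsilon>\<close>.\<close>
    have "((\<lambda>\<epsilon>. 2 * ((real d / 2 - \<epsilon>) * K)) \<longlongrightarrow> 2 * ((real d / 2 - 0) * K)) (at_right 0)"
      by (intro tendsto_intros)
    then have "eventually (\<lambda>\<epsilon>. y < 2 * ((real d / 2 - \<epsilon>) * K)) (at_right 0)"
      using y by (intro order_tendstoD) auto
    moreover have "eventually (\<lambda>\<epsilon>. \<epsilon> \<in> {0<..<real d / 2}) (at_right 0)"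
      using d2 by (intro eventually_at_right_real) auto
    ultimately have "eventually (\<lambda>\<epsilon>. y < 2 * ((real d / 2 - \<epsilon>) * K) \<and> 0 < \<epsilon> \<and> \<epsilon> < real d / 2) (at_right 0)"
      by eventually_elim auto
    then obtain \<epsilon> where \<epsilon>: "y < 2 * ((real d / 2 - \<epsilon>) * K)" "0 < \<epsilon>" "\<epsilon> < real d / 2"
      using eventually_happens'[of "at_right (0::real)"] by fastforce
    define \<kappa> where "\<kappa> = real d / 2 - \<epsilon>"
    have \<kappa>: "0 < \<kappa>" "\<kappa> \<le> real d / 2" using \<epsilon> by (auto simp: \<kappa>_def)
    obtain C' where C': "\<forall>P\<ge>1. (\<Sum>x\<in>{x\<in>points P. mpoly_eval f x \<noteq> 0 \<and>
        \<bar>real_of_int (mpoly_eval f x)\<bar> \<le> P powr (real d - 2 * \<epsilon>)}. real (divisor_tau (nat \<bar>mpoly_eval f x\<bar>)))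
      \<le> C' * P ^ CARD('n) * P powr (- \<epsilon> / real d)"
      using small_values_le[OF hom smooth d c \<epsilon>(2,3)] by (elim exE) (rule that)
    \<comment> \<open>The main count, the zeros and the small values, each divided by
      \<open>P ^ n * ln P\<close>.\<close>
    let ?h = "\<lambda>P. 2 * (?dc 1 \<kappa> P / ?g P) - 4 * (P powr (- \<epsilon>) * (?dc 1 (real d / 2) P / ?g P))
      - C' * (P powr (- \<epsilon> / real d) / ln P)"
    have "((\<lambda>P :: real. P powr (- \<epsilon>)) \<longlongrightarrow> 0) at_top" using \<epsilon> by real_asymp
    moreover have "((\<lambda>P :: real. P powr (- \<epsilon> / real d) / ln P) \<longlongrightarrow> 0) at_top"
    proof -
      define \<delta> where "\<delta> = \<epsilon> / real d"
      have "0 < \<delta>" using \<epsilon> d by (simp add: \<delta>_def)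
      then have "((\<lambda>P :: real. P powr (- \<delta>) / ln P) \<longlongrightarrow> 0) at_top" by real_asymp
      then show ?thesis by (simp add: \<delta>_def)
    qed
    ultimately have "(?h \<longlongrightarrow> 2 * (\<kappa> * K) - 4 * (0 * (real d / 2 * K)) - C' * 0) at_top"
      by (intro tendsto_diff tendsto_mult tendsto_const lim \<kappa> d2) auto
    then have "eventually (\<lambda>P. y < ?h P) at_top"
      using \<epsilon>(1) by (intro order_tendstoD) (auto simp: \<kappa>_def)
    then show ?thesis
      using g
    proof eventually_elim
      case (elim P)
      then have P: "1 \<le> P" and g: "0 < ?g P" by auto
      let ?Q = "cutoff 1 \<kappa> P" and ?z = "real (card {x\<in>points P. mpoly_eval f x = 0})"
      have Q: "real ?Q \<le> P powr \<kappa>" using cutoff_le[of 1 \<kappa> P] by simp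
      then have "real ?Q * real ?Q \<le> P powr \<kappa> * P powr \<kappa>" by (intro mult_mono) auto
      also have "\<dots> = P powr (real d - 2 * \<epsilon>)" by (simp add: powr_add[symmetric] \<kappa>_def algebra_simps)
      finally have "2 * ?dc 1 \<kappa> P \<le> divisor_sum f (cbox a a') P + 2 * real ?Q * ?z
          + C' * P ^ CARD('n) * P powr (- \<epsilon> / real d)"
        using divisor_sum_ge[OF P, of ?Q "P powr (real d - 2 * \<epsilon>)"] C'[rule_format, OF P] by linarith
      moreover have "2 * real ?Q * ?z \<le> 4 * (P powr (- \<epsilon>) * ?dc 1 (real d / 2) P)"
      proof -
        \<comment> \<open>The zeros are compared with the count at the full exponent
          \<open>d / 2\<close>, which is larger than \<open>\<kappa>\<close> by
          \<open>\<epsilon>\<close>; this gains the factor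
          \<open>P powr (- \<epsilon>)\<close>.\<close>
        have "real ?Q * ?z \<le> P powr \<kappa> * ?z" using Q by (intro mult_right_mono) auto
        also have "\<dots> = P powr (- \<epsilon>) * (P powr (real d / 2) * ?z)"
          by (simp add: \<kappa>_def powr_add[symmetric] mult.assoc[symmetric])
        also have "\<dots> \<le> P powr (- \<epsilon>) * (2 * ?dc 1 (real d / 2) P)"
          by (intro mult_left_mono zeros_le P d2) auto
        finally show ?thesis by simp
      qed
      ultimately have "2 * ?dc 1 \<kappa> P - 4 * (P powr (- \<epsilon>) * ?dc 1 (real d / 2) P) - C' * P ^ CARD('n) * P powr (- \<epsilon> / real d)
          \<le> divisor_sum f (cbox a a') P" by linarith
      then have "(2 * ?dc 1 \<kappa> P - 4 * (P powr (- \<epsilon>) * ?dc 1 (real d / 2) P) - C' * P ^ CARD('n) * P powr (- \<epsilon> / real d)) / ?g P \<le> ?D P"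
        using g by (intro divide_right_mono) auto
      moreover have "(2 * ?dc 1 \<kappa> P - 4 * (P powr (- \<epsilon>) * ?dc 1 (real d / 2) P) - C' * P ^ CARD('n) * P powr (- \<epsilon> / real d)) / ?g P = ?h P"
        using P g by (simp add: diff_divide_distrib)
      ultimately show ?case using elim by linarith
    qed
  qed
  have "(?D \<longlongrightarrow> real d * K) at_top"
  proof (rule order_tendstoI)
    fix y assume "real d * K < y"
    then have "eventually (\<lambda>P. 2 * (?dc (sqrt C) (real d / 2) P / ?g P) < y) at_top"
      using order_tendstoD(2)[OF ulim] by blast
    then show "eventually (\<lambda>P. ?D P < y) at_top" using upper by eventually_elim linarith
  qed (rule lower)
  then show ?thesis by (simp add: K_def mult.assoc)
qed

end

text \<open>In degree 0 all partial derivatives vanish identically, so every nonzero point violates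
  smoothness.\<close>

lemma smooth_form_degree_pos:
  fixes f :: "('n::finite) int_mpoly"
  assumes hom: "homogeneous_of_degree d f" and smooth: "smooth_form f"
  shows "1 \<le> d"
proof (rule ccontr)
  assume "\<not> ?thesis"
  then have "(\<Sum>i\<in>UNIV. Poly_Mapping.lookup e i) = 0" if "e \<in> Poly_Mapping.keys f" for e
    using hom that by (simp add: homogeneous_of_degree_def)
  then have "Poly_Mapping.lookup e i = 0" if "e \<in> Poly_Mapping.keys f" for e i using that by auto
  then have "mpoly_pderiv i f = 0" for i
    unfolding mpoly_pderiv_def by (intro sum.neutral ballI) simp
  then have "mpoly_eval (mpoly_pderiv i f) ((\<chi> i. 1) :: complex ^ 'n) = 0" for i by (simp add: mpoly_eval_def)
  moreover have "(\<chi> i. 1) \<noteq> (0 :: complex ^ 'n)" by (simp add: vec_eq_iff)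
  ultimately show False using smooth unfolding smooth_form_def by blast
qed

theorem theorem1p8:
  fixes f :: "('n::finite) int_mpoly" and d :: nat and B :: "(real ^ 'n) set"
  assumes "homogeneous_of_degree d f"
    and "smooth_form f"
    and "int CARD('n) > 2 ^ d * (int d - 1)"
    and "is_box B"
  shows "(\<forall>p. prime p \<longrightarrow> convergent (local_average f p)) \<and>
    convergent_prod (\<lambda>p::nat. if prime p then (1 - 1 / real p) * lim (local_average f p) else 1) \<and>
    ((\<lambda>P::real. 1 / (P ^ CARD('n) * ln P) * divisor_sum f B P) \<longlongrightarrow>
       real d * measure lebesgue B *
       prodinf (\<lambda>p::nat. if prime p then (1 - 1 / real p) * lim (local_average f p) else 1)) at_top"
proof -
  have d: "1 \<le> d" by (rule smooth_form_degree_pos[OF assms(1,2)])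
  \<comment> \<open>The integer \<open>int d - 1\<close> agrees with the truncated
    \<open>d - 1\<close> because \<open>d \<ge> 1\<close>.\<close>
  have "int (2 ^ d * (d - 1)) < int CARD('n)" using assms(3) d by (simp add: of_nat_diff)
  then have n: "2 ^ d * (d - 1) < CARD('n)" by (rule of_nat_less_imp_less)
  have s: "summable (\<lambda>q. \<bar>arith_coeff f q / real q\<bar>)" by (rule summable_arith_coeff[OF assms(1,2) d n])
  obtain a a' where B: "B = cbox a a'" "\<forall>j. \<bar>a' $ j - a $ j\<bar> \<le> 1"
    and sub: "B \<subseteq> {t. \<forall>j. -1 \<le> t $ j \<and> t $ j \<le> 1}"
    using assms(4) unfolding is_box_def by (elim exE conjE) (rule that)
  have "((\<lambda>P. divisor_sum f B P / (P ^ CARD('n) * ln P)) \<longlongrightarrow>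
      real d * measure lebesgue B * suminf (\<lambda>q. arith_coeff f q / real q)) at_top"
  \<comment> \<open>A box may be empty, as \<open>is_box\<close> bounds only the absolute
    differences of the endpoints; then there are no lattice points, the measure is zero and both
    sides vanish.\<close>
  proof (cases "B = {}")
    case True
    then show ?thesis by (simp add: divisor_sum_def lattice_points_def)
  next
    case False
    then obtain t where "t \<in> cbox a a'" using B(1) by auto
    then have "a $ i \<le> t $ i" "t $ i \<le> a' $ i" for i by (simp_all add: mem_box_cart)
    then have le: "a $ i \<le> a' $ i" for i by (rule order_trans)
    interpret unit_box a a' f
      using le B(2) by unfold_locales (auto simp: abs_le_iff)
    have "measure lebesgue B = vol"
      using content_cbox_cart[of a a'] False
      by (simp add: B(1) vol_def scaled_box.vol_def[OF scaled[of 1]])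
    then show ?thesis
      using divisor_sum_asymptotic[OF assms(1,2) d n sub[unfolded B(1)]] by (simp add: B(1))
  qed
  then have "((\<lambda>P. 1 / (P ^ CARD('n) * ln P) * divisor_sum f B P) \<longlongrightarrow>
      real d * measure lebesgue B *
      prodinf (\<lambda>p::nat. if prime p then (1 - 1 / real p) * lim (local_average f p) else 1)) at_top"
    unfolding singular_series(3)[OF s] by simp
  then show ?thesis
    using singular_series(1,2)[OF s] by blast
qed

end
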